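(* Let $X_t$ be a L\'evy process as described in the context, and for $s,u>0$, $x\in\mathbb R$ let $$D_x(s,u)=\mathsf E\exp\Big(-u\int_0^{\theta_s}I\{X_t>x\}\,dt\Big).$$ (i) Suppose the negative jumps are of matrix-exponential type and that either case $(NS)_-$ holds, or case $(S)_-$ holds with $a>0$. Then $$D_0(s,u)=\frac{s}{s+u}\,\frac{\rho^-_{N_-}(s+u)}{\rho^-_{N_-}(s)},$$ and for $x<0$ $$D_x(s,u)=\frac{s}{s+u}\left(1-\frac{\rho^-_{N_-}(s+u)}{\rho^-_{N_-}(s)}\,\big(\boldsymbol\rho_-(s)-\boldsymbol\rho_-(s+u)\big)\,\mathbf R_-^{-1}(s+u)\,e^{\mathbf R_-(s+u)x}\,\mathbf e\right).$$ (ii) Suppose the positive jumps are of matrix-exponential type and that either case $(NS)_+$ holds, or case $(S)_+$ holds with $a<0$. Then $$D_0(s,u)=\frac{\rho^+_{N_+}(s)}{\rho^+_{N_+}(s+u)},$$ and for $x>0$ $$D_x(s,u)=1+\frac{\rho^+_{N_+}(s)}{\rho^+_{N_+}(s+u)}\,\big(\boldsymbol\rho_+(s+u)-\boldsymbol\rho_+(s)\big)\,\mathbf R_+^{-1}(s)\,e^{\mathbf R_+(s)x}\,\mathbf e.$$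
   Context: Process: $(X_t)_{t\ge 0}$ is a real L\'evy process, $X_0=0$, with $\mathsf E e^{rX_t}=e^{tk(r)}$ for $\Re[r]=0$ and cumulant function $k(r)=ar+\frac{\sigma^2}{2}r^2+\int_{\mathbb R\setminus\{0\}}(e^{rx}-1)\,\Pi(dx)$, where $a\in\mathbb R$, $\sigma\ge 0$, and $\Pi$ is a nonnegative measure on $\mathbb R\setminus\{0\}$ with $\int\min\{x^2,1\}\,\Pi(dx)<\infty$ and $\int_{-1}^1|x|\,\Pi(dx)<\infty$. Negative jumps of matrix-exponential type: $\lambda_-=\Pi((-\infty,0))\in(0,\infty)$ and $\Pi(dx)=\lambda_-\sum_{i=1}^{m_-}P_i^-(x)e^{b_ix}dx$ for $x<0$, where $P_i^-$ is a polynomial of degree $k_i^-$, the $b_i$ are distinct, $\Re[b_{m_-}]\ge\dots\ge\Re[b_2]>b_1>0$, $d_-=\sum_{i=1}^{m_-}k_i^-+m_-$ (positive jumps then arbitrary). Positive jumps of matrix-exponential type: $\lambda_+=\Pi((0,\infty))\in(0,\infty)$ and $\Pi(dx)=\lambda_+\sum_{i=1}^{m_+}P_i^+(x)e^{-c_ix}dx$ for $x>0$, where $P_i^+$ is a polynomial of degree $k_i^+$, the $c_i$ are distinct, $\Re[c_{m_+}]\ge\dots\ge\Re[c_2]>c_1>0$, $d_+=\sum_{i=1}^{m_+}k_i^++m_+$ (negative jumps then arbitrary). Cases: $(NS)_\pm$ means that the jumps of sign $\pm$ are of matrix-exponential type and $\sigma>0$, or $\sigma=0$ and $\pm a>0$.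 $(S)_\pm$ means that the jumps of sign $\pm$ are of matrix-exponential type and $\sigma=0$, $\mp a\ge0$. Put $N_\pm=d_\pm+1$ in case $(NS)_\pm$ and $N_\pm=d_\pm$ in case $(S)_\pm$. Roots: in case $(NS)_\pm$ or $(S)_\pm$, for $s>0$ the equation $k(r)=s$ (with $k$ continued meromorphically to $\pm\Re[r]>0$) has exactly $N_\pm$ roots, counted with multiplicity, in $\pm\Re[r]>0$, denoted $\pm r_i^\pm(s)$, $i=1,\dots,N_\pm$. Notation: $\rho_k^\pm(s)=\sum_{1\le i_1<\dots<i_k\le N_\pm}r_{i_1}^\pm(s)\cdots r_{i_k}^\pm(s)$; row vector $\boldsymbol\rho_\pm(s)=(\rho^\pm_{N_\pm}(s),\dots,\rho^\pm_1(s))$; $\mathbf R_\pm(s)=\begin{pmatrix}0\quad \pm\mathbf I\\ \mp\boldsymbol\rho_\pm(s)\end{pmatrix}$ is the $N_\pm\times N_\pm$ matrix whose first $N_\pm-1$ rows are $(0\mid\pm\mathbf I_{N_\pm-1})$ and whose last row is $\mp\boldsymbol\rho_\pm(s)$; $\mathbf R_\pm^{-1}(s)$ is its inverse; $\mathbf e=(0,\dots,0,1)^\top\in\mathbb R^{N_\pm}$. $\theta_s$ is exponential with parameter $s$ ($\mathsf P\{\theta_s>t\}=e^{-st}$), independent of $X$; $I\{\cdot\}$ is the indicator. *)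

theory Defs
  imports
    "HOL-Probability.Probability"
    "HOL-Complex_Analysis.Complex_Analysis"
    "Jordan_Normal_Form.Matrix"
    "Jordan_Normal_Form.Gauss_Jordan_Elimination"
begin

no_notation inner (infix \<open>\<bullet>\<close> 70)

subsection \<open>Levy processes and their cumulants\<close>

text \<open>The time parameter ranges over the nonnegative reals; values of \<open>X\<close> at negative times are
  irrelevant. The paths are cadlag everywhere (not just almost everywhere), so that occupation times
  are measurable without completing \<open>M\<close>.\<close>

definition levy_process :: "'a measure \<Rightarrow> (real \<Rightarrow> 'a \<Rightarrow> real) \<Rightarrow> bool" where
  "levy_process M X \<longleftrightarrow>
     prob_space M \<and>
     (\<forall>t\<ge>0. X t \<in> borel_measurable M) \<and>
     (AE \<omega> in M. X 0 \<omega> = 0) \<and>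
     (\<forall>(n::nat) (t :: nat \<Rightarrow> real). 0 \<le> t 0 \<and> (\<forall>i<n. t i \<le> t (Suc i)) \<longrightarrow>
        prob_space.indep_vars M (\<lambda>_. borel) (\<lambda>i \<omega>. X (t (Suc i)) \<omega> - X (t i) \<omega>) {..<n}) \<and>
     (\<forall>t h. 0 \<le> t \<and> 0 \<le> h \<longrightarrow>
        distr M borel (\<lambda>\<omega>. X (t + h) \<omega> - X t \<omega>) = distr M borel (X h)) \<and>
     (\<forall>\<omega>\<in>space M. \<forall>t\<ge>0. continuous (at_right t) (\<lambda>t. X t \<omega>)) \<and>
     (\<forall>\<omega>\<in>space M. \<forall>t>0. \<exists>l. ((\<lambda>t. X t \<omega>) \<longlongrightarrow> l) (at_left t))"

text \<open>The jump measure is written \<open>\<nu>\<close> (the capital letter is library syntax). A measure on the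
  punctured line is modelled as a Borel measure on the line that does not charge the origin.\<close>

definition levy_measure :: "real measure \<Rightarrow> bool" where
  "levy_measure \<nu> \<longleftrightarrow>
     sets \<nu> = sets borel \<and> emeasure \<nu> {0} = 0 \<and>
     (\<integral>\<^sup>+x. ennreal (min (x\<^sup>2) 1) \<partial>\<nu>) < \<infinity> \<and>
     (\<integral>\<^sup>+x\<in>{-1..1}. ennreal \<bar>x\<bar> \<partial>\<nu>) < \<infinity>"

definition cumulant :: "real \<Rightarrow> real \<Rightarrow> real measure \<Rightarrow> complex \<Rightarrow> complex" where
  "cumulant a \<sigma> \<nu> r =
     of_real a * r + of_real (\<sigma>\<^sup>2) / 2 * r\<^sup>2 + (CLINT x:(- {0})|\<nu>. exp (r * of_real x) - 1)"

subsection \<open>Matrix-exponential jumps\<close>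

text \<open>Here and below, \<open>\<epsilon> = 1\<close> selects the positive and \<open>\<epsilon> = -1\<close> the negative sign wherever the
  mathematics uses \<open>\<plusminus>\<close>. The measure restricted to the half-line \<open>\<epsilon> x > 0\<close> has the density
  \<open>\<lambda> (\<Sum>i=1..m. P\<^sub>i(x) exp (- \<epsilon> c\<^sub>i x))\<close>; for \<open>\<epsilon> = -1\<close> the exponents are \<open>b\<^sub>i = c\<^sub>i\<close>. Coefficients
  and exponents may be complex, and the equation of (complex) measures forces the density to be real
  and nonnegative. The degree of \<open>P\<^sub>i\<close> is meant literally, so \<open>P\<^sub>i\<close> is not zero.\<close>

definition matrix_exp_jumps ::
    "real \<Rightarrow> real measure \<Rightarrow> nat \<Rightarrow> (nat \<Rightarrow> complex poly) \<Rightarrow> (nat \<Rightarrow> complex) \<Rightarrow> bool" where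
  "matrix_exp_jumps \<epsilon> \<nu> m P c \<longleftrightarrow>
     0 < emeasure \<nu> {x. 0 < \<epsilon> * x} \<and> emeasure \<nu> {x. 0 < \<epsilon> * x} < \<infinity> \<and>
     1 \<le> m \<and>
     (\<forall>i\<in>{1..m}. P i \<noteq> 0) \<and>
     inj_on c {1..m} \<and>
     Im (c 1) = 0 \<and> 0 < Re (c 1) \<and>
     (\<forall>i\<in>{2..m}. Re (c 1) < Re (c i)) \<and>
     (\<forall>i\<in>{2..m}. \<forall>j\<in>{2..m}. i \<le> j \<longrightarrow> Re (c i) \<le> Re (c j)) \<and>
     (\<forall>A\<in>sets borel. A \<subseteq> {x. 0 < \<epsilon> * x} \<longrightarrow>
        complex_of_real (measure \<nu> A) =
        (CLINT x:A|lborel. of_real (measure \<nu> {x. 0 < \<epsilon> * x}) *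
           (\<Sum>i=1..m. poly (P i) (of_real x) * exp (- of_real \<epsilon> * c i * of_real x))))"

definition case_NS ::
    "real \<Rightarrow> real \<Rightarrow> real \<Rightarrow> real measure \<Rightarrow> nat \<Rightarrow> (nat \<Rightarrow> complex poly) \<Rightarrow> (nat \<Rightarrow> complex) \<Rightarrow> bool"
  where
  "case_NS \<epsilon> a \<sigma> \<nu> m P c \<longleftrightarrow> matrix_exp_jumps \<epsilon> \<nu> m P c \<and> (0 < \<sigma> \<or> \<sigma> = 0 \<and> 0 < \<epsilon> * a)"

definition case_S ::
    "real \<Rightarrow> real \<Rightarrow> real \<Rightarrow> real measure \<Rightarrow> nat \<Rightarrow> (nat \<Rightarrow> complex poly) \<Rightarrow> (nat \<Rightarrow> complex) \<Rightarrow> bool"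
  where
  "case_S \<epsilon> a \<sigma> \<nu> m P c \<longleftrightarrow> matrix_exp_jumps \<epsilon> \<nu> m P c \<and> \<sigma> = 0 \<and> 0 \<le> - \<epsilon> * a"

definition me_degree :: "nat \<Rightarrow> (nat \<Rightarrow> complex poly) \<Rightarrow> nat" where
  "me_degree m P = (\<Sum>i=1..m. degree (P i)) + m"

definition num_roots ::
    "real \<Rightarrow> real \<Rightarrow> real \<Rightarrow> real measure \<Rightarrow> nat \<Rightarrow> (nat \<Rightarrow> complex poly) \<Rightarrow> (nat \<Rightarrow> complex) \<Rightarrow> nat"
  where
  "num_roots \<epsilon> a \<sigma> \<nu> m P c =
     (if case_NS \<epsilon> a \<sigma> \<nu> m P c then me_degree m P + 1 else me_degree m P)"

subsection \<open>Roots of the cumulant equation\<close>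

text \<open>The continuation to the half-plane \<open>\<epsilon> Re r > 0\<close> extends the cumulant from all points of the
  half-plane where its integral converges, which is a strip along the imaginary axis when the jumps
  of sign \<open>\<epsilon>\<close> are of matrix-exponential type. Being \<^emph>\<open>nicely\<close> meromorphic excludes wrong values at
  removable singularities, so the continuation is unique on the half-plane. At poles it takes the
  value 0 by convention, so that poles do not solve the equation \<open>k(r) = s\<close> for \<open>s > 0\<close>.\<close>

definition is_continuation ::
    "real \<Rightarrow> real \<Rightarrow> real \<Rightarrow> real measure \<Rightarrow> (complex \<Rightarrow> complex) \<Rightarrow> bool" where
  "is_continuation \<epsilon> a \<sigma> \<nu> K \<longleftrightarrow>
     K nicely_meromorphic_on {r. 0 < \<epsilon> * Re r} \<and>
     (\<forall>r. 0 < \<epsilon> * Re r \<and> complex_set_integrable \<nu> (- {0}) (\<lambda>x. exp (r * of_real x) - 1) \<longrightarrow>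
        K r = cumulant a \<sigma> \<nu> r)"

definition cumulant_ext :: "real \<Rightarrow> real \<Rightarrow> real \<Rightarrow> real measure \<Rightarrow> complex \<Rightarrow> complex" where
  "cumulant_ext \<epsilon> a \<sigma> \<nu> = (SOME K. is_continuation \<epsilon> a \<sigma> \<nu> K)"

definition solution_mult :: "(complex \<Rightarrow> complex) \<Rightarrow> real \<Rightarrow> complex \<Rightarrow> nat" where
  "solution_mult K s z = (if K z = of_real s then nat (zorder (\<lambda>w. K w - of_real s) z) else 0)"

text \<open>\<open>\<epsilon> r\<^sub>1, \<dots>, \<epsilon> r\<^sub>N\<close> is the list of all roots of \<open>K(z) = s\<close> in \<open>\<epsilon> Re z > 0\<close>, each repeated
  according to its multiplicity. The list is unique up to order, and everything below is symmetric
  in its members.\<close>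

definition lists_roots ::
    "real \<Rightarrow> (complex \<Rightarrow> complex) \<Rightarrow> real \<Rightarrow> nat \<Rightarrow> (nat \<Rightarrow> complex) \<Rightarrow> bool" where
  "lists_roots \<epsilon> K s N r \<longleftrightarrow>
     (\<forall>i\<in>{1..N}. 0 < Re (r i)) \<and>
     (\<forall>z. 0 < \<epsilon> * Re z \<longrightarrow> card {i\<in>{1..N}. of_real \<epsilon> * r i = z} = solution_mult K s z)"

definition cumulant_roots ::
    "real \<Rightarrow> real \<Rightarrow> real \<Rightarrow> real measure \<Rightarrow> nat \<Rightarrow> real \<Rightarrow> nat \<Rightarrow> complex" where
  "cumulant_roots \<epsilon> a \<sigma> \<nu> N s = (SOME r. lists_roots \<epsilon> (cumulant_ext \<epsilon> a \<sigma> \<nu>) s N r)"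

definition elem_sym :: "nat \<Rightarrow> (nat \<Rightarrow> complex) \<Rightarrow> nat \<Rightarrow> complex" where
  "elem_sym N r k = (\<Sum>A\<in>{A. A \<subseteq> {1..N} \<and> card A = k}. \<Prod>i\<in>A. r i)"

definition rho :: "real \<Rightarrow> real \<Rightarrow> real \<Rightarrow> real measure \<Rightarrow> nat \<Rightarrow> nat \<Rightarrow> real \<Rightarrow> complex" where
  "rho \<epsilon> a \<sigma> \<nu> N k s = elem_sym N (cumulant_roots \<epsilon> a \<sigma> \<nu> N s) k"

text \<open>Vector and matrix indices start at 0, so entry \<open>j\<close> of \<open>(\<rho>\<^sub>N, \<dots>, \<rho>\<^sub>1)\<close> is \<open>\<rho>\<close> with index
  \<open>N - j\<close>.\<close>

definition rho_vec :: "real \<Rightarrow> real \<Rightarrow> real \<Rightarrow> real measure \<Rightarrow> nat \<Rightarrow> real \<Rightarrow> complex vec" where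
  "rho_vec \<epsilon> a \<sigma> \<nu> N s = vec N (\<lambda>j. rho \<epsilon> a \<sigma> \<nu> N (N - j) s)"

definition R_mat :: "real \<Rightarrow> real \<Rightarrow> real \<Rightarrow> real measure \<Rightarrow> nat \<Rightarrow> real \<Rightarrow> complex mat" where
  "R_mat \<epsilon> a \<sigma> \<nu> N s = mat N N (\<lambda>(i, j).
     if i = N - 1 then - of_real \<epsilon> * rho_vec \<epsilon> a \<sigma> \<nu> N s $ j
     else if j = i + 1 then of_real \<epsilon> else 0)"

definition R_inv :: "real \<Rightarrow> real \<Rightarrow> real \<Rightarrow> real measure \<Rightarrow> nat \<Rightarrow> real \<Rightarrow> complex mat" where
  "R_inv \<epsilon> a \<sigma> \<nu> N s = the (mat_inverse (R_mat \<epsilon> a \<sigma> \<nu> N s))"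

definition mat_exp :: "complex mat \<Rightarrow> complex mat" where
  "mat_exp A = mat (dim_row A) (dim_row A) (\<lambda>(i, j). \<Sum>k. (A ^\<^sub>m k) $$ (i, j) / fact k)"

subsection \<open>Occupation times up to an exponential time\<close>

definition occupation_transform ::
    "'a measure \<Rightarrow> (real \<Rightarrow> 'a \<Rightarrow> real) \<Rightarrow> ('a \<Rightarrow> real) \<Rightarrow> real \<Rightarrow> real \<Rightarrow> real" where
  "occupation_transform M X \<theta> u x =
     (LINT \<omega>|M. exp (- u * (LINT t:{0..\<theta> \<omega>}|lborel. indicator {x<..} (X t \<omega>))))"

text \<open>Independence is that of the sigma-algebra of \<open>\<theta>\<close> and the one generated by the whole process.\<close>

definition independent_exponential ::
    "'a measure \<Rightarrow> (real \<Rightarrow> 'a \<Rightarrow> real) \<Rightarrow> ('a \<Rightarrow> real) \<Rightarrow> real \<Rightarrow> bool" where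
  "independent_exponential M X \<theta> s \<longleftrightarrow>
     distributed M lborel \<theta> (exponential_density s) \<and>
     prob_space.indep_set M
       (sets (vimage_algebra (space M) \<theta> borel))
       (sets (vimage_algebra (space M) (\<lambda>\<omega>. \<lambda>t\<in>{0..}. X t \<omega>) (Pi\<^sub>M {0..} (\<lambda>_. borel))))"

end

theory Submission
  imports Defs "Jordan_Normal_Form.Determinant"
begin

text \<open>Write \<open>q = s + u\<close>, \<open>k\<close> for the cumulant, and \<open>\<mu>\<^sub>p\<close> for the law of the process at an independent
  exponential time with parameter \<open>p\<close>; its characteristic function is \<open>p / (p - k(i t))\<close>.

  Along a single path, \<open>exp (u A)\<close> with \<open>A\<close> the occupation time above \<open>x\<close> is the integral of its own
  derivative. Multiplying by \<open>exp (- u A)\<close> and using the Markov property at the time of integration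
  gives a renewal equation for \<open>D(x)\<close> (lemma \<open>occ_trf_equation\<close>):
  \<open>D(x) = 1 - (u/s) E [D(x - Y); Y > x]\<close> with \<open>Y\<close> distributed as \<open>\<mu>\<^sub>s\<close>. Stopping at the
  smaller rate \<open>s\<close> is the same as stopping at rate \<open>q\<close> and, with probability \<open>u/q\<close>, continuing
  afresh until rate \<open>s\<close>. This resolvent identity turns the equation into
  \<open>D(x) = s/q + (u/q) E [D(x - Y); Y \<le> x]\<close> with \<open>Y\<close> distributed as \<open>\<mu>\<^sub>q\<close> (lemma \<open>renewal_transfer\<close>). The
  factor \<open>u/q < 1\<close> makes the right-hand side a contraction on bounded functions on the half-line, so
  a bounded solution is unique and it remains to exhibit one.

  The solution comes from a Wiener-Hopf argument that involves one half-plane only. Let \<open>r\<^sub>i\<close> and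
  \<open>r'\<^sub>i\<close> be the roots of \<open>k = s\<close> and \<open>k = q\<close> in \<open>Re z > 0\<close>, there being \<open>N\<close> of each (lemma
  \<open>root_count\<close>, by comparison with an explicit polynomial on a large rectangle). In
  \<open>(s - k(z)) / (q - k(z)) * (\<Prod>i. r'\<^sub>i - z) / (\<Prod>i. r\<^sub>i - z)\<close> all zeros and poles cancel, and what
  remains is bounded and holomorphic on the right half-plane (lemma \<open>transfer_function\<close>). On the
  imaginary axis it is the Fourier transform of the convolution of two measures: a measure made of
  \<open>\<mu>\<^sub>q\<close> and a point mass, and a measure on \<open>[0, \<infinity>)\<close> with a point mass at 0 and a density that solves
  the linear differential equation with characteristic roots \<open>- r\<^sub>i\<close>. By Liouville's theorem a measure
  with such a transform gives no mass to \<open>(0, \<infinity>)\<close> (lemma \<open>fourier_support_nonpos\<close>), so its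
  distribution function is constant on \<open>[0, \<infinity>)\<close>. That constancy is precisely the contracted renewal
  equation for the distribution function of the second measure, \<open>occ_profile\<close>.

  The matrix expressions of the theorem are this profile: the powers of the companion matrix shift the
  solution of a linear recurrence, so its exponential applied to the last unit vector lists the
  successive derivatives of the fundamental solution, and its inverse integrates once (lemma
  \<open>companion_inv_mat_exp\<close>).

  The formula for negative jumps follows by reflecting the line. The reflected renewal equation has
  the complementary inequality under the expectation, so there the profile solves the equation with
  rate \<open>s\<close> directly, and the contraction applies to the difference. Strict and weak inequality can be
  exchanged because \<open>\<mu>\<^sub>s\<close> has no atoms, which would fail for a compound Poisson process without
  drift.\<close>

section \<open>Parameter integrals and Fourier transforms on a half-plane\<close>

text \<open>Sequences suffice because the parameter space is first countable, and for sequences this is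
  dominated convergence.\<close>

lemma tendsto_integral_at_within:
  fixes F :: "'c::first_countable_topology \<Rightarrow> 'b \<Rightarrow> 'd::{banach,second_countable_topology}"
  assumes G: "G \<in> borel_measurable N" and w: "integrable N w"
    and meas: "\<forall>\<^sub>F y in at a within S. F y \<in> borel_measurable N"
    and bound: "\<forall>\<^sub>F y in at a within S. AE x in N. norm (F y x) \<le> w x"
    and lim: "AE x in N. ((\<lambda>y. F y x) \<longlongrightarrow> G x) (at a within S)"
  shows "((\<lambda>y. \<integral>x. F y x \<partial>N) \<longlongrightarrow> (\<integral>x. G x \<partial>N)) (at a within S)"
  unfolding tendsto_at_iff_sequentially
proof (intro allI impI)
  fix X assume X: "\<forall>i. X i \<in> S - {a}" "X \<longlonglongrightarrow> a"
  then have fl: "filterlim X (at a within S) sequentially"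
    by (auto simp: filterlim_at)
  have "\<forall>\<^sub>F n in sequentially. F (X n) \<in> borel_measurable N \<and> (AE x in N. norm (F (X n) x) \<le> w x)"
    using eventually_compose_filterlim[OF eventually_conj[OF meas bound] fl] .
  then obtain n0 where n0: "\<And>n. n \<ge> n0 \<Longrightarrow> F (X n) \<in> borel_measurable N"
      "\<And>n. n \<ge> n0 \<Longrightarrow> AE x in N. norm (F (X n) x) \<le> w x"
    by (auto simp: eventually_sequentially)
  have "(\<lambda>n. \<integral>x. F (X (n + n0)) x \<partial>N) \<longlonglongrightarrow> (\<integral>x. G x \<partial>N)"
  proof (rule integral_dominated_convergence[OF G _ w])
    show "AE x in N. (\<lambda>n. F (X (n + n0)) x) \<longlonglongrightarrow> G x"
      using lim
    proof eventually_elim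
      case (elim x)
      then have "(\<lambda>n. F (X n) x) \<longlonglongrightarrow> G x"
        by (rule filterlim_compose[OF _ fl])
      then show ?case by (rule LIMSEQ_ignore_initial_segment)
    qed
  qed (use n0 in auto)
  then show "((\<lambda>y. \<integral>x. F y x \<partial>N) \<circ> X) \<longlonglongrightarrow> (\<integral>x. G x \<partial>N)"
    unfolding o_def by (rule LIMSEQ_offset)
qed

text \<open>Cauchy's inequality turns local domination of the integrand into domination of its
  derivative, hence of the difference quotients, so dominated convergence differentiates under the
  integral.\<close>

lemma holomorphic_on_parameter_integral:
  fixes F :: "complex \<Rightarrow> 'b \<Rightarrow> complex"
  assumes meas: "\<And>z. z \<in> S \<Longrightarrow> F z \<in> borel_measurable N"
    and holo: "\<And>x. x \<in> space N \<Longrightarrow> (\<lambda>z. F z x) holomorphic_on S"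
    and dom: "\<And>z. z \<in> S \<Longrightarrow> \<exists>e>0. \<exists>g. ball z e \<subseteq> S \<and> integrable N g \<and>
       (\<forall>x\<in>space N. \<forall>w\<in>ball z e. norm (F w x) \<le> g x)"
  shows "(\<lambda>z. \<integral>x. F z x \<partial>N) holomorphic_on S"
proof (rule holomorphic_onI)
  fix z assume z: "z \<in> S"
  obtain e g where e: "e > 0" "ball z e \<subseteq> S" and g: "integrable N g"
    and b: "\<And>x w. x \<in> space N \<Longrightarrow> w \<in> ball z e \<Longrightarrow> norm (F w x) \<le> g x"
    using dom[OF z] by blast
  have int: "integrable N (F w)" if "w \<in> ball z e" for w
    by (rule Bochner_Integration.integrable_bound[OF g])
       (use that e meas b in \<open>auto intro!: AE_I2 order_trans[OF _ abs_ge_self]\<close>)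
  have db: "norm (deriv (\<lambda>w. F w x) v) \<le> g x / (e / 4)"
    if x: "x \<in> space N" and v: "v \<in> ball z (e/2)" for x v
  proof -
    have sub: "cball v (e/4) \<subseteq> ball z e"
    proof
      fix y assume "y \<in> cball v (e/4)"
      then have "dist z y \<le> dist z v + e/4"
        using dist_triangle[of z y v] by (auto simp: dist_commute)
      then show "y \<in> ball z e" using v e(1) by auto
    qed
    have "norm ((deriv ^^ 1) (\<lambda>w. F w x) v) \<le> fact 1 * g x / (e/4)^1"
    proof (rule Cauchy_inequality)
      have h: "(\<lambda>w. F w x) holomorphic_on cball v (e/4)"
        by (rule holomorphic_on_subset[OF holo[OF x]]) (use sub e in auto)
      show "(\<lambda>w. F w x) holomorphic_on ball v (e/4)"
        by (rule holomorphic_on_subset[OF h]) auto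
      show "continuous_on (cball v (e/4)) (\<lambda>w. F w x)"
        using h by (rule holomorphic_on_imp_continuous_on)
      show "norm (F y x) \<le> g x" if "norm (v - y) = e/4" for y
        using b[OF x, of y] sub that by (auto simp: dist_norm subset_iff)
    qed (use e in auto)
    then show ?thesis by simp
  qed
  have qb: "norm ((F w x - F z x) / (w - z)) \<le> g x / (e/4)"
    if x: "x \<in> space N" and w: "w \<in> ball z (e/2)" "w \<noteq> z" for x w
  proof -
    have "norm (F w x - F z x) \<le> g x / (e/4) * norm (w - z)"
    proof (rule field_differentiable_bound[of "ball z (e/2)" "\<lambda>w. F w x" "deriv (\<lambda>w. F w x)"])
      fix y assume y: "y \<in> ball z (e/2)"
      have "(\<lambda>w. F w x) holomorphic_on ball z (e/2)"
        by (rule holomorphic_on_subset[OF holo[OF x]]) (use e in auto)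
      then show "((\<lambda>w. F w x) has_field_derivative deriv (\<lambda>w. F w x) y) (at y within ball z (e/2))"
        using holomorphic_derivI[OF _ open_ball y] has_field_derivative_at_within by blast
      show "norm (deriv (\<lambda>w. F w x) y) \<le> g x / (e/4)" by (rule db[OF x y])
    qed (use w e in auto)
    moreover have "norm (w - z) > 0" using w by simp
    ultimately show ?thesis by (simp add: norm_divide pos_divide_le_eq)
  qed
  let ?q = "\<lambda>w x. (F w x - F z x) / (w - z)"
  have evb: "\<forall>\<^sub>F w in at z. w \<in> ball z (e/2) \<and> w \<noteq> z"
    using e(1) eventually_at_ball[of "e/2" z UNIV] eventually_neq_at_within[of z z UNIV]
    by (simp add: eventually_conj_iff)
  have lim: "((\<lambda>w. ?q w x) \<longlongrightarrow> deriv (\<lambda>w. F w x) z) (at z)" if x: "x \<in> space N" for x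
  proof -
    have "(\<lambda>w. F w x) holomorphic_on ball z e"
      by (rule holomorphic_on_subset[OF holo[OF x]]) (use e in auto)
    from holomorphic_derivI[OF this open_ball] e(1)
    show ?thesis unfolding has_field_derivative_iff by auto
  qed
  have G: "(\<lambda>x. deriv (\<lambda>w. F w x) z) \<in> borel_measurable N"
  proof (rule borel_measurable_LIMSEQ_metric)
    let ?w = "\<lambda>n::nat. z + of_real (e/4) * of_real (inverse (real (Suc n)))"
    have w0: "?w \<longlonglongrightarrow> z + of_real (e/4) * of_real 0"
      by (intro tendsto_intros LIMSEQ_inverse_real_of_nat)
    have fl: "filterlim ?w (at z) sequentially"
      using w0 e(1) by (auto simp: filterlim_at simp del: of_nat_Suc)
    show "(\<lambda>n. ?q (?w n) x) \<longlonglongrightarrow> deriv (\<lambda>w. F w x) z" if "x \<in> space N" for x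
      by (rule filterlim_compose[OF lim[OF that] fl])
    show "?q (?w n) \<in> borel_measurable N" for n
    proof -
      have "norm (of_real (e/4) * of_real (inverse (real (Suc n))) :: complex) \<le> e/4 * 1"
        using e(1) unfolding norm_mult
        by (intro mult_mono) (auto simp: inverse_le_1_iff norm_inverse simp del: of_nat_Suc)
      then have "?w n \<in> ball z e" using e(1) by (simp add: dist_norm)
      then have "?w n \<in> S" using e by auto
      then show ?thesis using meas[OF z] meas[of "?w n"] by measurable
    qed
  qed
  have "((\<lambda>w. \<integral>x. ?q w x \<partial>N) \<longlongrightarrow> (\<integral>x. deriv (\<lambda>w. F w x) z \<partial>N)) (at z)"
  proof (rule tendsto_integral_at_within[OF G])
    show "integrable N (\<lambda>x. g x / (e/4))" using g by simp
    show "\<forall>\<^sub>F y in at z. ?q y \<in> borel_measurable N"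
      using evb
    proof eventually_elim
      case (elim y)
      then have "y \<in> S" using e by auto
      then show ?case using meas[OF z] meas[of y] by measurable
    qed
    show "\<forall>\<^sub>F y in at z. AE x in N. norm (?q y x) \<le> g x / (e/4)"
      using evb by eventually_elim (use qb in \<open>auto intro!: AE_I2\<close>)
  qed (use lim in auto)
  moreover have "\<forall>\<^sub>F w in at z. (\<integral>x. ?q w x \<partial>N) = ((\<integral>x. F w x \<partial>N) - (\<integral>x. F z x \<partial>N)) / (w - z)"
    using evb
    by eventually_elim (use int e in \<open>simp add: Bochner_Integration.integral_diff\<close>)
  ultimately have "((\<lambda>w. ((\<integral>x. F w x \<partial>N) - (\<integral>x. F z x \<partial>N)) / (w - z)) \<longlongrightarrow> (\<integral>x. deriv (\<lambda>w. F w x) z \<partial>N)) (at z)"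
    by (rule Lim_transform_eventually)
  then have "((\<lambda>z. \<integral>x. F z x \<partial>N) has_field_derivative (\<integral>x. deriv (\<lambda>w. F w x) z \<partial>N)) (at z)"
    unfolding has_field_derivative_iff .
  then show "(\<lambda>z. \<integral>x. F z x \<partial>N) field_differentiable at z within S"
    using field_differentiable_at_within field_differentiable_def by blast
qed

text \<open>A signed density that integrates to zero splits into two nonnegative parts of equal mass.
  Normalised and pushed forward by \<open>\<xi>\<close> they become probability measures with the same
  characteristic function, so Levy's uniqueness theorem applies.\<close>

lemma real_density_fourier_unique:
  fixes h \<xi> :: "'b \<Rightarrow> real"
  assumes h: "integrable N h" and \<xi>: "\<xi> \<in> borel_measurable N"
    and four: "\<And>t. (CLINT x|N. of_real (h x) * iexp (t * \<xi> x)) = 0" and A: "A \<in> sets borel"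
  shows "(\<integral>x. h x * indicator A (\<xi> x) \<partial>N) = 0"
proof -
  have hm[measurable]: "h \<in> borel_measurable N" using h by auto
  note [measurable] = \<xi> A
  define m where "m = (\<integral>x. max 0 (h x) \<partial>N)"
  have ip: "integrable N (\<lambda>x. max 0 (h x))" "integrable N (\<lambda>x. max 0 (- h x))"
    using h by (auto intro!: integrable_max)
  have hpm: "h x = max 0 (h x) - max 0 (- h x)" for x by auto
  have "(CLINT x|N. of_real (h x)) = (0::complex)" using four[of 0] by simp
  then have "(\<integral>x. h x \<partial>N) = 0" by simp
  then have m2: "m = (\<integral>x. max 0 (- h x) \<partial>N)"
    using Bochner_Integration.integral_diff[OF ip] hpm[symmetric] unfolding m_def by simp
  have "m \<ge> 0" unfolding m_def by (intro integral_nonneg_AE) auto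
  show ?thesis
  proof (cases "m = 0")
    case True
    have "AE x in N. max 0 (h x) = 0"
      using integral_nonneg_eq_0_iff_AE[OF ip(1)] True m_def by auto
    moreover have "AE x in N. max 0 (- h x) = 0"
      using integral_nonneg_eq_0_iff_AE[OF ip(2)] True m2 by auto
    ultimately have "AE x in N. h x * indicator A (\<xi> x) = 0"
      by eventually_elim auto
    then show ?thesis using integral_cong_AE[of "\<lambda>x. h x * indicator A (\<xi> x)" N "\<lambda>_. 0"] by auto
  next
    case False
    with \<open>m \<ge> 0\<close> have m: "m > 0" by simp
    define D where "D f = distr (density N (\<lambda>x. ennreal (f x / m))) borel \<xi>" for f :: "'b \<Rightarrow> real"
    have D: "real_distribution (D f)" if "integrable N f" "(\<integral>x. f x \<partial>N) = m" "\<And>x. f x \<ge> 0" for f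
    proof -
      have [measurable]: "f \<in> borel_measurable N" using that by auto
      have "emeasure (density N (\<lambda>x. ennreal (f x / m))) (space N) = (\<integral>\<^sup>+x. ennreal (f x / m) \<partial>N)"
        by (auto simp: emeasure_density cong: nn_integral_cong)
      also have "\<dots> = ennreal (\<integral>x. f x / m \<partial>N)"
        by (rule nn_integral_eq_integral) (use that m in auto)
      also have "\<dots> = 1" using that m by simp
      finally have E: "emeasure (density N (\<lambda>x. ennreal (f x / m))) (space N) = 1" .
      interpret prob_space "density N (\<lambda>x. ennreal (f x / m))" by (rule prob_spaceI) (simp only: space_density E)
      show ?thesis unfolding D_def by (rule real_distribution_distr) simp
    qed
    have charD: "char (D f) t = (CLINT x|N. of_real (f x) * iexp (t * \<xi> x)) / m"
      if "integrable N f" "\<And>x. f x \<ge> 0" for f t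
    proof -
      have [measurable]: "f \<in> borel_measurable N" using that by auto
      have "char (D f) t = (CLINT x|density N (\<lambda>x. ennreal (f x / m)). iexp (t * \<xi> x))"
        unfolding char_def D_def by (subst integral_distr) auto
      also have "\<dots> = (CLINT x|N. (f x / m) *\<^sub>R iexp (t * \<xi> x))"
        by (subst integral_density) (use that m in auto)
      also have "\<dots> = (CLINT x|N. (of_real (f x) * iexp (t * \<xi> x)) / m)"
        by (intro Bochner_Integration.integral_cong) (auto simp: scaleR_conv_of_real)
      finally show ?thesis by simp
    qed
    have int: "complex_integrable N (\<lambda>x. of_real (f x) * iexp (t * \<xi> x))" if "integrable N f" for f t
    proof -
      have [measurable]: "f \<in> borel_measurable N" using that by auto
      show ?thesis
        by (rule Bochner_Integration.integrable_bound[OF integrable_abs[OF that]]) (auto simp: norm_mult)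
    qed
    have "char (D (\<lambda>x. max 0 (h x))) = char (D (\<lambda>x. max 0 (- h x)))"
    proof
      fix t
      have "of_real (h x) * iexp (t * \<xi> x) = of_real (max 0 (h x)) * iexp (t * \<xi> x)
          - of_real (max 0 (- h x)) * iexp (t * \<xi> x)" for x
        by (subst hpm) (simp add: algebra_simps)
      then have "(CLINT x|N. of_real (max 0 (h x)) * iexp (t * \<xi> x)) - (CLINT x|N. of_real (max 0 (- h x)) * iexp (t * \<xi> x)) = 0"
        using four[of t] Bochner_Integration.integral_diff[OF int[OF ip(1)] int[OF ip(2)]] by simp
      then show "char (D (\<lambda>x. max 0 (h x))) t = char (D (\<lambda>x. max 0 (- h x))) t"
        using ip by (simp add: charD)
    qed
    then have "D (\<lambda>x. max 0 (h x)) = D (\<lambda>x. max 0 (- h x))"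
      using ip m_def m2 by (intro Levy_uniqueness D) auto
    moreover have mD: "measure (D f) A = (\<integral>x. f x * indicator A (\<xi> x) \<partial>N) / m"
      if "integrable N f" "\<And>x. f x \<ge> 0" for f
    proof -
      have [measurable]: "f \<in> borel_measurable N" using that by auto
      have "measure (D f) A = (\<integral>x. indicator A x \<partial>D f)" by (simp add: D_def)
      also have "\<dots> = (\<integral>x. (f x / m) *\<^sub>R indicator A (\<xi> x) \<partial>N)"
        unfolding D_def by (subst integral_distr, simp, simp, subst integral_density) (use that m in auto)
      finally show ?thesis by simp
    qed
    ultimately have "(\<integral>x. max 0 (h x) * indicator A (\<xi> x) \<partial>N) = (\<integral>x. max 0 (- h x) * indicator A (\<xi> x) \<partial>N)"
      using mD[OF ip(1)] mD[OF ip(2)] m by simp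
    moreover have "integrable N (\<lambda>x. f x * indicator A (\<xi> x))" if "integrable N f" for f :: "'b \<Rightarrow> real"
    proof -
      have [measurable]: "f \<in> borel_measurable N" using that by auto
      show ?thesis
        by (rule Bochner_Integration.integrable_bound[OF integrable_abs[OF that]]) (auto split: split_indicator)
    qed
    moreover have "h x * indicator A (\<xi> x) = max 0 (h x) * indicator A (\<xi> x) - max 0 (- h x) * indicator A (\<xi> x)" for x
      by (subst hpm) (simp add: algebra_simps)
    ultimately show ?thesis using ip by simp
  qed
qed

text \<open>The conjugate density has vanishing Fourier transform as well, hence so do the real and
  imaginary parts.\<close>

lemma complex_density_fourier_unique:
  fixes h :: "'b \<Rightarrow> complex" and \<xi> :: "'b \<Rightarrow> real"
  assumes h: "complex_integrable N h" and \<xi>: "\<xi> \<in> borel_measurable N"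
    and four: "\<And>t. (CLINT x|N. h x * iexp (t * \<xi> x)) = 0" and A: "A \<in> sets borel"
  shows "(CLINT x|N. h x * indicator A (\<xi> x)) = 0"
proof -
  note [measurable] = \<xi> A
  have hm[measurable]: "h \<in> borel_measurable N" using h by auto
  have int: "complex_integrable N (\<lambda>x. h x * iexp (t * \<xi> x))" for t
    by (rule Bochner_Integration.integrable_bound[OF integrable_norm[OF h]]) (auto simp: norm_mult)
  have cn: "(CLINT x|N. cnj (h x) * iexp (t * \<xi> x)) = 0" for t
  proof -
    have "cnj (h x) * iexp (t * \<xi> x) = cnj (h x * iexp ((- t) * \<xi> x))" for x
      by (simp add: exp_cnj)
    then have "(CLINT x|N. cnj (h x) * iexp (t * \<xi> x)) = (CLINT x|N. cnj (h x * iexp ((- t) * \<xi> x)))"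
      by (simp only:)
    also have "\<dots> = cnj (CLINT x|N. h x * iexp ((- t) * \<xi> x))" by (rule Bochner_Integration.integral_cnj)
    finally show ?thesis unfolding four by simp
  qed
  have [measurable]: "(\<lambda>x. cnj (h x)) \<in> borel_measurable N"
    by (rule borel_measurable_integrable) (use h in simp)
  have cint: "complex_integrable N (\<lambda>x. cnj (h x) * iexp (t * \<xi> x))" for t
    by (rule Bochner_Integration.integrable_bound[OF integrable_norm[OF h]]) (auto simp: norm_mult)
  have R: "(\<integral>x. Re (h x) * indicator A (\<xi> x) \<partial>N) = 0"
  proof (rule real_density_fourier_unique[OF _ \<xi> _ A])
    show "integrable N (\<lambda>x. Re (h x))" using h by simp
    fix t
    have "of_real (Re (h x)) * iexp (t * \<xi> x) = (1/2) * (h x * iexp (t * \<xi> x) + cnj (h x) * iexp (t * \<xi> x))" for x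
      by (simp add: complex_eq_iff field_simps)
    then have "(CLINT x|N. of_real (Re (h x)) * iexp (t * \<xi> x)) = (1/2) * (CLINT x|N. h x * iexp (t * \<xi> x) + cnj (h x) * iexp (t * \<xi> x))"
      by (simp only: integral_mult_right_zero)
    then show "(CLINT x|N. of_real (Re (h x)) * iexp (t * \<xi> x)) = 0"
      by (simp only: Bochner_Integration.integral_add[OF int cint] four cn add_0 mult_zero_right)
  qed
  have I: "(\<integral>x. Im (h x) * indicator A (\<xi> x) \<partial>N) = 0"
  proof (rule real_density_fourier_unique[OF _ \<xi> _ A])
    show "integrable N (\<lambda>x. Im (h x))" using h by simp
    fix t
    have "of_real (Im (h x)) * iexp (t * \<xi> x) = (- \<i>/2) * (h x * iexp (t * \<xi> x) - cnj (h x) * iexp (t * \<xi> x))" for x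
      by (simp add: complex_eq_iff field_simps)
    then have "(CLINT x|N. of_real (Im (h x)) * iexp (t * \<xi> x)) = (- \<i>/2) * (CLINT x|N. h x * iexp (t * \<xi> x) - cnj (h x) * iexp (t * \<xi> x))"
      by (simp only: integral_mult_right_zero)
    then show "(CLINT x|N. of_real (Im (h x)) * iexp (t * \<xi> x)) = 0"
      by (simp only: Bochner_Integration.integral_diff[OF int cint] four cn diff_0_right mult_zero_right)
  qed
  have ii: "complex_integrable N (\<lambda>x. h x * indicator A (\<xi> x))"
    by (rule Bochner_Integration.integrable_bound[OF integrable_norm[OF h]]) (auto simp: norm_mult split: split_indicator)
  have re: "Re (h x * indicator A (\<xi> x)) = Re (h x) * indicator A (\<xi> x)"
     "Im (h x * indicator A (\<xi> x)) = Im (h x) * indicator A (\<xi> x)" for x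
    by (auto split: split_indicator)
  show ?thesis
    by (rule complex_eqI) (simp_all only: integral_Re[OF ii, symmetric] integral_Im[OF ii, symmetric] re R I zero_complex.sel)
qed

text \<open>A complex measure, given as the image under \<open>\<xi>\<close> of the density
  \<open>h\<close>, whose Fourier transform extends to a bounded holomorphic function on the right
  half-plane does not charge \<open>(0, \<infinity>)\<close>. This replaces both the factorisation and
  the inversion step of the usual Wiener-Hopf method. Only values of the distribution function are
  needed, and the total mass is \<open>T 0\<close>.\<close>

lemma fourier_support_nonpos:
  fixes h :: "'b \<Rightarrow> complex" and \<xi> :: "'b \<Rightarrow> real"
  assumes h: "complex_integrable N h" and \<xi>[measurable]: "\<xi> \<in> borel_measurable N"
    and contT: "continuous_on {z. 0 \<le> Re z} T" and holT: "T holomorphic_on {z. 0 < Re z}"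
    and bT: "\<And>z. 0 \<le> Re z \<Longrightarrow> norm (T z) \<le> C"
    and four: "\<And>t. (CLINT x|N. h x * iexp (t * \<xi> x)) = T (\<i> * of_real t)" and x0: "x0 \<ge> 0"
  shows "(CLINT x|N. h x * indicator {..x0} (\<xi> x)) = T 0"
proof -
  have hm[measurable]: "h \<in> borel_measurable N" using h by auto
  define I where "I B z = (CLINT x|N. h x * indicator B (\<xi> x) * exp (z * of_real (\<xi> x)))" for B :: "real set" and z
  have bnd: "norm (h x * indicator B (\<xi> x) * exp (z * of_real (\<xi> x))) \<le> norm (h x)"
    if "\<And>y. y \<in> B \<Longrightarrow> Re z * y \<le> 0" for x B z
    using that[of "\<xi> x"] by (auto simp: norm_mult mult_left_le split: split_indicator)
  have cont: "continuous_on S (I B)" if S: "\<And>z y. z \<in> S \<Longrightarrow> y \<in> B \<Longrightarrow> Re z * y \<le> 0" and [measurable]: "B \<in> sets borel" for S B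
    unfolding continuous_on_def I_def
  proof
    fix z assume z: "z \<in> S"
    show "((\<lambda>z. CLINT x|N. h x * indicator B (\<xi> x) * exp (z * of_real (\<xi> x))) \<longlongrightarrow> (CLINT x|N. h x * indicator B (\<xi> x) * exp (z * of_real (\<xi> x)))) (at z within S)"
    proof (rule tendsto_integral_at_within[where w = "\<lambda>x. norm (h x)"])
      show "\<forall>\<^sub>F y in at z within S. AE x in N. cmod (h x * indicator B (\<xi> x) * exp (y * of_real (\<xi> x))) \<le> cmod (h x)"
        by (rule eventually_at_filter[THEN iffD2], rule always_eventually) (auto intro!: AE_I2 bnd S)
    qed (use h in \<open>auto intro!: AE_I2 tendsto_intros\<close>)
  qed
  have hol: "I B holomorphic_on S" if S: "open S" "\<And>z y. z \<in> S \<Longrightarrow> y \<in> B \<Longrightarrow> Re z * y \<le> 0" and [measurable]: "B \<in> sets borel" for S B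
    unfolding I_def
  proof (rule holomorphic_on_parameter_integral)
    fix z assume "z \<in> S"
    then obtain e where e: "e > 0" "ball z e \<subseteq> S" using S(1) openE by blast
    show "\<exists>e>0. \<exists>g. ball z e \<subseteq> S \<and> integrable N g \<and>
       (\<forall>x\<in>space N. \<forall>w\<in>ball z e. norm (h x * indicator B (\<xi> x) * exp (w * of_real (\<xi> x))) \<le> g x)"
      using e h S(2) by (intro exI[of _ e] conjI exI[of _ "\<lambda>x. norm (h x)"]) (auto intro!: bnd)
  qed (auto intro!: holomorphic_intros)
  let ?P = "{0<..} :: real set" and ?M = "{..0} :: real set"
  have hle: "{z. Re z \<le> 0} = {z. inner 1 z \<le> 0}" "{z. 0 \<le> Re z} = {z. 0 \<le> inner 1 z}" by auto
  have norm_I: "norm (I B z) \<le> (\<integral>x. norm (h x) \<partial>N)" if "\<And>y. y \<in> B \<Longrightarrow> Re z * y \<le> 0" and [measurable]: "B \<in> sets borel" for B z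
    unfolding I_def by (rule order_trans[OF integral_norm_bound], rule integral_mono)
      (use h that in \<open>auto intro!: AE_I2 bnd Bochner_Integration.integrable_bound[OF integrable_norm[OF h]]\<close>)
  have sum: "I ?P (\<i> * of_real t) + I ?M (\<i> * of_real t) = T (\<i> * of_real t)" for t
  proof -
    have "complex_integrable N (\<lambda>x. h x * indicator B (\<xi> x) * iexp (t * \<xi> x))" if [measurable]: "B \<in> sets borel" for B
      by (rule Bochner_Integration.integrable_bound[OF integrable_norm[OF h]]) (auto simp: norm_mult split: split_indicator)
    then have "I ?P (\<i> * of_real t) + I ?M (\<i> * of_real t) =
      (CLINT x|N. h x * indicator ?P (\<xi> x) * iexp (t * \<xi> x) + h x * indicator ?M (\<xi> x) * iexp (t * \<xi> x))"
      unfolding I_def by (subst Bochner_Integration.integral_add) (auto simp: mult.assoc)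
    also have "\<dots> = (CLINT x|N. h x * iexp (t * \<xi> x))"
      by (intro Bochner_Integration.integral_cong) (auto split: split_indicator)
    finally show ?thesis using four by simp
  qed
  (* The transform of the part on the positive half-line is defined and bounded for Re z <= 0, and T
     minus the transform of the rest for Re z >= 0. They agree on the imaginary axis, so together they
     form a bounded entire function. *)
  define f where "f z = (if Re z \<le> 0 then I ?P z else T z - I ?M z)" for z
  have contf: "continuous_on UNIV f"
  proof -
    have "continuous_on ({z. Re z \<le> 0} \<union> {z. 0 \<le> Re z}) (\<lambda>z. if Re z \<le> 0 then I ?P z else T z - I ?M z)"
    proof (rule continuous_on_cases)
      show "closed {z. Re z \<le> 0}" "closed {z. 0 \<le> Re z}" unfolding hle by (rule closed_halfspace_le closed_halfspace_ge)+
      show "continuous_on {z. Re z \<le> 0} (I ?P)" by (rule cont) (auto intro: mult_nonpos_nonneg)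
      show "continuous_on {z. 0 \<le> Re z} (\<lambda>z. T z - I ?M z)"
        by (intro continuous_intros contT cont) (auto intro: mult_nonneg_nonpos)
      show "\<forall>z. z \<in> {z. Re z \<le> 0} \<and> \<not> Re z \<le> 0 \<or> z \<in> {z. 0 \<le> Re z} \<and> Re z \<le> 0 \<longrightarrow> I ?P z = T z - I ?M z"
      proof (intro allI impI)
        fix z assume "z \<in> {z. Re z \<le> 0} \<and> \<not> Re z \<le> 0 \<or> z \<in> {z. 0 \<le> Re z} \<and> Re z \<le> 0"
        then have "z = \<i> * of_real (Im z)" by (auto simp: complex_eq_iff)
        then show "I ?P z = T z - I ?M z" using sum[of "Im z"] by (metis add_diff_cancel_right')
      qed
    qed
    moreover have "{z. Re z \<le> 0} \<union> {z. 0 \<le> Re z} = UNIV" by auto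
    ultimately show ?thesis unfolding f_def by simp
  qed
  have "f holomorphic_on UNIV"
  proof (rule holomorphic_on_paste_across_line[of UNIV 1 f 0])
    have "I ?P holomorphic_on {z. Re z < 0}"
      by (rule hol) (auto simp: open_halfspace_Re_lt intro: mult_nonpos_nonneg)
    then show "f holomorphic_on UNIV \<inter> {z. inner 1 z < 0}"
      by (subst holomorphic_cong[OF refl, of _ _ "I ?P"]) (auto simp: f_def)
    have "(\<lambda>z. T z - I ?M z) holomorphic_on {z. 0 < Re z}"
      by (intro holomorphic_intros holT hol) (auto simp: open_halfspace_Re_gt intro: mult_nonneg_nonpos)
    then show "f holomorphic_on UNIV \<inter> {z. 0 < inner 1 z}"
      by (subst holomorphic_cong[OF refl, of _ _ "\<lambda>z. T z - I ?M z"]) (auto simp: f_def)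
  qed (use contf in auto)
  moreover have "norm (f z) \<le> (\<integral>x. norm (h x) \<partial>N) + \<bar>C\<bar>" for z
  proof (cases "Re z \<le> 0")
    case True
    then have "norm (f z) \<le> (\<integral>x. norm (h x) \<partial>N)" unfolding f_def by (auto intro!: norm_I mult_nonpos_nonneg)
    then show ?thesis by linarith
  next
    case False
    then have "norm (I ?M z) \<le> (\<integral>x. norm (h x) \<partial>N)" by (intro norm_I) (auto intro: mult_nonneg_nonpos)
    moreover have "norm (T z) \<le> C" using False bT by auto
    ultimately show ?thesis using False norm_triangle_ineq4[of "T z" "I ?M z"] by (auto simp: f_def)
  qed
  then have "bounded (range f)" by (auto intro!: boundedI)
  ultimately obtain c where c: "\<And>z. f z = c"
    using Liouville_theorem[of f] by (auto simp: constant_on_def)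
  (* The constant value of f is found far to the left. *)
  have "((\<lambda>n::nat. I ?P (- of_nat n)) \<longlonglongrightarrow> (CLINT x|N. 0))"
    unfolding I_def
  proof (rule integral_dominated_convergence[where w = "\<lambda>x. norm (h x)"])
    show "AE x in N. (\<lambda>n. h x * indicator ?P (\<xi> x) * exp (- of_nat n * of_real (\<xi> x))) \<longlonglongrightarrow> 0"
    proof (rule AE_I2)
      fix x
      show "(\<lambda>n. h x * indicator ?P (\<xi> x) * exp (- of_nat n * of_real (\<xi> x))) \<longlonglongrightarrow> 0"
      proof (cases "\<xi> x > 0")
        case True
        have "(\<lambda>n. (exp (- \<xi> x)) ^ n) \<longlonglongrightarrow> 0"
          using True by (intro LIMSEQ_realpow_zero) auto
        then have "(\<lambda>n. exp (- real n * \<xi> x)) \<longlonglongrightarrow> 0"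
          by (simp add: exp_of_nat_mult[symmetric])
        then have "(\<lambda>n. exp (- of_nat n * of_real (\<xi> x)) :: complex) \<longlonglongrightarrow> 0"
          by (subst tendsto_norm_zero_iff[symmetric]) simp
        then show ?thesis by (intro tendsto_mult_right_zero)
      qed simp
    qed
    show "AE x in N. norm (h x * indicator ?P (\<xi> x) * exp (- of_nat n * of_real (\<xi> x))) \<le> norm (h x)" for n
      by (intro AE_I2 bnd) (auto)
  qed (use h in auto)
  moreover have "I ?P (- of_nat n) = c" for n using c[of "- of_nat n"] by (simp add: f_def)
  ultimately have c0: "c = 0" by (simp add: LIMSEQ_const_iff)
  have z: "I ?P (\<i> * of_real t) = 0" for t using c[of "\<i> * of_real t"] c0 by (simp add: f_def)
  have hP: "complex_integrable N (\<lambda>x. h x * indicator B (\<xi> x))" if [measurable]: "B \<in> sets borel" for B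
    by (rule Bochner_Integration.integrable_bound[OF integrable_norm[OF h]]) (auto simp: norm_mult split: split_indicator)
  have four': "(CLINT x|N. h x * indicator ?P (\<xi> x) * iexp (t * \<xi> x)) = 0" for t
    using z[of t] unfolding I_def by (simp add: mult.assoc)
  have "(CLINT x|N. (h x * indicator ?P (\<xi> x)) * indicator {x0<..} (\<xi> x)) = 0"
    by (rule complex_density_fourier_unique[OF hP \<xi> four']) auto
  moreover have "(CLINT x|N. h x) = T 0" using four[of 0] by simp
  moreover have "(CLINT x|N. h x * indicator {..x0} (\<xi> x)) =
     (CLINT x|N. h x) - (CLINT x|N. (h x * indicator ?P (\<xi> x)) * indicator {x0<..} (\<xi> x))"
  proof -
    have e: "(h x * indicator ?P (\<xi> x)) * indicator {x0<..} (\<xi> x) = h x * indicator {x0<..} (\<xi> x)" for x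
      using x0 by (auto split: split_indicator)
    show ?thesis unfolding e
      by (subst Bochner_Integration.integral_diff[OF h hP, symmetric])
         (auto intro!: Bochner_Integration.integral_cong split: split_indicator)
  qed
  ultimately show ?thesis by simp
qed

section \<open>Companion matrices and their impulse responses\<close>

lemma elem_sym_0 [simp]: "elem_sym n r 0 = 1"
proof -
  have "{A. A \<subseteq> {1..n} \<and> card A = 0} = {{}}"
    using finite_subset[of _ "{1..n}"] by auto
  then show ?thesis by (simp add: elem_sym_def)
qed

lemma elem_sym_gt: "n < k \<Longrightarrow> elem_sym n r k = 0"
proof -
  assume "n < k"
  have "\<not> (A \<subseteq> {1..n} \<and> card A = k)" for A :: "nat set"
    using \<open>n < k\<close> card_mono[of "{1..n}" A] by auto
  then have "{A. A \<subseteq> {1..n} \<and> card A = k} = {}" by blast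
  then show ?thesis unfolding elem_sym_def by (simp only: sum.empty)
qed

text \<open>Subsets of \<open>{1..n+1}\<close> are sorted by whether they contain the last
  index.\<close>

lemma elem_sym_Suc:
  "elem_sym (Suc n) r (Suc k) = elem_sym n r (Suc k) + r (Suc n) * elem_sym n r k"
proof -
  let ?F = "\<lambda>(n::nat) k. {A. A \<subseteq> {1..n} \<and> card A = k}"
  have fin: "finite (?F n k)" for n k by (rule finite_subset[of _ "Pow {1..n}"]) auto
  have split: "?F (Suc n) (Suc k) = ?F n (Suc k) \<union> insert (Suc n) ` ?F n k" (is "?L = ?A \<union> ?B")
  proof
    show "?L \<subseteq> ?A \<union> ?B"
    proof
      fix A assume A: "A \<in> ?L"
      then have fA: "finite A" using finite_subset by fastforce
      show "A \<in> ?A \<union> ?B"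
      proof (cases "Suc n \<in> A")
        case True
        then have "A = insert (Suc n) (A - {Suc n})" by auto
        moreover have "A - {Suc n} \<in> ?F n k"
          using A True fA by (auto simp: atLeastAtMostSuc_conv)
        ultimately show ?thesis by blast
      next
        case False
        then show ?thesis using A by (auto simp: atLeastAtMostSuc_conv)
      qed
    qed
    have "card (insert (Suc n) A) = Suc k" if "A \<in> ?F n k" for A
      using that finite_subset[of A "{1..n}"] by (subst card_insert_disjoint) auto
    then show "?A \<union> ?B \<subseteq> ?L" by auto
  qed
  have dis: "?A \<inter> ?B = {}" by auto
  have inj: "inj_on (insert (Suc n)) (?F n k)"
    by (rule inj_onI) (metis (no_types, lifting) Diff_insert_absorb atLeastAtMost_iff mem_Collect_eq not_less_eq_eq order_refl subsetD)
  have "(\<Prod>i\<in>insert (Suc n) A. r i) = r (Suc n) * (\<Prod>i\<in>A. r i)" if "A \<in> ?F n k" for A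
    using that finite_subset[of A "{1..n}"] by (subst prod.insert) auto
  then have "(\<Sum>A\<in>?B. \<Prod>i\<in>A. r i) = r (Suc n) * elem_sym n r k"
    unfolding elem_sym_def sum_distrib_left by (subst sum.reindex[OF inj]) (auto intro!: sum.cong)
  then show ?thesis
    unfolding elem_sym_def[of "Suc n"] split
    by (subst sum.union_disjoint) (auto simp: fin dis elem_sym_def simp del: atLeastAtMostSuc_conv)
qed

text \<open>Applying the polynomial with zeros \<open>- r\<^sub>1, \<dots>, -
  r\<^sub>n\<^sub>+\<^sub>1\<close> to the shift operator on sequences amounts to applying first the
  factor of the last zero and then the others. Every recurrence below is an instance.\<close>

lemma elem_sym_factor_Suc:
  "(\<Sum>j\<le>Suc n. elem_sym (Suc n) r (Suc n - j) * b j) =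
   (\<Sum>j\<le>n. elem_sym n r (n - j) * (b (Suc j) + r (Suc n) * b j))"
proof -
  have "(\<Sum>j\<le>Suc n. elem_sym (Suc n) r (Suc n - j) * b j) =
     b (Suc n) + (\<Sum>j\<le>n. elem_sym n r (Suc n - j) * b j) + (\<Sum>j\<le>n. elem_sym n r (n - j) * (r (Suc n) * b j))"
    by (simp add: Suc_diff_le elem_sym_Suc algebra_simps sum.distrib)
  also have "b (Suc n) + (\<Sum>j\<le>n. elem_sym n r (Suc n - j) * b j) = (\<Sum>j\<le>Suc n. elem_sym n r (Suc n - j) * b j)"
    by simp
  also have "\<dots> = (\<Sum>j\<le>n. elem_sym n r (n - j) * b (Suc j))"
    unfolding sum.atMost_Suc_shift by (simp add: elem_sym_gt)
  finally show ?thesis by (simp add: algebra_simps sum.distrib)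
qed

lemma prod_eq_elem_sym:
  "(\<Prod>i=1..n. z + r i) = (\<Sum>j\<le>n. elem_sym n r (n - j) * z ^ j)"
proof (induction n)
  case (Suc n)
  have "(\<Sum>j\<le>n. elem_sym n r (n - j) * (z ^ Suc j + r (Suc n) * z ^ j))
     = (z + r (Suc n)) * (\<Sum>j\<le>n. elem_sym n r (n - j) * z ^ j)"
    by (simp add: sum_distrib_left algebra_simps sum.distrib)
  then show ?case using Suc unfolding elem_sym_factor_Suc by (simp add: mult.commute)
qed simp

lemma elem_sym_top: "elem_sym n r n = (\<Prod>i=1..n. r i)"
  using prod_eq_elem_sym[where z=0 and n=n and r=r]
  by (simp add: power_0_left if_distrib cong: if_cong)

text \<open>For \<open>n > 0\<close>, \<open>impulse r n\<close> is the solution of the linear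
  recurrence with characteristic roots \<open>- r\<^sub>1, \<dots>, - r\<^sub>n\<close> that starts with
  \<open>n - 1\<close> zeros followed by 1. Defining it one root at a time makes distinct and repeated
  roots look alike; the sequence for \<open>n = 0\<close> is zero, and the unit at index 0 is put in
  when the first root is added.\<close>

fun impulse :: "(nat \<Rightarrow> complex) \<Rightarrow> nat \<Rightarrow> nat \<Rightarrow> complex" where
  "impulse r 0 k = 0"
| "impulse r (Suc n) 0 = (if n = 0 then 1 else 0)"
| "impulse r (Suc n) (Suc k) = - r (Suc n) * impulse r (Suc n) k + impulse r n k"

lemma impulse_initial: "k \<le> n \<Longrightarrow> impulse r (Suc n) k = (if k = n then 1 else 0)"
proof (induction n arbitrary: k)
  case 0 then show ?case by simp
next
  case (Suc n)
  note IH = Suc.IH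
  show ?case using Suc.prems
  proof (induction k)
    case (Suc k)
    then show ?case using IH[of k] by simp
  qed simp
qed

lemma impulse_recurrence: "(\<Sum>j\<le>n. elem_sym n r (n - j) * impulse r n (k + j)) = 0"
proof (induction n)
  case (Suc n)
  then show ?case unfolding elem_sym_factor_Suc by simp
qed simp

lemma impulse_bound: "(\<And>i. i \<in> {1..n} \<Longrightarrow> norm (r i) \<le> B) \<Longrightarrow> 0 \<le> B \<Longrightarrow> norm (impulse r n k) \<le> (1 + B) ^ k"
proof (induction n arbitrary: k)
  case (Suc n)
  have IH: "norm (impulse r n k) \<le> (1 + B) ^ k" for k
    by (rule Suc.IH) (use Suc.prems in auto)
  have bd: "norm (r (Suc n)) \<le> B" "0 \<le> B" using Suc.prems by auto
  show ?case
  proof (induction k)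
    case (Suc k)
    have "norm (impulse r (Suc n) (Suc k)) \<le> norm (r (Suc n)) * norm (impulse r (Suc n) k) + norm (impulse r n k)"
      using norm_triangle_ineq[of "- r (Suc n) * impulse r (Suc n) k" "impulse r n k"] by (simp add: norm_mult)
    also have "\<dots> \<le> B * (1 + B) ^ k + (1 + B) ^ k"
      using Suc.IH IH[of k] bd by (intro add_mono mult_mono) auto
    finally show ?case by (simp add: algebra_simps)
  qed simp
qed simp

definition egf :: "(nat \<Rightarrow> complex) \<Rightarrow> complex \<Rightarrow> complex" where
  "egf b z = (\<Sum>k. b k / fact k * z ^ k)"

lemma egf_0 [simp]: "egf b 0 = b 0"
  unfolding egf_def by (subst powser_zero) simp

lemma impulse_bounded: "\<exists>C\<ge>1. \<forall>k. norm (impulse r n k) \<le> C ^ k"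
proof -
  define B where "B = (\<Sum>i\<in>{1..n}. norm (r i))"
  have "norm (r i) \<le> B" if "i \<in> {1..n}" for i
    unfolding B_def by (rule member_le_sum) (use that in auto)
  moreover have "B \<ge> 0" by (auto simp: B_def intro: sum_nonneg)
  ultimately show ?thesis using impulse_bound[of n r B] by (intro exI[of _ "1+B"]) auto
qed

text \<open>Exponential generating functions turn the recurrence into a differential equation:
  \<open>response r n 0\<close> is the fundamental solution of the equation with characteristic roots
  \<open>- r\<^sub>i\<close>, and the index \<open>j\<close> counts derivatives.\<close>

definition response :: "(nat \<Rightarrow> complex) \<Rightarrow> nat \<Rightarrow> nat \<Rightarrow> real \<Rightarrow> complex" where
  "response r n j x = egf (\<lambda>k. impulse r n (k + j)) (of_real x)"

lemma egf_summable:
  fixes b :: "nat \<Rightarrow> complex"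
  assumes "\<And>k. norm (b k) \<le> D * C ^ k"
  shows "summable (\<lambda>k. b k / fact k * z ^ k)"
proof (rule Series.summable_comparison_test'[where N=0])
  show "summable (\<lambda>k. D * (inverse (fact k) * (C * norm z) ^ k))" by (intro summable_mult summable_exp)
  fix k
  show "norm (b k / fact k * z ^ k) \<le> D * (inverse (fact k) * (C * norm z) ^ k)"
    using assms[of k] by (auto simp: norm_mult norm_divide norm_power divide_simps power_mult_distrib mult.assoc[symmetric] intro!: mult_right_mono)
qed

lemma impulse_series: "summable (\<lambda>k. impulse r n (k + j) / fact k * z ^ k)"
proof -
  obtain C where C: "C \<ge> 1" "\<And>k. norm (impulse r n k) \<le> C ^ k" using impulse_bounded by blast
  show ?thesis
    by (rule egf_summable[of _ "C ^ j" C]) (use C(2) in \<open>simp add: power_add[symmetric] add.commute\<close>)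
qed

lemma response_deriv: "(response r n j has_vector_derivative response r n (Suc j) x) (at x)"
proof -
  have "diffs (\<lambda>k. impulse r n (k + j) / fact k) m = impulse r n (m + Suc j) / fact m" for m
    by (simp add: diffs_def divide_simps del: of_nat_Suc impulse.simps)
  then have "(egf (\<lambda>k. impulse r n (k + j)) has_field_derivative egf (\<lambda>k. impulse r n (k + Suc j)) (of_real x)) (at (of_real x))"
    using termdiffs_strong_converges_everywhere[of "\<lambda>k. impulse r n (k + j) / fact k" "of_real x", OF impulse_series]
    unfolding egf_def by (simp del: impulse.simps)
  from has_vector_derivative_real_field[OF this]
  show ?thesis unfolding response_def .
qed

lemma response_ode: "response r (Suc n) (Suc j) x = - r (Suc n) * response r (Suc n) j x + response r n j x"
proof -
  have "egf (\<lambda>k. impulse r (Suc n) (k + Suc j)) z = (\<Sum>k. - r (Suc n) * (impulse r (Suc n) (k + j) / fact k * z ^ k) + impulse r n (k + j) / fact k * z ^ k)" for z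
    unfolding egf_def by (intro suminf_cong) (simp add: field_simps add_divide_distrib)
  also have "\<dots> z = - r (Suc n) * egf (\<lambda>k. impulse r (Suc n) (k + j)) z + egf (\<lambda>k. impulse r n (k + j)) z" for z
    unfolding egf_def
    by (subst suminf_add[symmetric], intro summable_mult impulse_series, rule impulse_series)
       (subst suminf_mult[OF impulse_series], simp)
  finally show ?thesis unfolding response_def .
qed

lemma response_at_0: "response r n j 0 = impulse r n j"
  by (simp add: response_def)

lemma response_cont: "continuous_on A (response r n j)"
  by (rule continuous_at_imp_continuous_on) (use response_deriv has_vector_derivative_continuous in blast)

text \<open>Adding a root convolves with an exponential, so the bound picks up one power of
  \<open>x\<close> per root. The convolution is avoided by comparing derivatives after multiplication
  with the integrating factor.\<close>

lemma response_poly_exp_bound: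
  assumes "\<And>i. i \<in> {1..Suc n} \<Longrightarrow> \<delta> \<le> Re (r i)" and "0 \<le> x"
  shows "norm (response r (Suc n) 0 x) \<le> x ^ n / fact n * exp (- \<delta> * x)"
  using assms
proof (induction n arbitrary: x)
  case 0
  have imp: "impulse r (Suc 0) k = (- r (Suc 0)) ^ k" for k
    by (induction k) simp_all
  have "response r (Suc 0) 0 x = exp (- r (Suc 0) * of_real x)"
  proof -
    have "impulse r (Suc 0) (k + 0) / fact k * of_real x ^ k = (- r (Suc 0) * of_real x) ^ k /\<^sub>R fact k" for k
      by (simp only: power_mult_distrib imp add_0_right) (simp add: scaleR_conv_of_real divide_inverse)
    then show ?thesis unfolding response_def egf_def exp_def by simp
  qed
  then show ?case using 0 by (auto intro: mult_right_mono)
next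
  case (Suc n)
  let ?r = "r (Suc (Suc n))"
  let ?E = "response r (Suc (Suc n)) 0"
  show ?case
  proof (cases "x = 0")
    case False
    then have x: "x > 0" using Suc.prems by simp
    let ?\<rho> = "Re ?r"
    have \<rho>: "\<delta> \<le> ?\<rho>" using Suc.prems by simp
    have "norm (exp (?r * of_real x) * ?E x - exp (?r * of_real 0) * ?E 0)
       \<le> exp ((?\<rho> - \<delta>) * x) * x ^ Suc n / fact (Suc n) - exp ((?\<rho> - \<delta>) * 0) * 0 ^ Suc n / fact (Suc n)"
    proof (rule differentiable_bound_general[OF x, where f' = "\<lambda>y. exp (?r * of_real y) * response r (Suc n) 0 y"
          and \<phi>' = "\<lambda>y. exp ((?\<rho> - \<delta>) * y) * y ^ n / fact n + (?\<rho> - \<delta>) * exp ((?\<rho> - \<delta>) * y) * y ^ Suc n / fact (Suc n)"])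
      show "continuous_on {0..x} (\<lambda>x. exp (?r * of_real x) * ?E x)"
        by (intro continuous_intros response_cont)
      show "continuous_on {0..x} (\<lambda>x. exp ((?\<rho> - \<delta>) * x) * x ^ Suc n / fact (Suc n))"
        by (intro continuous_intros) auto
      fix y assume y: "0 < y" "y < x"
      have "((\<lambda>x. exp (?r * of_real x) * ?E x) has_vector_derivative
         exp (?r * of_real y) * response r (Suc (Suc n)) (Suc 0) y + ?r * exp (?r * of_real y) * ?E y) (at y)"
        by (rule has_vector_derivative_mult[OF _ response_deriv])
           (auto intro!: derivative_eq_intros has_vector_derivative_real_field simp: mult.commute)
      then show "((\<lambda>x. exp (?r * of_real x) * ?E x) has_vector_derivative exp (?r * of_real y) * response r (Suc n) 0 y) (at y)"
        by (simp add: response_ode algebra_simps)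
      show "((\<lambda>x. exp ((?\<rho> - \<delta>) * x) * x ^ Suc n / fact (Suc n)) has_vector_derivative
         exp ((?\<rho> - \<delta>) * y) * y ^ n / fact n + (?\<rho> - \<delta>) * exp ((?\<rho> - \<delta>) * y) * y ^ Suc n / fact (Suc n)) (at y)"
        unfolding has_real_derivative_iff_has_vector_derivative[symmetric]
        by (auto intro!: derivative_eq_intros simp: divide_simps simp del: of_nat_Suc power_Suc)
      have "norm (exp (?r * of_real y) * response r (Suc n) 0 y) \<le> exp (?\<rho> * y) * (y ^ n / fact n * exp (- \<delta> * y))"
        unfolding norm_mult by (intro mult_mono Suc.IH) (use Suc.prems y in auto)
      also have "\<dots> = exp ((?\<rho> - \<delta>) * y) * y ^ n / fact n"
        by (simp add: algebra_simps exp_diff exp_minus divide_simps)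
      also have "\<dots> \<le> exp ((?\<rho> - \<delta>) * y) * y ^ n / fact n + (?\<rho> - \<delta>) * exp ((?\<rho> - \<delta>) * y) * y ^ Suc n / fact (Suc n)"
        using \<rho> y by simp
      finally show "norm (exp (?r * of_real y) * response r (Suc n) 0 y) \<le> \<dots>" .
    qed
    then have "exp (?\<rho> * x) * norm (?E x) \<le> exp ((?\<rho> - \<delta>) * x) * x ^ Suc n / fact (Suc n)"
      by (simp add: norm_mult response_at_0)
    also have "\<dots> = exp (?\<rho> * x) * (x ^ Suc n / fact (Suc n) * exp (- \<delta> * x))"
      by (simp add: algebra_simps exp_diff exp_minus divide_simps)
    finally show ?thesis by (subst (asm) mult_le_cancel_left_pos) auto
  qed (simp add: response_at_0)
qed

lemma power_exp_bounded:
  assumes "(\<epsilon>::real) > 0"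
  shows "\<exists>C\<ge>0. \<forall>x\<ge>0. x ^ n * exp (- \<epsilon> * x) \<le> C"
proof (intro exI conjI allI impI)
  show "0 \<le> fact n / \<epsilon> ^ n" using assms by simp
  fix x :: real assume x: "0 \<le> x"
  have "(\<epsilon> * x) ^ n /\<^sub>R fact n \<le> exp (\<epsilon> * x)"
    unfolding exp_def using x assms
    by (intro sum_le_suminf[where I="{n}", simplified]) (auto simp: summable_exp)
  then have "\<epsilon> ^ n * x ^ n \<le> exp (\<epsilon> * x) * fact n"
    by (simp add: power_mult_distrib field_simps)
  then show "x ^ n * exp (- \<epsilon> * x) \<le> fact n / \<epsilon> ^ n"
    using assms by (simp add: exp_minus field_simps)
qed

text \<open>A little of the decay rate pays for the power of \<open>x\<close>; higher derivatives reduce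
  to lower ones by the differential equation.\<close>

lemma response_exp_bound:
  assumes "\<And>i. i \<in> {1..n} \<Longrightarrow> \<delta> < Re (r i)"
  shows "\<exists>C\<ge>0. \<forall>x\<ge>0. norm (response r n j x) \<le> C * exp (- \<delta> * x)"
  using assms
proof (induction j arbitrary: n)
  case 0
  show ?case
  proof (cases n)
    case 0
    have "response r 0 0 x = 0" for x by (simp add: response_def egf_def)
    then show ?thesis using 0 by (intro exI[of _ 0]) auto
  next
    case (Suc m)
    define \<delta>' where "\<delta>' = Min (insert (\<delta> + 1) ((\<lambda>i. Re (r i)) ` {1..n}))"
    have d: "\<delta> < \<delta>'" unfolding \<delta>'_def using "0.prems" by (subst Min_gr_iff) auto
    have d2: "\<delta>' \<le> Re (r i)" if "i \<in> {1..Suc m}" for i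
      unfolding \<delta>'_def using that Suc by (intro Min_le) auto
    obtain C where C: "C \<ge> 0" "\<And>x. x \<ge> 0 \<Longrightarrow> x ^ m * exp (- (\<delta>' - \<delta>) * x) \<le> C"
      using power_exp_bounded[of "\<delta>' - \<delta>" m] d by auto
    have "norm (response r n 0 x) \<le> (C / fact m) * exp (- \<delta> * x)" if x: "x \<ge> 0" for x
    proof -
      have "norm (response r (Suc m) 0 x) \<le> x ^ m / fact m * exp (- \<delta>' * x)"
        by (rule response_poly_exp_bound[OF d2 x])
      also have "\<dots> = (x ^ m * exp (- (\<delta>' - \<delta>) * x)) / fact m * exp (- \<delta> * x)"
        by (simp add: exp_add[symmetric] algebra_simps)
      also have "\<dots> \<le> C / fact m * exp (- \<delta> * x)"
        using C(2)[OF x] by (intro mult_right_mono divide_right_mono) auto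
      finally show ?thesis using Suc by simp
    qed
    then show ?thesis using C(1) by (intro exI[of _ "C / fact m"]) auto
  qed
next
  case (Suc j)
  show ?case
  proof (cases n)
    case 0
    have "response r 0 (Suc j) x = 0" for x by (simp add: response_def egf_def)
    then show ?thesis using 0 by (intro exI[of _ 0]) auto
  next
    case (Suc m)
    obtain C1 where C1: "C1 \<ge> 0" "\<And>x. x \<ge> 0 \<Longrightarrow> norm (response r n j x) \<le> C1 * exp (- \<delta> * x)"
      using Suc.IH[of n] Suc.prems by auto
    obtain C2 where C2: "C2 \<ge> 0" "\<And>x. x \<ge> 0 \<Longrightarrow> norm (response r m j x) \<le> C2 * exp (- \<delta> * x)"
      using Suc.IH[of m] Suc.prems Suc by auto
    have "norm (response r n (Suc j) x) \<le> (norm (r n) * C1 + C2) * exp (- \<delta> * x)" if x: "x \<ge> 0" for x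
    proof -
      have "norm (response r n (Suc j) x) \<le> norm (r n) * norm (response r n j x) + norm (response r m j x)"
        using norm_triangle_ineq[of "- r n * response r n j x" "response r m j x"]
        by (simp add: Suc response_ode norm_mult)
      also have "\<dots> \<le> norm (r n) * (C1 * exp (- \<delta> * x)) + C2 * exp (- \<delta> * x)"
        using C1(2)[OF x] C2(2)[OF x] by (intro add_mono mult_left_mono) auto
      finally show ?thesis by (simp add: algebra_simps)
    qed
    then show ?thesis using C1 C2 by (intro exI[of _ "norm (r n) * C1 + C2"]) auto
  qed
qed

lemma integral_FTC_Ici:
  fixes F g :: "real \<Rightarrow> complex"
  assumes F: "\<And>x. (F has_vector_derivative g x) (at x)" and g: "continuous_on UNIV g"
    and int: "set_integrable lborel {0..} g" and lim: "(F \<longlongrightarrow> 0) at_top"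
  shows "(CLINT x:{0..}|lborel. g x) = - F 0"
proof -
  have "((\<lambda>n::nat. CLINT x|lborel. indicator {0..real n} x *\<^sub>R g x) \<longlonglongrightarrow> (CLINT x|lborel. indicator {0..} x *\<^sub>R g x))"
  proof (rule integral_dominated_convergence[where w = "\<lambda>x. norm (indicator {0..} x *\<^sub>R g x)"])
    have [measurable]: "g \<in> borel_measurable borel" using g by (rule borel_measurable_continuous_onI)
    show "(\<lambda>x. indicator {0..} x *\<^sub>R g x) \<in> borel_measurable lborel" by measurable
    show "(\<lambda>x. indicator {0..real n} x *\<^sub>R g x) \<in> borel_measurable lborel" for n by measurable
    show "AE x in lborel. (\<lambda>n. indicator {0..real n} x *\<^sub>R g x) \<longlonglongrightarrow> indicator {0..} x *\<^sub>R g x"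
    proof (rule AE_I2)
      fix x :: real
      have "\<forall>\<^sub>F n in sequentially. real n \<ge> x"
        using filterlim_real_sequentially by (simp add: filterlim_at_top)
      then have "\<forall>\<^sub>F n in sequentially. indicator {0..real n} x *\<^sub>R g x = indicator {0..} x *\<^sub>R g x"
        by eventually_elim (auto split: split_indicator)
      then show "(\<lambda>n. indicator {0..real n} x *\<^sub>R g x) \<longlonglongrightarrow> indicator {0..} x *\<^sub>R g x"
        by (rule tendsto_eventually)
    qed
    show "integrable lborel (\<lambda>x. norm (indicator {0..} x *\<^sub>R g x))"
      using int unfolding set_integrable_def by (rule integrable_norm)
  qed (auto split: split_indicator)
  moreover have "(CLINT x|lborel. indicator {0..real n} x *\<^sub>R g x) = F (real n) - F 0" for n
    by (rule integral_FTC_atLeastAtMost)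
       (use F g in \<open>auto intro: has_vector_derivative_at_within continuous_on_subset\<close>)
  moreover have "(\<lambda>n. F (real n) - F 0) \<longlonglongrightarrow> 0 - F 0"
    by (intro tendsto_intros filterlim_compose[OF lim] filterlim_real_sequentially)
  ultimately show ?thesis
    unfolding set_lebesgue_integral_def using LIMSEQ_unique by fastforce
qed

lemma integrable_exp_Ici: "(\<delta>::real) > 0 \<Longrightarrow> integrable lborel (\<lambda>x. indicator {0..} x * exp (- \<delta> * x))"
proof -
  assume d: "\<delta> > 0"
  have "(\<integral>\<^sup>+x. ennreal (exp (- \<delta> * x)) * indicator {0..} x \<partial>lborel) = ennreal (0 - (- exp (- \<delta> * 0) / \<delta>))"
  proof (rule nn_integral_FTC_atLeast)
    have "((\<lambda>x. - exp (- \<delta> * x) / \<delta>) \<longlongrightarrow> - 0 / \<delta>) at_top"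
    proof (intro tendsto_intros filterlim_compose[OF exp_at_bot])
      show "filterlim (\<lambda>x. - \<delta> * x) at_bot at_top"
        using d by (intro filterlim_tendsto_neg_mult_at_bot[OF tendsto_const] filterlim_ident) auto
    qed (use d in simp)
    then show "((\<lambda>x. - exp (- \<delta> * x) / \<delta>) \<longlongrightarrow> 0) at_top" by simp
  qed (use d in \<open>auto intro!: derivative_eq_intros\<close>)
  then show ?thesis
    by (intro integrableI_nonneg) (auto simp: ennreal_mult' ennreal_indicator mult.commute)
qed

lemma exp_bounded_integrable:
  fixes g :: "real \<Rightarrow> complex"
  assumes "\<delta> > 0" and g: "g \<in> borel_measurable borel" and b: "\<And>x. x \<ge> 0 \<Longrightarrow> norm (g x) \<le> C * exp (- \<delta> * x)"
    and z: "Re z \<le> 0"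
  shows "set_integrable lborel {0..} (\<lambda>x. exp (z * of_real x) * g x)"
  unfolding set_integrable_def
proof (rule Bochner_Integration.integrable_bound)
  show "integrable lborel (\<lambda>x. C * (indicator {0..} x * exp (- \<delta> * x)))"
    by (intro integrable_mult_right integrable_exp_Ici assms)
  show "(\<lambda>x. indicator {0..} x *\<^sub>R (exp (z * of_real x) * g x)) \<in> borel_measurable lborel"
    using g by measurable
  show "AE x in lborel. norm (indicator {0..} x *\<^sub>R (exp (z * of_real x) * g x)) \<le> norm (C * (indicator {0..} x * exp (- \<delta> * x)))"
  proof (rule AE_I2)
    fix x :: real
    show "norm (indicator {0..} x *\<^sub>R (exp (z * of_real x) * g x)) \<le> norm (C * (indicator {0..} x * exp (- \<delta> * x)))"
    proof (cases "x \<ge> 0")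
      case True
      then have "Re z * x \<le> 0" using z by (simp add: mult_nonpos_nonneg)
      then have "norm (exp (z * of_real x) * g x) \<le> 1 * (C * exp (- \<delta> * x))"
        unfolding norm_mult using b[OF True] by (intro mult_mono) auto
      then show ?thesis using True by auto
    qed simp
  qed
qed

lemma response_laplace_step:
  assumes r: "\<And>i. i \<in> {1..n} \<Longrightarrow> 0 < Re (r i)" and z: "Re z \<le> 0"
  shows "set_integrable lborel {0..} (\<lambda>x. exp (z * of_real x) * response r n j x)"
    and "(CLINT x:{0..}|lborel. exp (z * of_real x) * response r n (Suc j) x)
       = - impulse r n j - z * (CLINT x:{0..}|lborel. exp (z * of_real x) * response r n j x)"
proof -
  define \<delta> where "\<delta> = Min (insert 1 ((\<lambda>i. Re (r i)) ` {1..n})) / 2"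
  have M: "0 < Min (insert 1 ((\<lambda>i. Re (r i)) ` {1..n}))" using r by (subst Min_gr_iff) auto
  then have d: "\<delta> > 0" by (simp add: \<delta>_def)
  have dr: "\<delta> < Re (r i)" if "i \<in> {1..n}" for i
  proof -
    have "Min (insert 1 ((\<lambda>i. Re (r i)) ` {1..n})) \<le> Re (r i)" by (rule Min_le) (use that in auto)
    then have "2 * \<delta> \<le> Re (r i)" unfolding \<delta>_def by simp
    then show ?thesis using d by simp
  qed
  have "\<forall>j. \<exists>C. \<forall>x\<ge>0. norm (response r n j x) \<le> C * exp (- \<delta> * x)"
    using response_exp_bound[where n = n and r = r, OF dr] by blast
  from choice[OF this] obtain C where C: "\<And>j x. x \<ge> 0 \<Longrightarrow> norm (response r n j x) \<le> C j * exp (- \<delta> * x)"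
    by blast
  have meas: "response r n j \<in> borel_measurable borel" for j
    using response_cont by (rule borel_measurable_continuous_onI)
  have int: "set_integrable lborel {0..} (\<lambda>x. exp (z * of_real x) * response r n j x)" for j
    by (rule exp_bounded_integrable[OF d meas C z])
  then show "set_integrable lborel {0..} (\<lambda>x. exp (z * of_real x) * response r n j x)" .
  have lim: "((\<lambda>x. exp (z * of_real x) * response r n j x) \<longlongrightarrow> 0) at_top"
  proof (rule tendsto_0_le)
    show "((\<lambda>x. C j * exp (- \<delta> * x)) \<longlongrightarrow> 0) at_top"
    proof -
      have "filterlim (\<lambda>x. - \<delta> * x) at_bot at_top"
        using d by (intro filterlim_tendsto_neg_mult_at_bot[OF tendsto_const] filterlim_ident) auto
      then have "((\<lambda>x. exp (- \<delta> * x)) \<longlongrightarrow> 0) at_top" by (rule filterlim_compose[OF exp_at_bot])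
      then show ?thesis by (rule tendsto_mult_right_zero)
    qed
    show "\<forall>\<^sub>F x in at_top. norm (exp (z * of_real x) * response r n j x) \<le> norm (C j * exp (- \<delta> * x)) * 1"
      using eventually_ge_at_top[of 0]
    proof eventually_elim
      case (elim x)
      then have "Re z * x \<le> 0" using z by (simp add: mult_nonpos_nonneg)
      then have "norm (exp (z * of_real x) * response r n j x) \<le> 1 * (C j * exp (- \<delta> * x))"
        unfolding norm_mult using C[OF elim] by (intro mult_mono) auto
      then show ?case by simp
    qed
  qed
  have "(CLINT x:{0..}|lborel. exp (z * of_real x) * response r n (Suc j) x + z * (exp (z * of_real x) * response r n j x))
     = - (exp (z * of_real 0) * response r n j 0)"
  proof (rule integral_FTC_Ici[OF _ _ _ lim])
    show "((\<lambda>x. exp (z * of_real x) * response r n j x) has_vector_derivative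
       exp (z * of_real x) * response r n (Suc j) x + z * (exp (z * of_real x) * response r n j x)) (at x)" for x
      unfolding mult.assoc[symmetric]
      by (rule has_vector_derivative_mult[OF _ response_deriv])
         (auto intro!: derivative_eq_intros has_vector_derivative_real_field simp: mult.commute)
    show "continuous_on UNIV (\<lambda>x. exp (z * of_real x) * response r n (Suc j) x + z * (exp (z * of_real x) * response r n j x))"
      by (intro continuous_intros response_cont)
    show "set_integrable lborel {0..} (\<lambda>x. exp (z * of_real x) * response r n (Suc j) x + z * (exp (z * of_real x) * response r n j x))"
      by (intro set_integral_add int set_integrable_mult_right)
  qed
  then show "(CLINT x:{0..}|lborel. exp (z * of_real x) * response r n (Suc j) x)
       = - impulse r n j - z * (CLINT x:{0..}|lborel. exp (z * of_real x) * response r n j x)"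
    by (subst (asm) set_integral_add(2)[OF int set_integrable_mult_right[OF int]])
       (simp add: response_at_0 algebra_simps)
qed

text \<open>The first-order equation that introduces the last root divides the transform by \<open>r -
  z\<close>.\<close>

lemma response_laplace_0:
  assumes r: "\<And>i. i \<in> {1..Suc n} \<Longrightarrow> 0 < Re (r i)" and z: "Re z \<le> 0"
  shows "(CLINT x:{0..}|lborel. exp (z * of_real x) * response r (Suc n) 0 x) = 1 / (\<Prod>i=1..Suc n. r i - z)"
  using r
proof (induction n)
  let ?L = "\<lambda>n j. (CLINT x:{0..}|lborel. exp (z * of_real x) * response r n j x)"
  have step: "(r (Suc n) - z) * ?L (Suc n) 0 = ?L n 0 + impulse r (Suc n) 0"
    if "\<And>i. i \<in> {1..Suc n} \<Longrightarrow> 0 < Re (r i)" for n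
  proof -
    have aux: "L1 = - b * L + L0 \<Longrightarrow> L1 = - i - z * L \<Longrightarrow> (b - z) * L = L0 + i" for L1 L L0 i b :: complex
      by (simp add: algebra_simps)
    have i1: "set_integrable lborel {0..} (\<lambda>x. exp (z * of_real x) * response r (Suc n) 0 x)"
      by (rule response_laplace_step(1)[OF that z])
    have i2: "set_integrable lborel {0..} (\<lambda>x. exp (z * of_real x) * response r n 0 x)"
      by (rule response_laplace_step(1)[OF that z]) auto
    have "?L (Suc n) (Suc 0) = (CLINT x:{0..}|lborel. (- r (Suc n)) * (exp (z * of_real x) * response r (Suc n) 0 x) + exp (z * of_real x) * response r n 0 x)"
      by (simp add: response_ode algebra_simps)
    also have "\<dots> = (- r (Suc n)) * ?L (Suc n) 0 + ?L n 0"
      by (simp only: set_integral_add(2)[OF set_integrable_mult_right[OF i1] i2] set_integral_mult_right)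
    finally show ?thesis
      using aux response_laplace_step(2)[where n = "Suc n" and r = r and j = 0, OF that z] by blast
  qed
  {
    case 0
    have "response r 0 0 x = 0" for x by (simp add: response_def egf_def)
    then have "?L 0 0 = 0" by simp
    moreover have "r (Suc 0) - z \<noteq> 0" using 0[of 1] z by auto
    ultimately show ?case using step[of 0] 0 by (simp add: field_simps)
  next
    case (Suc n)
    have "r (Suc (Suc n)) - z \<noteq> 0" using Suc.prems[of "Suc (Suc n)"] z by auto
    then have "?L (Suc (Suc n)) 0 = ?L (Suc n) 0 / (r (Suc (Suc n)) - z)"
      using step[of "Suc n"] Suc.prems by (simp add: nonzero_eq_divide_eq mult.commute)
    moreover have "?L (Suc n) 0 = 1 / (\<Prod>i=1..Suc n. r i - z)" by (rule Suc.IH) (use Suc.prems in auto)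
    ultimately show ?case by (simp add: mult.commute)
  }
qed

lemma response_laplace:
  assumes r: "\<And>i. i \<in> {1..n} \<Longrightarrow> 0 < Re (r i)" and z: "Re z \<le> 0" and j: "j < n"
  shows "(CLINT x:{0..}|lborel. exp (z * of_real x) * response r n j x) = (- z) ^ j / (\<Prod>i=1..n. r i - z)"
proof -
  obtain m where n: "n = Suc m" using j by (cases n) auto
  show ?thesis using j
  proof (induction j)
    case 0
    then show ?case using response_laplace_0[of m r z] r z n by simp
  next
    case (Suc j)
    then have "impulse r n j = 0" using n by (simp add: impulse_initial del: impulse.simps)
    then show ?case using Suc response_laplace_step(2)[OF r z, where j = j] by simp
  qed
qed

lemma response_recurrence: "(\<Sum>j\<le>n. elem_sym n r (n - j) * response r n j x) = 0"
proof -
  have "(\<Sum>j\<le>n. elem_sym n r (n - j) * response r n j x)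
     = (\<Sum>j\<le>n. \<Sum>k. elem_sym n r (n - j) * (impulse r n (k + j) / fact k * of_real x ^ k))"
    unfolding response_def egf_def by (intro sum.cong refl suminf_mult[symmetric] impulse_series)
  also have "\<dots> = (\<Sum>k. \<Sum>j\<le>n. elem_sym n r (n - j) * (impulse r n (k + j) / fact k * of_real x ^ k))"
    by (intro suminf_sum[symmetric] summable_mult impulse_series)
  also have "\<dots> = (\<Sum>k. (\<Sum>j\<le>n. elem_sym n r (n - j) * impulse r n (k + j)) * (of_real x ^ k / fact k))"
    by (intro suminf_cong) (simp add: sum_distrib_right sum_distrib_left algebra_simps)
  finally show ?thesis by (simp add: impulse_recurrence)
qed

definition companion :: "nat \<Rightarrow> (nat \<Rightarrow> complex) \<Rightarrow> complex \<Rightarrow> complex mat" where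
  "companion N r \<epsilon> = mat N N (\<lambda>(i, j). if i = N - 1 then - \<epsilon> * elem_sym N r (N - j)
     else if j = i + 1 then \<epsilon> else 0)"

lemma companion_carrier [simp]: "companion N r \<epsilon> \<in> carrier_mat N N"
  by (simp add: companion_def)

lemma companion_mult_vec_index:
  assumes "i < N" "v \<in> carrier_vec N"
  shows "vec_index (companion N r \<epsilon> *\<^sub>v v) i = (if i = N - 1 then - \<epsilon> * (\<Sum>j<N. elem_sym N r (N - j) * vec_index v j)
     else \<epsilon> * vec_index v (i + 1))"
proof -
  have "vec_index (companion N r \<epsilon> *\<^sub>v v) i = (\<Sum>j<N. (if i = N - 1 then - \<epsilon> * elem_sym N r (N - j)
     else if j = i + 1 then \<epsilon> else 0) * vec_index v j)"
    using assms by (simp add: companion_def scalar_prod_def atLeast0LessThan)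
  then show ?thesis
    using assms by (auto simp: sum_distrib_left mult.assoc if_distrib[of "\<lambda>a. a * _"] sum.delta cong: if_cong)
qed

text \<open>The companion matrix moves a window of a solution of the recurrence by one step; only the
  last row needs the recurrence.\<close>

lemma companion_impulse:
  assumes "0 < N"
  shows "companion N r \<epsilon> *\<^sub>v vec N (\<lambda>j. impulse r N (l + j)) = \<epsilon> \<cdot>\<^sub>v vec N (\<lambda>j. impulse r N (Suc l + j))"
proof (rule eq_vecI)
  fix i assume "i < dim_vec (\<epsilon> \<cdot>\<^sub>v vec N (\<lambda>j. impulse r N (Suc l + j)))"
  then have i: "i < N" by simp
  have "(\<Sum>j<N. elem_sym N r (N - j) * impulse r N (l + j)) + impulse r N (l + N) = 0"
    using impulse_recurrence[where n=N and r=r and k=l] by (simp add: lessThan_Suc_atMost[symmetric])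
  then have rec: "(\<Sum>j<N. elem_sym N r (N - j) * impulse r N (l + j)) = - impulse r N (l + N)"
    by (simp add: add_eq_0_iff)
  show "vec_index (companion N r \<epsilon> *\<^sub>v vec N (\<lambda>j. impulse r N (l + j))) i = vec_index (\<epsilon> \<cdot>\<^sub>v vec N (\<lambda>j. impulse r N (Suc l + j))) i"
  proof (cases "i = N - 1")
    case True
    then have "Suc (l + i) = l + N" using assms by simp
    then show ?thesis using True i rec by (simp add: companion_mult_vec_index del: impulse.simps)
  next
    case False
    have "l + (i + 1) = Suc l + i" by simp
    then show ?thesis using i False by (simp only: companion_mult_vec_index vec_carrier index_smult_vec index_vec if_False dim_vec) simp
  qed
qed (simp add: companion_def)

lemma smult_mat_mult_vec:
  fixes a :: "'a::comm_ring"
  assumes "A \<in> carrier_mat n m" "v \<in> carrier_vec m"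
  shows "(a \<cdot>\<^sub>m A) *\<^sub>v v = a \<cdot>\<^sub>v (A *\<^sub>v v)"
  using assms by (intro eq_vecI) (auto simp: scalar_prod_def sum_distrib_left mult.assoc intro!: sum.cong)

lemma companion_power_impulse:
  assumes "0 < N"
  shows "((x \<cdot>\<^sub>m companion N r \<epsilon>) ^\<^sub>m k) *\<^sub>v vec N (\<lambda>j. impulse r N (l + j)) = (x * \<epsilon>) ^ k \<cdot>\<^sub>v vec N (\<lambda>j. impulse r N (k + l + j))"
proof (induction k arbitrary: l)
  case 0
  then show ?case by (simp add: companion_def)
next
  case (Suc k)
  let ?A = "x \<cdot>\<^sub>m companion N r \<epsilon>" and ?w = "\<lambda>l. vec N (\<lambda>j. impulse r N (l + j))"
  have A: "?A \<in> carrier_mat N N" by simp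
  have Ak: "?A ^\<^sub>m k \<in> carrier_mat N N" by (rule pow_carrier_mat[OF A])
  have "(?A ^\<^sub>m Suc k) *\<^sub>v ?w l = ?A ^\<^sub>m k *\<^sub>v (?A *\<^sub>v ?w l)"
    using Ak A by (simp add: assoc_mult_mat_vec[where n\<^sub>1=N and n\<^sub>2=N and n\<^sub>3=N])
  also have "?A *\<^sub>v ?w l = (x * \<epsilon>) \<cdot>\<^sub>v ?w (Suc l)"
    using companion_impulse[OF assms, of r \<epsilon> l]
    by (subst smult_mat_mult_vec[of _ N N]) (auto simp: smult_smult_assoc)
  also have "?A ^\<^sub>m k *\<^sub>v ((x * \<epsilon>) \<cdot>\<^sub>v ?w (Suc l)) = (x * \<epsilon>) \<cdot>\<^sub>v (?A ^\<^sub>m k *\<^sub>v ?w (Suc l))"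
    by (rule mult_mat_vec[OF Ak]) simp
  also have "\<dots> = (x * \<epsilon>) ^ Suc k \<cdot>\<^sub>v vec N (\<lambda>j. impulse r N (k + Suc l + j))"
    by (simp only: Suc.IH smult_smult_assoc power_Suc)
  finally show ?case by (simp only: add_Suc_right add_Suc)
qed

text \<open>The last unit vector is the initial window of the impulse sequence, so the matrix powers in
  the exponential series produce its later windows.\<close>

lemma mat_exp_companion:
  assumes "0 < N"
  shows "mat_exp (of_real x \<cdot>\<^sub>m companion N r (of_real \<epsilon>)) *\<^sub>v unit_vec N (N - 1) = vec N (\<lambda>j. response r N j (\<epsilon> * x))"
proof (rule eq_vecI)
  fix j assume "j < dim_vec (vec N (\<lambda>j. response r N j (\<epsilon> * x)))"
  then have j: "j < N" by simp
  let ?A = "of_real x \<cdot>\<^sub>m companion N r (of_real \<epsilon>)"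
  have dA: "dim_row ?A = N" by (simp add: companion_def)
  obtain n where n: "N = Suc n" using assms by (cases N) auto
  have u: "unit_vec N (N - 1) = vec N (\<lambda>j. impulse r N (0 + j))"
    by (rule eq_vecI) (auto simp: n impulse_initial simp del: impulse.simps)
  have col: "vec_index (B *\<^sub>v unit_vec N (N - 1)) j = B $$ (j, N - 1)" if "B \<in> carrier_mat N N" for B :: "complex mat"
    using that j assms by (simp add: scalar_prod_right_unit)
  have pw: "(?A ^\<^sub>m k) $$ (j, N - 1) = (of_real (\<epsilon> * x)) ^ k * impulse r N (k + j)" for k
  proof -
    have "?A ^\<^sub>m k \<in> carrier_mat N N" by (rule pow_carrier_mat) simp
    then have "(?A ^\<^sub>m k) $$ (j, N - 1) = vec_index (?A ^\<^sub>m k *\<^sub>v vec N (\<lambda>j. impulse r N (0 + j))) j"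
      using col[of "?A ^\<^sub>m k"] u by simp
    also have "\<dots> = (of_real (\<epsilon> * x)) ^ k * impulse r N (k + j)"
      using j by (subst companion_power_impulse[OF assms]) (simp add: mult.commute)
    finally show ?thesis .
  qed
  have "vec_index (mat_exp ?A *\<^sub>v unit_vec N (N - 1)) j = mat_exp ?A $$ (j, N - 1)"
    by (rule col) (simp add: mat_exp_def dA[simplified])
  also have "\<dots> = (\<Sum>k. (?A ^\<^sub>m k) $$ (j, N - 1) / fact k)"
    using j assms by (simp add: mat_exp_def dA[simplified])
  also have "\<dots> = response r N j (\<epsilon> * x)"
    unfolding pw response_def egf_def by (intro suminf_cong) simp
  finally show "vec_index (mat_exp ?A *\<^sub>v unit_vec N (N - 1)) j = vec_index (vec N (\<lambda>j. response r N j (\<epsilon> * x))) j"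
    using j by simp
qed (simp add: mat_exp_def companion_def)

text \<open>Solving the shift backwards: the recurrence is divided by its constant coefficient.\<close>

definition companion_inv :: "nat \<Rightarrow> (nat \<Rightarrow> complex) \<Rightarrow> complex \<Rightarrow> complex mat" where
  "companion_inv N r \<epsilon> = mat N N (\<lambda>(i, j). \<epsilon> * (if i = 0 then - elem_sym N r (N - Suc j) / elem_sym N r N
     else if i = Suc j then 1 else 0))"

lemma companion_inv_right:
  assumes "0 < N" "elem_sym N r N \<noteq> 0" "\<epsilon> * \<epsilon> = 1"
  shows "companion N r \<epsilon> * companion_inv N r \<epsilon> = 1\<^sub>m N"
proof (rule eq_matI)
  fix i j assume "i < dim_row (1\<^sub>m N)" "j < dim_col (1\<^sub>m N :: complex mat)"
  then have ij: "i < N" "j < N" by auto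
  let ?c = "vec N (\<lambda>i. \<epsilon> * (if i = 0 then - elem_sym N r (N - Suc j) / elem_sym N r N else if i = Suc j then 1 else 0))"
  have "(companion N r \<epsilon> * companion_inv N r \<epsilon>) $$ (i, j) = vec_index (companion N r \<epsilon> *\<^sub>v ?c) i"
    using ij by (auto simp: companion_def companion_inv_def scalar_prod_def intro!: sum.cong)
  also have "\<dots> = (1\<^sub>m N) $$ (i, j)"
  proof (cases "i = N - 1")
    case False
    then have "vec_index (companion N r \<epsilon> *\<^sub>v ?c) i = \<epsilon> * vec_index ?c (i + 1)"
      using ij by (subst companion_mult_vec_index) auto
    also have "\<dots> = (if i = j then 1 else 0)" using False ij assms by auto
    finally show ?thesis using ij by simp
  next
    case True
    have "vec_index (companion N r \<epsilon> *\<^sub>v ?c) i = - \<epsilon> * (\<Sum>l<N. elem_sym N r (N - l) * vec_index ?c l)"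
      using ij True by (subst companion_mult_vec_index) auto
    also have "(\<Sum>l<N. elem_sym N r (N - l) * vec_index ?c l) =
       elem_sym N r N * (\<epsilon> * (- elem_sym N r (N - Suc j) / elem_sym N r N)) + (\<Sum>l\<in>{..<N} - {0}. elem_sym N r (N - l) * vec_index ?c l)"
      using assms by (subst sum.remove[of _ 0]) auto
    also have "(\<Sum>l\<in>{..<N} - {0}. elem_sym N r (N - l) * vec_index ?c l) = (\<Sum>l\<in>{..<N} - {0}. if l = Suc j then \<epsilon> * elem_sym N r (N - l) else 0)"
      by (intro sum.cong) auto
    also have "\<dots> = (if Suc j < N then \<epsilon> * elem_sym N r (N - Suc j) else 0)"
      by (subst sum.delta) auto
    finally have "vec_index (companion N r \<epsilon> *\<^sub>v ?c) i = (if Suc j < N then 0 else 1)"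
      using assms ij by (cases "Suc j = N") (auto simp: algebra_simps)
    then show ?thesis using ij True by auto
  qed
  finally show "(companion N r \<epsilon> * companion_inv N r \<epsilon>) $$ (i, j) = 1\<^sub>m N $$ (i, j)" .
qed (auto simp: companion_def companion_inv_def)

text \<open>The Gauss-Jordan inverse is identified through uniqueness of two-sided inverses.\<close>

lemma the_mat_inverse_companion:
  assumes "0 < N" "elem_sym N r N \<noteq> 0" "\<epsilon> * \<epsilon> = 1"
  shows "the (mat_inverse (companion N r \<epsilon>)) = companion_inv N r \<epsilon>"
proof -
  let ?A = "companion N r \<epsilon>" and ?B = "companion_inv N r \<epsilon>"
  have B: "?B \<in> carrier_mat N N" by (simp add: companion_inv_def)
  have AB: "?A * ?B = 1\<^sub>m N" by (rule companion_inv_right[OF assms])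
  have BA: "?B * ?A = 1\<^sub>m N" by (rule mat_mult_left_right_inverse[OF companion_carrier B AB])
  have U: "?A \<in> Units (ring_mat TYPE(complex) N ())"
    unfolding Units_def ring_mat_def using AB BA B by auto
  have "mat_inverse ?A \<noteq> None"
  proof
    assume "mat_inverse ?A = None"
    from mat_inverse(1)[OF companion_carrier this, where b = "()"] U show False by contradiction
  qed
  then obtain C where C: "mat_inverse ?A = Some C" by auto
  have "C * ?A = 1\<^sub>m N" "C \<in> carrier_mat N N" using mat_inverse(2)[OF companion_carrier C] by auto
  then have "C * (?A * ?B) = ?B" using B by (subst assoc_mult_mat[symmetric]) auto
  then have "C = ?B" using AB \<open>C \<in> carrier_mat N N\<close> by simp
  then show ?thesis using C by simp
qed

text \<open>The antiderivatives of the responses; if all roots have positive real part they are those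
  that vanish at infinity. For \<open>j > 0\<close> this is the response one index lower, for \<open>j =
  0\<close> the differential equation is solved for its term of order zero.\<close>

definition response_prim :: "(nat \<Rightarrow> complex) \<Rightarrow> nat \<Rightarrow> nat \<Rightarrow> real \<Rightarrow> complex" where
  "response_prim r n j x = (if j = 0 then - (\<Sum>i<n. elem_sym n r (n - Suc i) * response r n i x) / elem_sym n r n
     else response r n (j - 1) x)"

lemma companion_inv_mat_exp:
  assumes "0 < N" "elem_sym N r N \<noteq> 0" "\<epsilon> * \<epsilon> = 1"
  shows "the (mat_inverse (companion N r (of_real \<epsilon>))) *\<^sub>v
    (mat_exp (of_real x \<cdot>\<^sub>m companion N r (of_real \<epsilon>)) *\<^sub>v unit_vec N (N - 1))
    = of_real \<epsilon> \<cdot>\<^sub>v vec N (\<lambda>j. response_prim r N j (\<epsilon> * x))"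
proof -
  have e: "of_real \<epsilon> * of_real \<epsilon> = (1 :: complex)" using assms(3) by (metis of_real_1 of_real_mult)
  show ?thesis
    unfolding mat_exp_companion[OF assms(1)] the_mat_inverse_companion[OF assms(1,2) e]
  proof (rule eq_vecI)
    fix i assume "i < dim_vec (of_real \<epsilon> \<cdot>\<^sub>v vec N (\<lambda>j. response_prim r N j (\<epsilon> * x)))"
    then have i: "i < N" by simp
    have "vec_index (companion_inv N r (of_real \<epsilon>) *\<^sub>v vec N (\<lambda>j. response r N j (\<epsilon> * x))) i =
      (\<Sum>j<N. of_real \<epsilon> * (if i = 0 then - elem_sym N r (N - Suc j) / elem_sym N r N
          else if i = Suc j then 1 else 0) * response r N j (\<epsilon> * x))"
      using i by (simp add: companion_inv_def scalar_prod_def atLeast0LessThan)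
    also have "\<dots> = of_real \<epsilon> * response_prim r N i (\<epsilon> * x)"
    proof (cases i)
      case 0
      then show ?thesis by (simp add: response_prim_def sum_distrib_left sum_divide_distrib sum_negf[symmetric] algebra_simps)
    next
      case (Suc k)
      then have "(\<Sum>j<N. of_real \<epsilon> * (if i = 0 then - elem_sym N r (N - Suc j) / elem_sym N r N
          else if i = Suc j then 1 else 0) * response r N j (\<epsilon> * x)) = (\<Sum>j<N. if j = k then of_real \<epsilon> * response r N j (\<epsilon> * x) else 0)"
        by (intro sum.cong) auto
      also have "\<dots> = of_real \<epsilon> * response r N k (\<epsilon> * x)" using i Suc by (subst sum.delta) auto
      finally show ?thesis using Suc by (simp add: response_prim_def)
    qed
    finally show "vec_index (companion_inv N r (of_real \<epsilon>) *\<^sub>v vec N (\<lambda>j. response r N j (\<epsilon> * x))) i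
       = vec_index (of_real \<epsilon> \<cdot>\<^sub>v vec N (\<lambda>j. response_prim r N j (\<epsilon> * x))) i"
      using i by simp
  qed (simp add: companion_inv_def)
qed

lemma response_prim_deriv:
  assumes "elem_sym n r n \<noteq> 0"
  shows "(response_prim r n j has_vector_derivative response r n j x) (at x)"
proof (cases j)
  case 0
  have eq: "response_prim r n 0 = (\<lambda>x. \<Sum>i<n. - elem_sym n r (n - Suc i) / elem_sym n r n * response r n i x)"
    by (auto simp: fun_eq_iff response_prim_def sum_divide_distrib sum_negf)
  have "(response_prim r n 0 has_vector_derivative (\<Sum>i<n. - elem_sym n r (n - Suc i) / elem_sym n r n * response r n (Suc i) x)) (at x)"
    unfolding eq by (intro has_vector_derivative_sum has_vector_derivative_mult_right response_deriv)
  also have "(\<Sum>i<n. - elem_sym n r (n - Suc i) / elem_sym n r n * response r n (Suc i) x) =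
     - (\<Sum>i<n. elem_sym n r (n - Suc i) * response r n (Suc i) x) / elem_sym n r n"
    by (simp add: sum_divide_distrib sum_negf)
  also have "(\<Sum>i<n. elem_sym n r (n - Suc i) * response r n (Suc i) x) = - (elem_sym n r n * response r n 0 x)"
    using response_recurrence[where n=n and r=r and x=x] by (subst (asm) sum.atMost_shift) (simp add: add_eq_0_iff2)
  finally show ?thesis using 0 assms by simp
next
  case (Suc k)
  have "response_prim r n (Suc k) = response r n k" by (auto simp: response_prim_def)
  then show ?thesis using Suc response_deriv by simp
qed

text \<open>The function on the half-line with Laplace transform \<open>(\<Prod>i. r'\<^sub>i - z) /
  (\<Prod>i. r\<^sub>i - z) - 1\<close>; the numerator minus the denominator is expanded in elementary
  symmetric functions.\<close>

definition occ_density :: "nat \<Rightarrow> (nat \<Rightarrow> complex) \<Rightarrow> (nat \<Rightarrow> complex) \<Rightarrow> real \<Rightarrow> complex" where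
  "occ_density N r r' x = (\<Sum>j<N. (elem_sym N r' (N - j) - elem_sym N r (N - j)) * response r N j x)"

text \<open>The distribution function of the unit mass at 0 together with \<open>occ_density\<close>,
  written with the antiderivatives that vanish at infinity, so the first term is the limit at
  infinity.\<close>

definition occ_profile :: "nat \<Rightarrow> (nat \<Rightarrow> complex) \<Rightarrow> (nat \<Rightarrow> complex) \<Rightarrow> real \<Rightarrow> complex" where
  "occ_profile N r r' x = elem_sym N r' N / elem_sym N r N +
     (\<Sum>j<N. (elem_sym N r' (N - j) - elem_sym N r (N - j)) * response_prim r N j x)"

lemma elem_sym_top_nz:
  assumes "\<And>i. i \<in> {1..N} \<Longrightarrow> 0 < Re (r i)"
  shows "elem_sym N r N \<noteq> 0"
proof -
  have "r i \<noteq> 0" if "i \<in> {1..N}" for i using assms[OF that] by auto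
  then show ?thesis unfolding elem_sym_top by (subst prod_zero_iff) auto
qed

lemma occ_profile_deriv:
  "elem_sym N r N \<noteq> 0 \<Longrightarrow> (occ_profile N r r' has_vector_derivative occ_density N r r' x) (at x)"
  unfolding occ_profile_def occ_density_def
  by (auto intro!: derivative_eq_intros has_vector_derivative_sum has_vector_derivative_mult_right response_prim_deriv)

lemma occ_profile_0:
  assumes "0 < N" "elem_sym N r N \<noteq> 0"
  shows "occ_profile N r r' 0 = 1"
proof -
  obtain n where n: "N = Suc n" using assms by (cases N) auto
  have "(\<Sum>i<N. elem_sym N r (N - Suc i) * response r N i 0) = (\<Sum>i<N. if i = n then 1 else 0)"
    by (intro sum.cong) (auto simp: response_at_0 n impulse_initial simp del: impulse.simps)
  also have "\<dots> = 1" using n by (simp only: sum.delta finite_lessThan) simp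
  finally have p0: "response_prim r N 0 0 = - 1 / elem_sym N r N" by (simp add: response_prim_def)
  have "response_prim r N (Suc k) 0 = 0" if "Suc k < N" for k
    using that n by (simp add: response_prim_def response_at_0 impulse_initial del: impulse.simps)
  then have "(\<Sum>j<N. (elem_sym N r' (N - j) - elem_sym N r (N - j)) * response_prim r N j 0)
     = (\<Sum>j<N. if j = 0 then (elem_sym N r' N - elem_sym N r N) * (- 1 / elem_sym N r N) else 0)"
    using p0 by (intro sum.cong refl) (auto simp: gr0_conv_Suc)
  also have "\<dots> = (elem_sym N r' N - elem_sym N r N) * (- 1 / elem_sym N r N)"
    using assms(1) by (simp only: sum.delta finite_lessThan) simp
  finally show ?thesis using assms by (simp add: occ_profile_def field_simps)
qed

lemma occ_density_cont: "continuous_on A (occ_density N r r')"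
  unfolding occ_density_def by (intro continuous_intros response_cont)

lemma occ_density_bound:
  assumes r: "\<And>i. i \<in> {1..N} \<Longrightarrow> 0 < Re (r i)"
  shows "\<exists>\<delta>>0. \<exists>C\<ge>0. \<forall>x\<ge>0. norm (occ_density N r r' x) \<le> C * exp (- \<delta> * x)"
proof -
  define \<delta> where "\<delta> = Min (insert 1 ((\<lambda>i. Re (r i)) ` {1..N})) / 2"
  have M: "0 < Min (insert 1 ((\<lambda>i. Re (r i)) ` {1..N}))" using r by (subst Min_gr_iff) auto
  then have d: "\<delta> > 0" by (simp add: \<delta>_def)
  have dr: "\<delta> < Re (r i)" if "i \<in> {1..N}" for i
  proof -
    have "Min (insert 1 ((\<lambda>i. Re (r i)) ` {1..N})) \<le> Re (r i)" by (rule Min_le) (use that in auto)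
    then have "2 * \<delta> \<le> Re (r i)" unfolding \<delta>_def by simp
    then show ?thesis using d by simp
  qed
  have "\<forall>j. \<exists>C. C \<ge> 0 \<and> (\<forall>x\<ge>0. norm (response r N j x) \<le> C * exp (- \<delta> * x))"
    using response_exp_bound[where n = N and r = r, OF dr] by blast
  from choice[OF this] obtain C where C: "\<And>j. C j \<ge> 0" "\<And>j x. x \<ge> 0 \<Longrightarrow> norm (response r N j x) \<le> C j * exp (- \<delta> * x)"
    by blast
  show ?thesis
  proof (rule exI[of _ \<delta>], intro conjI d, rule exI[of _ "\<Sum>j<N. norm (elem_sym N r' (N - j) - elem_sym N r (N - j)) * C j"], intro conjI allI impI)
    let ?D = "\<lambda>j. norm (elem_sym N r' (N - j) - elem_sym N r (N - j))"
    show "0 \<le> (\<Sum>j<N. ?D j * C j)" using C(1) by (intro sum_nonneg) auto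
    fix x :: real assume x: "x \<ge> 0"
    have "norm (occ_density N r r' x) \<le> (\<Sum>j<N. ?D j * norm (response r N j x))"
      unfolding occ_density_def by (rule order_trans[OF norm_sum]) (simp add: norm_mult)
    also have "\<dots> \<le> (\<Sum>j<N. ?D j * (C j * exp (- \<delta> * x)))"
      by (intro sum_mono mult_left_mono C(2) x) auto
    finally show "norm (occ_density N r r' x) \<le> (\<Sum>j<N. ?D j * C j) * exp (- \<delta> * x)"
      by (simp add: sum_distrib_right mult.assoc)
  qed
qed

lemma set_integral_sum':
  assumes "\<And>i. i \<in> I \<Longrightarrow> set_integrable M A (f i)"
  shows "(CLINT x:A|M. (\<Sum>i\<in>I. f i x)) = (\<Sum>i\<in>I. CLINT x:A|M. f i x)"
  using assms unfolding set_lebesgue_integral_def set_integrable_def scaleR_sum_right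
  by (rule Bochner_Integration.integral_sum)

text \<open>Each response transforms to a power of \<open>- z\<close> over the product, and the powers
  are collected by the generating identity of the elementary symmetric functions.\<close>

lemma occ_density_laplace:
  assumes r: "\<And>i. i \<in> {1..N} \<Longrightarrow> 0 < Re (r i)" and z: "Re z \<le> 0"
  shows "(CLINT x:{0..}|lborel. exp (z * of_real x) * occ_density N r r' x)
    = (\<Prod>i=1..N. r' i - z) / (\<Prod>i=1..N. r i - z) - 1"
proof -
  let ?d = "\<lambda>j. elem_sym N r' (N - j) - elem_sym N r (N - j)"
  let ?P = "\<lambda>r. \<Prod>i=1..N. r i - z"
  have P: "?P r \<noteq> 0"
  proof -
    have "r i - z \<noteq> 0" if "i \<in> {1..N}" for i using r[OF that] z by auto
    then show ?thesis by (subst prod_zero_iff) auto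
  qed
  have ex: "?P r = (\<Sum>j\<le>N. elem_sym N r (N - j) * (- z) ^ j)" for r
    using prod_eq_elem_sym[of "- z" r N] by (simp add: add.commute)
  have "(CLINT x:{0..}|lborel. exp (z * of_real x) * occ_density N r r' x)
     = (CLINT x:{0..}|lborel. (\<Sum>j<N. ?d j * (exp (z * of_real x) * response r N j x)))"
    unfolding occ_density_def by (simp add: sum_distrib_left mult_ac)
  also have "\<dots> = (\<Sum>j<N. CLINT x:{0..}|lborel. ?d j * (exp (z * of_real x) * response r N j x))"
    by (intro set_integral_sum' set_integrable_mult_right response_laplace_step(1) r z)
  also have "\<dots> = (\<Sum>j<N. ?d j * ((- z) ^ j / ?P r))"
    by (intro sum.cong refl) (simp only: set_integral_mult_right response_laplace[OF r z] lessThan_iff)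
  also have "\<dots> = (\<Sum>j<N. ?d j * (- z) ^ j) / ?P r" by (simp add: sum_divide_distrib)
  also have "(\<Sum>j<N. ?d j * (- z) ^ j) = ?P r' - ?P r"
    unfolding ex lessThan_Suc_atMost[symmetric] by (simp add: sum_subtractf algebra_simps)
  finally show ?thesis using P by (simp add: diff_divide_distrib)
qed

section \<open>The half-line equation of the profile function\<close>

text \<open>Adds finitely many complex densities on the same space by adding a finite
  coordinate.\<close>

lemma integral_pair_count_space:
  fixes f :: "'i \<Rightarrow> 'b \<Rightarrow> complex"
  assumes "sigma_finite_measure M" and I: "finite I" and f: "\<And>i. i \<in> I \<Longrightarrow> complex_integrable M (f i)"
  shows "complex_integrable (M \<Otimes>\<^sub>M count_space I) (\<lambda>(x, i). f i x)"
    and "(CLINT w|(M \<Otimes>\<^sub>M count_space I). (case w of (x, i) \<Rightarrow> f i x)) = (\<Sum>i\<in>I. CLINT x|M. f i x)"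
proof -
  interpret A: sigma_finite_measure M by fact
  interpret B: sigma_finite_measure "count_space I" by (rule sigma_finite_measure_count_space_finite[OF I])
  interpret pair_sigma_finite M "count_space I" ..
  have meas: "(\<lambda>(x, i). f i x) \<in> borel_measurable (M \<Otimes>\<^sub>M count_space I)"
  proof -
    have "(\<lambda>p. f (snd p) (fst p)) \<in> borel_measurable (M \<Otimes>\<^sub>M count_space I)"
      by (rule measurable_compose_countable'[where I = I and f = "\<lambda>i p. f i (fst p)" and g = snd])
         (use f I in \<open>auto intro: countable_finite intro!: measurable_compose[OF measurable_fst] borel_measurable_integrable\<close>)
    then show ?thesis by (simp add: case_prod_beta')
  qed
  show int: "complex_integrable (M \<Otimes>\<^sub>M count_space I) (\<lambda>(x, i). f i x)"
  proof (rule integrableI_bounded[OF meas])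
    have "(\<integral>\<^sup>+w. ennreal (norm (case w of (x, i) \<Rightarrow> f i x)) \<partial>(M \<Otimes>\<^sub>M count_space I))
       = (\<integral>\<^sup>+i. (\<integral>\<^sup>+x. ennreal (norm (f i x)) \<partial>M) \<partial>count_space I)"
      using meas by (subst nn_integral_snd[symmetric]) auto
    also have "\<dots> = (\<Sum>i\<in>I. \<integral>\<^sup>+x. ennreal (norm (f i x)) \<partial>M)"
      by (rule nn_integral_count_space_finite[OF I])
    also have "\<dots> < \<infinity>"
      using f I by (simp add: integrable_iff_bounded)
    finally show "(\<integral>\<^sup>+w. ennreal (norm (case w of (x, i) \<Rightarrow> f i x)) \<partial>(M \<Otimes>\<^sub>M count_space I)) < \<infinity>" .
  qed
  show "(CLINT w|(M \<Otimes>\<^sub>M count_space I). (case w of (x, i) \<Rightarrow> f i x)) = (\<Sum>i\<in>I. CLINT x|M. f i x)"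
    using integral_snd[OF int] I by (simp add: lebesgue_integral_count_space_finite)
qed

lemma integral_pair_weight:
  fixes b :: "'b \<Rightarrow> complex" and w :: "'b \<times> 'c \<Rightarrow> complex"
  assumes "sigma_finite_measure M1" "prob_space M2" and b: "complex_integrable M1 b"
    and w: "w \<in> borel_measurable (M1 \<Otimes>\<^sub>M M2)" and bd: "\<And>z. norm (w z) \<le> 1"
  shows "complex_integrable (M1 \<Otimes>\<^sub>M M2) (\<lambda>(x, y). b x * w (x, y))"
    and "(CLINT z|(M1 \<Otimes>\<^sub>M M2). (case z of (x, y) \<Rightarrow> b x * w (x, y))) = (CLINT x|M1. b x * (CLINT y|M2. w (x, y)))"
    and "(CLINT z|(M1 \<Otimes>\<^sub>M M2). (case z of (x, y) \<Rightarrow> b x * w (x, y))) = (CLINT y|M2. (CLINT x|M1. b x * w (x, y)))"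
proof -
  interpret A: sigma_finite_measure M1 by fact
  interpret B: prob_space M2 by fact
  interpret pair_sigma_finite M1 M2 ..
  note [measurable] = w
  have [measurable]: "b \<in> borel_measurable M1" using b by auto
  show int: "complex_integrable (M1 \<Otimes>\<^sub>M M2) (\<lambda>(x, y). b x * w (x, y))"
  proof (rule Bochner_Integration.integrable_bound)
    show "complex_integrable (M1 \<Otimes>\<^sub>M M2) (\<lambda>(x, y). b x)"
      by (rule Fubini_integrable) (use b in auto)
    show "AE z in M1 \<Otimes>\<^sub>M M2. norm (case z of (x, y) \<Rightarrow> b x * w (x, y)) \<le> norm (case z of (x, y) \<Rightarrow> b x)"
      using bd by (intro AE_I2) (auto simp: norm_mult intro!: mult_left_le)
  qed measurable
  show "(CLINT z|(M1 \<Otimes>\<^sub>M M2). (case z of (x, y) \<Rightarrow> b x * w (x, y))) = (CLINT x|M1. b x * (CLINT y|M2. w (x, y)))"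
    by (subst integral_fst[OF int, symmetric]) simp
  show "(CLINT z|(M1 \<Otimes>\<^sub>M M2). (case z of (x, y) \<Rightarrow> b x * w (x, y))) = (CLINT y|M2. (CLINT x|M1. b x * w (x, y)))"
    by (subst integral_snd[OF int, symmetric]) simp
qed

text \<open>The left-hand side is the distribution function at \<open>x0\<close> of the convolution of
  \<open>\<delta>\<^sub>0 + ((p - q) / q) \<mu>\<close> with \<open>\<delta>\<^sub>0 +
  occ_density\<close>, and the hypothesis on \<open>T\<close> says that the Fourier transform of this
  complex measure extends boundedly to the right half-plane.\<close>

lemma occ_profile_equation:
  fixes \<mu> :: "real measure" and k :: "real \<Rightarrow> complex" and p q x0 :: real and T :: "complex \<Rightarrow> complex"
  assumes N: "0 < N" and r: "\<And>i. i \<in> {1..N} \<Longrightarrow> 0 < Re (r i)"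
    and \<mu>: "real_distribution \<mu>" and q: "q \<noteq> 0"
    and kq: "\<And>t. of_real q - k t \<noteq> 0" and char: "\<And>t. char \<mu> t = of_real q / (of_real q - k t)"
    and contT: "continuous_on {z. 0 \<le> Re z} T" and holT: "T holomorphic_on {z. 0 < Re z}"
    and bT: "\<And>z. 0 \<le> Re z \<Longrightarrow> norm (T z) \<le> C"
    and TT: "\<And>t. T (\<i> * of_real t) = (of_real p - k t) / (of_real q - k t) *
          ((\<Prod>i=1..N. r' i - \<i> * of_real t) / (\<Prod>i=1..N. r i - \<i> * of_real t))"
    and x0: "x0 \<ge> 0"
  shows "occ_profile N r r' x0 + of_real ((p - q) / q) *
       (CLINT y|\<mu>. indicator {..x0} y * occ_profile N r r' (x0 - y)) = T 0"
proof -
  interpret \<mu>: real_distribution \<mu> by fact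
  have esN: "elem_sym N r N \<noteq> 0" using r by (rule elem_sym_top_nz)
  define \<kappa> :: complex where "\<kappa> = of_real ((p - q) / q)"
  define g where "g x = indicator {0..} x *\<^sub>R occ_density N r r' x" for x
  define e :: "real \<Rightarrow> complex" where "e x = of_real (indicator {0..} x * exp (- x))" for x
  have od[measurable]: "occ_density N r r' \<in> borel_measurable borel"
    using occ_density_cont by (rule borel_measurable_continuous_onI)
  obtain \<delta> D where cd: "\<delta> > 0" "D \<ge> 0" "\<And>x. x \<ge> 0 \<Longrightarrow> norm (occ_density N r r' x) \<le> D * exp (- \<delta> * x)"
    using occ_density_bound[where r = r and N = N and r' = r', OF r] by blast
  have gint: "complex_integrable lborel g"
    using exp_bounded_integrable[where z = 0 and g = "occ_density N r r'", OF cd(1) od cd(3)]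
    unfolding g_def set_integrable_def by simp
  have eint: "complex_integrable lborel e"
    unfolding e_def using integrable_exp_Ici[of 1] by (intro integrable_of_real) auto
  have e1: "(CLINT x|lborel. e x) = 1"
  proof -
    have ex: "exp (- complex_of_real x) = of_real (exp (- x))" for x by (metis exp_of_real of_real_minus)
    have "((\<lambda>x. - exp (of_real (- x)) :: complex) \<longlongrightarrow> - 0) at_top"
      by (intro tendsto_minus, subst tendsto_norm_zero_iff[symmetric])
         (auto intro!: filterlim_compose[OF exp_at_bot] simp: filterlim_uminus_at_bot filterlim_ident)
    then have "(CLINT x:{0..}|lborel. exp (of_real (- x))) = - (- exp (of_real (- 0)) :: complex)"
      using eint unfolding e_def
      by (intro integral_FTC_Ici continuous_intros)
         (auto intro!: derivative_eq_intros has_vector_derivative_real_field simp: set_integrable_def scaleR_conv_of_real ex)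
    then show ?thesis unfolding e_def set_lebesgue_integral_def by (simp add: scaleR_conv_of_real ex)
  qed
  have [measurable]: "g \<in> borel_measurable borel" "e \<in> borel_measurable borel"
    using gint eint by auto
  (* The four terms of the convolution are placed on one space by a finite coordinate i. The term i has
     density c i in the first variable and is mapped to the line by \<xi> i; the probability density e
     represents the point mass at 0 where no first variable is needed. *)
  define N' where "N' = ((lborel :: real measure) \<Otimes>\<^sub>M \<mu>) \<Otimes>\<^sub>M count_space {..<4::nat}"
  define c where "c i = (if i = 0 then e else if i = 1 then (\<lambda>x. \<kappa> * e x) else if i = 2 then g else (\<lambda>x. \<kappa> * g x))" for i :: nat
  define \<xi> where "\<xi> i w = (if i = 0 then 0 else if i = 1 then snd w else if i = 2 then fst w else fst w + snd w)" for i :: nat and w :: "real \<times> real"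
  have pU: "measure \<mu> UNIV = 1" using \<mu>.prob_space by simp
  have lb: "sigma_finite_measure (lborel :: real measure)" and pm: "prob_space \<mu>" by unfold_locales
  have sf: "sigma_finite_measure ((lborel :: real measure) \<Otimes>\<^sub>M \<mu>)"
  proof -
    interpret pair_sigma_finite "lborel :: real measure" \<mu> ..
    show ?thesis by unfold_locales
  qed
  have cint: "complex_integrable lborel (c i)" for i
    unfolding c_def using gint eint by auto
  have [measurable]: "\<xi> i \<in> borel_measurable ((lborel :: real measure) \<Otimes>\<^sub>M \<mu>)" for i unfolding \<xi>_def by measurable
  have \<xi>m: "(\<lambda>z. \<xi> (snd z) (fst z)) \<in> borel_measurable N'"
    unfolding N'_def
    by (rule measurable_compose_countable'[where I = "{..<4}" and f = "\<lambda>i p. \<xi> i (fst p)" and g = snd]) auto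
  have key: "complex_integrable N' (\<lambda>(w, i). c i (fst w) * \<phi> (\<xi> i w)) \<and>
     (CLINT z|N'. (case z of (w, i) \<Rightarrow> c i (fst w) * \<phi> (\<xi> i w))) =
       \<phi> 0 + \<kappa> * (CLINT y|\<mu>. \<phi> y) + (CLINT x|lborel. g x * \<phi> x)
        + \<kappa> * (CLINT y|\<mu>. CLINT x|lborel. g x * \<phi> (x + y))"
    if [measurable]: "\<phi> \<in> borel_measurable borel" and b: "\<And>y. norm (\<phi> y) \<le> 1" for \<phi> :: "real \<Rightarrow> complex"
  proof -
    have m: "(\<lambda>w. \<phi> (\<xi> i w)) \<in> borel_measurable ((lborel :: real measure) \<Otimes>\<^sub>M \<mu>)" for i by measurable
    note W = integral_pair_weight[OF lb pm cint m b]
    have I: "complex_integrable ((lborel :: real measure) \<Otimes>\<^sub>M \<mu>) (\<lambda>w. c i (fst w) * \<phi> (\<xi> i w))" for i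
      using W(1)[of i i] by (simp add: case_prod_beta')
    have S: "(CLINT w|((lborel :: real measure) \<Otimes>\<^sub>M \<mu>). c i (fst w) * \<phi> (\<xi> i w)) = (CLINT x|lborel. c i x * (CLINT y|\<mu>. \<phi> (\<xi> i (x, y))))" for i
      using W(2)[of i i] by (simp add: case_prod_beta')
    have S': "(CLINT w|((lborel :: real measure) \<Otimes>\<^sub>M \<mu>). c i (fst w) * \<phi> (\<xi> i w)) = (CLINT y|\<mu>. (CLINT x|lborel. c i x * \<phi> (\<xi> i (x, y))))" for i
      using W(3)[of i i] by (simp add: case_prod_beta')
    have four: "{..<4::nat} = {0, 1, 2, 3}" by auto
    have "(CLINT z|N'. (case z of (w, i) \<Rightarrow> c i (fst w) * \<phi> (\<xi> i w))) = (\<Sum>i<4. CLINT w|((lborel :: real measure) \<Otimes>\<^sub>M \<mu>). c i (fst w) * \<phi> (\<xi> i w))"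
      unfolding N'_def by (rule integral_pair_count_space(2)[OF sf _ I]) auto
    also have "\<dots> = \<phi> 0 + \<kappa> * (CLINT y|\<mu>. \<phi> y) + (CLINT x|lborel. g x * \<phi> x)
        + \<kappa> * (CLINT y|\<mu>. CLINT x|lborel. g x * \<phi> (x + y))"
    proof -
      have "(CLINT w|((lborel :: real measure) \<Otimes>\<^sub>M \<mu>). c 0 (fst w) * \<phi> (\<xi> 0 w)) = \<phi> 0"
        unfolding S by (simp add: c_def \<xi>_def e1 pU)
      moreover have "(CLINT w|((lborel :: real measure) \<Otimes>\<^sub>M \<mu>). c 1 (fst w) * \<phi> (\<xi> 1 w)) = \<kappa> * (CLINT y|\<mu>. \<phi> y)"
        unfolding S by (simp add: c_def \<xi>_def e1)
      moreover have "(CLINT w|((lborel :: real measure) \<Otimes>\<^sub>M \<mu>). c 2 (fst w) * \<phi> (\<xi> 2 w)) = (CLINT x|lborel. g x * \<phi> x)"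
        unfolding S by (simp add: c_def \<xi>_def pU)
      moreover have "(CLINT w|((lborel :: real measure) \<Otimes>\<^sub>M \<mu>). c 3 (fst w) * \<phi> (\<xi> 3 w)) = \<kappa> * (CLINT y|\<mu>. CLINT x|lborel. g x * \<phi> (x + y))"
        unfolding S' by (simp add: c_def \<xi>_def mult.assoc)
      ultimately show ?thesis unfolding four by simp
    qed
    finally show ?thesis
      using integral_pair_count_space(1)[where f = "\<lambda>i w. c i (fst w) * \<phi> (\<xi> i w)" and I = "{..<4}", OF sf _ I] by (simp add: N'_def)
  qed
  define h where "h z = (case z of (w, i) \<Rightarrow> c i (fst w))" for z :: "(real \<times> real) \<times> nat"
  define X where "X z = (case z of (w, i) \<Rightarrow> \<xi> i w)" for z :: "(real \<times> real) \<times> nat"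
  have hX: "h z * \<phi> (X z) = (case z of (w, i) \<Rightarrow> c i (fst w) * \<phi> (\<xi> i w))" for z \<phi>
    by (auto simp: h_def X_def split: prod.splits)
  have "(CLINT z|N'. h z * indicator {..x0} (X z)) = T 0"
  proof (rule fourier_support_nonpos[OF _ _ contT holT bT _ x0])
    show "complex_integrable N' h" using key[of "\<lambda>_. 1"] by (simp add: h_def[abs_def] case_prod_beta')
    show "X \<in> borel_measurable N'" using \<xi>m by (simp add: X_def[abs_def] case_prod_beta')
    fix t
    let ?\<phi> = "\<lambda>y. iexp (t * y)"
    have gh: "(CLINT x|lborel. g x * iexp (t * x)) = (\<Prod>i=1..N. r' i - \<i> * of_real t) / (\<Prod>i=1..N. r i - \<i> * of_real t) - 1"
      using occ_density_laplace[where r = r and r' = r' and N = N and z = "\<i> * of_real t", OF r]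
      unfolding set_lebesgue_integral_def g_def by (simp add: mult_ac)
    have "(CLINT y|\<mu>. CLINT x|lborel. g x * iexp (t * (x + y))) = (CLINT y|\<mu>. iexp (t * y) * (CLINT x|lborel. g x * iexp (t * x)))"
      by (intro Bochner_Integration.integral_cong refl, subst integral_mult_right_zero[symmetric])
         (intro Bochner_Integration.integral_cong refl, simp add: exp_add distrib_left distrib_right mult_ac)
    also have "\<dots> = char \<mu> t * (CLINT x|lborel. g x * iexp (t * x))"
      unfolding char_def by (rule integral_mult_left_zero)
    finally have gh2: "(CLINT y|\<mu>. CLINT x|lborel. g x * iexp (t * (x + y))) = char \<mu> t * (CLINT x|lborel. g x * iexp (t * x))" .
    have "(CLINT z|N'. h z * iexp (t * X z)) = ?\<phi> 0 + \<kappa> * (CLINT y|\<mu>. ?\<phi> y) + (CLINT x|lborel. g x * ?\<phi> x)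
        + \<kappa> * (CLINT y|\<mu>. CLINT x|lborel. g x * ?\<phi> (x + y))"
      unfolding hX[of _ ?\<phi>] by (rule conjunct2[OF key]) auto
    also have "\<dots> = 1 + \<kappa> * char \<mu> t + (CLINT x|lborel. g x * ?\<phi> x) + \<kappa> * (char \<mu> t * (CLINT x|lborel. g x * ?\<phi> x))"
      unfolding gh2 by (simp add: char_def)
    also have "\<dots> = (1 + \<kappa> * char \<mu> t) * (1 + (CLINT x|lborel. g x * ?\<phi> x))"
      by (simp add: algebra_simps)
    also have "1 + \<kappa> * char \<mu> t = (of_real p - k t) / (of_real q - k t)"
      using kq[of t] q unfolding char \<kappa>_def by (simp add: field_simps)
    finally show "(CLINT z|N'. h z * iexp (t * X z)) = T (\<i> * of_real t)"
      unfolding gh TT by simp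
  qed
  moreover have "(CLINT z|N'. h z * indicator {..x0} (X z)) =
     occ_profile N r r' x0 + \<kappa> * (CLINT y|\<mu>. indicator {..x0} y * occ_profile N r r' (x0 - y))"
  proof -
    let ?\<phi> = "indicator {..x0} :: real \<Rightarrow> complex"
    have FTC: "(CLINT x|lborel. g x * indicator {..a} x) = occ_profile N r r' a - 1" if a: "a \<ge> 0" for a
    proof -
      have "(CLINT x|lborel. indicator {0..a} x *\<^sub>R occ_density N r r' x) = occ_profile N r r' a - occ_profile N r r' 0"
        by (rule integral_FTC_atLeastAtMost[OF a])
           (auto intro!: has_vector_derivative_at_within[OF occ_profile_deriv[OF esN]] occ_density_cont)
      moreover have "g x * indicator {..a} x = indicator {0..a} x *\<^sub>R occ_density N r r' x" for x
        unfolding g_def by (auto split: split_indicator)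
      ultimately show ?thesis using occ_profile_0[OF N esN] by simp
    qed
    have sh: "(CLINT x|lborel. g x * indicator {..x0} (x + y)) = indicator {..x0} y * (occ_profile N r r' (x0 - y) - 1)" for y
    proof (cases "y \<le> x0")
      case True
      then have "(CLINT x|lborel. g x * indicator {..x0} (x + y)) = (CLINT x|lborel. g x * indicator {..x0 - y} x)"
        by (intro Bochner_Integration.integral_cong refl) (auto split: split_indicator)
      then show ?thesis using True FTC[of "x0 - y"] by simp
    next
      case False
      then have "(CLINT x|lborel. g x * indicator {..x0} (x + y)) = (CLINT x|(lborel :: real measure). 0)"
        by (intro Bochner_Integration.integral_cong) (auto simp: g_def split: split_indicator)
      then show ?thesis using False by simp
    qed
    have pc: "continuous_on UNIV (occ_profile N r r')"
      by (rule continuous_at_imp_continuous_on) (use occ_profile_deriv[OF esN] has_vector_derivative_continuous in blast)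
    have [measurable]: "occ_profile N r r' \<in> borel_measurable borel"
      using pc by (rule borel_measurable_continuous_onI)
    have i1: "complex_integrable \<mu> (indicator {..x0})"
      by (rule \<mu>.integrable_const_bound[where B = 1]) (auto split: split_indicator)
    have i2: "complex_integrable \<mu> (\<lambda>y. indicator {..x0} y * (occ_profile N r r' (x0 - y) - 1))"
    proof (rule \<mu>.integrable_const_bound[where B = "LINT x|lborel. norm (g x)"])
      show "AE y in \<mu>. cmod (indicator {..x0} y * (occ_profile N r r' (x0 - y) - 1)) \<le> (LINT x|lborel. cmod (g x))"
      proof (rule AE_I2)
        fix y
        show "cmod (indicator {..x0} y * (occ_profile N r r' (x0 - y) - 1)) \<le> (LINT x|lborel. cmod (g x))"
          unfolding sh[symmetric]
          by (rule order_trans[OF integral_norm_bound], rule integral_mono)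
             (use gint in \<open>auto intro!: Bochner_Integration.integrable_bound[OF integrable_norm[OF gint]] split: split_indicator\<close>)
      qed
    qed measurable
    have "(CLINT z|N'. h z * indicator {..x0} (X z)) = ?\<phi> 0 + \<kappa> * (CLINT y|\<mu>. ?\<phi> y) + (CLINT x|lborel. g x * ?\<phi> x)
        + \<kappa> * (CLINT y|\<mu>. CLINT x|lborel. g x * ?\<phi> (x + y))"
      unfolding hX[of _ ?\<phi>] by (rule conjunct2[OF key]) (auto split: split_indicator)
    also have "\<dots> = occ_profile N r r' x0 + \<kappa> * ((CLINT y|\<mu>. ?\<phi> y) + (CLINT y|\<mu>. indicator {..x0} y * (occ_profile N r r' (x0 - y) - 1)))"
      unfolding sh FTC[OF x0] using x0 by (simp add: algebra_simps)
    also have "(CLINT y|\<mu>. ?\<phi> y) + (CLINT y|\<mu>. indicator {..x0} y * (occ_profile N r r' (x0 - y) - 1)) =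
       (CLINT y|\<mu>. indicator {..x0} y * occ_profile N r r' (x0 - y))"
      by (subst Bochner_Integration.integral_add[OF i1 i2, symmetric]) (simp add: algebra_simps)
    finally show ?thesis .
  qed
  ultimately show ?thesis unfolding \<kappa>_def by simp
qed

section \<open>Complex densities and Laplace transforms of monomials\<close>

text \<open>A complex density of a nonnegative measure is itself almost everywhere real and nonnegative,
  as seen on the sets where this fails.\<close>

lemma complex_density_nonneg:
  fixes \<nu> :: "real measure" and h :: "real \<Rightarrow> complex"
  assumes s[measurable_cong]: "sets \<nu> = sets borel" and B[measurable]: "B \<in> sets borel"
    and fin: "emeasure \<nu> B < \<infinity>" and h: "set_integrable lborel B h"
    and eq: "\<And>A. A \<in> sets borel \<Longrightarrow> A \<subseteq> B \<Longrightarrow> of_real (measure \<nu> A) = (CLINT x:A|lborel. h x)"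
  shows "AE x in lborel. x \<in> B \<longrightarrow> h x = of_real (Re (h x)) \<and> 0 \<le> Re (h x)"
proof -
  have int: "complex_integrable lborel (\<lambda>x. indicator B x *\<^sub>R h x)"
    using h by (simp add: set_integrable_def)
  have set: "(CLINT x:A|lborel. indicator B x *\<^sub>R h x) = of_real (measure \<nu> (A \<inter> B))" if "A \<in> sets borel" for A
  proof -
    have "(CLINT x:A|lborel. indicator B x *\<^sub>R h x) = (CLINT x:A \<inter> B|lborel. h x)"
      unfolding set_lebesgue_integral_def by (intro Bochner_Integration.integral_cong) (auto split: split_indicator)
    then show ?thesis using eq[of "A \<inter> B"] that by simp
  qed
  have intA: "complex_integrable lborel (\<lambda>x. indicator A x *\<^sub>R (indicator B x *\<^sub>R h x))" if [measurable]: "A \<in> sets borel" for A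
    by (rule integrable_mult_indicator[OF _ int]) (simp add: that)
  have im: "AE x in lborel. Im (indicator B x *\<^sub>R h x) = 0"
  proof (rule sigma_finite_measure.density_zero[OF lborel.sigma_finite_measure_axioms])
    show "integrable lborel (\<lambda>x. Im (indicator B x *\<^sub>R h x))" using int by (rule integrable_Im)
    fix A :: "real set" assume A: "A \<in> sets lborel"
    have "(LINT x:A|lborel. Im (indicator B x *\<^sub>R h x)) = Im (CLINT x:A|lborel. indicator B x *\<^sub>R h x)"
      unfolding set_lebesgue_integral_def
      by (subst integral_Im[OF intA, symmetric]) (use A in \<open>auto simp: mult.assoc\<close>)
    then show "(LINT x:A|lborel. Im (indicator B x *\<^sub>R h x)) = 0" using A set by simp
  qed
  define f where "f x = Re (indicator B x *\<^sub>R h x)" for x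
  have fint: "integrable lborel f" unfolding f_def using int by (rule integrable_Re)
  then have [measurable]: "f \<in> borel_measurable borel" by auto
  have fA: "(LINT x:A|lborel. f x) = measure \<nu> (A \<inter> B)" if "A \<in> sets borel" for A
  proof -
    have "(LINT x:A|lborel. f x) = Re (CLINT x:A|lborel. indicator B x *\<^sub>R h x)"
      unfolding set_lebesgue_integral_def f_def
      by (subst integral_Re[OF intA, symmetric]) (use that in \<open>auto simp: mult.assoc\<close>)
    then show ?thesis using that set by simp
  qed
  define N where "N = {x. f x < 0}"
  have N[measurable]: "N \<in> sets borel" unfolding N_def by measurable
  have "AE x in lborel. indicator N x * (- f x) = 0"
  proof -
    have i: "integrable lborel (\<lambda>x. indicator N x * (- f x))"
      by (rule Bochner_Integration.integrable_bound[OF fint]) (auto split: split_indicator)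
    have nn: "AE x in lborel. 0 \<le> indicator N x * (- f x)" by (auto simp: N_def split: split_indicator)
    have "(\<integral>x. indicator N x * (- f x) \<partial>lborel) = - (LINT x:N|lborel. f x)"
      unfolding set_lebesgue_integral_def by (simp flip: Bochner_Integration.integral_minus)
    also have "\<dots> \<le> 0" unfolding fA[OF N] by simp
    finally have "(\<integral>x. indicator N x * (- f x) \<partial>lborel) = 0"
      using integral_nonneg_AE[OF nn] by linarith
    then show ?thesis using integral_nonneg_eq_0_iff_AE[OF i nn] by simp
  qed
  with im show ?thesis
  proof eventually_elim
    case (elim x)
    then show ?case by (auto simp: f_def N_def complex_eq_iff split: split_indicator_asm)
  qed
qed

text \<open>Once the density is known to be nonnegative, both integrals are integrals against the same
  measure.\<close>

lemma complex_density_transfer: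
  fixes \<nu> :: "real measure" and h F :: "real \<Rightarrow> complex"
  assumes s[measurable_cong]: "sets \<nu> = sets borel" and B[measurable]: "B \<in> sets borel"
    and fin: "emeasure \<nu> B < \<infinity>" and h: "set_integrable lborel B h"
    and eq: "\<And>A. A \<in> sets borel \<Longrightarrow> A \<subseteq> B \<Longrightarrow> of_real (measure \<nu> A) = (CLINT x:A|lborel. h x)"
    and F[measurable]: "F \<in> borel_measurable borel"
  shows "set_integrable \<nu> B F \<longleftrightarrow> set_integrable lborel B (\<lambda>x. h x * F x)"
    and "(CLINT x:B|\<nu>. F x) = (CLINT x:B|lborel. h x * F x)"
proof -
  have int: "complex_integrable lborel (\<lambda>x. indicator B x *\<^sub>R h x)"
    using h by (simp add: set_integrable_def)
  define f where "f x = Re (indicator B x *\<^sub>R h x)" for x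
  have fint: "integrable lborel f" unfolding f_def using int by (rule integrable_Re)
  then have fm[measurable]: "f \<in> borel_measurable borel" by auto
  have hm: "(\<lambda>x. indicator B x *\<^sub>R h x) \<in> borel_measurable borel" using int by auto
  have nn: "AE x in lborel. x \<in> B \<longrightarrow> h x = of_real (Re (h x)) \<and> 0 \<le> Re (h x)"
    by (rule complex_density_nonneg[OF s B fin h eq])
  have ae: "AE x in lborel. 0 \<le> f x \<and> indicator B x *\<^sub>R h x = of_real (f x)"
    using nn by eventually_elim (auto simp: f_def split: split_indicator)
  then have f0: "AE x in lborel. 0 \<le> f x" by eventually_elim auto
  have "density \<nu> (\<lambda>x. ennreal (indicator B x)) = density lborel (\<lambda>x. ennreal (f x))"
  proof (rule measure_eqI)
    fix A assume "A \<in> sets (density \<nu> (\<lambda>x. ennreal (indicator B x)))"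
    then have A[measurable]: "A \<in> sets borel" using s by simp
    have "emeasure (density \<nu> (\<lambda>x. ennreal (indicator B x))) A = (\<integral>\<^sup>+x. indicator (A \<inter> B) x \<partial>\<nu>)"
      using A by (subst emeasure_density, measurable) (intro nn_integral_cong, auto split: split_indicator)
    also have "\<dots> = emeasure \<nu> (A \<inter> B)" by simp
    also have "\<dots> = ennreal (measure \<nu> (A \<inter> B))"
    proof -
      have "emeasure \<nu> (A \<inter> B) \<le> emeasure \<nu> B" by (rule emeasure_mono) (use s in auto)
      then show ?thesis using fin by (intro emeasure_eq_ennreal_measure) (auto simp: top_unique)
    qed
    also have "measure \<nu> (A \<inter> B) = (\<integral>x. indicator A x * f x \<partial>lborel)"
    proof -
      have "complex_of_real (measure \<nu> (A \<inter> B)) = (CLINT x|lborel. indicator (A \<inter> B) x *\<^sub>R h x)"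
        using eq[of "A \<inter> B"] by (simp add: set_lebesgue_integral_def)
      also have "\<dots> = (CLINT x|lborel. of_real (indicator A x * f x))"
      proof (rule integral_cong_AE)
        show "AE x in lborel. indicator (A \<inter> B) x *\<^sub>R h x = of_real (indicator A x * f x)"
          using ae by eventually_elim (auto split: split_indicator)
        have "(\<lambda>x. indicator A x *\<^sub>R (indicator B x *\<^sub>R h x)) \<in> borel_measurable borel" using hm by measurable
        moreover have "(\<lambda>x. indicator A x *\<^sub>R (indicator B x *\<^sub>R h x)) = (\<lambda>x. indicator (A \<inter> B) x *\<^sub>R h x)"
          by (auto split: split_indicator)
        ultimately show "(\<lambda>x. indicator (A \<inter> B) x *\<^sub>R h x) \<in> borel_measurable lborel" by simp
      qed simp
      also have "\<dots> = of_real (\<integral>x. indicator A x * f x \<partial>lborel)" by (rule integral_complex_of_real)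
      finally show ?thesis by (simp only: of_real_eq_iff)
    qed
    also have "ennreal (\<integral>x. indicator A x * f x \<partial>lborel) = (\<integral>\<^sup>+x. ennreal (indicator A x * f x) \<partial>lborel)"
    proof (rule nn_integral_eq_integral[symmetric])
      show "integrable lborel (\<lambda>x. indicator A x * f x)"
        unfolding real_scaleR_def[symmetric] by (rule integrable_mult_indicator[OF _ fint]) (use A in simp)
      show "AE x in lborel. 0 \<le> indicator A x * f x" using f0 by eventually_elim (auto split: split_indicator)
    qed
    also have "\<dots> = emeasure (density lborel (\<lambda>x. ennreal (f x))) A"
      by (subst emeasure_density) (auto intro!: nn_integral_cong split: split_indicator)
    finally show "emeasure (density \<nu> (\<lambda>x. ennreal (indicator B x))) A = emeasure (density lborel (\<lambda>x. ennreal (f x))) A" .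
  qed (use s in simp)
  note D = this
  have bm: "(indicator B :: real \<Rightarrow> real) \<in> borel_measurable \<nu>" "F \<in> borel_measurable \<nu>"
    "F \<in> borel_measurable lborel" "f \<in> borel_measurable lborel" by measurable
  have hF: "AE x in lborel. f x *\<^sub>R F x = indicator B x *\<^sub>R (h x * F x)"
    using ae
  proof eventually_elim
    case (elim x)
    then show ?case by (auto simp: scaleR_conv_of_real)
  qed
  have m2: "(\<lambda>x. indicator B x *\<^sub>R (h x * F x)) \<in> borel_measurable lborel"
  proof -
    have "(\<lambda>x. (indicator B x *\<^sub>R h x) * F x) \<in> borel_measurable borel" using hm by measurable
    then show ?thesis by simp
  qed
  have "set_integrable \<nu> B F \<longleftrightarrow> complex_integrable (density \<nu> (\<lambda>x. ennreal (indicator B x))) F"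
    unfolding set_integrable_def by (subst integrable_density) (use bm in auto)
  also have "\<dots> \<longleftrightarrow> complex_integrable lborel (\<lambda>x. f x *\<^sub>R F x)"
    unfolding D by (subst integrable_density) (use bm f0 in auto)
  also have "\<dots> \<longleftrightarrow> complex_integrable lborel (\<lambda>x. indicator B x *\<^sub>R (h x * F x))"
    by (rule integrable_cong_AE) (use hF m2 in auto)
  finally show "set_integrable \<nu> B F \<longleftrightarrow> set_integrable lborel B (\<lambda>x. h x * F x)"
    unfolding set_integrable_def .
  have "(CLINT x:B|\<nu>. F x) = (CLINT x|density \<nu> (\<lambda>x. ennreal (indicator B x)). F x)"
    unfolding set_lebesgue_integral_def by (subst integral_density) (use bm in auto)
  also have "\<dots> = (CLINT x|lborel. f x *\<^sub>R F x)"
    unfolding D by (subst integral_density) (use bm f0 in auto)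
  also have "\<dots> = (CLINT x|lborel. indicator B x *\<^sub>R (h x * F x))"
    by (rule integral_cong_AE) (use hF m2 in auto)
  finally show "(CLINT x:B|\<nu>. F x) = (CLINT x:B|lborel. h x * F x)"
    unfolding set_lebesgue_integral_def .
qed

text \<open>Integration by parts, as an induction on \<open>k\<close> with antiderivatives that vanish
  at infinity.\<close>

lemma laplace_monomial:
  fixes w :: complex
  assumes w: "0 < Re w"
  shows "set_integrable lborel {0..} (\<lambda>x. of_real x ^ k * exp (- w * of_real x))"
    and "(CLINT x:{0..}|lborel. of_real x ^ k * exp (- w * of_real x)) = fact k / w ^ Suc k"
proof -
  have bd: "\<exists>C\<ge>0. \<forall>x\<ge>0. norm (of_real x ^ k * exp (- w * of_real x)) \<le> C * exp (- (Re w / 2) * x)" for k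
  proof -
    obtain C where C: "C \<ge> 0" "\<And>x. x \<ge> 0 \<Longrightarrow> x ^ k * exp (- (Re w / 2) * x) \<le> C"
      using power_exp_bounded[of "Re w / 2" k] w by auto
    have "norm (of_real x ^ k * exp (- w * of_real x)) \<le> C * exp (- (Re w / 2) * x)" if x: "x \<ge> 0" for x
    proof -
      have "norm (of_real x ^ k * exp (- w * of_real x)) = (x ^ k * exp (- (Re w / 2) * x)) * exp (- (Re w / 2) * x)"
        using x by (simp add: norm_mult norm_power exp_add[symmetric] mult.assoc)
      also have "\<dots> \<le> C * exp (- (Re w / 2) * x)" using C(2)[OF x] by (intro mult_right_mono) auto
      finally show ?thesis .
    qed
    then show ?thesis using C(1) by blast
  qed
  have int: "set_integrable lborel {0..} (\<lambda>x. of_real x ^ k * exp (- w * of_real x))" for k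
  proof -
    obtain C where "\<forall>x\<ge>0. norm (of_real x ^ k * exp (- w * of_real x)) \<le> C * exp (- (Re w / 2) * x)"
      using bd by blast
    then show ?thesis
      using exp_bounded_integrable[where z = 0 and g = "\<lambda>x. of_real x ^ k * exp (- w * of_real x)" and \<delta> = "Re w / 2" and C = C] w
      by auto
  qed
  then show "set_integrable lborel {0..} (\<lambda>x. of_real x ^ k * exp (- w * of_real x))" .
  have lim: "((\<lambda>x. of_real x ^ k * exp (- w * of_real x)) \<longlongrightarrow> 0) at_top" for k
  proof -
    obtain C where C: "\<forall>x\<ge>0. norm (of_real x ^ k * exp (- w * of_real x)) \<le> C * exp (- (Re w / 2) * x)"
      using bd by blast
    show ?thesis
    proof (rule tendsto_0_le)
      have "filterlim (\<lambda>x. - (Re w / 2) * x) at_bot at_top"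
        using w by (intro filterlim_tendsto_neg_mult_at_bot[OF tendsto_const] filterlim_ident) auto
      then have "((\<lambda>x. exp (- (Re w / 2) * x)) \<longlongrightarrow> 0) at_top" by (rule filterlim_compose[OF exp_at_bot])
      then show "((\<lambda>x. C * exp (- (Re w / 2) * x)) \<longlongrightarrow> 0) at_top" by (rule tendsto_mult_right_zero)
      show "\<forall>\<^sub>F x in at_top. norm (of_real x ^ k * exp (- w * of_real x)) \<le> norm (C * exp (- (Re w / 2) * x)) * 1"
        using eventually_ge_at_top[of 0]
      proof eventually_elim
        case (elim x)
        then have "norm (of_real x ^ k * exp (- w * of_real x)) \<le> C * exp (- (Re w / 2) * x)" using C by blast
        also have "\<dots> \<le> norm (C * exp (- (Re w / 2) * x)) * 1" by simp
        finally show ?case .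
      qed
    qed
  qed
  have w0: "w \<noteq> 0" using w by auto
  show "(CLINT x:{0..}|lborel. of_real x ^ k * exp (- w * of_real x)) = fact k / w ^ Suc k"
  proof (induction k)
    case 0
    have "(CLINT x:{0..}|lborel. - w * (of_real x ^ 0 * exp (- w * of_real x))) = - (of_real 0 ^ 0 * exp (- w * of_real 0))"
      by (rule integral_FTC_Ici[OF _ _ set_integrable_mult_right[OF int] lim])
         (auto intro!: continuous_intros derivative_eq_intros has_vector_derivative_real_field)
    then show ?case using w0 unfolding set_integral_mult_right by (simp add: field_simps)
  next
    case (Suc k)
    have "(CLINT x:{0..}|lborel. of_nat (Suc k) * (of_real x ^ k * exp (- w * of_real x)) - w * (of_real x ^ Suc k * exp (- w * of_real x)))
       = - (of_real 0 ^ Suc k * exp (- w * of_real 0))"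
    proof (rule integral_FTC_Ici[OF _ _ _ lim])
      show "((\<lambda>x. of_real x ^ Suc k * exp (- w * of_real x)) has_vector_derivative
          of_nat (Suc k) * (of_real x ^ k * exp (- w * of_real x)) - w * (of_real x ^ Suc k * exp (- w * of_real x))) (at x)" for x
      proof -
        have "((\<lambda>z. z ^ Suc k * exp (- w * z)) has_field_derivative
          of_nat (Suc k) * (of_real x ^ k * exp (- w * of_real x)) - w * (of_real x ^ Suc k * exp (- w * of_real x))) (at (of_real x))"
          by (rule derivative_eq_intros refl | simp add: algebra_simps del: of_nat_Suc)+
        then show ?thesis by (rule has_vector_derivative_real_field)
      qed
      show "set_integrable lborel {0..} (\<lambda>x. of_nat (Suc k) * (of_real x ^ k * exp (- w * of_real x)) - w * (of_real x ^ Suc k * exp (- w * of_real x)))"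
        by (intro set_integral_diff(1) set_integrable_mult_right int)
    qed (intro continuous_intros)
    also have "- (of_real 0 ^ Suc k * exp (- w * of_real 0)) = (0 :: complex)" by simp
    finally have "of_nat (Suc k) * (CLINT x:{0..}|lborel. of_real x ^ k * exp (- w * of_real x)) = w * (CLINT x:{0..}|lborel. of_real x ^ Suc k * exp (- w * of_real x))"
      by (simp only: set_integral_diff(2)[OF set_integrable_mult_right[OF int] set_integrable_mult_right[OF int]] set_integral_mult_right right_minus_eq)
    then show ?case using w0 unfolding Suc.IH by (simp add: field_simps)
  qed
qed

section \<open>The cumulant when the positive jumps are of matrix-exponential type\<close>

lemma set_integrable_sum':
  fixes f :: "'i \<Rightarrow> 'b \<Rightarrow> complex"
  assumes "\<And>i. i \<in> I \<Longrightarrow> set_integrable M A (f i)"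
  shows "set_integrable M A (\<lambda>x. \<Sum>i\<in>I. f i x)"
  using assms unfolding set_integrable_def scaleR_sum_right by (rule Bochner_Integration.integrable_sum)

text \<open>Matrix-exponential jumps to the right and arbitrary jumps to the left. The condition
  \<open>nd\<close> excludes a pure jump part without drift and Gaussian part, and covers the remaining
  cases at once.\<close>

locale me_cumulant =
  fixes a \<sigma> :: real and \<nu> :: "real measure" and m :: nat and P :: "nat \<Rightarrow> complex poly" and c :: "nat \<Rightarrow> complex"
  assumes lm: "levy_measure \<nu>" and sig: "0 \<le> \<sigma>" and me: "matrix_exp_jumps 1 \<nu> m P c" and nd: "\<sigma> > 0 \<or> a \<noteq> 0"
begin

definition lam :: real where "lam = measure \<nu> {0<..}"

definition dens :: "real \<Rightarrow> complex" where
  "dens x = of_real lam * (\<Sum>i=1..m. poly (P i) (of_real x) * exp (- c i * of_real x))"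

text \<open>The Laplace transform of the positive jump density, summed in closed form and therefore
  defined off its poles \<open>c\<^sub>i\<close>.\<close>

definition pos_lt :: "complex \<Rightarrow> complex" where
  "pos_lt z = of_real lam * (\<Sum>i=1..m. \<Sum>k\<le>degree (P i). coeff (P i) k * fact k / (c i - z) ^ Suc k)"

definition neg_part :: "complex \<Rightarrow> complex" where
  "neg_part z = (CLINT x:{..<0}|\<nu>. exp (z * of_real x) - 1)"

definition cumul :: "complex \<Rightarrow> complex" where
  "cumul z = of_real a * z + of_real (\<sigma>\<^sup>2) / 2 * z\<^sup>2 + neg_part z + pos_lt z - of_real lam"

definition pole_poly :: "complex \<Rightarrow> complex" where
  "pole_poly z = (\<Prod>i=1..m. (c i - z) ^ Suc (degree (P i)))"

definition pos_num :: "complex \<Rightarrow> complex" where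
  "pos_num z = of_real lam * (\<Sum>i=1..m. \<Sum>k\<le>degree (P i). coeff (P i) k * fact k * (c i - z) ^ (degree (P i) - k) *
      (\<Prod>l\<in>{1..m} - {i}. (c l - z) ^ Suc (degree (P l))))"

text \<open>The function \<open>s - k\<close> cleared of its poles. It is holomorphic on the open and
  continuous on the closed right half-plane, and nonzero at the former poles, so its zeros are exactly
  the solutions of \<open>k = s\<close> with the same multiplicities.\<close>

definition cleared :: "real \<Rightarrow> complex \<Rightarrow> complex" where
  "cleared s z = (of_real s - of_real a * z - of_real (\<sigma>\<^sup>2) / 2 * z\<^sup>2 - neg_part z + of_real lam) * pole_poly z - pos_num z"

lemma half_line: "{x::real. 0 < 1 * x} = {0<..}" by auto

lemma sets_nu[measurable_cong, simp]: "sets \<nu> = sets borel"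
  and nu_int: "(\<integral>\<^sup>+x. ennreal (min (x\<^sup>2) 1) \<partial>\<nu>) < \<infinity>" "(\<integral>\<^sup>+x\<in>{-1..1}. ennreal \<bar>x\<bar> \<partial>\<nu>) < \<infinity>"
  using lm by (auto simp: levy_measure_def)

lemma space_nu[simp]: "space \<nu> = UNIV"
  using sets_eq_imp_space_eq[OF sets_nu] by simp

lemma me': "0 < emeasure \<nu> {0<..}" "emeasure \<nu> {0<..} < \<infinity>" "1 \<le> m" "\<And>i. i \<in> {1..m} \<Longrightarrow> P i \<noteq> 0" "inj_on c {1..m}"
  "Im (c 1) = 0" "0 < Re (c 1)" "\<And>i. i \<in> {2..m} \<Longrightarrow> Re (c 1) < Re (c i)"
  using me[unfolded matrix_exp_jumps_def half_line] by blast+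

lemma measure_eq_dens:
  assumes "A \<in> sets borel" "A \<subseteq> {0<..}"
  shows "of_real (measure \<nu> A) = (CLINT x:A|lborel. dens x)"
proof -
  have "\<forall>A\<in>sets borel. A \<subseteq> {x. 0 < 1 * x} \<longrightarrow>
        complex_of_real (measure \<nu> A) =
        (CLINT x:A|lborel. of_real (measure \<nu> {x. 0 < 1 * x}) *
           (\<Sum>i=1..m. poly (P i) (of_real x) * exp (- of_real 1 * c i * of_real x)))"
    using me[unfolded matrix_exp_jumps_def] by (elim conjE)
  with assms have "complex_of_real (measure \<nu> A) =
        (CLINT x:A|lborel. of_real (measure \<nu> {x. 0 < 1 * x}) *
           (\<Sum>i=1..m. poly (P i) (of_real x) * exp (- of_real 1 * c i * of_real x)))"
    unfolding half_line by blast
  then show ?thesis unfolding half_line dens_def lam_def by simp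
qed

lemma lam_pos: "lam > 0"
  unfolding lam_def using me'(1,2) by (simp add: measure_def enn2real_positive_iff)

lemma Re_c: "i \<in> {1..m} \<Longrightarrow> 0 < Re (c i)" "i \<in> {1..m} \<Longrightarrow> Re (c 1) \<le> Re (c i)"
  "i \<in> {1..m} \<Longrightarrow> Re (c i) = Re (c 1) \<Longrightarrow> i = 1"
  using me'(7) me'(8)[of i] by (cases "i = 1"; fastforce)+

lemma strip_not_c: "Re z < Re (c 1) \<Longrightarrow> z \<notin> c ` {1..m}"
proof
  assume z: "Re z < Re (c 1)" "z \<in> c ` {1..m}"
  then obtain i where "i \<in> {1..m}" "z = c i" by blast
  then show False using Re_c(2)[of i] z(1) by simp
qed

lemma set_integral_Ici_Ioi:
  fixes f :: "real \<Rightarrow> complex"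
  assumes "set_integrable lborel {0..} f"
  shows "set_integrable lborel {0<..} f" "(CLINT x:{0<..}|lborel. f x) = (CLINT x:{0..}|lborel. f x)"
proof -
  show i: "set_integrable lborel {0<..} f" by (rule set_integrable_subset[OF assms]) auto
  show "(CLINT x:{0<..}|lborel. f x) = (CLINT x:{0..}|lborel. f x)"
    unfolding set_lebesgue_integral_def
  proof (rule integral_cong_AE)
    show "AE x in lborel. indicator {0<..} x *\<^sub>R f x = indicator {0..} x *\<^sub>R f x"
      using AE_lborel_singleton[of 0] by eventually_elim (auto split: split_indicator)
  qed (use assms i in \<open>auto simp: set_integrable_def\<close>)
qed

lemma dens_laplace:
  assumes z: "Re z < Re (c 1)"
  shows "set_integrable lborel {0<..} (\<lambda>x. dens x * exp (z * of_real x))"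
    and "(CLINT x:{0<..}|lborel. dens x * exp (z * of_real x)) = pos_lt z"
proof -
  let ?g = "\<lambda>i k x. (of_real lam * coeff (P i) k) * (of_real x ^ k * exp (- (c i - z) * of_real x))"
  have eq: "dens x * exp (z * of_real x) = (\<Sum>i=1..m. \<Sum>k\<le>degree (P i). ?g i k x)" for x
    unfolding dens_def poly_altdef
    by (simp add: sum_distrib_left sum_distrib_right mult_ac left_diff_distrib exp_diff exp_minus field_simps)
  have pos: "0 < Re (c i - z)" if "i \<in> {1..m}" for i using Re_c(2)[OF that] z by simp
  have i0: "set_integrable lborel {0..} (?g i k)" if "i \<in> {1..m}" for i k
    by (intro set_integrable_mult_right laplace_monomial(1) pos that)
  have i: "set_integrable lborel {0<..} (?g i k)" if "i \<in> {1..m}" for i k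
    by (rule set_integral_Ici_Ioi(1)[OF i0[OF that]])
  have ii: "set_integrable lborel {0<..} (\<lambda>x. \<Sum>k\<le>degree (P i). ?g i k x)" if "i \<in> {1..m}" for i
    by (intro set_integrable_sum' i that)
  show "set_integrable lborel {0<..} (\<lambda>x. dens x * exp (z * of_real x))"
    unfolding eq by (intro set_integrable_sum' ii)
  have "(CLINT x:{0<..}|lborel. dens x * exp (z * of_real x)) = (\<Sum>i=1..m. \<Sum>k\<le>degree (P i). CLINT x:{0<..}|lborel. ?g i k x)"
    unfolding eq by (subst set_integral_sum'[OF ii], assumption, intro sum.cong refl set_integral_sum' i)
  also have "\<dots> = (\<Sum>i=1..m. \<Sum>k\<le>degree (P i). (of_real lam * coeff (P i) k) * (fact k / (c i - z) ^ Suc k))"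
    by (intro sum.cong refl) (simp only: set_integral_mult_right set_integral_Ici_Ioi(2)[OF laplace_monomial(1)[OF pos]] laplace_monomial(2)[OF pos])
  also have "\<dots> = pos_lt z" unfolding pos_lt_def by (simp add: sum_distrib_left mult_ac)
  finally show "(CLINT x:{0<..}|lborel. dens x * exp (z * of_real x)) = pos_lt z" .
qed

lemma dens_int: "set_integrable lborel {0<..} dens"
  using dens_laplace(1)[of 0] me'(7) by simp

lemma pos_transfer:
  assumes "F \<in> borel_measurable borel"
  shows "set_integrable \<nu> {0<..} F \<longleftrightarrow> set_integrable lborel {0<..} (\<lambda>x. dens x * F x)"
    and "(CLINT x:{0<..}|\<nu>. F x) = (CLINT x:{0<..}|lborel. dens x * F x)"
  by (rule complex_density_transfer[OF sets_nu _ me'(2) dens_int measure_eq_dens assms]; simp)+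

lemma pos_lt_0: "pos_lt 0 = of_real lam"
  using dens_laplace(2)[of 0] me'(7) measure_eq_dens[of "{0<..}"] by (simp add: lam_def)

lemma pos_part:
  assumes "Re z < Re (c 1)"
  shows "set_integrable \<nu> {0<..} (\<lambda>x. exp (z * of_real x) - 1)"
    and "(CLINT x:{0<..}|\<nu>. exp (z * of_real x) - 1) = pos_lt z - of_real lam"
proof -
  have eq: "dens x * (exp (z * of_real x) - 1) = dens x * exp (z * of_real x) - dens x * exp (0 * of_real x)" for x
    by (simp add: algebra_simps)
  have z0: "Re 0 < Re (c 1)" using me'(7) by simp
  have "set_integrable lborel {0<..} (\<lambda>x. dens x * (exp (z * of_real x) - 1))"
    unfolding eq by (intro set_integral_diff dens_laplace assms z0)
  then show "set_integrable \<nu> {0<..} (\<lambda>x. exp (z * of_real x) - 1)"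
    by (subst pos_transfer) auto
  have "(CLINT x:{0<..}|\<nu>. exp (z * of_real x) - 1) = (CLINT x:{0<..}|lborel. dens x * (exp (z * of_real x) - 1))"
    by (rule pos_transfer(2)) simp
  also have "\<dots> = pos_lt z - pos_lt 0"
    unfolding eq by (simp only: set_integral_diff(2)[OF dens_laplace(1)[OF assms] dens_laplace(1)[OF z0]] dens_laplace(2)[OF assms] dens_laplace(2)[OF z0])
  finally show "(CLINT x:{0<..}|\<nu>. exp (z * of_real x) - 1) = pos_lt z - of_real lam" by (simp add: pos_lt_0)
qed

text \<open>Finite variation near 0 and finite mass away from 0 are combined in one weight.\<close>

lemma weight_integrable: "integrable \<nu> (\<lambda>x. min \<bar>x\<bar> 1)"
proof (rule integrableI_nonneg)
  have "(\<integral>\<^sup>+x. ennreal (min \<bar>x\<bar> 1) \<partial>\<nu>) \<le> (\<integral>\<^sup>+x. ennreal \<bar>x\<bar> * indicator {-1..1} x + ennreal (min (x\<^sup>2) 1) \<partial>\<nu>)"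
  proof (rule nn_integral_mono)
    fix x :: real
    show "ennreal (min \<bar>x\<bar> 1) \<le> ennreal \<bar>x\<bar> * indicator {-1..1} x + ennreal (min (x\<^sup>2) 1)"
    proof (cases "\<bar>x\<bar> \<le> 1")
      case True
      then show ?thesis by (auto simp: min_def intro: order_trans[of _ "ennreal \<bar>x\<bar>"] split: split_indicator)
    next
      case False
      then have "1 \<le> x\<^sup>2" by (simp add: abs_square_le_1 not_le[symmetric] flip: abs_square_le_1)
      then show ?thesis using False by (auto simp: min_def split: split_indicator)
    qed
  qed
  also have "\<dots> = (\<integral>\<^sup>+x. ennreal \<bar>x\<bar> * indicator {-1..1} x \<partial>\<nu>) + (\<integral>\<^sup>+x. ennreal (min (x\<^sup>2) 1) \<partial>\<nu>)"
    by (rule nn_integral_add) measurable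
  also have "\<dots> < \<infinity>" using nu_int by simp
  finally show "(\<integral>\<^sup>+x. ennreal (min \<bar>x\<bar> 1) \<partial>\<nu>) < \<infinity>" .
qed auto

lemma exp_minus_one_bound:
  assumes "0 \<le> Re z" "x \<le> 0"
  shows "norm (exp (z * of_real x) - 1) \<le> min (norm z * \<bar>x\<bar>) 2"
proof -
  have le: "norm (exp (t * (z * of_real x))) \<le> 1" if "0 \<le> Re t" "Im t = 0" for t
  proof -
    have "Re (t * (z * of_real x)) = Re t * (Re z * x)" using that by simp
    also have "\<dots> \<le> 0" using that assms by (intro mult_nonneg_nonpos) auto
    finally show ?thesis by simp
  qed
  have "norm (exp (z * of_real x) - exp 0) \<le> 1 * norm (z * of_real x - 0)"
  proof (rule field_differentiable_bound[of "closed_segment 0 (z * of_real x)" exp exp])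
    fix w assume "w \<in> closed_segment 0 (z * of_real x)"
    then obtain t where t: "0 \<le> t" "t \<le> 1" "w = of_real t * (z * of_real x)"
      by (auto simp: closed_segment_def scaleR_conv_of_real)
    then show "norm (exp w) \<le> 1" using le[of "of_real t"] by simp
  qed (auto intro: DERIV_subset[OF DERIV_exp])
  moreover have "norm (exp (z * of_real x)) \<le> 1" using le[of 1] by simp
  then have "norm (exp (z * of_real x) - 1) \<le> 1 + 1"
    using norm_triangle_ineq4[of "exp (z * of_real x)" 1] unfolding norm_one by linarith
  ultimately show ?thesis by (simp add: norm_mult)
qed

lemma exp_minus_one_weight:
  assumes "0 \<le> Re z" "x \<le> 0"
  shows "norm (exp (z * of_real x) - 1) \<le> (norm z + 2) * min \<bar>x\<bar> 1"
proof -
  have "min (norm z * \<bar>x\<bar>) 2 \<le> (norm z + 2) * min \<bar>x\<bar> 1"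
  proof (cases "\<bar>x\<bar> \<le> 1")
    case True
    have "min (norm z * \<bar>x\<bar>) 2 \<le> norm z * \<bar>x\<bar>" by simp
    also have "\<dots> \<le> (norm z + 2) * \<bar>x\<bar>" by (intro mult_right_mono) auto
    finally show ?thesis using True by (simp add: min_def)
  next
    case False
    have "min (norm z * \<bar>x\<bar>) 2 \<le> 2" by simp
    also have "\<dots> \<le> norm z + 2" by simp
    finally show ?thesis using False by (simp add: min_absorb2)
  qed
  then show ?thesis using exp_minus_one_bound[OF assms] by linarith
qed

lemma neg_part_integrable: "0 \<le> Re z \<Longrightarrow> set_integrable \<nu> {..<0} (\<lambda>x. exp (z * of_real x) - 1)"
  unfolding set_integrable_def
  by (rule Bochner_Integration.integrable_bound[OF integrable_mult_right[OF weight_integrable, of "norm z + 2"]])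
     (auto split: split_indicator intro!: AE_I2 order_trans[OF exp_minus_one_weight] simp del: mult_le_cancel_left)

text \<open>In the strip to the left of the smallest exponent the negative jumps are harmless because
  \<open>exp (z x)\<close> is bounded for \<open>x < 0\<close>, and the positive jumps give the closed
  form.\<close>

lemma cumulant_eq:
  assumes "0 \<le> Re z" "Re z < Re (c 1)"
  shows "cumulant a \<sigma> \<nu> z = cumul z"
    and "complex_set_integrable \<nu> (- {0}) (\<lambda>x. exp (z * of_real x) - 1)"
proof -
  have un: "- {0::real} = {..<0} \<union> {0<..}" by auto
  show "complex_set_integrable \<nu> (- {0}) (\<lambda>x. exp (z * of_real x) - 1)"
    unfolding un by (rule set_integrable_Un[OF neg_part_integrable[OF assms(1)] pos_part(1)[OF assms(2)]]) auto
  have "(CLINT x:(- {0})|\<nu>. exp (z * of_real x) - 1) = neg_part z + (pos_lt z - of_real lam)"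
    unfolding un neg_part_def pos_part(2)[OF assms(2), symmetric]
    by (rule set_integral_Un[OF _ neg_part_integrable[OF assms(1)] pos_part(1)[OF assms(2)]]) auto
  then show "cumulant a \<sigma> \<nu> z = cumul z" unfolding cumulant_def cumul_def by simp
qed

lemma neg_part_holomorphic: "neg_part holomorphic_on {z. 0 < Re z}"
  unfolding neg_part_def set_lebesgue_integral_def
proof (rule holomorphic_on_parameter_integral)
  fix z :: complex assume "z \<in> {z. 0 < Re z}"
  then obtain e where e: "e > 0" "ball z e \<subseteq> {z. 0 < Re z}" using open_halfspace_Re_gt openE by blast
  show "\<exists>e>0. \<exists>g. ball z e \<subseteq> {z. 0 < Re z} \<and> integrable \<nu> g \<and>
       (\<forall>x\<in>space \<nu>. \<forall>w\<in>ball z e. norm (indicator {..<0} x *\<^sub>R (exp (w * of_real x) - 1)) \<le> g x)"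
  proof (intro exI[of _ e] conjI exI[of _ "\<lambda>x. (norm z + e + 2) * min \<bar>x\<bar> 1"] ballI)
    show "integrable \<nu> (\<lambda>x. (norm z + e + 2) * min \<bar>x\<bar> 1)" by (intro integrable_mult_right weight_integrable)
    fix x w assume w: "w \<in> ball z e"
    then have "0 \<le> Re w" using e by auto
    have "norm w \<le> norm z + e" using w norm_triangle_ineq2[of w z] by (auto simp: dist_norm norm_minus_commute)
    then have "(norm w + 2) * min \<bar>x\<bar> 1 \<le> (norm z + e + 2) * min \<bar>x\<bar> 1" by (intro mult_right_mono) auto
    then show "norm (indicator {..<0} x *\<^sub>R (exp (w * of_real x) - 1)) \<le> (norm z + e + 2) * min \<bar>x\<bar> 1"
      using exp_minus_one_weight[OF \<open>0 \<le> Re w\<close>, of x] e(1)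
      by (cases "x < 0") (auto simp del: abs_of_neg intro: order_trans)
  qed (use e in auto)
qed (auto intro!: holomorphic_intros)

lemma neg_part_cont: "continuous_on {z. 0 \<le> Re z} neg_part"
  unfolding continuous_on_def neg_part_def set_lebesgue_integral_def
proof
  fix z :: complex assume z: "z \<in> {z. 0 \<le> Re z}"
  show "((\<lambda>z. CLINT x|\<nu>. indicator {..<0} x *\<^sub>R (exp (z * of_real x) - 1)) \<longlongrightarrow> (CLINT x|\<nu>. indicator {..<0} x *\<^sub>R (exp (z * of_real x) - 1))) (at z within {z. 0 \<le> Re z})"
  proof (rule tendsto_integral_at_within[where w = "\<lambda>x. (norm z + 1 + 2) * min \<bar>x\<bar> 1"])
    have "\<forall>\<^sub>F w in at z within {z. 0 \<le> Re z}. w \<in> ball z 1 \<and> w \<in> {z. 0 \<le> Re z}"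
      by (intro eventually_conj eventually_at_ball) (auto simp: eventually_at_filter)
    then show "\<forall>\<^sub>F y in at z within {z. 0 \<le> Re z}. AE x in \<nu>. norm (indicator {..<0} x *\<^sub>R (exp (y * of_real x) - 1)) \<le> (norm z + 1 + 2) * min \<bar>x\<bar> 1"
    proof eventually_elim
      case (elim w)
      show ?case
      proof (rule AE_I2)
        fix x
        have "norm w \<le> norm z + 1" using elim norm_triangle_ineq2[of w z] by (auto simp: dist_norm norm_minus_commute)
        then have "(norm w + 2) * min \<bar>x\<bar> 1 \<le> (norm z + 1 + 2) * min \<bar>x\<bar> 1" by (intro mult_right_mono) auto
        then show "norm (indicator {..<0} x *\<^sub>R (exp (w * of_real x) - 1)) \<le> (norm z + 1 + 2) * min \<bar>x\<bar> 1"
          using exp_minus_one_weight[of w x] elim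
          by (cases "x < 0") (auto simp del: abs_of_neg intro: order_trans)
      qed
    qed
  qed (auto intro!: AE_I2 tendsto_intros integrable_mult_right weight_integrable)
qed

lemma pole_poly_nz: "z \<notin> c ` {1..m} \<Longrightarrow> pole_poly z \<noteq> 0"
  unfolding pole_poly_def by (subst prod_zero_iff) auto

lemma pos_num_eq: "z \<notin> c ` {1..m} \<Longrightarrow> pos_num z = pos_lt z * pole_poly z"
proof -
  assume z: "z \<notin> c ` {1..m}"
  have "(c i - z) ^ (degree (P i) - k) * (\<Prod>l\<in>{1..m} - {i}. (c l - z) ^ Suc (degree (P l))) = pole_poly z / (c i - z) ^ Suc k"
    if i: "i \<in> {1..m}" and k: "k \<in> {..degree (P i)}" for i k
  proof -
    have nz: "c i - z \<noteq> 0" using z i by auto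
    have "pole_poly z = (c i - z) ^ Suc (degree (P i)) * (\<Prod>l\<in>{1..m} - {i}. (c l - z) ^ Suc (degree (P l)))"
      unfolding pole_poly_def by (rule prod.remove) (use i in auto)
    also have "(c i - z) ^ Suc (degree (P i)) = (c i - z) ^ (degree (P i) - k) * (c i - z) ^ Suc k"
      using k by (simp flip: power_add del: power_Suc)
    finally show ?thesis using nz by (simp add: mult_ac del: power_Suc)
  qed
  then have "pos_num z = of_real lam * (\<Sum>i=1..m. \<Sum>k\<le>degree (P i). coeff (P i) k * fact k * (pole_poly z / (c i - z) ^ Suc k))"
    unfolding pos_num_def by (simp only: mult.assoc cong: sum.cong)
  then show ?thesis unfolding pos_lt_def by (simp add: sum_distrib_right sum_distrib_left mult_ac del: power_Suc)
qed

lemma cleared_eq: "z \<notin> c ` {1..m} \<Longrightarrow> cleared s z = (of_real s - cumul z) * pole_poly z"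
  unfolding cleared_def cumul_def by (simp add: pos_num_eq algebra_simps)

text \<open>At \<open>c\<^sub>i\<close> every term of the numerator vanishes except the leading
  coefficient of \<open>P\<^sub>i\<close>, which is not zero.\<close>

lemma cleared_at_pole: "i \<in> {1..m} \<Longrightarrow> cleared s (c i) \<noteq> 0"
proof -
  assume i: "i \<in> {1..m}"
  have M0: "pole_poly (c i) = 0" unfolding pole_poly_def by (subst prod_zero_iff) (use i in auto)
  let ?pr = "\<lambda>j. (\<Prod>l\<in>{1..m} - {j}. (c l - c i) ^ Suc (degree (P l)))"
  have pr0: "?pr j = 0" if "j \<in> {1..m}" "j \<noteq> i" for j
    by (subst prod_zero_iff) (use i that in auto)
  have pri: "?pr i \<noteq> 0"
  proof -
    have "c l - c i \<noteq> 0" if "l \<in> {1..m} - {i}" for l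
      using me'(5) that i by (auto dest: inj_onD)
    then show ?thesis by (subst prod_zero_iff) auto
  qed
  have "(\<Sum>j=1..m. \<Sum>k\<le>degree (P j). coeff (P j) k * fact k * (c j - c i) ^ (degree (P j) - k) * ?pr j)
     = (\<Sum>j=1..m. if j = i then coeff (P i) (degree (P i)) * fact (degree (P i)) * ?pr i else 0)"
  proof (intro sum.cong refl)
    fix j assume j: "j \<in> {1..m}"
    show "(\<Sum>k\<le>degree (P j). coeff (P j) k * fact k * (c j - c i) ^ (degree (P j) - k) * ?pr j)
      = (if j = i then coeff (P i) (degree (P i)) * fact (degree (P i)) * ?pr i else 0)"
    proof (cases "j = i")
      case True
      have "(\<Sum>k\<le>degree (P i). coeff (P i) k * fact k * (c i - c i) ^ (degree (P i) - k) * ?pr i)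
         = (\<Sum>k\<le>degree (P i). if k = degree (P i) then coeff (P i) k * fact k * ?pr i else 0)"
        by (intro sum.cong refl) (auto simp: power_0_left)
      then show ?thesis using True by simp
    next
      case False
      then show ?thesis by (simp only: pr0[OF j False] mult_zero_right sum.neutral_const if_False)
    qed
  qed
  also have "\<dots> = coeff (P i) (degree (P i)) * fact (degree (P i)) * ?pr i"
    using i by (simp only: sum.delta finite_atLeastAtMost) simp
  finally have "pos_num (c i) = of_real lam * (lead_coeff (P i) * fact (degree (P i)) * ?pr i)"
    unfolding pos_num_def by simp
  then have "pos_num (c i) \<noteq> 0" using lam_pos pri me'(4)[OF i] by auto
  then show ?thesis unfolding cleared_def M0 by simp
qed

lemma pole_poly_holo: "pole_poly holomorphic_on S"
  unfolding pole_poly_def by (intro holomorphic_intros)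

lemma cleared_holo: "cleared s holomorphic_on {z. 0 < Re z}"
  unfolding cleared_def pos_num_def by (intro holomorphic_intros neg_part_holomorphic pole_poly_holo)

lemma cleared_cont: "continuous_on {z. 0 \<le> Re z} (cleared s)"
  unfolding cleared_def pos_num_def
  by (intro continuous_intros neg_part_cont holomorphic_on_imp_continuous_on[OF pole_poly_holo])

lemma pos_lt_holo: "c ` {1..m} \<inter> S = {} \<Longrightarrow> pos_lt holomorphic_on S"
  unfolding pos_lt_def by (auto intro!: holomorphic_intros)

lemma cumul_holo: "cumul holomorphic_on ({z. 0 < Re z} - c ` {1..m})"
  unfolding cumul_def
  by (intro holomorphic_intros pos_lt_holo holomorphic_on_subset[OF neg_part_holomorphic]) auto

text \<open>Integrability at \<open>Re r \<ge> c\<^sub>1\<close> would bound the Laplace transform of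
  the positive jumps on the real axis up to its pole \<open>c\<^sub>1\<close>. This uses that the
  exponent of smallest real part is real and is a genuine pole.\<close>

lemma integrable_imp_strip:
  assumes r: "0 < Re r" and int: "complex_set_integrable \<nu> (- {0}) (\<lambda>x. exp (r * of_real x) - 1)"
  shows "Re r < Re (c 1)"
proof (rule ccontr)
  assume "\<not> Re r < Re (c 1)"
  then have ge: "Re (c 1) \<le> Re r" by simp
  define b where "b = Re (c 1)"
  have c1: "c 1 = of_real b" unfolding b_def using me'(6) by (simp add: complex_eq_iff)
  have b0: "b > 0" unfolding b_def by (rule me'(7))
  have i1: "set_integrable \<nu> {0<..} (\<lambda>x. exp (r * of_real x) - 1)"
    by (rule set_integrable_subset[OF int]) auto
  have i2: "set_integrable \<nu> {0<..} (\<lambda>x. 1 :: real)"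
    unfolding set_integrable_def using me'(2) by (simp add: integrable_indicator_iff less_top)
  have ib: "set_integrable \<nu> {0<..} (\<lambda>x. exp (b * x))"
    unfolding set_integrable_def
  proof (rule Bochner_Integration.integrable_bound)
    show "integrable \<nu> (\<lambda>x. indicator {0<..} x *\<^sub>R norm (exp (r * of_real x) - 1) + indicator {0<..} x *\<^sub>R 1)"
      using set_integrable_norm[OF i1] i2 unfolding set_integrable_def by (rule Bochner_Integration.integrable_add)
    show "AE x in \<nu>. norm (indicator {0<..} x *\<^sub>R exp (b * x)) \<le> norm (indicator {0<..} x *\<^sub>R norm (exp (r * of_real x) - 1) + indicator {0<..} x *\<^sub>R (1::real))"
    proof (rule AE_I2)
      fix x :: real
      show "norm (indicator {0<..} x *\<^sub>R exp (b * x)) \<le> norm (indicator {0<..} x *\<^sub>R norm (exp (r * of_real x) - 1) + indicator {0<..} x *\<^sub>R (1::real))"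
      proof (cases "x > 0")
        case True
        have "exp (b * x) \<le> exp (Re r * x)" using ge True by (simp add: b_def)
        also have "\<dots> = norm (exp (r * of_real x) - 1 + 1)" by simp
        also have "\<dots> \<le> norm (exp (r * of_real x) - 1) + 1" using norm_triangle_ineq[of "exp (r * of_real x) - 1" 1] by simp
        finally show ?thesis using True by simp
      qed simp
    qed
  qed measurable
  define E where "E = (LINT x:{0<..}|\<nu>. exp (b * x))"
  have GE: "norm (pos_lt (of_real z)) \<le> E" if z: "z < b" for z
  proof -
    have "pos_lt (of_real z) = (CLINT x:{0<..}|\<nu>. exp (of_real z * of_real x))"
      by (subst pos_transfer(2)) (use dens_laplace(2)[of "of_real z"] z in \<open>auto simp: b_def\<close>)
    also have "norm \<dots> \<le> E"
      unfolding E_def set_lebesgue_integral_def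
    proof (rule order_trans[OF integral_norm_bound], rule integral_mono)
      have "set_integrable \<nu> {0<..} (\<lambda>x. exp (of_real z * complex_of_real x))"
        by (subst pos_transfer(1)) (use dens_laplace(1)[of "of_real z"] z in \<open>auto simp: b_def\<close>)
      then show "integrable \<nu> (\<lambda>x. norm (indicator {0<..} x *\<^sub>R exp (of_real z * complex_of_real x)))"
        unfolding set_integrable_def by (rule integrable_norm)
      show "integrable \<nu> (\<lambda>x. indicator {0<..} x *\<^sub>R exp (b * x))" using ib unfolding set_integrable_def .
      show "norm (indicator {0<..} x *\<^sub>R exp (of_real z * complex_of_real x)) \<le> indicator {0<..} x *\<^sub>R exp (b * x)" for x
        using z by (auto split: split_indicator)
    qed
    finally show ?thesis .
  qed
  define zn where "zn n = b - b / real (n + 2)" for n :: nat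
  have zn: "0 < zn n" "zn n < b" for n proof -
    have "b / real (n + 2) < b / 1" by (rule divide_strict_left_mono) (use b0 in auto)
    then show "0 < zn n" by (simp add: zn_def)
    show "zn n < b" using b0 by (simp add: zn_def)
  qed
  have znl: "(\<lambda>n. complex_of_real (zn n)) \<longlonglongrightarrow> c 1"
  proof -
    have "(\<lambda>n. b / real (n + 2)) \<longlonglongrightarrow> 0" by (intro LIMSEQ_ignore_initial_segment lim_const_over_n)
    then have "zn \<longlonglongrightarrow> b - 0" unfolding zn_def by (intro tendsto_intros)
    then show ?thesis unfolding c1 by (intro tendsto_of_real) simp
  qed
  have cS: "c 1 \<in> {z. 0 \<le> Re z}" using me'(7) by simp
  have lim: "(\<lambda>n. f (of_real (zn n))) \<longlonglongrightarrow> f (c 1)" if "continuous_on {z. 0 \<le> Re z} f" for f :: "complex \<Rightarrow> complex"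
    by (rule continuous_on_tendsto_compose[OF that znl cS]) (auto intro!: always_eventually simp: zn less_imp_le)
  have nc: "of_real (zn n) \<notin> c ` {1..m}" for n
    by (rule strip_not_c) (use zn(2)[of n] in \<open>simp add: b_def\<close>)
  let ?B = "\<lambda>z. of_real 1 - of_real a * z - of_real (\<sigma>\<^sup>2) / 2 * z\<^sup>2 - neg_part z + of_real lam :: complex"
  have "(\<lambda>n. ?B (of_real (zn n)) * pole_poly (of_real (zn n)) - pos_lt (of_real (zn n)) * pole_poly (of_real (zn n))) \<longlonglongrightarrow> ?B (c 1) * 0 - 0"
  proof (intro tendsto_diff tendsto_mult)
    show "(\<lambda>n. ?B (of_real (zn n))) \<longlonglongrightarrow> ?B (c 1)"
      by (rule lim) (intro continuous_intros neg_part_cont)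
    have "pole_poly (c 1) = 0" unfolding pole_poly_def by (subst prod_zero_iff) (use me'(3) in auto)
    moreover have "(\<lambda>n. pole_poly (of_real (zn n))) \<longlonglongrightarrow> pole_poly (c 1)"
      by (rule lim) (intro holomorphic_on_imp_continuous_on pole_poly_holo)
    ultimately show M0: "(\<lambda>n. pole_poly (of_real (zn n))) \<longlonglongrightarrow> 0" by simp
    show "(\<lambda>n. pos_lt (of_real (zn n)) * pole_poly (of_real (zn n))) \<longlonglongrightarrow> 0"
    proof (rule tendsto_0_le[where K = E])
      show "(\<lambda>n. pole_poly (of_real (zn n))) \<longlonglongrightarrow> 0" by (rule M0)
      show "\<forall>\<^sub>F n in sequentially. norm (pos_lt (of_real (zn n)) * pole_poly (of_real (zn n))) \<le> norm (pole_poly (of_real (zn n))) * E"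
      proof (intro always_eventually allI)
        fix n
        have "norm (pole_poly (of_real (zn n))) * norm (pos_lt (of_real (zn n))) \<le> norm (pole_poly (of_real (zn n))) * E"
          by (intro mult_left_mono GE zn) auto
        then show "norm (pos_lt (of_real (zn n)) * pole_poly (of_real (zn n))) \<le> norm (pole_poly (of_real (zn n))) * E"
          by (simp add: norm_mult mult.commute)
      qed
    qed
  qed
  moreover have "?B (of_real (zn n)) * pole_poly (of_real (zn n)) - pos_lt (of_real (zn n)) * pole_poly (of_real (zn n)) = cleared 1 (of_real (zn n))" for n
    unfolding cleared_def using pos_num_eq[OF nc] by simp
  ultimately have "(\<lambda>n. cleared 1 (of_real (zn n))) \<longlonglongrightarrow> 0" by simp
  moreover have "(\<lambda>n. cleared 1 (of_real (zn n))) \<longlonglongrightarrow> cleared 1 (c 1)" by (rule lim[OF cleared_cont])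
  ultimately have "cleared 1 (c 1) = 0" using LIMSEQ_unique by blast
  then show False using cleared_at_pole[of 1 1] me'(3) by auto
qed

end

section \<open>Meromorphic continuation of the cumulant\<close>

text \<open>Counts the zeros of a finite product of linear factors, repeated factors included.\<close>

lemma zorder_factored:
  fixes f g :: "complex \<Rightarrow> complex" and r :: "'i \<Rightarrow> complex"
  assumes S: "open S" "p \<in> S" and g: "g holomorphic_on S" "g p \<noteq> 0" and I: "finite I"
    and f: "\<And>w. w \<in> S \<Longrightarrow> f w = g w * (\<Prod>i\<in>I. r i - w)"
  shows "zorder f p = int (card {i\<in>I. r i = p})"
proof -
  let ?J = "{i\<in>I. r i = p}" and ?L = "{i\<in>I. r i \<noteq> p}"
  have un: "I = ?J \<union> ?L" "?J \<inter> ?L = {}" by auto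
  show ?thesis
  proof (rule zorder_eqI[OF S, where g = "\<lambda>w. g w * (\<Prod>i\<in>?L. r i - w) * (- 1) ^ card ?J"])
    show "(\<lambda>w. g w * (\<Prod>i\<in>?L. r i - w) * (- 1) ^ card ?J) holomorphic_on S"
      by (intro holomorphic_intros g)
    show "g p * (\<Prod>i\<in>?L. r i - p) * (- 1) ^ card ?J \<noteq> 0"
      using g(2) I by (auto simp: prod_zero_iff)
    fix w assume w: "w \<in> S"
    have "(\<Prod>i\<in>I. r i - w) = (\<Prod>i\<in>?J. r i - w) * (\<Prod>i\<in>?L. r i - w)"
      using I by (subst un(1), subst prod.union_disjoint) auto
    also have "(\<Prod>i\<in>?J. r i - w) = (\<Prod>i\<in>?J. p - w)" by (intro prod.cong) auto
    also have "\<dots> = (p - w) ^ card ?J" by simp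
    also have "\<dots> = (- 1) ^ card ?J * (w - p) ^ card ?J" by (simp flip: power_mult_distrib)
    finally show "f w = g w * (\<Prod>i\<in>?L. r i - w) * (- 1) ^ card ?J * (w - p) powi int (card ?J)"
      using f[OF w] by (simp add: power_int_def)
  qed
qed

lemma holomorphic_tendsto:
  fixes f :: "complex \<Rightarrow> complex"
  assumes "f holomorphic_on S" "open S" "p \<in> S"
  shows "f \<midarrow>p\<rightarrow> f p"
  using holomorphic_on_imp_continuous_on[OF assms(1)] assms(2,3)
  by (simp add: continuous_on_eq_continuous_at isCont_def)

text \<open>Dividing a holomorphic function by linear factors that match its zeros and their orders
  leaves a zero-free holomorphic function; the quotient has removable singularities only.\<close>

lemma divide_out_zeros:
  fixes f :: "complex \<Rightarrow> complex" and r :: "'i \<Rightarrow> complex"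
  assumes S: "open S" "connected S" and f: "f holomorphic_on S" and nz: "\<beta> \<in> S" "f \<beta> \<noteq> 0" and I: "finite I"
    and ord: "\<And>p. p \<in> S \<Longrightarrow> card {i\<in>I. r i = p} = (if f p = 0 then nat (zorder f p) else 0)"
  obtains g where "g holomorphic_on S" "\<And>p. p \<in> S \<Longrightarrow> g p \<noteq> 0" "\<And>p. p \<in> S \<Longrightarrow> f p = g p * (\<Prod>i\<in>I. r i - p)"
proof -
  let ?Q = "\<lambda>z. \<Prod>i\<in>I. r i - z"
  let ?q = "\<lambda>z. f z / ?Q z"
  define g where "g = remove_sings ?q"
  have local: "\<exists>c. c \<noteq> 0 \<and> ?q \<midarrow>p\<rightarrow> c \<and> isolated_singularity_at ?q p \<and> (?Q p \<noteq> 0 \<longrightarrow> c = ?q p) \<and> (?Q p = 0 \<longrightarrow> f p = 0)" if p: "p \<in> S" for p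
  proof -
    let ?L = "{i\<in>I. r i \<noteq> p}" and ?J = "{i\<in>I. r i = p}"
    define n where "n = card ?J"
    obtain h e where h: "e > 0" "ball p e \<subseteq> S" "h holomorphic_on ball p e" "h p \<noteq> 0"
        "\<And>w. w \<in> ball p e \<Longrightarrow> f w = h w * (w - p) ^ n"
    proof -
      have ev: "\<forall>\<^sub>F w in at p. f w \<noteq> 0" "f analytic_on {p}"
        using non_zero_neighbour_alt[OF f S p nz] eventually_mono apply fastforce
        using f S p analytic_at by blast
      have iso: "isolated_singularity_at f p" "not_essential f p" using ev(2)
        by (auto intro: isolated_singularity_at_analytic not_essential_analytic)
      obtain e1 where e1: "e1 > 0" "ball p e1 \<subseteq> S" using S(1) p openE by blast
      have fr: "\<exists>\<^sub>F w in at p. f w \<noteq> 0" using ev(1) by (simp add: eventually_frequently)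
      obtain e2 where e2: "zor_poly f p p \<noteq> 0" "e2 > 0" "zor_poly f p holomorphic_on cball p e2"
          "\<And>w. w \<in> cball p e2 - {p} \<Longrightarrow> f w = zor_poly f p w * (w - p) powi zorder f p"
        using zorder_exist[OF iso fr] by blast
      define e where "e = min e1 e2"
      have zn: "zorder f p = int n"
      proof (cases "f p = 0")
        case True
        have "zorder f p \<ge> 0" using ev(2) fr
          by (intro zorder_ge_0)
        then show ?thesis using ord[OF p] True unfolding n_def by simp
      next
        case False
        have "zorder f p = 0" by (rule zorder_zero_eqI[OF f S(1) p]) (use False in auto)
        then show ?thesis using ord[OF p] False unfolding n_def by simp
      qed
      have off: "f w = zor_poly f p w * (w - p) ^ n" if "w \<in> ball p e - {p}" for w
        using e2(4)[of w] that zn by (auto simp: e_def power_int_def)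
      have hc: "zor_poly f p holomorphic_on ball p e" by (rule holomorphic_on_subset[OF e2(3)]) (auto simp: e_def)
      have e: "e > 0" using e1 e2 by (simp add: e_def)
      have at: "f p = zor_poly f p p * (p - p) ^ n"
      proof -
        have "f \<midarrow>p\<rightarrow> f p" using ev(2) analytic_at_imp_isCont isContD by blast
        moreover have zl: "(\<lambda>w. zor_poly f p w * (w - p) ^ n) \<midarrow>p\<rightarrow> zor_poly f p p * (p - p) ^ n"
        proof (intro tendsto_intros)
          show "zor_poly f p \<midarrow>p\<rightarrow> zor_poly f p p"
            by (rule holomorphic_tendsto[OF hc open_ball]) (use e in simp)
        qed
        moreover have "\<forall>\<^sub>F w in at p. zor_poly f p w * (w - p) ^ n = f w"
          using eventually_at_in_open[OF open_ball centre_in_ball[THEN iffD2, OF e]] by eventually_elim (simp add: off)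
        ultimately show ?thesis using LIM_unique Lim_transform_eventually[OF zl] by blast
      qed
      have fw: "f w = zor_poly f p w * (w - p) ^ n" if "w \<in> ball p e" for w using off at that by (cases "w = p") auto
      show ?thesis
        by (rule that[OF e _ hc e2(1) fw]) (use e1 in \<open>auto simp: e_def\<close>)
    qed
    have Q: "?Q w = ((- 1) ^ n * (\<Prod>i\<in>?L. r i - w)) * (w - p) ^ n" for w
    proof -
      have un: "I = ?J \<union> ?L" "?J \<inter> ?L = {}" by auto
      have "?Q w = (\<Prod>i\<in>?J. r i - w) * (\<Prod>i\<in>?L. r i - w)"
        using I by (subst un(1), subst prod.union_disjoint) auto
      also have "(\<Prod>i\<in>?J. r i - w) = (\<Prod>i\<in>?J. p - w)" by (intro prod.cong) auto
      also have "\<dots> = (p - w) ^ n" by (simp add: n_def)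
      also have "\<dots> = (- 1) ^ n * (w - p) ^ n" by (simp flip: power_mult_distrib)
      finally show ?thesis by simp
    qed
    let ?k = "\<lambda>w. (- 1) ^ n * (\<Prod>i\<in>?L. r i - w)"
    have kp: "?k p \<noteq> 0" using I by (auto simp: prod_zero_iff)
    have lim: "(\<lambda>w. h w / ?k w) \<midarrow>p\<rightarrow> h p / ?k p"
    proof (intro tendsto_divide kp)
      show "h \<midarrow>p\<rightarrow> h p" by (rule holomorphic_tendsto[OF h(3) open_ball]) (use h(1) in simp)
    qed (intro tendsto_intros)
    have eq: "?q w = h w / ?k w" if "w \<in> ball p e - {p}" for w
      using h(5)[of w] Q[of w] that by auto
    have limq: "?q \<midarrow>p\<rightarrow> h p / ?k p"
    proof (rule Lim_transform_eventually[OF lim])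
      show "\<forall>\<^sub>F w in at p. h w / ?k w = ?q w"
        using eventually_at_in_open[OF open_ball centre_in_ball[THEN iffD2, OF h(1)]] by eventually_elim (simp add: eq)
    qed
    have iso: "isolated_singularity_at ?q p"
    proof -
      have "f analytic_on {p}" using f S p analytic_at by blast
      moreover have "?Q analytic_on {p}" by (intro analytic_intros)
      ultimately show ?thesis
        by (intro singularity_intros) (auto intro: isolated_singularity_at_analytic not_essential_analytic)
    qed
    have same: "h p / ?k p = ?q p" if "?Q p \<noteq> 0"
    proof -
      have "n = 0"
      proof (rule ccontr)
        assume "n \<noteq> 0"
        then have "?Q p = 0" unfolding Q by simp
        with that show False by contradiction
      qed
      then show ?thesis using h(5)[of p] Q[of p] h(1) by simp
    qed
    have z: "f p = 0" if "?Q p = 0"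
    proof -
      have "?J \<noteq> {}" using that I by (auto simp: prod_zero_iff)
      then have "card ?J \<noteq> 0" using I by simp
      then show ?thesis using ord[OF p] by (auto split: if_splits)
    qed
    show ?thesis using limq iso kp h(4) same z by (intro exI[of _ "h p / ?k p"]) auto
  qed
  have g_at: "g analytic_on {p}" "g p \<noteq> 0" "f p = g p * ?Q p" if p: "p \<in> S" for p
  proof -
    obtain c where c: "c \<noteq> 0" "?q \<midarrow>p\<rightarrow> c" "isolated_singularity_at ?q p" "?Q p \<noteq> 0 \<longrightarrow> c = ?q p" "?Q p = 0 \<longrightarrow> f p = 0"
      using local[OF p] by blast
    show "g analytic_on {p}" unfolding g_def by (rule remove_sings_analytic_at[OF c(3,2)])
    have gp: "g p = c" unfolding g_def by (rule remove_sings_eqI[OF c(2)])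
    show "g p \<noteq> 0" using gp c by simp
    show "f p = g p * ?Q p" using gp c(4,5) by (cases "?Q p = 0") auto
  qed
  show thesis
  proof (rule that)
    show "g holomorphic_on S" using g_at(1) analytic_imp_holomorphic analytic_on_analytic_at by blast
  qed (use g_at in auto)
qed

text \<open>Multiplicities that sum to \<open>N\<close> can be realised by a list of length
  \<open>N\<close>.\<close>

lemma list_with_multiplicities:
  assumes "finite Z" "(\<Sum>z\<in>Z. n z) = (N::nat)"
  shows "\<exists>r. (\<forall>i\<in>{1..N}. r i \<in> Z) \<and> (\<forall>z\<in>Z. card {i\<in>{1..N}. r i = z} = n z)"
  using assms
proof (induction Z arbitrary: N rule: finite_induct)
  case empty
  then show ?case by auto
next
  case (insert y Z)
  define N' where "N' = (\<Sum>z\<in>Z. n z)"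
  obtain r where r: "\<forall>i\<in>{1..N'}. r i \<in> Z" "\<forall>z\<in>Z. card {i\<in>{1..N'}. r i = z} = n z"
    using insert.IH[of N'] N'_def by blast
  have N: "N = N' + n y" using insert unfolding N'_def by simp
  define r' where "r' i = (if i \<le> N' then r i else y)" for i
  show ?case
  proof (intro exI[of _ r'] conjI ballI)
    fix i assume "i \<in> {1..N}" then show "r' i \<in> insert y Z" using r(1) by (auto simp: r'_def)
  next
    fix z assume z: "z \<in> insert y Z"
    show "card {i\<in>{1..N}. r' i = z} = n z"
    proof (cases "z = y")
      case True
      have "{i\<in>{1..N}. r' i = z} = {N'<..N}"
        using True r(1) insert(2) by (auto simp: r'_def split: if_splits)
      then show ?thesis using N True by simp
    next
      case False
      have "{i\<in>{1..N}. r' i = z} = {i\<in>{1..N'}. r i = z}"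
        using False N by (auto simp: r'_def split: if_splits)
      then show ?thesis using False z r(2) by auto
    qed
  qed
qed

context me_cumulant
begin

lemma open_A: "open {z::complex. 0 < Re z}" and conn_A: "connected {z::complex. 0 < Re z}"
  by (auto simp: open_halfspace_Re_gt intro!: convex_connected convex_halfspace_Re_gt)

lemma c_in: "i \<in> {1..m} \<Longrightarrow> c i \<in> {z. 0 < Re z}" using Re_c(1) by auto

lemma cleared_ev_nz: "0 < Re z \<Longrightarrow> \<forall>\<^sub>F w in at z. cleared s w \<noteq> 0"
  using non_zero_neighbour_alt[OF cleared_holo open_A conn_A, of z "c 1" s] c_in[of 1] cleared_at_pole[of 1 s] me'(3)
  by (auto elim: eventually_mono)

text \<open>The value 0 at poles is the convention for nicely meromorphic functions.\<close>

definition cumul_ext :: "complex \<Rightarrow> complex" where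
  "cumul_ext z = (if z \<in> c ` {1..m} then 0 else cumul z)"

lemma ev_not_c: "\<forall>\<^sub>F w in at z. w \<notin> c ` {1..m}"
proof -
  have "open (- (c ` {1..m} - {z}))" by (intro open_Compl finite_imp_closed) auto
  then have "\<forall>\<^sub>F w in at z. w \<in> - (c ` {1..m} - {z}) - {z}" by (rule eventually_at_in_open) auto
  then show ?thesis by eventually_elim blast
qed

lemma is_pole_cumul_ext: "i \<in> {1..m} \<Longrightarrow> is_pole cumul_ext (c i)"
proof -
  assume i: "i \<in> {1..m}"
  have "is_pole (\<lambda>z. (- cleared 0 z) / pole_poly z) (c i)"
  proof (rule is_pole_divide)
    show "isCont (\<lambda>z. - cleared 0 z) (c i)"
      using holomorphic_on_imp_continuous_on[OF cleared_holo[of 0]] c_in[OF i]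
      by (intro continuous_minus) (simp add: continuous_on_eq_continuous_at[OF open_A])
    have "pole_poly (c i) = 0" unfolding pole_poly_def by (subst prod_zero_iff) (use i in auto)
    moreover have "isCont pole_poly (c i)"
      using holomorphic_on_imp_continuous_on[OF pole_poly_holo[of UNIV]] by (simp add: continuous_on_eq_continuous_at)
    ultimately have "pole_poly \<midarrow>c i\<rightarrow> 0" by (simp add: isCont_def)
    moreover have "\<forall>\<^sub>F w in at (c i). pole_poly w \<noteq> 0"
      using ev_not_c by eventually_elim (rule pole_poly_nz)
    ultimately show "filterlim pole_poly (at 0) (at (c i))" by (simp add: filterlim_at)
    show "- cleared 0 (c i) \<noteq> 0" using cleared_at_pole[OF i] by simp
  qed
  moreover have ev: "\<forall>\<^sub>F w in at (c i). (- cleared 0 w) / pole_poly w = cumul_ext w"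
    using ev_not_c by eventually_elim (auto simp: cumul_ext_def cleared_eq pole_poly_nz)
  ultimately show ?thesis using is_pole_cong[OF ev refl] by simp
qed

lemma cumul_ext_nice: "cumul_ext nicely_meromorphic_on {z. 0 < Re z}"
proof (rule nicely_meromorphic_onI_open[OF open_A, where pts = "c ` {1..m}"])
  have op: "open ({z. 0 < Re z} - c ` {1..m})" by (intro open_Diff open_A finite_imp_closed) auto
  have hol: "cumul_ext holomorphic_on ({z. 0 < Re z} - c ` {1..m})"
    by (rule holomorphic_transform[OF cumul_holo]) (auto simp: cumul_ext_def)
  then show an: "cumul_ext analytic_on {z. 0 < Re z} - c ` {1..m}" using op by (simp add: analytic_on_open)
  show "is_pole cumul_ext x \<and> cumul_ext x = 0" if "x \<in> c ` {1..m}" for x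
    using that is_pole_cumul_ext by (auto simp: cumul_ext_def)
  show "isolated_singularity_at cumul_ext x" if x: "x \<in> {z. 0 < Re z}" for x
  proof -
    have "open ({z. 0 < Re z} - (c ` {1..m} - {x}))" by (intro open_Diff open_A finite_imp_closed) auto
    moreover have "x \<in> {z. 0 < Re z} - (c ` {1..m} - {x})" using x by auto
    ultimately obtain e where e: "e > 0" "ball x e \<subseteq> {z. 0 < Re z} - (c ` {1..m} - {x})" using openE by blast
    have "cumul_ext analytic_on ball x e - {x}"
      by (rule analytic_on_subset[OF an]) (use e in auto)
    then show ?thesis using e unfolding isolated_singularity_at_def by blast
  qed
qed

lemma cumul_ext_continuation: "is_continuation 1 a \<sigma> \<nu> cumul_ext"
  unfolding is_continuation_def
proof (intro conjI allI impI)
  show "cumul_ext nicely_meromorphic_on {r. 0 < 1 * Re r}" using cumul_ext_nice by simp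
  fix r assume r: "0 < 1 * Re r \<and> complex_set_integrable \<nu> (- {0}) (\<lambda>x. exp (r * complex_of_real x) - 1)"
  then have "Re r < Re (c 1)" by (intro integrable_imp_strip) auto
  moreover from this have "r \<notin> c ` {1..m}" by (rule strip_not_c)
  ultimately show "cumul_ext r = cumulant a \<sigma> \<nu> r" using r by (simp add: cumul_ext_def cumulant_eq)
qed

lemma nicely_eq_remove_sings:
  assumes "f nicely_meromorphic_on A" "z \<in> A"
  shows "remove_sings f z = f z"
  using assms unfolding nicely_meromorphic_on_def by (metis remove_sings_at_pole remove_sings_eqI)

text \<open>Two continuations agree on the strip where the defining integral converges, hence everywhere
  by the identity theorem; being nicely meromorphic they also agree at the singularities.\<close>

lemma continuation_unique:
  assumes "is_continuation 1 a \<sigma> \<nu> K" "0 < Re z"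
  shows "K z = cumul_ext z"
proof -
  let ?A = "{z. 0 < Re z}"
  have nK: "K nicely_meromorphic_on ?A"
    and eqK: "\<And>r. 0 < Re r \<Longrightarrow> complex_set_integrable \<nu> (- {0}) (\<lambda>x. exp (r * complex_of_real x) - 1) \<Longrightarrow> K r = cumulant a \<sigma> \<nu> r"
    using assms(1) unfolding is_continuation_def by auto
  have strip: "K r = cumul_ext r" if "0 < Re r" "Re r < Re (c 1)" for r
  proof -
    have "r \<notin> c ` {1..m}" using strip_not_c that by blast
    then show ?thesis using that eqK cumulant_eq[of r] by (simp add: cumul_ext_def)
  qed
  let ?D = "\<lambda>z. K z - cumul_ext z"
  have mD: "?D meromorphic_on ?A"
    using nK cumul_ext_nice by (intro meromorphic_intros) (auto simp: nicely_meromorphic_on_def)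
  define w where "w = complex_of_real (Re (c 1) / 2)"
  have w: "0 < Re w" "Re w < Re (c 1)" unfolding w_def using me'(7) by auto
  have "\<forall>\<^sub>F v in at w. v \<in> {v. 0 < Re v} \<inter> {v. Re v < Re (c 1)} - {w}"
    by (rule eventually_at_in_open) (use w in \<open>auto simp: open_A open_halfspace_Re_lt\<close>)
  moreover have "\<forall>\<^sub>F v in at w. remove_sings ?D v = ?D v"
    by (rule eventually_remove_sings_eq_at, rule meromorphic_on_isolated_singularity, rule meromorphic_on_subset[OF mD]) (use w in auto)
  ultimately have "\<forall>\<^sub>F v in at w. remove_sings ?D v = 0"
    by eventually_elim (auto simp: strip)
  then have fr: "\<exists>\<^sub>F v in at w. remove_sings ?D v = 0" by (simp add: eventually_frequently)
  have zero: "remove_sings ?D v = 0" if "v \<in> ?A" for v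
    by (rule frequently_eq_meromorphic_imp_constant[OF fr remove_sings_nicely_meromorphic[OF mD] open_A conn_A _ that])
       (use w in auto)
  have "\<forall>\<^sub>F v in at z. remove_sings ?D v = ?D v"
    by (rule eventually_remove_sings_eq_at, rule meromorphic_on_isolated_singularity, rule meromorphic_on_subset[OF mD]) (use assms in auto)
  moreover have "\<forall>\<^sub>F v in at z. v \<in> ?A - {z}"
    by (rule eventually_at_in_open) (use assms in \<open>auto simp: open_A\<close>)
  ultimately have "\<forall>\<^sub>F v in at z. K v = cumul_ext v" by eventually_elim (use zero in auto)
  then have "remove_sings K z = remove_sings cumul_ext z" by (intro remove_sings_cong) auto
  then show ?thesis using nicely_eq_remove_sings[OF nK] nicely_eq_remove_sings[OF cumul_ext_nice] assms by auto
qed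

text \<open>Near a solution the factor \<open>pole_poly\<close> has no zero, and a pole is never a
  solution because \<open>s > 0\<close> differs from the conventional value 0.\<close>

lemma solution_mult_cleared:
  assumes s: "0 < s" and z: "0 < Re z" and K: "\<And>w. 0 < Re w \<Longrightarrow> K w = cumul_ext w"
  shows "solution_mult K s z = (if cleared s z = 0 then nat (zorder (cleared s) z) else 0)"
proof (cases "z \<in> c ` {1..m}")
  case True
  then have "K z = 0" using K[OF z] by (simp add: cumul_ext_def)
  moreover have "cleared s z \<noteq> 0" using True cleared_at_pole by auto
  ultimately show ?thesis using s by (simp add: solution_mult_def)
next
  case False
  have iff: "K z = of_real s \<longleftrightarrow> cleared s z = 0"
    using False K[OF z] pole_poly_nz[OF False] by (auto simp: cumul_ext_def cleared_eq)
  have "zorder (\<lambda>w. K w - of_real s) z = zorder (cleared s) z"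
  proof -
    have an: "pole_poly analytic_on {z}" using pole_poly_holo[of UNIV] analytic_at by blast
    have anF: "cleared s analytic_on {z}" using cleared_holo open_A z analytic_at by blast
    have "zorder (\<lambda>w. cleared s w / (- pole_poly w)) z = zorder (cleared s) z - zorder (\<lambda>w. - pole_poly w) z"
    proof (rule zorder_divide)
      show "cleared s meromorphic_on {z}" "(\<lambda>w. - pole_poly w) meromorphic_on {z}"
        using an anF by (auto intro!: analytic_on_imp_meromorphic_on analytic_intros)
      show "\<exists>\<^sub>F w in at z. cleared s w \<noteq> 0" using cleared_ev_nz[OF z] by (simp add: eventually_frequently)
      have "\<forall>\<^sub>F w in at z. - pole_poly w \<noteq> 0" using ev_not_c by eventually_elim (simp add: pole_poly_nz)
      then show "\<exists>\<^sub>F w in at z. - pole_poly w \<noteq> 0" by (simp add: eventually_frequently)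
    qed
    moreover have "zorder (\<lambda>w. - pole_poly w) z = 0"
      by (rule zorder_zero_eqI[of _ UNIV]) (use pole_poly_nz[OF False] in \<open>auto intro!: holomorphic_intros pole_poly_holo\<close>)
    moreover have "zorder (\<lambda>w. K w - of_real s) z = zorder (\<lambda>w. cleared s w / (- pole_poly w)) z"
    proof (rule zorder_cong[OF _ refl])
      have "\<forall>\<^sub>F w in at z. w \<in> {w. 0 < Re w} - {z}" by (rule eventually_at_in_open) (use z open_A in auto)
      with ev_not_c show "\<forall>\<^sub>F w in at z. K w - of_real s = cleared s w / (- pole_poly w)"
        by eventually_elim (auto simp: K cumul_ext_def cleared_eq pole_poly_nz divide_simps algebra_simps)
    qed
    ultimately show ?thesis by simp
  qed
  then show ?thesis using iff by (simp add: solution_mult_def)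
qed

end

section \<open>Counting the roots of the cumulant equation\<close>

context me_cumulant
begin

definition n_neg :: nat where "n_neg = (if \<sigma> > 0 \<or> a < 0 then 1 else 0)"
definition n_pos :: nat where "n_pos = (if \<sigma> > 0 \<or> a > 0 then 1 else 0)"
definition lead :: real where "lead = (if \<sigma> > 0 then \<sigma>\<^sup>2 / 2 else \<bar>a\<bar>)"

text \<open>A polynomial with the growth of \<open>s - k\<close> at infinity in the right half-plane,
  factored so that it has \<open>n_pos\<close> zeros to the right, none on the axis, and positive real
  part near the axis. With a Gaussian part it is quadratic with one zero on each side; otherwise it is
  linear and the sign of the drift decides.\<close>

definition growth_poly :: "complex \<Rightarrow> complex" where "growth_poly z = of_real lead * (1 + z) ^ n_neg * (1 - z) ^ n_pos"

lemma lead_pos: "lead > 0" unfolding lead_def using nd by auto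

text \<open>The zeros contributed by the polynomial factor at infinity are what separates the two
  cases.\<close>

lemma num_roots_eq: "num_roots 1 a \<sigma> \<nu> m P c = me_degree m P + n_pos"
  unfolding num_roots_def case_NS_def n_pos_def using me sig by auto

lemma cumul_0: "cumul 0 = 0"
  by (simp add: cumul_def pos_lt_0 neg_part_def)

abbreviation (input) "right_inf \<equiv> inf at_infinity (principal {z::complex. 0 \<le> Re z})"

lemma inv_right_inf: "((\<lambda>z. 1 / z) \<longlongrightarrow> 0) right_inf"
  unfolding inverse_eq_divide[symmetric] by (rule tendsto_mono[OF inf_le1 tendsto_inverse_0])

lemma pos_lt_right_inf: "(pos_lt \<longlongrightarrow> 0) right_inf"
proof -
  have "((\<lambda>z. 1 / (c i - z)) \<longlongrightarrow> 0) at_infinity" for i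
  proof -
    have "filterlim (\<lambda>z::complex. - z) at_infinity at_infinity"
      by (subst filterlim_at_infinity_conv_norm_at_top) (simp add: filterlim_norm_at_top)
    then have "filterlim (\<lambda>z. c i + - z) at_infinity at_infinity"
      by (rule tendsto_add_filterlim_at_infinity[OF tendsto_const])
    from filterlim_compose[OF tendsto_inverse_0 this] show ?thesis by (simp add: inverse_eq_divide)
  qed
  then have t: "((\<lambda>z. 1 / (c i - z)) \<longlongrightarrow> 0) right_inf" for i by (rule tendsto_mono[OF inf_le1])
  have "((\<lambda>z. of_real lam * (\<Sum>i=1..m. \<Sum>k\<le>degree (P i). coeff (P i) k * fact k * (1 / (c i - z)) ^ Suc k)) \<longlongrightarrow>
     of_real lam * (\<Sum>i=1..m. \<Sum>k\<le>degree (P i). coeff (P i) k * fact k * 0 ^ Suc k)) right_inf"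
    by (intro tendsto_intros t)
  moreover have "(\<lambda>z. of_real lam * (\<Sum>i=1..m. \<Sum>k\<le>degree (P i). coeff (P i) k * fact k * (1 / (c i - z)) ^ Suc k)) = pos_lt"
    unfolding pos_lt_def by (simp add: power_divide del: power_Suc)
  ultimately show ?thesis by simp
qed

text \<open>The integrand is at most \<open>min (|z| |x|) 2\<close>, so after division by
  \<open>|z|\<close> dominated convergence applies with the weight \<open>min |x| 1\<close>; here the
  finite variation of the jumps enters.\<close>

lemma neg_part_right_inf: "((\<lambda>z. neg_part z / z) \<longlongrightarrow> 0) right_inf"
proof -
  define \<psi> where "\<psi> R = (LINT x|\<nu>. indicator {..<0} x * min \<bar>x\<bar> (2 / R))" for R :: real
  have "((\<lambda>R. LINT x|\<nu>. indicator {..<0} x * min \<bar>x\<bar> (2 / R)) \<longlongrightarrow> (LINT x|\<nu>. 0)) at_top"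
  proof (rule integral_dominated_convergence_at_top[where w = "\<lambda>x. 2 * min \<bar>x\<bar> 1"])
    show "integrable \<nu> (\<lambda>x. 2 * min \<bar>x\<bar> 1)" by (intro integrable_mult_right weight_integrable)
    show "\<forall>\<^sub>F R in at_top. AE x in \<nu>. norm (indicator {..<0} x * min \<bar>x\<bar> (2 / R)) \<le> 2 * min \<bar>x\<bar> 1"
      using eventually_ge_at_top[of 1]
    proof eventually_elim
      case (elim R)
      then have "2 / R \<le> 2" by (simp add: divide_le_eq)
      then show ?case using elim by (auto intro!: AE_I2 simp: min_def split: split_indicator)
    qed
    show "AE x in \<nu>. ((\<lambda>R. indicator {..<0} x * min \<bar>x\<bar> (2 / R)) \<longlongrightarrow> 0) at_top"
    proof (rule AE_I2)
      fix x :: real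
      have "((\<lambda>R::real. 2 / R) \<longlongrightarrow> 0) at_top" by (intro tendsto_divide_0[OF tendsto_const] filterlim_at_top_imp_at_infinity filterlim_ident)
      then have "((\<lambda>R. indicator {..<0} x * min \<bar>x\<bar> (2 / R)) \<longlongrightarrow> indicator {..<0} x * min \<bar>x\<bar> 0) at_top"
        by (intro tendsto_intros)
      then show "((\<lambda>R. indicator {..<0} x * min \<bar>x\<bar> (2 / R)) \<longlongrightarrow> 0) at_top" by simp
    qed
  qed auto
  then have \<psi>: "(\<psi> \<longlongrightarrow> 0) at_top" unfolding \<psi>_def by simp
  have nt: "filterlim (norm :: complex \<Rightarrow> real) at_top right_inf"
    using filterlim_mono[OF filterlim_norm_at_top order_refl inf_le1] .
  have bd: "norm (neg_part z / z) \<le> \<psi> (norm z)" if z: "0 \<le> Re z" "z \<noteq> 0" for z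
  proof -
    have "norm (neg_part z) \<le> (LINT x|\<nu>. norm z * (indicator {..<0} x * min \<bar>x\<bar> (2 / norm z)))"
      unfolding neg_part_def set_lebesgue_integral_def
    proof (rule order_trans[OF integral_norm_bound], rule integral_mono)
      show "integrable \<nu> (\<lambda>x. norm (indicator {..<0} x *\<^sub>R (exp (z * of_real x) - 1)))"
        using neg_part_integrable[OF z(1)] unfolding set_integrable_def by (rule integrable_norm)
      show "integrable \<nu> (\<lambda>x. norm z * (indicator {..<0} x * min \<bar>x\<bar> (2 / norm z)))"
      proof (intro integrable_mult_right Bochner_Integration.integrable_bound[OF integrable_mult_right[OF weight_integrable, of "1 + 2 / norm z"]] AE_I2)
        fix x :: real
        have p: "2 / norm z > 0" using z by simp
        have "min \<bar>x\<bar> (2 / norm z) \<le> (1 + 2 / norm z) * min \<bar>x\<bar> 1"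
        proof (cases "\<bar>x\<bar> \<le> 1")
          case True
          have "1 * \<bar>x\<bar> \<le> (1 + 2 / norm z) * \<bar>x\<bar>" by (intro mult_right_mono) (use p in auto)
          then show ?thesis using True by (simp add: min_def)
        next
          case False
          have "min \<bar>x\<bar> (2 / norm z) \<le> 1 + 2 / norm z" by linarith
          then show ?thesis using False by (simp add: min_absorb2)
        qed
        moreover have "0 \<le> (1 + 2 / norm z) * min \<bar>x\<bar> 1" using p by simp
        ultimately show "norm (indicator {..<0} x * min \<bar>x\<bar> (2 / norm z)) \<le> norm ((1 + 2 / norm z) * min \<bar>x\<bar> 1)"
          using p by (auto split: split_indicator)
      qed auto
      show "norm (indicator {..<0} x *\<^sub>R (exp (z * of_real x) - 1)) \<le> norm z * (indicator {..<0} x * min \<bar>x\<bar> (2 / norm z))" for x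
      proof (cases "x < 0")
        case True
        have "norm z * min \<bar>x\<bar> (2 / norm z) = min (norm z * \<bar>x\<bar>) 2"
          using z by (simp add: min_mult_distrib_left)
        then show ?thesis using exp_minus_one_bound[OF z(1), of x] True by simp
      qed simp
    qed
    also have "\<dots> = norm z * \<psi> (norm z)" unfolding \<psi>_def by simp
    finally show ?thesis using z by (simp add: norm_divide divide_le_eq mult.commute)
  qed
  show ?thesis
  proof (rule Lim_null_comparison)
    show "((\<lambda>z. \<psi> (norm z)) \<longlongrightarrow> 0) right_inf" by (rule filterlim_compose[OF \<psi> nt])
    have "\<forall>\<^sub>F z in right_inf. z \<noteq> 0"
      by (rule filter_leD[OF inf_le1]) (simp add: eventually_not_equal_at_infinity)
    moreover have "\<forall>\<^sub>F z in right_inf. 0 \<le> Re z" by (simp add: eventually_inf_principal)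
    ultimately show "\<forall>\<^sub>F z in right_inf. norm (neg_part z / z) \<le> \<psi> (norm z)"
      by eventually_elim (rule bd)
  qed
qed

lemma ratio_right_inf: "((\<lambda>z. (of_real s - cumul z) / growth_poly z) \<longlongrightarrow> 1) right_inf"
proof -
  have nz: "\<forall>\<^sub>F z in right_inf. z \<noteq> 0"
    by (rule filter_leD[OF inf_le1]) (simp add: eventually_not_equal_at_infinity)
  show ?thesis
  proof (cases "\<sigma> > 0")
    case True
    let ?N = "\<lambda>z. of_real s * (1 / z)\<^sup>2 - of_real a * (1 / z) - of_real (\<sigma>\<^sup>2) / 2 - (neg_part z / z) * (1 / z) - pos_lt z * (1 / z)\<^sup>2 + of_real lam * (1 / z)\<^sup>2"
    let ?D = "\<lambda>z. of_real (\<sigma>\<^sup>2) / 2 * ((1 / z)\<^sup>2 - 1) :: complex"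
    have N: "(?N \<longlongrightarrow> of_real s * 0\<^sup>2 - of_real a * 0 - of_real (\<sigma>\<^sup>2) / 2 - 0 * 0 - 0 * 0\<^sup>2 + of_real lam * 0\<^sup>2) right_inf"
      by (intro tendsto_intros inv_right_inf neg_part_right_inf pos_lt_right_inf)
    have D: "(?D \<longlongrightarrow> of_real (\<sigma>\<^sup>2) / 2 * (0\<^sup>2 - 1)) right_inf"
      by (intro tendsto_intros inv_right_inf)
    have "((\<lambda>z. ?N z / ?D z) \<longlongrightarrow> 1) right_inf"
      using tendsto_divide[OF N D] True by simp
    moreover have "\<forall>\<^sub>F z in right_inf. ?N z / ?D z = (of_real s - cumul z) / growth_poly z"
      using nz
    proof eventually_elim
      case (elim z)
      have "?N z = (of_real s - cumul z) / z\<^sup>2"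
        using elim unfolding cumul_def by (simp add: field_simps power2_eq_square)
      moreover have "?D z = growth_poly z / z\<^sup>2"
        using elim True unfolding growth_poly_def lead_def n_neg_def n_pos_def by (simp add: field_simps power2_eq_square)
      ultimately show ?case using elim by simp
    qed
    ultimately show ?thesis by (rule Lim_transform_eventually)
  next
    case False
    then have \<sigma>: "\<sigma> = 0" and a: "a \<noteq> 0" using sig nd by auto
    let ?N = "\<lambda>z. of_real s * (1 / z) - of_real a - (neg_part z / z) - pos_lt z * (1 / z) + of_real lam * (1 / z)"
    let ?D = "\<lambda>z. of_real \<bar>a\<bar> * (1 / z + (if a < 0 then 1 else - 1)) :: complex"
    have N: "(?N \<longlongrightarrow> of_real s * 0 - of_real a - 0 - 0 * 0 + of_real lam * 0) right_inf"
      by (intro tendsto_intros inv_right_inf neg_part_right_inf pos_lt_right_inf)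
    have D: "(?D \<longlongrightarrow> of_real \<bar>a\<bar> * (0 + (if a < 0 then 1 else - 1))) right_inf"
      by (intro tendsto_intros inv_right_inf)
    have "((\<lambda>z. ?N z / ?D z) \<longlongrightarrow> 1) right_inf"
      using tendsto_divide[OF N D] a by (auto split: if_splits)
    moreover have "\<forall>\<^sub>F z in right_inf. ?N z / ?D z = (of_real s - cumul z) / growth_poly z"
      using nz
    proof eventually_elim
      case (elim z)
      have "?N z = (of_real s - cumul z) / z"
        unfolding cumul_def using elim \<sigma> by (simp add: field_simps)
      moreover have "?D z = growth_poly z / z"
        using elim \<sigma> a unfolding growth_poly_def lead_def n_neg_def n_pos_def by (auto simp: field_simps)
      ultimately show ?case using elim by simp
    qed
    ultimately show ?thesis by (rule Lim_transform_eventually)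
  qed
qed

lemma far_bound:
  "\<exists>R0>0. (\<forall>i\<in>{1..m}. norm (c i) < R0) \<and>
     (\<forall>z. 0 \<le> Re z \<longrightarrow> R0 \<le> norm z \<longrightarrow> norm ((of_real s - cumul z) / growth_poly z - 1) < 1)"
proof -
  have "\<forall>\<^sub>F z in right_inf. dist ((of_real s - cumul z) / growth_poly z) 1 < 1"
    using ratio_right_inf[of s] by (rule tendstoD) simp
  then obtain b where b: "\<And>z. b \<le> norm z \<Longrightarrow> 0 \<le> Re z \<Longrightarrow> norm ((of_real s - cumul z) / growth_poly z - 1) < 1"
    by (auto simp: eventually_inf_principal eventually_at_infinity dist_norm)
  define R0 where "R0 = max b (1 + (\<Sum>i=1..m. norm (c i)))"
  have ge: "norm (c i) < R0" if "i \<in> {1..m}" for i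
  proof -
    have "norm (c i) \<le> (\<Sum>i=1..m. norm (c i))" by (rule member_le_sum) (use that in auto)
    then show ?thesis unfolding R0_def by linarith
  qed
  have "0 \<le> (\<Sum>i=1..m. norm (c i))" by (intro sum_nonneg) auto
  then have "R0 > 0" unfolding R0_def by linarith
  then show ?thesis using ge b by (intro exI[of _ R0]) (auto simp: R0_def)
qed

text \<open>Moving along a vertical line away from the real axis decreases the real part of the
  cumulant, since \<open>exp\<close> of the jumps decreases in real part and so does the quadratic
  term.\<close>

lemma Re_cumul_le:
  assumes z: "0 \<le> Re z" "Re z < Re (c 1)"
  shows "Re (cumul z) \<le> Re (cumul (of_real (Re z)))"
proof -
  let ?f = "\<lambda>z x. indicator (- {0}) x *\<^sub>R (exp (z * complex_of_real x) - 1)"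
  have z': "0 \<le> Re (of_real (Re z))" "Re (of_real (Re z)) < Re (c 1)" using z by auto
  have i: "complex_integrable \<nu> (?f z)" "complex_integrable \<nu> (?f (of_real (Re z)))"
    using cumulant_eq(2)[OF z] cumulant_eq(2)[OF z'] by (simp_all add: set_integrable_def)
  have "(LINT x|\<nu>. Re (?f z x)) \<le> (LINT x|\<nu>. Re (?f (of_real (Re z)) x))"
  proof (rule integral_mono)
    show "integrable \<nu> (\<lambda>x. Re (?f z x))" "integrable \<nu> (\<lambda>x. Re (?f (of_real (Re z)) x))"
      by (rule integrable_Re[OF i(1)], rule integrable_Re[OF i(2)])
    fix x
    have "Re (exp (z * complex_of_real x)) \<le> exp (Re z * x)"
      using complex_Re_le_cmod[of "exp (z * complex_of_real x)"] by simp
    also have "\<dots> = Re (exp (of_real (Re z) * complex_of_real x))"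
      by (simp add: Re_exp)
    finally show "Re (?f z x) \<le> Re (?f (of_real (Re z)) x)" by (auto split: split_indicator)
  qed
  then have I: "Re (CLINT x|\<nu>. ?f z x) \<le> Re (CLINT x|\<nu>. ?f (of_real (Re z)) x)"
    using integral_Re[OF i(1)] integral_Re[OF i(2)] by simp
  have "Re (z\<^sup>2) \<le> Re ((complex_of_real (Re z))\<^sup>2)" by (simp add: power2_eq_square)
  then have "\<sigma>\<^sup>2 / 2 * Re (z\<^sup>2) \<le> \<sigma>\<^sup>2 / 2 * Re ((complex_of_real (Re z))\<^sup>2)" by (intro mult_left_mono) auto
  moreover have "Re (of_real (\<sigma>\<^sup>2) / 2 * w) = \<sigma>\<^sup>2 / 2 * Re w" for w by simp
  ultimately show ?thesis
    using I unfolding cumulant_eq(1)[OF z, symmetric] cumulant_eq(1)[OF z', symmetric] cumulant_def set_lebesgue_integral_def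
    by simp
qed

text \<open>By monotonicity along vertical lines it suffices to look at the real axis, where
  \<open>k\<close> is continuous with \<open>k(0) = 0 < s\<close>.\<close>

lemma near_bound:
  assumes s: "0 < s"
  shows "\<exists>e>0. e < 1 \<and> e < Re (c 1) \<and> (\<forall>z. 0 \<le> Re z \<longrightarrow> Re z \<le> e \<longrightarrow> 0 < Re (of_real s - cumul z))"
proof -
  let ?S = "{z. 0 \<le> Re z} - c ` {1..m}"
  have "continuous_on ?S cumul"
    unfolding cumul_def
    by (intro continuous_intros continuous_on_subset[OF neg_part_cont] holomorphic_on_imp_continuous_on pos_lt_holo) auto
  moreover have "0 \<in> ?S" using strip_not_c[of 0] me'(7) by auto
  ultimately have "\<forall>\<^sub>F z in at 0 within ?S. dist (cumul z) (cumul 0) < s"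
    using s unfolding continuous_on_def by (auto dest: tendstoD)
  then obtain d where d: "d > 0" "\<And>z. z \<in> ?S \<Longrightarrow> z \<noteq> 0 \<Longrightarrow> norm z < d \<Longrightarrow> norm (cumul z) < s"
    by (auto simp: eventually_at dist_norm cumul_0)
  define e where "e = min (d / 2) (min (1 / 2) (Re (c 1) / 2))"
  have e: "e > 0" "e < d" "e < 1" "e < Re (c 1)" unfolding e_def using d me'(7) by auto
  have "0 < Re (of_real s - cumul z)" if z: "0 \<le> Re z" "Re z \<le> e" for z
  proof -
    have r: "Re z < Re (c 1)" using z e by simp
    have "Re (cumul z) \<le> Re (cumul (of_real (Re z)))" by (rule Re_cumul_le[OF z(1) r])
    also have "\<dots> < s"
    proof (cases "Re z = 0")
      case True
      then show ?thesis using s by (simp add: cumul_0)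
    next
      case False
      have "complex_of_real (Re z) \<in> ?S" using strip_not_c[of "of_real (Re z)"] r z by auto
      then have "norm (cumul (of_real (Re z))) < s" using d(2)[of "of_real (Re z)"] False z e by auto
      then show ?thesis using complex_Re_le_cmod[of "cumul (of_real (Re z))"] by linarith
    qed
    finally show ?thesis by simp
  qed
  then show ?thesis using e by blast
qed

lemma Re_growth_poly_pos: "0 \<le> Re z \<Longrightarrow> Re z < 1 \<Longrightarrow> 0 < Re (growth_poly z)"
proof -
  assume z: "0 \<le> Re z" "Re z < 1"
  have "Re z * Re z \<le> Re z * 1" using z by (intro mult_left_mono) auto
  then have sq: "Re z * Re z < 1" using z by linarith
  have B: "growth_poly z = of_real lead * ((1 + z) ^ n_neg * (1 - z) ^ n_pos)" by (simp add: growth_poly_def mult.assoc)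
  have "0 < Re ((1 + z) ^ n_neg * (1 - z) ^ n_pos)"
    using z sq nd sig unfolding n_neg_def n_pos_def
    by (auto simp: algebra_simps intro: add_pos_nonneg) (smt (verit) zero_le_square)+
  then show ?thesis unfolding B using lead_pos by simp
qed

text \<open>An index set for the zeros in the right half-plane of the comparison function, with
  multiplicity: \<open>(i, j)\<close> stands for the \<open>j\<close>-th copy of
  \<open>c\<^sub>i\<close>, and the index 0 is used for the zero at 1.\<close>

definition zero_index :: "(nat \<times> nat) set" where
  "zero_index = Sigma {1..m} (\<lambda>i. {..degree (P i)}) \<union> {0} \<times> {..<n_pos}"

definition zero_of :: "nat \<times> nat \<Rightarrow> complex" where
  "zero_of w = (if fst w = 0 then 1 else c (fst w))"

lemma finite_zero_index: "finite zero_index" by (simp add: zero_index_def)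

lemma card_zero_index: "card zero_index = me_degree m P + n_pos"
proof -
  have "card zero_index = card (Sigma {1..m} (\<lambda>i. {..degree (P i)})) + card ({0::nat} \<times> {..<n_pos})"
    unfolding zero_index_def by (rule card_Un_disjoint) auto
  then show ?thesis by (simp add: me_degree_def sum_Suc)
qed

lemma reference_factored: "growth_poly z * pole_poly z = (of_real lead * (1 + z) ^ n_neg) * (\<Prod>w\<in>zero_index. zero_of w - z)"
proof -
  have "(\<Prod>w\<in>zero_index. zero_of w - z) = (\<Prod>w\<in>Sigma {1..m} (\<lambda>i. {..degree (P i)}). zero_of w - z) * (\<Prod>w\<in>{0} \<times> {..<n_pos}. zero_of w - z)"
    unfolding zero_index_def by (rule prod.union_disjoint) auto
  also have "(\<Prod>w\<in>Sigma {1..m} (\<lambda>i. {..degree (P i)}). zero_of w - z) = (\<Prod>i=1..m. \<Prod>l\<le>degree (P i). zero_of (i, l) - z)"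
    by (subst prod.Sigma) (auto simp: case_prod_beta')
  also have "\<dots> = pole_poly z" unfolding pole_poly_def by (intro prod.cong refl) (auto simp: zero_of_def)
  also have "(\<Prod>w\<in>{0::nat} \<times> {..<n_pos}. zero_of w - z) = (\<Prod>w\<in>{0::nat} \<times> {..<n_pos}. 1 - z)"
    by (intro prod.cong) (auto simp: zero_of_def)
  also have "\<dots> = (1 - z) ^ n_pos" by (simp add: card_cartesian_product)
  finally show ?thesis by (simp add: growth_poly_def mult_ac)
qed

lemma zero_of_Re: "w \<in> zero_index \<Longrightarrow> 0 < Re (zero_of w)"
  using Re_c(1) by (auto simp: zero_index_def zero_of_def)

text \<open>A Rouche-type comparison. On the boundary of a large rectangle in the right half-plane the
  quotient of \<open>cleared\<close> and the explicit function \<open>growth_poly * pole_poly\<close>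
  avoids the closed negative real axis, on the left side because both \<open>s - k\<close> and
  \<open>growth_poly\<close> have positive real part and elsewhere because the quotient is near 1. So
  the quotient has a logarithm there and both functions have equally many zeros inside.\<close>

lemma root_count:
  assumes s: "0 < s"
  shows "finite {z. 0 < Re z \<and> cleared s z = 0}"
    and "(\<Sum>z\<in>{z. 0 < Re z \<and> cleared s z = 0}. nat (zorder (cleared s) z)) = me_degree m P + n_pos"
proof -
  let ?A = "{z. 0 < Re z}"
  let ?F = "cleared s"
  define H where "H z = growth_poly z * pole_poly z" for z
  obtain e where e: "e > 0" "e < 1" "e < Re (c 1)" and near: "\<And>z. 0 \<le> Re z \<Longrightarrow> Re z \<le> e \<Longrightarrow> 0 < Re (of_real s - cumul z)"
    using near_bound[OF s] by blast
  obtain R0 where R0: "R0 > 0" "\<And>i. i \<in> {1..m} \<Longrightarrow> norm (c i) < R0"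
    and far: "\<And>z. 0 \<le> Re z \<Longrightarrow> R0 \<le> norm z \<Longrightarrow> norm ((of_real s - cumul z) / growth_poly z - 1) < 1"
    using far_bound[of s] by blast
  define R where "R = R0 + 2"
  define Z where "Z = {z. 0 < Re z \<and> ?F z = 0}"
  have good: "z \<notin> c ` {1..m} \<and> ?F z \<noteq> 0 \<and> growth_poly z \<noteq> 0 \<and> (of_real s - cumul z) / growth_poly z \<notin> \<real>\<^sub>\<le>\<^sub>0"
    if z: "0 \<le> Re z" "Re z \<le> e \<or> R0 \<le> norm z" for z
  proof -
    have nc: "z \<notin> c ` {1..m}"
    proof
      assume "z \<in> c ` {1..m}"
      then obtain i where i: "i \<in> {1..m}" "z = c i" by blast
      show False using z(2) R0(2)[OF i(1)] Re_c(2)[OF i(1)] e i(2) by auto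
    qed
    have q: "(of_real s - cumul z) / growth_poly z \<notin> \<real>\<^sub>\<le>\<^sub>0"
    proof
      assume n: "(of_real s - cumul z) / growth_poly z \<in> \<real>\<^sub>\<le>\<^sub>0"
      then obtain t where t: "t \<le> 0" "(of_real s - cumul z) / growth_poly z = of_real t"
        by (auto elim: nonpos_Reals_cases)
      from z(2) show False
      proof
        assume le: "Re z \<le> e"
        have p: "0 < Re (of_real s - cumul z)" "0 < Re (growth_poly z)" using near[OF z(1) le] Re_growth_poly_pos[OF z(1)] le e by auto
        then have "growth_poly z \<noteq> 0" by auto
        then have "of_real s - cumul z = of_real t * growth_poly z" using t(2) by (simp add: field_simps)
        then have "Re (of_real s - cumul z) = t * Re (growth_poly z)" by simp
        then show False using p t(1) mult_nonpos_nonneg[of t "Re (growth_poly z)"] by linarith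
      next
        assume "R0 \<le> norm z"
        then have "norm (complex_of_real t - 1) < 1" using far[OF z(1)] t(2) by simp
        then have "\<bar>t - 1\<bar> < 1" by (metis norm_of_real of_real_1 of_real_diff)
        then show False using t(1) by simp
      qed
    qed
    then have "of_real s - cumul z \<noteq> 0" "growth_poly z \<noteq> 0" by auto
    then show ?thesis using q nc pole_poly_nz[OF nc] by (simp add: cleared_eq)
  qed
  have Zsub: "Z \<subseteq> {z. e < Re z \<and> norm z < R0}"
  proof
    fix z assume "z \<in> Z"
    then have "0 \<le> Re z" "?F z = 0" by (auto simp: Z_def)
    then show "z \<in> {z. e < Re z \<and> norm z < R0}"
      using good[of z] by (cases "Re z \<le> e \<or> R0 \<le> norm z") auto
  qed
  show finZ: "finite Z"
  proof (cases "?F constant_on ?A")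
    case True
    then have "?F z = ?F (c 1)" if "0 < Re z" for z
      using that c_in[of 1] me'(3) unfolding constant_on_def by auto
    then have "Z = {}" unfolding Z_def using cleared_at_pole[of 1 s] me'(3) by auto
    then show ?thesis by simp
  next
    case False
    let ?K = "{z. e \<le> Re z} \<inter> cball 0 R0"
    have "finite {z\<in>?K. ?F z = 0}"
    proof (rule holomorphic_compact_finite_zeros[OF cleared_holo open_A conn_A _ _ False])
      show "compact ?K" by (intro closed_Int_compact closed_halfspace_Re_ge compact_cball)
      show "?K \<subseteq> ?A" using e by auto
    qed
    then show ?thesis by (rule rev_finite_subset) (use Zsub in \<open>auto simp: Z_def\<close>)
  qed
  (* All zeros lie to the right of Re z = e and inside the disc of radius R0. The margin 2 makes room
     for the zero at 1 of the comparison function. *)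
  define \<gamma> where "\<gamma> = rectpath (Complex e (- R)) (Complex R R)"
  have le: "e \<le> R" "- R \<le> R" using e R0 unfolding R_def by auto
  have img: "path_image \<gamma> = cbox (Complex e (- R)) (Complex R R) - box (Complex e (- R)) (Complex R R)"
    unfolding \<gamma>_def by (rule path_image_rectpath_cbox_minus_box) (use le in auto)
  have onpath: "e \<le> Re z \<and> (Re z \<le> e \<or> R0 \<le> norm z)" if "z \<in> path_image \<gamma>" for z
  proof -
    have b: "e \<le> Re z" "Re z \<le> R" "- R \<le> Im z" "Im z \<le> R" using that unfolding img by (auto simp: in_cbox_complex_iff)
    have "Re z = e \<or> Re z = R \<or> Im z = - R \<or> Im z = R"
      using that b unfolding img by (auto simp: in_box_complex_iff)
    then have "Re z \<le> e \<or> R \<le> \<bar>Re z\<bar> \<or> R \<le> \<bar>Im z\<bar>" by auto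
    then show ?thesis using b(1) abs_Re_le_cmod[of z] abs_Im_le_cmod[of z] unfolding R_def by linarith
  qed
  have inside: "z \<in> box (Complex e (- R)) (Complex R R)" if "e < Re z" "norm z < R0 + 2" for z
    using that abs_Re_le_cmod[of z] abs_Im_le_cmod[of z] unfolding R_def by (auto simp: in_box_complex_iff)
  have vp: "valid_path \<gamma>" "pathfinish \<gamma> = pathstart \<gamma>" unfolding \<gamma>_def by auto
  have wn1: "winding_number \<gamma> z = 1" if "e < Re z" "norm z < R0 + 2" for z
    unfolding \<gamma>_def by (rule winding_number_rectpath[OF inside[OF that]])
  have wn0: "\<forall>z. z \<notin> ?A \<longrightarrow> winding_number \<gamma> z = 0"
  proof (intro allI impI)
    fix z assume "z \<notin> ?A"
    then show "winding_number \<gamma> z = 0"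
      unfolding \<gamma>_def by (intro winding_number_rectpath_outside) (use le e in \<open>auto simp: in_cbox_complex_iff\<close>)
  qed
  have Hholo: "H holomorphic_on S" for S
    unfolding H_def growth_poly_def by (intro holomorphic_intros pole_poly_holo)
  define ZH where "ZH = {w \<in> ?A. H w = 0}"
  have H_eq: "H z = (of_real lead * (1 + z) ^ n_neg) * (\<Prod>w\<in>zero_index. zero_of w - z)" for z
    unfolding H_def by (rule reference_factored)
  have lead_nz: "of_real lead * (1 + z) ^ n_neg \<noteq> 0" if "0 < Re z" for z :: complex
  proof -
    have "1 + z \<noteq> 0" using that by (auto simp: complex_eq_iff)
    then show ?thesis using lead_pos by simp
  qed
  have ZH_eq: "ZH = zero_of ` zero_index"
  proof -
    have "H z = 0 \<longleftrightarrow> z \<in> zero_of ` zero_index" if "0 < Re z" for z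
      unfolding H_eq using lead_nz[OF that] finite_zero_index by (auto simp: prod_zero_iff)
    then show ?thesis unfolding ZH_def using zero_of_Re by auto
  qed
  have ZH_in: "e < Re z \<and> norm z < R0 + 2" if "z \<in> ZH" for z
  proof -
    have "z \<in> zero_of ` zero_index" using that ZH_eq by simp
    then obtain w where w: "w \<in> zero_index" "z = zero_of w" by blast
    show ?thesis
    proof (cases "fst w = 0")
      case True
      then show ?thesis using w e R0(1) by (simp add: zero_of_def)
    next
      case False
      then have "fst w \<in> {1..m}" "z = c (fst w)" using w by (auto simp: zero_index_def zero_of_def)
      then show ?thesis using R0(2)[of "fst w"] Re_c(2)[of "fst w"] e by simp
    qed
  qed
  have onp: "0 < Re z \<and> z \<notin> c ` {1..m} \<and> ?F z \<noteq> 0 \<and> H z \<noteq> 0" if "z \<in> path_image \<gamma>" for z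
    using good[of z] onpath[OF that] e pole_poly_nz[of z] by (simp add: H_def)
  then have pathA: "path_image \<gamma> \<subseteq> ?A" by blast
  have AF: "contour_integral \<gamma> (\<lambda>x. deriv ?F x * 1 / ?F x) = 2 * pi * \<i> * (\<Sum>p\<in>Z. winding_number \<gamma> p * 1 * zorder ?F p)"
  proof -
    have Zeq: "Z = {w \<in> ?A. ?F w = 0 \<or> w \<in> {}}" unfolding Z_def by auto
    show ?thesis unfolding Zeq
    proof (rule argument_principle[OF open_A conn_A _ _ vp _ wn0])
      show "path_image \<gamma> \<subseteq> ?A - {w \<in> ?A. ?F w = 0 \<or> w \<in> {}}" using onp by blast
      show "finite {w \<in> ?A. ?F w = 0 \<or> w \<in> {}}" using finZ Zeq by simp
    qed (auto intro: cleared_holo)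
  qed
  have AH: "contour_integral \<gamma> (\<lambda>x. deriv H x * 1 / H x) = 2 * pi * \<i> * (\<Sum>p\<in>ZH. winding_number \<gamma> p * 1 * zorder H p)"
  proof -
    have Zeq: "ZH = {w \<in> ?A. H w = 0 \<or> w \<in> {}}" unfolding ZH_def by auto
    show ?thesis unfolding Zeq
    proof (rule argument_principle[OF open_A conn_A _ _ vp _ wn0])
      show "path_image \<gamma> \<subseteq> ?A - {w \<in> ?A. H w = 0 \<or> w \<in> {}}"
        using onp by blast
      show "finite {w \<in> ?A. H w = 0 \<or> w \<in> {}}" using finite_zero_index ZH_eq Zeq by simp
    qed (auto intro: Hholo)
  qed
  (* On this neighbourhood of the path the logarithm of the quotient is a primitive of the difference of
     the logarithmic derivatives. *)
  define V where "V = {z \<in> {z \<in> ?A. H z \<noteq> 0}. ?F z / H z \<in> - \<real>\<^sub>\<le>\<^sub>0}"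
  have pathV: "path_image \<gamma> \<subseteq> V"
  proof
    fix z assume z: "z \<in> path_image \<gamma>"
    then have g: "z \<notin> c ` {1..m}" "?F z \<noteq> 0" "growth_poly z \<noteq> 0" "(of_real s - cumul z) / growth_poly z \<notin> \<real>\<^sub>\<le>\<^sub>0"
      using good[of z] onpath[OF z] e by auto
    have "?F z / H z = (of_real s - cumul z) / growth_poly z"
      using g pole_poly_nz[OF g(1)] by (simp add: H_def cleared_eq)
    then show "z \<in> V" using g pathA z pole_poly_nz[OF g(1)] by (auto simp: V_def H_def)
  qed
  have Vprop: "0 < Re z \<and> H z \<noteq> 0 \<and> ?F z \<noteq> 0 \<and> ?F z / H z \<notin> \<real>\<^sub>\<le>\<^sub>0" if "z \<in> V" for z
    using that unfolding V_def by auto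
  have openV: "open V"
  proof -
    have o1: "open {z \<in> ?A. H z \<noteq> 0}"
    proof -
      have "open (?A \<inter> H -` (- {0}))"
        by (rule continuous_open_preimage[OF holomorphic_on_imp_continuous_on[OF Hholo] open_A]) auto
      moreover have "{z \<in> ?A. H z \<noteq> 0} = ?A \<inter> H -` (- {0})" by auto
      ultimately show ?thesis by simp
    qed
    have "continuous_on {z \<in> ?A. H z \<noteq> 0} (\<lambda>z. ?F z / H z)"
      by (intro continuous_on_divide holomorphic_on_imp_continuous_on Hholo holomorphic_on_subset[OF cleared_holo]) auto
    from continuous_open_preimage[OF this o1, of "- \<real>\<^sub>\<le>\<^sub>0"]
    have "open ({z \<in> ?A. H z \<noteq> 0} \<inter> (\<lambda>z. ?F z / H z) -` (- \<real>\<^sub>\<le>\<^sub>0))" by (simp add: open_Compl)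
    moreover have "V = {z \<in> ?A. H z \<noteq> 0} \<inter> (\<lambda>z. ?F z / H z) -` (- \<real>\<^sub>\<le>\<^sub>0)" unfolding V_def by auto
    ultimately show ?thesis by simp
  qed
  have VA: "V \<subseteq> ?A" using Vprop by auto
  have FV: "?F holomorphic_on V" by (rule holomorphic_on_subset[OF cleared_holo VA])
  have "((\<lambda>x. deriv ?F x / ?F x - deriv H x / H x) has_contour_integral
      (Ln (?F (pathfinish \<gamma>) / H (pathfinish \<gamma>)) - Ln (?F (pathstart \<gamma>) / H (pathstart \<gamma>)))) \<gamma>"
  proof (rule contour_integral_primitive[OF _ vp(1) pathV])
    fix z assume z: "z \<in> V"
    have dF: "(?F has_field_derivative deriv ?F z) (at z)" by (rule holomorphic_derivI[OF FV openV z])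
    have dH: "(H has_field_derivative deriv H z) (at z)" by (rule holomorphic_derivI[OF Hholo openV z])
    have "((\<lambda>z. Ln (?F z / H z)) has_field_derivative
       (inverse (?F z / H z) * ((deriv ?F z * H z - ?F z * deriv H z) / (H z * H z)))) (at z)"
      by (rule DERIV_chain2[OF has_field_derivative_Ln DERIV_divide[OF dF dH]]) (use Vprop[OF z] in auto)
    moreover have "inverse (?F z / H z) * ((deriv ?F z * H z - ?F z * deriv H z) / (H z * H z)) = deriv ?F z / ?F z - deriv H z / H z"
      using Vprop[OF z] by (simp add: field_simps)
    ultimately show "((\<lambda>z. Ln (?F z / H z)) has_field_derivative deriv ?F z / ?F z - deriv H z / H z) (at z within V)"
      by (simp add: has_field_derivative_at_within)
  qed
  then have "contour_integral \<gamma> (\<lambda>x. deriv ?F x / ?F x - deriv H x / H x) = 0"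
    using contour_integral_unique vp(2) by force
  moreover have "contour_integral \<gamma> (\<lambda>x. deriv ?F x / ?F x - deriv H x / H x)
     = contour_integral \<gamma> (\<lambda>x. deriv ?F x / ?F x) - contour_integral \<gamma> (\<lambda>x. deriv H x / H x)"
  proof (rule contour_integral_diff)
    show "(\<lambda>x. deriv ?F x / ?F x) contour_integrable_on \<gamma>"
      by (rule contour_integrable_holomorphic_simple[OF _ openV vp(1) pathV])
         (use Vprop in \<open>auto intro!: holomorphic_on_divide holomorphic_deriv FV openV\<close>)
    show "(\<lambda>x. deriv H x / H x) contour_integrable_on \<gamma>"
      by (rule contour_integrable_holomorphic_simple[OF _ openV vp(1) pathV])
         (use Vprop in \<open>auto intro!: holomorphic_on_divide holomorphic_deriv Hholo openV\<close>)
  qed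
  ultimately have "(\<Sum>p\<in>Z. winding_number \<gamma> p * 1 * zorder ?F p) = (\<Sum>p\<in>ZH. winding_number \<gamma> p * 1 * zorder H p)"
    using AF AH by simp
  moreover have "(\<Sum>p\<in>Z. winding_number \<gamma> p * 1 * zorder ?F p) = of_int (\<Sum>p\<in>Z. zorder ?F p)"
    using wn1 Zsub by (subst of_int_sum) (intro sum.cong, auto)
  moreover have "(\<Sum>p\<in>ZH. winding_number \<gamma> p * 1 * zorder H p) = of_int (\<Sum>p\<in>ZH. zorder H p)"
    using wn1 ZH_in by (subst of_int_sum) (intro sum.cong, auto)
  ultimately have eq: "(\<Sum>p\<in>Z. zorder ?F p) = (\<Sum>p\<in>ZH. zorder H p)"
    by (metis of_int_eq_iff)
  have "(\<Sum>p\<in>ZH. zorder H p) = (\<Sum>p\<in>ZH. int (card {w\<in>zero_index. zero_of w = p}))"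
  proof (intro sum.cong refl)
    fix p assume "p \<in> ZH"
    then have p: "p \<in> ?A" unfolding ZH_def by simp
    show "zorder H p = int (card {w\<in>zero_index. zero_of w = p})"
      by (rule zorder_factored[OF open_A p _ _ finite_zero_index H_eq])
         (use p lead_nz[of p] in \<open>auto intro!: holomorphic_intros\<close>)
  qed
  also have "\<dots> = int (\<Sum>p\<in>ZH. card {w\<in>zero_index. zero_of w = p})" by simp
  also have "(\<Sum>p\<in>ZH. card {w\<in>zero_index. zero_of w = p}) = card zero_index"
    unfolding ZH_eq card_eq_sum sum.image_gen[OF finite_zero_index, of "\<lambda>_. 1" zero_of] ..
  finally have total: "(\<Sum>p\<in>Z. zorder ?F p) = int (me_degree m P + n_pos)"
    unfolding eq card_zero_index .
  have "zorder ?F p \<ge> 0" if "p \<in> Z" for p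
  proof (rule zorder_ge_0)
    have p: "0 < Re p" using that by (simp add: Z_def)
    then show "?F analytic_on {p}" using cleared_holo open_A analytic_at by blast
    show "\<exists>\<^sub>F z in at p. ?F z \<noteq> 0" using cleared_ev_nz[OF p] by (simp add: eventually_frequently)
  qed
  then have "int (\<Sum>p\<in>Z. nat (zorder ?F p)) = (\<Sum>p\<in>Z. zorder ?F p)" by simp
  then show "(\<Sum>z\<in>Z. nat (zorder ?F z)) = me_degree m P + n_pos" using total by linarith
qed

end

section \<open>The Wiener-Hopf quotient\<close>

context me_cumulant
begin

lemma lists_roots_exist:
  assumes s: "0 < s" and K: "\<And>w. 0 < Re w \<Longrightarrow> K w = cumul_ext w"
  shows "\<exists>r. lists_roots 1 K s (me_degree m P + n_pos) r"
proof -
  let ?Z = "{z. 0 < Re z \<and> cleared s z = 0}" and ?N = "me_degree m P + n_pos"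
  obtain r where r: "\<forall>i\<in>{1..?N}. r i \<in> ?Z" "\<forall>z\<in>?Z. card {i\<in>{1..?N}. r i = z} = nat (zorder (cleared s) z)"
    using list_with_multiplicities[OF root_count[OF s]] by blast
  have "lists_roots 1 K s ?N r"
    unfolding lists_roots_def
  proof (intro conjI ballI allI impI)
    show "0 < Re (r i)" if "i \<in> {1..?N}" for i using r(1) that by blast
    fix z assume "0 < 1 * Re z"
    then have z: "0 < Re z" by simp
    show "card {i \<in> {1..?N}. of_real 1 * r i = z} = solution_mult K s z"
    proof (cases "cleared s z = 0")
      case True
      then show ?thesis using r(2) z by (simp add: solution_mult_cleared[OF s z K])
    next
      case False
      then have "{i \<in> {1..?N}. r i = z} = {}" using r(1) by auto
      then show ?thesis using False by (simp add: solution_mult_cleared[OF s z K])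
    qed
  qed
  then show ?thesis by blast
qed

text \<open>The list of roots matches the zeros of \<open>cleared\<close>, so they can be divided
  out.\<close>

lemma cleared_factor:
  assumes s: "0 < s" and K: "\<And>w. 0 < Re w \<Longrightarrow> K w = cumul_ext w" and r: "lists_roots 1 K s N r"
  obtains E where "E holomorphic_on {z. 0 < Re z}" "\<And>z. 0 < Re z \<Longrightarrow> E z \<noteq> 0"
    "\<And>z. 0 < Re z \<Longrightarrow> cleared s z = E z * (\<Prod>i=1..N. r i - z)"
proof -
  have c1: "c 1 \<in> {z. 0 < Re z}" "cleared s (c 1) \<noteq> 0" using c_in[of 1] cleared_at_pole[of 1 s] me'(3) by auto
  have "card {i \<in> {1..N}. r i = p} = (if cleared s p = 0 then nat (zorder (cleared s) p) else 0)"
    if "p \<in> {z. 0 < Re z}" for p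
  proof -
    have p: "0 < Re p" using that by simp
    then have "card {i \<in> {1..N}. r i = p} = solution_mult K s p"
      using r unfolding lists_roots_def by simp
    then show ?thesis using solution_mult_cleared[OF s p K] by simp
  qed
  from divide_out_zeros[OF open_A conn_A cleared_holo c1 _ this]
  obtain E where E: "E holomorphic_on {z. 0 < Re z}" "\<And>p. p \<in> {z. 0 < Re z} \<Longrightarrow> E p \<noteq> 0"
      "\<And>p. p \<in> {z. 0 < Re z} \<Longrightarrow> cleared s p = E p * (\<Prod>i=1..N. r i - p)"
    by (metis finite_atLeastAtMost)
  show thesis by (rule that[OF E(1)]) (use E in auto)
qed

text \<open>On the imaginary axis the real part of \<open>s - k\<close> is at least
  \<open>s\<close>.\<close>

lemma cumul_imag_neq: "0 < s \<Longrightarrow> Re z = 0 \<Longrightarrow> of_real s - cumul z \<noteq> 0"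
  using near_bound[of s] by (metis less_irrefl order_less_imp_le order_refl zero_complex.sel(1))

lemma prod_ratio_right_inf:
  fixes r r' :: "nat \<Rightarrow> complex"
  shows "((\<lambda>z. (\<Prod>i=1..N. r' i - z) / (\<Prod>i=1..N. r i - z)) \<longlongrightarrow> 1) right_inf"
proof -
  have l: "((\<lambda>z. (r' i - z) / (r i - z)) \<longlongrightarrow> 1) right_inf" for i
  proof -
    have nz: "\<forall>\<^sub>F z in right_inf. z \<noteq> 0"
      by (rule filter_leD[OF inf_le1]) (simp add: eventually_not_equal_at_infinity)
    have "((\<lambda>z. (r' i * (1 / z) - 1) / (r i * (1 / z) - 1)) \<longlongrightarrow> (r' i * 0 - 1) / (r i * 0 - 1)) right_inf"
      by (intro tendsto_intros inv_right_inf) auto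
    moreover have "\<forall>\<^sub>F z in right_inf. (r' i * (1 / z) - 1) / (r i * (1 / z) - 1) = (r' i - z) / (r i - z)"
      using nz
    proof eventually_elim
      case (elim z)
      have "r' i * (1 / z) - 1 = (r' i - z) / z" "r i * (1 / z) - 1 = (r i - z) / z" using elim by (auto simp: field_simps)
      then show ?case using elim by simp
    qed
    ultimately show ?thesis using Lim_transform_eventually by fastforce
  qed
  have "((\<lambda>z. \<Prod>i=1..N. (r' i - z) / (r i - z)) \<longlongrightarrow> (\<Prod>i=1..N. 1)) right_inf"
    by (intro tendsto_prod l)
  then show ?thesis by (simp add: prod_dividef)
qed

lemma ev_right_inf_nonzero: "\<forall>\<^sub>F z in right_inf. (\<Prod>i=1..N. r i - z) \<noteq> 0" for r :: "nat \<Rightarrow> complex"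
proof -
  have "\<forall>\<^sub>F z in at_infinity. r i \<noteq> z" for i
    using eventually_not_equal_at_infinity[of "r i"] by (simp add: eq_commute)
  then have "\<forall>\<^sub>F z in right_inf. r i \<noteq> z" for i by (rule filter_leD[OF inf_le1])
  then have "\<forall>\<^sub>F z in right_inf. \<forall>i\<in>{1..N}. r i \<noteq> z" by (intro eventually_ball_finite) auto
  then show ?thesis by eventually_elim (auto simp: prod_zero_iff)
qed

text \<open>In the open half-plane the quotient equals that of the two zero-free factors. It tends to 1
  at infinity, since numerator and denominator grow alike, hence it is bounded.\<close>

lemma transfer_function:
  assumes p: "0 < p" and q: "0 < q" and K: "\<And>w. 0 < Re w \<Longrightarrow> K w = cumul_ext w"
    and r: "lists_roots 1 K p N r" and r': "lists_roots 1 K q N r'"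
  obtains T C where "continuous_on {z. 0 \<le> Re z} T" "T holomorphic_on {z. 0 < Re z}"
    "\<And>z. 0 \<le> Re z \<Longrightarrow> norm (T z) \<le> C"
    "\<And>z. Re z = 0 \<Longrightarrow> T z = (of_real p - cumul z) / (of_real q - cumul z) *
          ((\<Prod>i=1..N. r' i - z) / (\<Prod>i=1..N. r i - z))"
proof -
  let ?Q = "\<lambda>r z. \<Prod>i=1..N. r i - z"
  obtain Ep where Ep: "Ep holomorphic_on {z. 0 < Re z}" "\<And>z. 0 < Re z \<Longrightarrow> Ep z \<noteq> 0"
    "\<And>z. 0 < Re z \<Longrightarrow> cleared p z = Ep z * ?Q r z"
    using cleared_factor[OF p K r] by blast
  obtain Eq where Eq: "Eq holomorphic_on {z. 0 < Re z}" "\<And>z. 0 < Re z \<Longrightarrow> Eq z \<noteq> 0"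
    "\<And>z. 0 < Re z \<Longrightarrow> cleared q z = Eq z * ?Q r' z"
    using cleared_factor[OF q K r'] by blast
  define f where "f z = (cleared p z / cleared q z) * (?Q r' z / ?Q r z)" for z
  define T where "T z = (if ?Q r z \<noteq> 0 \<and> cleared q z \<noteq> 0 then f z else Ep z / Eq z)" for z
  have Tpos: "T z = Ep z / Eq z" if z: "0 < Re z" for z
    using z Ep(3)[OF z] Eq(3)[OF z] unfolding T_def f_def by auto
  have nc: "z \<notin> c ` {1..m}" if "Re z = 0" for z
    by (rule strip_not_c) (use that me'(7) in simp)
  have nz0: "?Q r z \<noteq> 0" "cleared q z \<noteq> 0" if z: "Re z = 0" for z
  proof -
    have "r i - z \<noteq> 0" if "i \<in> {1..N}" for i
    proof -
      have "0 < Re (r i)" using r that unfolding lists_roots_def by blast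
      then show ?thesis using z by auto
    qed
    then show "?Q r z \<noteq> 0" by (subst prod_zero_iff) auto
    show "cleared q z \<noteq> 0"
      using cumul_imag_neq[OF q z] pole_poly_nz[OF nc[OF z]] by (simp add: cleared_eq[OF nc[OF z]])
  qed
  let ?H = "{z. 0 \<le> Re z}" and ?A = "{z. 0 < Re z}"
  have holo: "T holomorphic_on ?A"
    by (rule holomorphic_transform[OF holomorphic_on_divide[OF Ep(1) Eq(1)]]) (use Eq(2) Tpos in auto)
  have contF: "continuous_on ?H (?Q r)" "continuous_on ?H (?Q r')" by (intro continuous_intros)+
  have cont: "continuous_on ?H T"
    unfolding continuous_on_def
  proof
    fix z assume z: "z \<in> ?H"
    show "(T \<longlongrightarrow> T z) (at z within ?H)"
    proof (cases "0 < Re z")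
      case True
      have "T \<midarrow>z\<rightarrow> T z" by (rule holomorphic_tendsto[OF holo open_A]) (use True in simp)
      then show ?thesis by (rule tendsto_within_subset) simp
    next
      case False
      then have z0: "Re z = 0" using z by simp
      note nz = nz0[OF z0]
      have tQ: "(?Q r \<longlongrightarrow> ?Q r z) (at z within ?H)" "(?Q r' \<longlongrightarrow> ?Q r' z) (at z within ?H)"
        using contF z unfolding continuous_on_def by auto
      have tF: "(cleared s \<longlongrightarrow> cleared s z) (at z within ?H)" for s
        using cleared_cont z unfolding continuous_on_def by auto
      have "(f \<longlongrightarrow> f z) (at z within ?H)"
        unfolding f_def by (intro tendsto_mult tendsto_divide tQ tF nz)
      moreover have "f z = T z" using nz by (simp add: T_def)
      moreover have "\<forall>\<^sub>F w in at z within ?H. f w = T w"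
        using tendsto_imp_eventually_ne[OF tQ(1) nz(1)] tendsto_imp_eventually_ne[OF tF nz(2)]
        by eventually_elim (simp add: T_def)
      ultimately show ?thesis using Lim_transform_eventually by fastforce
    qed
  qed
  have "(T \<longlongrightarrow> 1) right_inf"
  proof -
    have "((\<lambda>z. ((of_real p - cumul z) / growth_poly z) / ((of_real q - cumul z) / growth_poly z) * (?Q r' z / ?Q r z)) \<longlongrightarrow> 1 / 1 * 1) right_inf"
      by (intro tendsto_mult tendsto_divide ratio_right_inf prod_ratio_right_inf) auto
    moreover have "\<forall>\<^sub>F z in right_inf. ((of_real p - cumul z) / growth_poly z) / ((of_real q - cumul z) / growth_poly z) * (?Q r' z / ?Q r z) = T z"
    proof -
      have "\<forall>\<^sub>F z in right_inf. (of_real q - cumul z) / growth_poly z \<noteq> 0"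
        by (rule tendsto_imp_eventually_ne[OF ratio_right_inf]) simp
      moreover have "\<forall>\<^sub>F z in right_inf. z \<notin> c ` {1..m}"
      proof -
        have "\<forall>\<^sub>F z in at_infinity. z \<noteq> c i" for i by (rule eventually_not_equal_at_infinity)
        then have "\<forall>\<^sub>F z in right_inf. z \<noteq> c i" for i by (rule filter_leD[OF inf_le1])
        then have "\<forall>\<^sub>F z in right_inf. \<forall>i\<in>{1..m}. z \<noteq> c i" by (intro eventually_ball_finite) auto
        then show ?thesis by eventually_elim auto
      qed
      ultimately show ?thesis using ev_right_inf_nonzero[of r N]
      proof eventually_elim
        case (elim z)
        have F: "cleared p z / cleared q z = (of_real p - cumul z) / (of_real q - cumul z)" "cleared q z \<noteq> 0"
          using elim pole_poly_nz[OF elim(2)] by (auto simp: cleared_eq[OF elim(2)])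
        then show ?case using elim by (auto simp: T_def f_def)
      qed
    qed
    ultimately show ?thesis using Lim_transform_eventually by fastforce
  qed
  then have "\<forall>\<^sub>F z in right_inf. dist (T z) 1 < 1" by (rule tendstoD) simp
  then obtain b where b: "\<And>z. b \<le> norm z \<Longrightarrow> 0 \<le> Re z \<Longrightarrow> dist (T z) 1 < 1"
    by (auto simp: eventually_inf_principal eventually_at_infinity)
  have "compact (?H \<inter> cball 0 b)" by (intro closed_Int_compact closed_halfspace_Re_ge compact_cball)
  then have "compact (T ` (?H \<inter> cball 0 b))"
    by (rule compact_continuous_image[rotated]) (rule continuous_on_subset[OF cont], auto)
  then obtain B where B: "\<And>z. z \<in> ?H \<inter> cball 0 b \<Longrightarrow> norm (T z) \<le> B"
    using compact_imp_bounded bounded_iff by (metis imageI)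
  show thesis
  proof (rule that[OF cont holo])
    fix z assume z: "0 \<le> Re z"
    show "norm (T z) \<le> max B 2"
    proof (cases "norm z \<le> b")
      case True
      then have "norm (T z) \<le> B" using B z by auto
      then show ?thesis by simp
    next
      case False
      then have "dist (T z) 1 < 1" using b z by simp
      then have "norm (T z) \<le> 2" using norm_triangle_ineq[of "T z - 1" 1] by (simp add: dist_norm)
      then show ?thesis by simp
    qed
  next
    fix z assume z: "Re z = 0"
    show "T z = (of_real p - cumul z) / (of_real q - cumul z) * (?Q r' z / ?Q r z)"
      using nz0[OF z] pole_poly_nz[OF nc[OF z]] by (simp add: T_def f_def cleared_eq[OF nc[OF z]])
  qed
qed

text \<open>The total mass \<open>T 0\<close> is read off at 0, where the cumulant vanishes.\<close>

lemma profile_equation: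
  assumes p: "0 < p" and q: "0 < q" and K: "\<And>w. 0 < Re w \<Longrightarrow> K w = cumul_ext w"
    and r: "lists_roots 1 K p N r" and r': "lists_roots 1 K q N r'" and N: "0 < N"
    and \<mu>: "real_distribution \<mu>"
    and char: "\<And>t. char \<mu> t = of_real q / (of_real q - cumulant a \<sigma> \<nu> (\<i> * of_real t))"
    and x0: "0 \<le> x0"
  shows "occ_profile N r r' x0 + of_real ((p - q) / q) *
       (CLINT y|\<mu>. indicator {..x0} y * occ_profile N r r' (x0 - y))
     = of_real (p / q) * (elem_sym N r' N / elem_sym N r N)"
proof -
  obtain T C where T: "continuous_on {z. 0 \<le> Re z} T" "T holomorphic_on {z. 0 < Re z}"
    "\<And>z. 0 \<le> Re z \<Longrightarrow> norm (T z) \<le> C"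
    "\<And>z. Re z = 0 \<Longrightarrow> T z = (of_real p - cumul z) / (of_real q - cumul z) *
          ((\<Prod>i=1..N. r' i - z) / (\<Prod>i=1..N. r i - z))"
    using transfer_function[OF p q K r r'] by blast
  have ck: "cumulant a \<sigma> \<nu> (\<i> * of_real t) = cumul (\<i> * of_real t)" for t
    by (rule cumulant_eq(1)) (use me'(7) in auto)
  have "occ_profile N r r' x0 + of_real ((p - q) / q) *
       (CLINT y|\<mu>. indicator {..x0} y * occ_profile N r r' (x0 - y)) = T 0"
  proof (rule occ_profile_equation[OF N _ \<mu> _ _ _ T(1,2,3) _ x0])
    show "0 < Re (r i)" if "i \<in> {1..N}" for i using r that unfolding lists_roots_def by blast
    show "q \<noteq> 0" using q by simp
    show "of_real q - cumul (\<i> * of_real t) \<noteq> 0" for t by (rule cumul_imag_neq[OF q]) simp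
    show "char \<mu> t = of_real q / (of_real q - cumul (\<i> * of_real t))" for t using char ck by simp
    show "T (\<i> * of_real t) = (of_real p - cumul (\<i> * of_real t)) / (of_real q - cumul (\<i> * of_real t)) *
          ((\<Prod>i=1..N. r' i - \<i> * of_real t) / (\<Prod>i=1..N. r i - \<i> * of_real t))" for t
      by (rule T(4)) simp
  qed
  also have "T 0 = of_real (p / q) * (elem_sym N r' N / elem_sym N r N)"
    by (simp add: T(4) cumul_0 elem_sym_top)
  finally show ?thesis .
qed

end

section \<open>Exponentials of occupation times along one path\<close>

lemma exp_taylor1: "0 \<le> x \<Longrightarrow> \<bar>exp x - 1 - x\<bar> \<le> x\<^sup>2 * exp (x::real)"
proof -
  assume x: "0 \<le> x"
  have "1 - x \<le> exp (- x)" using exp_ge_add_one_self[of "- x"] by simp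
  then have "exp x * (1 - x) \<le> exp x * exp (- x)" by (intro mult_left_mono) auto
  then have "exp x - 1 \<le> x * exp x" by (simp add: exp_minus algebra_simps)
  moreover have "x * (exp x - 1) \<le> x * (x * exp x)" using calculation x by (intro mult_left_mono) auto
  ultimately show ?thesis using exp_ge_add_one_self[of x] by (simp add: power2_eq_square algebra_simps)
qed

lemma set_integral_singleton_0: "(LINT x:{0..0}|lborel. f x) = 0" for f :: "real \<Rightarrow> real"
  unfolding set_lebesgue_integral_def
proof (rule integral_eq_zero_AE)
  show "AE x in lborel. indicator {0..0} x *\<^sub>R f x = 0"
    using AE_lborel_singleton[of 0] by eventually_elim (auto split: split_indicator)
qed

lemma set_integral_Icc_Ioc:
  fixes f :: "real \<Rightarrow> real"
  assumes "f \<in> borel_measurable borel"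
  shows "(LINT v:{a..b}|lborel. f v) = (LINT v:{a<..b}|lborel. f v)"
  unfolding set_lebesgue_integral_def
proof (rule integral_cong_AE)
  show "AE x in lborel. indicator {a..b} x *\<^sub>R f x = indicator {a<..b} x *\<^sub>R f x"
    using AE_lborel_singleton[of a] by eventually_elim (auto split: split_indicator)
qed (use assms in measurable)

lemma exp_density_integral: "0 < s \<Longrightarrow> integrable lborel (\<lambda>t. indicator {0..} t * (s * exp (- s * t)))"
    "0 < s \<Longrightarrow> (LINT t|lborel. indicator {0..} t * (s * exp (- s * t))) = 1" for s :: real
proof -
  assume s: "0 < s"
  interpret E: prob_space "density lborel (exponential_density s)" by (rule prob_space_exponential_density[OF s])
  have eq: "exponential_density s t = indicator {0..} t * (s * exp (- s * t))" for t
    by (simp add: exponential_density_def mult.commute)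
  have "(\<integral>\<^sup>+t. ennreal (exponential_density s t) \<partial>lborel) = 1"
    using E.emeasure_space_1 by (simp add: emeasure_density)
  then have "has_bochner_integral lborel (exponential_density s) 1"
    by (intro has_bochner_integral_nn_integral) (auto simp: exponential_density_nonneg s)
  then show "integrable lborel (\<lambda>t. indicator {0..} t * (s * exp (- s * t)))"
    "(LINT t|lborel. indicator {0..} t * (s * exp (- s * t))) = 1"
    unfolding eq by (auto simp: has_bochner_integral_iff)
qed

definition occ :: "(real \<Rightarrow> real) \<Rightarrow> real \<Rightarrow> real" where
  "occ h t = (LINT v:{0..t}|lborel. h v)"

text \<open>The expectation over an exponential time \<open>v\<close> of \<open>exp (- u A)\<close>,
  where \<open>A\<close> is the occupation accumulated between \<open>r\<close> and \<open>r +
  v\<close>. Here \<open>h\<close> is the indicator of the occupied times, relaxed to values between 0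
  and 1.\<close>

definition occ_lap :: "(real \<Rightarrow> real) \<Rightarrow> real \<Rightarrow> real \<Rightarrow> real \<Rightarrow> real" where
  "occ_lap h s u r = (LINT v|lborel. indicator {0..} v * (s * exp (- s * v)) * exp (- u * (occ h (r + v) - occ h r)))"

context
  fixes h :: "real \<Rightarrow> real"
  assumes hm[measurable]: "h \<in> borel_measurable borel" and h0: "\<And>x. 0 \<le> h x" and h1: "\<And>x. h x \<le> 1"
begin

lemma h_int: "g \<in> borel_measurable borel \<Longrightarrow> (\<And>x. x \<in> {a..b} \<Longrightarrow> \<bar>g x\<bar> \<le> C) \<Longrightarrow> set_integrable lborel {a<..b} (\<lambda>x. h x * g x)"
  unfolding set_integrable_def
proof (rule Bochner_Integration.integrable_bound[of _ "\<lambda>x. \<bar>C\<bar> * indicator {a..b} x"])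
  assume g: "g \<in> borel_measurable borel" "\<And>x. x \<in> {a..b} \<Longrightarrow> \<bar>g x\<bar> \<le> C"
  show "integrable lborel (\<lambda>x. \<bar>C\<bar> * indicator {a..b} x)"
    by (intro integrable_mult_right integrable_real_indicator) (auto simp: emeasure_lborel_Icc_eq)
  show "(\<lambda>x. indicator {a<..b} x *\<^sub>R (h x * g x)) \<in> borel_measurable lborel" using g(1) by measurable
  show "AE x in lborel. norm (indicator {a<..b} x *\<^sub>R (h x * g x)) \<le> norm (\<bar>C\<bar> * indicator {a..b} x)"
  proof (rule AE_I2)
    fix x
    show "norm (indicator {a<..b} x *\<^sub>R (h x * g x)) \<le> norm (\<bar>C\<bar> * indicator {a..b} x)"
    proof (cases "x \<in> {a<..b}")
      case True
      then have "\<bar>g x\<bar> \<le> C" using g(2)[of x] by auto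
      then have "\<bar>h x\<bar> * \<bar>g x\<bar> \<le> 1 * \<bar>C\<bar>" using h0[of x] h1[of x] by (intro mult_mono) auto
      then show ?thesis using True by (simp add: abs_mult)
    qed simp
  qed
qed

lemma split_integral:
  assumes g: "g \<in> borel_measurable borel" "\<And>x. x \<in> {0..t} \<Longrightarrow> \<bar>g x\<bar> \<le> C" and st: "0 \<le> s" "s \<le> t"
  shows "(LINT v:{0..t}|lborel. h v * g v) = (LINT v:{0..s}|lborel. h v * g v) + (LINT v:{s<..t}|lborel. h v * g v)"
proof -
  have [measurable]: "(\<lambda>v. h v * g v) \<in> borel_measurable borel" using g(1) by measurable
  have un: "{0<..t} = {0<..s} \<union> {s<..t}" using st by auto
  have i: "set_integrable lborel {0<..t} (\<lambda>x. h x * g x)" by (rule h_int[OF g])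
  have "(LINT v:{0<..t}|lborel. h v * g v) = (LINT v:{0<..s}|lborel. h v * g v) + (LINT v:{s<..t}|lborel. h v * g v)"
    unfolding un by (rule set_integral_Un) (use st in \<open>auto intro: set_integrable_subset[OF i]\<close>)
  then show ?thesis by (simp add: set_integral_Icc_Ioc)
qed

lemma occ_split: "0 \<le> s \<Longrightarrow> s \<le> t \<Longrightarrow> occ h t = occ h s + (LINT v:{s<..t}|lborel. h v)"
  using split_integral[of "\<lambda>_. 1" t 1 s] by (simp add: occ_def)

lemma Ioc_bounds:
  assumes g: "g \<in> borel_measurable borel" "\<And>x. x \<in> {s..t} \<Longrightarrow> 0 \<le> g x" "\<And>x. x \<in> {s..t} \<Longrightarrow> g x \<le> C" and st: "s \<le> t"
  shows "0 \<le> (LINT v:{s<..t}|lborel. h v * g v)" "(LINT v:{s<..t}|lborel. h v * g v) \<le> C * (t - s)"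
proof -
  have C: "0 \<le> C" using g(2,3)[of s] st by auto
  show "0 \<le> (LINT v:{s<..t}|lborel. h v * g v)"
    unfolding set_lebesgue_integral_def by (intro integral_nonneg_AE AE_I2) (auto simp: h0 g split: split_indicator)
  have "(LINT v:{s<..t}|lborel. h v * g v) \<le> (LINT v|lborel. C * indicator {s<..t} v)"
    unfolding set_lebesgue_integral_def
  proof (rule integral_mono)
    show "integrable lborel (\<lambda>v. indicator {s<..t} v *\<^sub>R (h v * g v))"
      using h_int[OF g(1), of s t C] g by (simp add: set_integrable_def)
    show "indicator {s<..t} v *\<^sub>R (h v * g v) \<le> C * indicator {s<..t} v" for v
      using mult_mono[OF h1[of v] g(3)[of v]] h0[of v] g(2)[of v] by (auto split: split_indicator)
    show "integrable lborel (\<lambda>v. C * indicator {s<..t} v)"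
      by (intro integrable_mult_right integrable_real_indicator) (auto simp: st)
  qed
  also have "\<dots> = C * (t - s)" using st by simp
  finally show "(LINT v:{s<..t}|lborel. h v * g v) \<le> C * (t - s)" .
qed

lemma occ_bounds: "0 \<le> s \<Longrightarrow> s \<le> t \<Longrightarrow> 0 \<le> occ h t - occ h s \<and> occ h t - occ h s \<le> t - s"
  using Ioc_bounds[of "\<lambda>_. 1" s t 1] occ_split[of s t] by simp

lemma occ_0: "occ h 0 = 0" unfolding occ_def by (rule set_integral_singleton_0)

lemma occ_measurable[measurable]: "occ h \<in> borel_measurable borel"
proof -
  have [measurable]: "h \<in> borel_measurable lborel" by simp
  have "occ h = (\<lambda>t. LINT v|lborel. (if 0 \<le> v \<and> v \<le> t then h v else 0))"
    unfolding occ_def set_lebesgue_integral_def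
    by (intro ext Bochner_Integration.integral_cong) (auto split: split_indicator)
  also have "\<dots> \<in> borel_measurable borel" by measurable
  finally show ?thesis .
qed

text \<open>The fundamental theorem of calculus for \<open>exp (u A)\<close>, where \<open>A\<close> is
  only Lipschitz. Rather than invoking absolute continuity, the difference of both sides is shown to
  have increments of quadratic order, so its derivative is zero everywhere.\<close>

lemma occ_exp_identity:
  assumes u: "0 \<le> u" and t: "0 \<le> t"
  shows "u * (LINT r:{0..t}|lborel. h r * exp (u * occ h r)) = exp (u * occ h t) - 1"
proof (cases "t = 0")
  case True
  have "(LINT r:{0..0}|lborel. h r * exp (u * occ h r)) = 0"
    by (rule set_integral_singleton_0)
  then show ?thesis using True occ_0 by simp
next
  case False
  then have t: "0 < t" using t by simp
  define B where "B x = (LINT r:{0..x}|lborel. h r * exp (u * occ h r))" for x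
  define \<Psi> where "\<Psi> x = exp (u * occ h x) - 1 - u * B x" for x
  define C where "C = exp (u * t) * u\<^sup>2 + exp (u * t) * u\<^sup>2"
  have oc: "0 \<le> occ h x \<and> occ h x \<le> t" if "0 \<le> x" "x \<le> t" for x
    using occ_bounds[of 0 x] that by (simp add: occ_0)
  have eb: "0 \<le> exp (u * occ h x)" "exp (u * occ h x) \<le> exp (u * t)" if "0 \<le> x" "x \<le> t" for x
    using oc[OF that] u by (auto intro: mult_left_mono)
  have bound: "\<bar>\<Psi> y - \<Psi> x\<bar> \<le> C * (y - x)\<^sup>2" if xy: "0 \<le> x" "x \<le> y" "y \<le> t" for x y
  proof -
    define d where "d = occ h y - occ h x"
    have d: "0 \<le> d" "d \<le> y - x" using occ_bounds[of x y] xy by (auto simp: d_def)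
    have e1: "exp (u * occ h y) - exp (u * occ h x) = exp (u * occ h x) * (exp (u * d) - 1)"
      by (simp add: d_def algebra_simps flip: exp_add)
    have e2: "B y - B x = (LINT v:{x<..y}|lborel. h v * exp (u * occ h v))"
      unfolding B_def by (subst split_integral[of _ y "exp (u * t)" x]) (use xy eb in auto)
    have e3: "(LINT v:{x<..y}|lborel. h v * exp (u * occ h v)) - exp (u * occ h x) * d
       = (LINT v:{x<..y}|lborel. h v * (exp (u * occ h v) - exp (u * occ h x)))"
    proof -
      have i1: "set_integrable lborel {x<..y} (\<lambda>v. h v * exp (u * occ h v))"
        by (rule h_int[of _ _ _ "exp (u * t)"]) (use xy eb in auto)
      have i2: "set_integrable lborel {x<..y} (\<lambda>v. h v * exp (u * occ h x))"
        by (rule h_int[of _ _ _ "exp (u * t)"]) (use xy eb[of x] in auto)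
      have "d = (LINT v:{x<..y}|lborel. h v)" unfolding d_def using occ_split[OF xy(1,2)] by simp
      then have dd: "exp (u * occ h x) * d = (LINT v:{x<..y}|lborel. h v * exp (u * occ h x))" by simp
      show ?thesis by (simp only: right_diff_distrib set_integral_diff(2)[OF i1 i2] dd)
    qed
    have mono: "0 \<le> exp (u * occ h v) - exp (u * occ h x) \<and> exp (u * occ h v) - exp (u * occ h x) \<le> exp (u * t) * u * (y - x)"
      if v: "v \<in> {x..y}" for v
    proof -
      define w where "w = u * (occ h v - occ h x)"
      have wv: "0 \<le> occ h v - occ h x" "occ h v - occ h x \<le> y - x" using occ_bounds[of x v] xy v by auto
      have w: "0 \<le> w" "w \<le> u * (y - x)" using wv u by (auto simp: w_def intro: mult_left_mono)
      have "exp (u * occ h v) = exp (u * occ h x) * exp w" by (simp add: w_def algebra_simps flip: exp_add)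
      moreover have "1 - w \<le> exp (- w)" using exp_ge_add_one_self[of "- w"] by simp
      then have "exp w * (1 - w) \<le> exp w * exp (- w)" by (intro mult_left_mono) auto
      then have "exp w - 1 \<le> exp w * w" by (simp add: exp_minus algebra_simps)
      then have "exp (u * occ h x) * (exp w - 1) \<le> exp (u * occ h x) * (exp w * w)" by (intro mult_left_mono) auto
      ultimately have "exp (u * occ h v) - exp (u * occ h x) \<le> exp (u * occ h v) * w" by (simp add: algebra_simps)
      also have "\<dots> \<le> exp (u * t) * (u * (y - x))" using eb[of v] v xy w by (intro mult_mono) auto
      finally show ?thesis using wv u by (auto simp: mult.assoc intro: mult_left_mono)
    qed
    have b3: "0 \<le> (LINT v:{x<..y}|lborel. h v * (exp (u * occ h v) - exp (u * occ h x)))"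
         "(LINT v:{x<..y}|lborel. h v * (exp (u * occ h v) - exp (u * occ h x))) \<le> exp (u * t) * u * (y - x) * (y - x)"
      using Ioc_bounds[of "\<lambda>v. exp (u * occ h v) - exp (u * occ h x)" x y "exp (u * t) * u * (y - x)"] mono xy by auto
    have b1: "\<bar>exp (u * occ h x) * (exp (u * d) - 1 - u * d)\<bar> \<le> exp (u * t) * (u\<^sup>2 * (y - x)\<^sup>2)"
    proof -
      have "\<bar>exp (u * d) - 1 - u * d\<bar> \<le> (u * d)\<^sup>2 * exp (u * d)" by (rule exp_taylor1) (use u d in auto)
      then have "\<bar>exp (u * occ h x) * (exp (u * d) - 1 - u * d)\<bar> \<le> exp (u * occ h x) * ((u * d)\<^sup>2 * exp (u * d))"
        by (simp add: abs_mult)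
      also have "\<dots> = exp (u * occ h y) * (u * d)\<^sup>2" by (simp add: d_def algebra_simps flip: exp_add)
      also have "\<dots> \<le> exp (u * t) * (u\<^sup>2 * (y - x)\<^sup>2)"
        unfolding power_mult_distrib using eb[of y] xy d u by (intro mult_mono power_mono) auto
      finally show ?thesis .
    qed
    have "\<Psi> y - \<Psi> x = exp (u * occ h x) * (exp (u * d) - 1 - u * d) - u * (LINT v:{x<..y}|lborel. h v * (exp (u * occ h v) - exp (u * occ h x)))"
      unfolding \<Psi>_def e3[symmetric] e2[symmetric] using e1 by (simp add: algebra_simps)
    then have "\<bar>\<Psi> y - \<Psi> x\<bar> \<le> \<bar>exp (u * occ h x) * (exp (u * d) - 1 - u * d)\<bar> + u * (LINT v:{x<..y}|lborel. h v * (exp (u * occ h v) - exp (u * occ h x)))"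
      using mult_nonneg_nonneg[OF u b3(1)] by linarith
    also have "\<dots> \<le> exp (u * t) * (u\<^sup>2 * (y - x)\<^sup>2) + u * (exp (u * t) * u * (y - x) * (y - x))"
      using b1 b3(2) u by (intro add_mono mult_left_mono) auto
    also have "\<dots> = C * (y - x)\<^sup>2" by (simp add: C_def power2_eq_square algebra_simps)
    finally show ?thesis .
  qed
  have bound': "\<bar>\<Psi> y - \<Psi> x\<bar> \<le> C * (y - x)\<^sup>2" if "x \<in> {0..t}" "y \<in> {0..t}" for x y
    using bound[of x y] bound[of y x] that by (cases "x \<le> y") (auto simp: abs_minus_commute power2_commute)
  have "\<Psi> t = \<Psi> 0"
  proof (rule has_field_derivative_zero_constant[of "{0..t}" \<Psi>, THEN exE])
    show "convex {0..t}" by simp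
    fix x assume x: "x \<in> {0..t}"
    show "(\<Psi> has_field_derivative 0) (at x within {0..t})"
      unfolding has_field_derivative_iff
    proof (rule Lim_null_comparison)
      show "((\<lambda>y. C * \<bar>y - x\<bar>) \<longlongrightarrow> 0) (at x within {0..t})"
        by (rule tendsto_eq_intros refl | simp)+
      show "\<forall>\<^sub>F y in at x within {0..t}. norm ((\<Psi> y - \<Psi> x) / (y - x)) \<le> C * \<bar>y - x\<bar>"
        unfolding eventually_at_filter
      proof (intro always_eventually allI impI)
        fix y assume y: "y \<noteq> x" "y \<in> {0..t}"
        have "\<bar>\<Psi> y - \<Psi> x\<bar> \<le> C * \<bar>y - x\<bar> * \<bar>y - x\<bar>"
          using bound'[OF x y(2)] by (simp add: power2_eq_square abs_mult_self_eq mult.assoc)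
        then show "norm ((\<Psi> y - \<Psi> x) / (y - x)) \<le> C * \<bar>y - x\<bar>" using y(1) by (simp add: divide_le_eq)
      qed
    qed
  next
    fix k assume "\<forall>x\<in>{0..t}. \<Psi> x = k"
    then show ?thesis using t by auto
  qed
  moreover have "B 0 = 0" unfolding B_def by (rule set_integral_singleton_0)
  then have "\<Psi> 0 = 0" by (simp add: \<Psi>_def occ_0)
  ultimately show ?thesis unfolding \<Psi>_def B_def by simp
qed

text \<open>The identity \<open>1 - exp (- u A\<^sub>t) = u \<integral>\<^sub>0\<^sup>t h\<^sub>r exp (-
  u (A\<^sub>t - A\<^sub>r)) dr\<close> is averaged over an exponential \<open>t\<close>; by Fubini and
  lack of memory the inner average is the same functional started at \<open>r\<close>.\<close>

lemma occ_lap_identity: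
  assumes s: "0 < s" and u: "0 < u"
  shows "occ_lap h s u 0 = 1 - u * (LINT r|lborel. indicator {0..} r * exp (- s * r) * (h r * occ_lap h s u r))"
proof -
  define I where "I t r = (if 0 \<le> r \<and> r \<le> t then s * exp (- s * t) * (h r * exp (- u * (occ h t - occ h r))) else 0)" for t r
  have [measurable]: "h \<in> borel_measurable lborel" "occ h \<in> borel_measurable lborel" by simp_all
  have [measurable]: "case_prod I \<in> borel_measurable (lborel \<Otimes>\<^sub>M lborel)"
    unfolding I_def by measurable
  have I0: "0 \<le> I t r" for t r using s h0 by (auto simp: I_def)
  have inner: "integrable lborel (I t)" "(LINT r|lborel. I t r) = indicator {0..} t * (s * exp (- s * t)) * ((1 - exp (- u * occ h t)) / u)" for t
  proof -
    have eq: "I t r = (s * exp (- s * t) * exp (- u * occ h t)) * (indicator {0..t} r *\<^sub>R (h r * exp (u * occ h r)))" for r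
      by (auto simp: I_def algebra_simps exp_diff exp_minus divide_simps split: split_indicator)
    have bnd: "\<bar>exp (u * occ h r)\<bar> \<le> exp (u * t)" if "r \<in> {0..t}" for r
      using occ_bounds[of 0 r] that u by (auto simp: occ_0)
    have "set_integrable lborel {0<..t} (\<lambda>r. h r * exp (u * occ h r))"
      by (rule h_int[where C = "exp (u * t)"]) (use bnd in auto)
    then have "set_integrable lborel {0..t} (\<lambda>r. h r * exp (u * occ h r))"
      unfolding set_integrable_def
    proof (rule integrable_cong_AE_imp)
      show "AE r in lborel. indicator {0<..t} r *\<^sub>R (h r * exp (u * occ h r)) = indicator {0..t} r *\<^sub>R (h r * exp (u * occ h r))"
        using AE_lborel_singleton[of 0] by eventually_elim (auto split: split_indicator)
    qed measurable
    then show "integrable lborel (I t)" unfolding eq[abs_def] set_integrable_def by (rule integrable_mult_right)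
    show "(LINT r|lborel. I t r) = indicator {0..} t * (s * exp (- s * t)) * ((1 - exp (- u * occ h t)) / u)"
    proof (cases "0 \<le> t")
      case True
      have "(LINT r|lborel. I t r) = (s * exp (- s * t) * exp (- u * occ h t)) * (LINT r:{0..t}|lborel. h r * exp (u * occ h r))"
        unfolding eq set_lebesgue_integral_def by (rule integral_mult_right_zero)
      also have "(LINT r:{0..t}|lborel. h r * exp (u * occ h r)) = (exp (u * occ h t) - 1) / u"
        using occ_exp_identity[of u t] u True by (simp add: field_simps)
      finally show ?thesis using True u by (simp add: exp_minus field_simps)
    next
      case False
      then have "I t = (\<lambda>r. 0)" by (auto simp: I_def)
      then show ?thesis using False by simp
    qed
  qed
  have occ_nn: "0 \<le> occ h t" if "0 \<le> t" for t using occ_bounds[of 0 t] that by (simp add: occ_0)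
  have i1: "integrable lborel (\<lambda>t. indicator {0..} t * (s * exp (- s * t)) * exp (- u * occ h t))"
  proof (rule Bochner_Integration.integrable_bound[OF exp_density_integral(1)[OF s]])
    show "AE x in lborel. norm (indicator {0..} x * (s * exp (- s * x)) * exp (- u * occ h x)) \<le> norm (indicator {0..} x * (s * exp (- s * x)))"
      using s u occ_nn by (auto intro!: AE_I2 simp: abs_mult mult_left_le split: split_indicator)
  qed measurable
  have pairint: "integrable (lborel \<Otimes>\<^sub>M lborel) (case_prod I)"
  proof (rule lborel_pair.Fubini_integrable)
    have "integrable lborel (\<lambda>t. (1 / u) * (indicator {0..} t * (s * exp (- s * t)) - indicator {0..} t * (s * exp (- s * t)) * exp (- u * occ h t)))"
      by (intro integrable_mult_right Bochner_Integration.integrable_diff exp_density_integral(1) s i1)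
    moreover have "(\<lambda>t. (1 / u) * (indicator {0..} t * (s * exp (- s * t)) - indicator {0..} t * (s * exp (- s * t)) * exp (- u * occ h t)))
      = (\<lambda>t. LINT r|lborel. norm (case_prod I (t, r)))"
      using I0 by (auto simp: inner(2) field_simps)
    ultimately show "integrable lborel (\<lambda>t. LINT r|lborel. norm (case_prod I (t, r)))" by simp
    show "AE t in lborel. integrable lborel (\<lambda>r. case_prod I (t, r))" using inner(1) by simp
  qed measurable
  have outer: "(LINT t|lborel. I t r) = indicator {0..} r * exp (- s * r) * (h r * occ_lap h s u r)" for r
  proof (cases "0 \<le> r")
    case True
    have "(LINT t|lborel. I t r) = (LINT v|lborel. I (r + v) r)"
      using lborel_integral_real_affine[of 1 "\<lambda>t. I t r" r] by simp
    also have "\<dots> = (LINT v|lborel. (exp (- s * r) * h r) * (indicator {0..} v * (s * exp (- s * v)) * exp (- u * (occ h (r + v) - occ h r))))"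
      using True by (intro Bochner_Integration.integral_cong) (auto simp: I_def algebra_simps exp_add exp_minus exp_diff divide_simps split: split_indicator)
    also have "\<dots> = (exp (- s * r) * h r) * occ_lap h s u r"
      unfolding occ_lap_def by (rule integral_mult_right_zero)
    finally show ?thesis using True by simp
  next
    case False
    then have "(\<lambda>t. I t r) = (\<lambda>t. 0)" by (auto simp: I_def)
    then show ?thesis using False by simp
  qed
  have "(LINT r|lborel. LINT t|lborel. I t r) = (LINT t|lborel. LINT r|lborel. I t r)"
    by (rule lborel_pair.Fubini_integral[OF pairint])
  then have "(LINT r|lborel. indicator {0..} r * exp (- s * r) * (h r * occ_lap h s u r))
     = (LINT t|lborel. indicator {0..} t * (s * exp (- s * t)) * ((1 - exp (- u * occ h t)) / u))"
    unfolding outer inner(2) .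
  also have "\<dots> = (LINT t|lborel. (1 / u) * (indicator {0..} t * (s * exp (- s * t)) - indicator {0..} t * (s * exp (- s * t)) * exp (- u * occ h t)))"
    by (intro Bochner_Integration.integral_cong refl) (simp add: algebra_simps diff_divide_distrib)
  also have "\<dots> = (1 / u) * (1 - occ_lap h s u 0)"
    unfolding integral_mult_right_zero
    by (subst Bochner_Integration.integral_diff[OF exp_density_integral(1)[OF s] i1])
       (simp only: exp_density_integral(2)[OF s], simp add: occ_lap_def occ_0)
  finally show ?thesis using u by (simp add: field_simps)
qed

end

section \<open>The Markov property of a Levy process at a fixed time\<close>

locale levy_path =
  fixes M :: "'a measure" and X :: "real \<Rightarrow> 'a \<Rightarrow> real"
  assumes lp: "levy_process M X"

sublocale levy_path \<subseteq> prob_space M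
  using lp by (simp add: levy_process_def)

context levy_path
begin

abbreviation Om :: "(real \<Rightarrow> real) measure" where "Om \<equiv> Pi\<^sub>M {0..} (\<lambda>_. borel)"

lemma X_meas[measurable]: "0 \<le> t \<Longrightarrow> X t \<in> borel_measurable M"
  and X0: "AE \<omega> in M. X 0 \<omega> = 0"
  and stat: "0 \<le> t \<Longrightarrow> 0 \<le> h \<Longrightarrow> distr M borel (\<lambda>\<omega>. X (t + h) \<omega> - X t \<omega>) = distr M borel (X h)"
  and rcont: "\<omega> \<in> space M \<Longrightarrow> 0 \<le> t \<Longrightarrow> continuous (at_right t) (\<lambda>t. X t \<omega>)"
  using lp unfolding levy_process_def by blast+

lemma indep_incr: "0 \<le> t 0 \<Longrightarrow> (\<And>i. i < n \<Longrightarrow> t i \<le> t (Suc i)) \<Longrightarrow>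
    indep_vars (\<lambda>_. borel) (\<lambda>i \<omega>. X (t (Suc i)) \<omega> - X (t i) \<omega>) {..<n}"
  using lp unfolding levy_process_def by blast

definition post_path :: "real \<Rightarrow> 'a \<Rightarrow> real \<Rightarrow> real" where
  "post_path r \<omega> = (\<lambda>t\<in>{0..}. X (r + t) \<omega> - X r \<omega>)"

lemma post_path_meas[measurable]: "0 \<le> r \<Longrightarrow> post_path r \<in> measurable M Om"
  unfolding post_path_def by (rule measurable_restrict) auto

text \<open>Stationarity and independence, with the increment over \<open>[0, r]\<close> as an
  additional independent increment before the others.\<close>

lemma increments_law:
  assumes r: "0 \<le> r" and tt: "tt 0 = 0" "\<And>i. i < n \<Longrightarrow> tt i \<le> tt (Suc i)" and n: "0 < n"
  shows "distr M (Pi\<^sub>M {..<n} (\<lambda>_. borel)) (\<lambda>\<omega>. \<lambda>i\<in>{..<n}. X (r + tt (Suc i)) \<omega> - X (r + tt i) \<omega>)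
     = Pi\<^sub>M {..<n} (\<lambda>i. distr M borel (X (tt (Suc i) - tt i)))" (is ?A)
    and "\<And>A S. A \<in> sets borel \<Longrightarrow> S \<in> sets (Pi\<^sub>M {..<n} (\<lambda>_. borel :: real measure)) \<Longrightarrow>
      prob {\<omega>\<in>space M. X r \<omega> - X 0 \<omega> \<in> A \<and> (\<lambda>i\<in>{..<n}. X (r + tt (Suc i)) \<omega> - X (r + tt i) \<omega>) \<in> S} =
      prob {\<omega>\<in>space M. X r \<omega> - X 0 \<omega> \<in> A} * prob {\<omega>\<in>space M. (\<lambda>i\<in>{..<n}. X (r + tt (Suc i)) \<omega> - X (r + tt i) \<omega>) \<in> S}"
proof -
  have tt0: "0 \<le> tt i" if "i \<le> n" for i
    using that by (induction i) (use tt in \<open>auto intro: order_trans\<close>)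
  have law: "distr M borel (\<lambda>\<omega>. X (r + tt (Suc i)) \<omega> - X (r + tt i) \<omega>) = distr M borel (X (tt (Suc i) - tt i))" if "i < n" for i
    using stat[of "r + tt i" "tt (Suc i) - tt i"] r tt0[of i] tt(2)[OF that] that by (simp add: add.assoc)
  have ind: "indep_vars (\<lambda>_. borel) (\<lambda>i \<omega>. X (r + tt (Suc i)) \<omega> - X (r + tt i) \<omega>) {..<n}"
    by (rule indep_incr[of "\<lambda>i. r + tt i"]) (use r tt in auto)
  have rv: "random_variable borel (\<lambda>\<omega>. X (r + tt (Suc i)) \<omega> - X (r + tt i) \<omega>)" if "i < n" for i
    by (intro borel_measurable_diff X_meas) (use r tt0[of i] tt0[of "Suc i"] that in auto)
  show A: ?A
  proof -
    have "distr M (Pi\<^sub>M {..<n} (\<lambda>_. borel)) (\<lambda>\<omega>. \<lambda>i\<in>{..<n}. X (r + tt (Suc i)) \<omega> - X (r + tt i) \<omega>)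
     = Pi\<^sub>M {..<n} (\<lambda>i. distr M borel (\<lambda>\<omega>. X (r + tt (Suc i)) \<omega> - X (r + tt i) \<omega>))"
      using ind by (subst (asm) indep_vars_iff_distr_eq_PiM') (use n rv in auto)
    also have "\<dots> = Pi\<^sub>M {..<n} (\<lambda>i. distr M borel (X (tt (Suc i) - tt i)))"
      by (rule PiM_cong) (use law in auto)
    finally show ?thesis .
  qed
  (* The times 0, r, r + tt 1, ... : the first increment is the one over [0, r]. *)
  define t' where "t' i = (case i of 0 \<Rightarrow> 0 | Suc j \<Rightarrow> r + tt j)" for i
  have ind': "indep_vars (\<lambda>_. borel) (\<lambda>i \<omega>. X (t' (Suc i)) \<omega> - X (t' i) \<omega>) {..<Suc n}"
    by (rule indep_incr) (use r tt in \<open>auto simp: t'_def split: nat.splits\<close>)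
  have "indep_var (Pi\<^sub>M {0} (\<lambda>_. borel)) (\<lambda>\<omega>. restrict (\<lambda>i. X (t' (Suc i)) \<omega> - X (t' i) \<omega>) {0})
     (Pi\<^sub>M {1..<Suc n} (\<lambda>_. borel)) (\<lambda>\<omega>. restrict (\<lambda>i. X (t' (Suc i)) \<omega> - X (t' i) \<omega>) {1..<Suc n})"
    by (rule indep_var_restrict[OF ind']) auto
  then have iv: "indep_var (Pi\<^sub>M {0::nat} (\<lambda>_. borel)) (id \<circ> (\<lambda>\<omega>. restrict (\<lambda>i. X (t' (Suc i)) \<omega> - X (t' i) \<omega>) {0}))
     (Pi\<^sub>M {..<n} (\<lambda>_. borel)) ((\<lambda>v. \<lambda>i\<in>{..<n}. v (Suc i)) \<circ> (\<lambda>\<omega>. restrict (\<lambda>i. X (t' (Suc i)) \<omega> - X (t' i) \<omega>) {1..<Suc n}))"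
    by (rule indep_var_compose) (auto intro!: measurable_restrict measurable_component_singleton)
  fix A :: "real set" and S assume A[measurable]: "A \<in> sets borel" and S: "S \<in> sets (Pi\<^sub>M {..<n} (\<lambda>_. borel :: real measure))"
  let ?U = "id \<circ> (\<lambda>\<omega>. restrict (\<lambda>i. X (t' (Suc i)) \<omega> - X (t' i) \<omega>) {0::nat})"
  let ?V = "(\<lambda>v. \<lambda>i\<in>{..<n}. v (Suc i)) \<circ> (\<lambda>\<omega>. restrict (\<lambda>i. X (t' (Suc i)) \<omega> - X (t' i) \<omega>) {1..<Suc n})"
  let ?W = "\<lambda>\<omega>. \<lambda>i\<in>{..<n}. X (r + tt (Suc i)) \<omega> - X (r + tt i) \<omega>"
  have V: "?V \<omega> = ?W \<omega>" for \<omega> by (auto simp: t'_def fun_eq_iff)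
  have U: "?U \<omega> \<in> Pi\<^sub>E {0} (\<lambda>_. A) \<longleftrightarrow> X r \<omega> - X 0 \<omega> \<in> A" for \<omega> by (auto simp: t'_def tt)
  have "prob ((\<lambda>x. (?U x, ?V x)) -` (Pi\<^sub>E {0} (\<lambda>_. A) \<times> S) \<inter> space M) = prob (?U -` (Pi\<^sub>E {0} (\<lambda>_. A)) \<inter> space M) * prob (?V -` S \<inter> space M)"
    by (rule indep_varD[OF iv _ S]) (auto intro!: sets_PiM_I_finite)
  moreover have "(\<lambda>x. (?U x, ?V x)) -` (Pi\<^sub>E {0} (\<lambda>_. A) \<times> S) \<inter> space M = {\<omega>\<in>space M. X r \<omega> - X 0 \<omega> \<in> A \<and> ?W \<omega> \<in> S}"
    using U V by auto
  moreover have "?U -` (Pi\<^sub>E {0} (\<lambda>_. A)) \<inter> space M = {\<omega>\<in>space M. X r \<omega> - X 0 \<omega> \<in> A}"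
    using U by auto
  moreover have "?V -` S \<inter> space M = {\<omega>\<in>space M. ?W \<omega> \<in> S}" using V by auto
  ultimately show "prob {\<omega>\<in>space M. X r \<omega> - X 0 \<omega> \<in> A \<and> ?W \<omega> \<in> S} = prob {\<omega>\<in>space M. X r \<omega> - X 0 \<omega> \<in> A} * prob {\<omega>\<in>space M. ?W \<omega> \<in> S}"
    by simp
qed

text \<open>Finite-dimensional events of the path after \<open>r\<close> are events of finitely many
  increments: the times are sorted and the values are partial sums of increments.\<close>

lemma path_event:
  fixes F :: "real \<Rightarrow> real set"
  assumes r: "0 \<le> r" and J: "finite J" "J \<subseteq> {0..}" "J \<noteq> {}" and F: "\<And>j. j \<in> J \<Longrightarrow> F j \<in> sets borel"
  obtains n :: nat and tt S where "0 < n" "tt 0 = 0" "\<And>i. i < n \<Longrightarrow> tt i \<le> tt (Suc i)"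
    "S \<in> sets (Pi\<^sub>M {..<n} (\<lambda>_. borel :: real measure))"
    "\<And>r \<omega>. (\<forall>j\<in>J. X (r + j) \<omega> - X r \<omega> \<in> F j) \<longleftrightarrow> (\<lambda>i\<in>{..<n}. X (r + tt (Suc i)) \<omega> - X (r + tt i) \<omega>) \<in> S"
proof -
  define js where "js = sorted_list_of_set J"
  define n where "n = length js"
  define tt where "tt i = (case i of 0 \<Rightarrow> 0 | Suc k \<Rightarrow> js ! k)" for i
  have setjs: "set js = J" "sorted js" using J by (auto simp: js_def)
  have n: "0 < n" using J setjs by (auto simp: n_def)
  have mono: "tt i \<le> tt (Suc i)" if "i < n" for i
  proof (cases i)
    case 0
    have "js ! 0 \<in> set js" by (rule nth_mem) (use that in \<open>auto simp: n_def\<close>)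
    then have "js ! 0 \<in> J" using setjs(1) by simp
    then show ?thesis using 0 J by (auto simp: tt_def)
  next
    case (Suc k)
    then show ?thesis using that sorted_nth_mono[OF setjs(2), of k i] by (simp add: tt_def n_def)
  qed
  define S where "S = {v \<in> space (Pi\<^sub>M {..<n} (\<lambda>_. borel :: real measure)). \<forall>i\<in>{..<n}. (\<Sum>l\<le>i. v l) \<in> F (js ! i)}"
  have Fjs: "F (js ! i) \<in> sets borel" if "i \<in> {..<n}" for i
    using F setjs(1) nth_mem[of i js] that by (auto simp: n_def)
  have "S = (\<Inter>i\<in>{..<n}. {v \<in> space (Pi\<^sub>M {..<n} (\<lambda>_. borel :: real measure)). (\<Sum>l\<le>i. v l) \<in> F (js ! i)})"
    using n unfolding S_def by auto
  also have "\<dots> \<in> sets (Pi\<^sub>M {..<n} (\<lambda>_. borel :: real measure))"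
  proof (rule sets.finite_INT)
    fix i assume i: "i \<in> {..<n}"
    have [measurable]: "F (js ! i) \<in> sets borel" by (rule Fjs[OF i])
    have [measurable]: "(\<lambda>v. \<Sum>l\<le>i. v l) \<in> borel_measurable (Pi\<^sub>M {..<n} (\<lambda>_. borel :: real measure))"
      by (rule borel_measurable_sum) (use i in \<open>auto intro!: measurable_component_singleton\<close>)
    show "{v \<in> space (Pi\<^sub>M {..<n} (\<lambda>_. borel :: real measure)). (\<Sum>l\<le>i. v l) \<in> F (js ! i)} \<in> sets (Pi\<^sub>M {..<n} (\<lambda>_. borel :: real measure))"
      by measurable
  qed (use n in auto)
  finally have Sm: "S \<in> sets (Pi\<^sub>M {..<n} (\<lambda>_. borel :: real measure))" .
  have tel: "(\<Sum>l\<le>i. (\<lambda>i\<in>{..<n}. X (r + tt (Suc i)) \<omega> - X (r + tt i) \<omega>) l) = X (r + js ! i) \<omega> - X r \<omega>" if "i < n" for i r \<omega>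
  proof -
    have "(\<Sum>l\<le>i. (\<lambda>i\<in>{..<n}. X (r + tt (Suc i)) \<omega> - X (r + tt i) \<omega>) l) = (\<Sum>l<Suc i. X (r + tt (Suc l)) \<omega> - X (r + tt l) \<omega>)"
      using that by (intro sum.cong) auto
    also have "\<dots> = X (r + tt (Suc i)) \<omega> - X (r + tt 0) \<omega>" by (rule sum_lessThan_telescope)
    finally show ?thesis by (simp add: tt_def)
  qed
  have "(\<forall>j\<in>J. X (r + j) \<omega> - X r \<omega> \<in> F j) \<longleftrightarrow> (\<lambda>i\<in>{..<n}. X (r + tt (Suc i)) \<omega> - X (r + tt i) \<omega>) \<in> S" for r \<omega>
  proof -
    have "(\<forall>j\<in>J. X (r + j) \<omega> - X r \<omega> \<in> F j) \<longleftrightarrow> (\<forall>i\<in>{..<n}. X (r + js ! i) \<omega> - X r \<omega> \<in> F (js ! i))"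
      unfolding setjs(1)[symmetric] n_def by (auto simp: set_conv_nth)
    then show ?thesis using tel by (auto simp: S_def space_PiM)
  qed
  with n mono Sm show thesis by (intro that[of n tt S]) (auto simp: tt_def)
qed

text \<open>Both sides agree on rectangles. For a fixed event of the first increment, finite measures on
  path space are compared on finite-dimensional events, which depend on increments only.\<close>

lemma markov_law:
  assumes r: "0 \<le> r"
  shows "distr M (borel \<Otimes>\<^sub>M Om) (\<lambda>\<omega>. (X r \<omega> - X 0 \<omega>, post_path r \<omega>)) = distr M borel (X r) \<Otimes>\<^sub>M distr M Om (post_path 0)"
proof (rule pair_measure_eqI[symmetric])
  interpret P: prob_space "distr M borel (X r)" by (rule prob_space_distr) (use r in simp)
  interpret L: prob_space "distr M Om (post_path 0)" by (rule prob_space_distr) simp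
  show "sigma_finite_measure (distr M borel (X r))" "sigma_finite_measure (distr M Om (post_path 0))" by unfold_locales
  show "sets (distr M borel (X r) \<Otimes>\<^sub>M distr M Om (post_path 0)) = sets (distr M (borel \<Otimes>\<^sub>M Om) (\<lambda>\<omega>. (X r \<omega> - X 0 \<omega>, post_path r \<omega>)))"
    by (simp cong: sets_pair_measure_cong)
  fix A B assume A': "A \<in> sets (distr M borel (X r))" and B: "B \<in> sets (distr M Om (post_path 0))"
  then have A[measurable]: "A \<in> sets borel" by simp
  have rv[measurable]: "X r \<in> borel_measurable M" "X 0 \<in> borel_measurable M" "post_path r \<in> measurable M Om" "post_path 0 \<in> measurable M Om"
    using r by auto
  define E where "E = {\<omega>\<in>space M. X r \<omega> - X 0 \<omega> \<in> A}"
  have E[measurable]: "E \<in> sets M" unfolding E_def by measurable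
  define Q1 where "Q1 = distr (density M (indicator E)) Om (post_path r)"
  define Q2 where "Q2 = scale_measure (emeasure M E) (distr M Om (post_path 0))"
  have rvd: "post_path r \<in> measurable (density M (indicator E)) Om" by simp
  have Q1: "emeasure Q1 B = emeasure M (E \<inter> (post_path r -` B \<inter> space M))" if "B \<in> sets Om" for B
  proof -
    have [measurable]: "post_path r -` B \<inter> space M \<in> sets M" by (rule measurable_sets[OF rv(3) that])
    have "emeasure Q1 B = emeasure (density M (indicator E)) (post_path r -` B \<inter> space M)"
      unfolding Q1_def using that by (subst emeasure_distr[OF rvd]) auto
    also have "\<dots> = (\<integral>\<^sup>+x. indicator (E \<inter> (post_path r -` B \<inter> space M)) x \<partial>M)"
      by (subst emeasure_density, measurable) (intro nn_integral_cong, auto split: split_indicator)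
    finally show ?thesis by simp
  qed
  have "Q1 = Q2"
  proof (rule measure_eqI_PiM_infinite)
    show "sets Q1 = sets Om" "sets Q2 = sets Om" by (simp_all add: Q1_def Q2_def)
    show "finite_measure Q1"
    proof
      have "space Q1 = space Om" by (simp add: Q1_def)
      then have "emeasure Q1 (space Q1) \<le> emeasure M (space M)"
        by (simp add: Q1 emeasure_mono[OF sets.sets_into_space])
      then show "emeasure Q1 (space Q1) \<noteq> \<infinity>" by (auto simp: emeasure_space_1 top_unique)
    qed
    fix F J assume J: "finite J" "J \<subseteq> {0::real..}" and F: "\<And>i. i \<in> J \<Longrightarrow> F i \<in> sets (borel :: real measure)"
    let ?B = "prod_emb {0..} (\<lambda>_. borel :: real measure) J (Pi\<^sub>E J F)"
    have Bs: "?B \<in> sets Om" by (rule sets_PiM_I) (use J F in auto)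
    have ev: "post_path r \<omega> \<in> ?B \<longleftrightarrow> (\<forall>j\<in>J. X (r + j) \<omega> - X r \<omega> \<in> F j)" for r \<omega>
      using J(2) by (auto simp: prod_emb_def post_path_def PiE_def Pi_def extensional_def)
    have e1: "emeasure Q1 ?B = emeasure M {\<omega>\<in>space M. X r \<omega> - X 0 \<omega> \<in> A \<and> (\<forall>j\<in>J. X (r + j) \<omega> - X r \<omega> \<in> F j)}"
      unfolding Q1[OF Bs] by (rule arg_cong[where f = "emeasure M"]) (auto simp: E_def ev)
    have e2: "emeasure Q2 ?B = emeasure M E * emeasure M {\<omega>\<in>space M. \<forall>j\<in>J. X (0 + j) \<omega> - X 0 \<omega> \<in> F j}"
    proof -
      have "post_path 0 -` ?B \<inter> space M = {\<omega>\<in>space M. \<forall>j\<in>J. X (0 + j) \<omega> - X 0 \<omega> \<in> F j}"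
        using ev[of 0] by auto
      then show ?thesis unfolding Q2_def using Bs by (simp add: emeasure_distr)
    qed
    show "emeasure Q1 ?B = emeasure Q2 ?B"
    proof (cases "J = {}")
      case True
      then show ?thesis unfolding e1 e2 by (simp add: E_def emeasure_space_1)
    next
      case False
      obtain n tt S where n: "0 < n" and tt: "tt 0 = 0" "\<And>i. i < n \<Longrightarrow> tt i \<le> tt (Suc i)"
        and S: "S \<in> sets (Pi\<^sub>M {..<n} (\<lambda>_. borel :: real measure))"
        and evS: "\<And>r \<omega>. (\<forall>j\<in>J. X (r + j) \<omega> - X r \<omega> \<in> F j) \<longleftrightarrow> (\<lambda>i\<in>{..<n}. X (r + tt (Suc i)) \<omega> - X (r + tt i) \<omega>) \<in> S"
        by (rule path_event[OF r J False F]; (rule that; assumption)?)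
      have tt0: "0 \<le> tt i" if "i \<le> n" for i
        using that by (induction i) (use tt in \<open>auto intro: order_trans\<close>)
      have Wm: "(\<lambda>\<omega>. \<lambda>i\<in>{..<n}. X (r + tt (Suc i)) \<omega> - X (r + tt i) \<omega>) \<in> measurable M (Pi\<^sub>M {..<n} (\<lambda>_. borel))" if "0 \<le> r" for r
        by (intro measurable_restrict borel_measurable_diff X_meas) (use that tt0 in auto)
      have same: "prob {\<omega>\<in>space M. (\<lambda>i\<in>{..<n}. X (r' + tt (Suc i)) \<omega> - X (r' + tt i) \<omega>) \<in> S}
         = measure (Pi\<^sub>M {..<n} (\<lambda>i. distr M borel (X (tt (Suc i) - tt i)))) S" if "0 \<le> r'" for r'
      proof -
        have "measure (Pi\<^sub>M {..<n} (\<lambda>i. distr M borel (X (tt (Suc i) - tt i)))) S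
          = measure (distr M (Pi\<^sub>M {..<n} (\<lambda>_. borel)) (\<lambda>\<omega>. \<lambda>i\<in>{..<n}. X (r' + tt (Suc i)) \<omega> - X (r' + tt i) \<omega>)) S"
          by (rule arg_cong[where f = "\<lambda>m. measure m S"]) (rule increments_law(1)[where tt = tt, OF that tt n, symmetric])
        also have "\<dots> = prob ((\<lambda>\<omega>. \<lambda>i\<in>{..<n}. X (r' + tt (Suc i)) \<omega> - X (r' + tt i) \<omega>) -` S \<inter> space M)"
          by (rule measure_distr[OF Wm[OF that] S])
        also have "\<dots> = prob {\<omega>\<in>space M. (\<lambda>i\<in>{..<n}. X (r' + tt (Suc i)) \<omega> - X (r' + tt i) \<omega>) \<in> S}"
          by (rule arg_cong[where f = prob]) auto
        finally show ?thesis ..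
      qed
      have "prob {\<omega>\<in>space M. X r \<omega> - X 0 \<omega> \<in> A \<and> (\<forall>j\<in>J. X (r + j) \<omega> - X r \<omega> \<in> F j)}
          = prob E * prob {\<omega>\<in>space M. \<forall>j\<in>J. X (0 + j) \<omega> - X 0 \<omega> \<in> F j}"
        unfolding evS E_def
        by (rule trans[OF increments_law(2)[where tt = tt, OF r tt n A S]]) (use same[OF r] same[OF order_refl] in simp_all)
      then show ?thesis unfolding e1 e2 emeasure_eq_measure by (simp add: ennreal_mult)
    qed
  qed
  then have "emeasure Q1 B = emeasure Q2 B" by simp
  moreover have "emeasure Q2 B = emeasure M E * emeasure (distr M Om (post_path 0)) B" by (simp add: Q2_def)
  moreover have "emeasure M E = emeasure (distr M borel (X r)) A"
  proof -
    have "emeasure M E = emeasure (distr M borel (\<lambda>\<omega>. X (0 + r) \<omega> - X 0 \<omega>)) A"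
      by (subst emeasure_distr) (auto simp: E_def intro!: arg_cong[where f = "emeasure M"])
    then show ?thesis using stat[of 0 r] r by simp
  qed
  moreover have "emeasure (distr M (borel \<Otimes>\<^sub>M Om) (\<lambda>\<omega>. (X r \<omega> - X 0 \<omega>, post_path r \<omega>))) (A \<times> B) = emeasure Q1 B"
    using B by (subst emeasure_distr) (auto simp: Q1 E_def intro!: arg_cong[where f = "emeasure M"])
  ultimately show "emeasure (distr M borel (X r)) A * emeasure (distr M Om (post_path 0)) B
      = emeasure (distr M (borel \<Otimes>\<^sub>M Om) (\<lambda>\<omega>. (X r \<omega> - X 0 \<omega>, post_path r \<omega>))) (A \<times> B)" by simp
qed

end

section \<open>Occupation times as functionals of the path\<close>

text \<open>Strictly above \<open>v\<close> and tending to \<open>v\<close>, so that right continuity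
  recovers the value at \<open>v\<close> from the values on the grid.\<close>

definition grid :: "nat \<Rightarrow> real \<Rightarrow> real" where
  "grid n v = (real (nat \<lfloor>2 ^ n * max 0 v\<rfloor>) + 1) / 2 ^ n"

lemma grid_bounds: "0 \<le> v \<Longrightarrow> v < grid n v" "0 \<le> v \<Longrightarrow> grid n v \<le> v + 1 / 2 ^ n" "0 < grid n v"
proof -
  show "0 < grid n v" unfolding grid_def by (intro divide_pos_pos add_nonneg_pos) auto
  assume v: "0 \<le> v"
  have k: "real (nat \<lfloor>2 ^ n * max 0 v\<rfloor>) = of_int \<lfloor>2 ^ n * v\<rfloor>" using v by (simp add: max_def)
  have "2 ^ n * v < of_int \<lfloor>2 ^ n * v\<rfloor> + 1" by linarith
  then show "v < grid n v" unfolding grid_def k by (simp add: field_simps)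
  have "of_int \<lfloor>2 ^ n * v\<rfloor> \<le> 2 ^ n * v" by linarith
  then show "grid n v \<le> v + 1 / 2 ^ n" unfolding grid_def k by (simp add: field_simps)
qed

text \<open>Evaluation of a path at a time. On the product space, evaluation is not jointly measurable
  in time and path; the limit along dyadic times from the right is, and it agrees with evaluation for
  right-continuous paths.\<close>

definition ev :: "real \<Rightarrow> (real \<Rightarrow> real) \<Rightarrow> real" where
  "ev v p = lim (\<lambda>n. p (grid n v))"

lemma ev_measurable[measurable]: "(\<lambda>w. ev (fst w) (snd w)) \<in> borel_measurable (borel \<Otimes>\<^sub>M Pi\<^sub>M {0..} (\<lambda>_. borel))"
  unfolding ev_def
proof (rule borel_measurable_lim_metric)
  fix n
  let ?f = "\<lambda>k (w :: real \<times> (real \<Rightarrow> real)). snd w ((real k + 1) / 2 ^ n)"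
  have "(\<lambda>w. ?f (nat \<lfloor>2 ^ n * max 0 (fst w)\<rfloor>) w) \<in> borel_measurable (borel \<Otimes>\<^sub>M Pi\<^sub>M {0..} (\<lambda>_. borel))"
  proof (rule measurable_compose_countable[where f = ?f and g = "\<lambda>w. nat \<lfloor>2 ^ n * max 0 (fst w)\<rfloor>"])
    show "?f k \<in> borel_measurable (borel \<Otimes>\<^sub>M Pi\<^sub>M {0..} (\<lambda>_. borel))" for k :: nat
      by (rule measurable_compose[OF measurable_snd measurable_component_singleton]) simp
  qed measurable
  then show "(\<lambda>w. snd w (grid n (fst w))) \<in> borel_measurable (borel \<Otimes>\<^sub>M Pi\<^sub>M {0..} (\<lambda>_. borel :: real measure))"
    by (simp add: grid_def)
qed

lemma ev_measurable'[measurable (raw)]: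
  assumes "f \<in> borel_measurable N" "g \<in> measurable N (Pi\<^sub>M {0..} (\<lambda>_. borel))"
  shows "(\<lambda>w. ev (f w) (g w)) \<in> borel_measurable N"
  using measurable_compose[OF measurable_Pair[OF assms] ev_measurable] by simp

lemma ev_right_continuous:
  assumes v: "0 \<le> v" and c: "continuous (at_right (r + v)) f" and p: "\<And>t. 0 \<le> t \<Longrightarrow> p t = f (r + t) - a"
  shows "ev v p = f (r + v) - a"
proof -
  have "(\<lambda>n. v + 1 / 2 ^ n) \<longlonglongrightarrow> v + 0"
    by (intro tendsto_add tendsto_const) (simp add: LIMSEQ_inverse_realpow_zero inverse_eq_divide[symmetric])
  then have g: "(\<lambda>n. grid n v) \<longlonglongrightarrow> v"
    by (intro tendsto_sandwich[of "\<lambda>_. v" "\<lambda>n. grid n v" sequentially "\<lambda>n. v + 1 / 2 ^ n" v])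
       (use grid_bounds v in \<open>auto intro!: always_eventually less_imp_le\<close>)
  have "filterlim (\<lambda>n. r + grid n v) (at_right (r + v)) sequentially"
    unfolding filterlim_at using grid_bounds(1)[OF v] by (auto intro!: tendsto_intros g always_eventually simp: less_imp_neq[symmetric])
  then have "(\<lambda>n. f (r + grid n v)) \<longlonglongrightarrow> f (r + v)"
    using c unfolding continuous_within by (rule filterlim_compose[rotated])
  then have "(\<lambda>n. f (r + grid n v) - a) \<longlonglongrightarrow> f (r + v) - a" by (intro tendsto_intros)
  moreover have "p (grid n v) = f (r + grid n v) - a" for n using grid_bounds(3)[of n v] by (intro p) simp
  ultimately show ?thesis unfolding ev_def by (intro limI) simp
qed

definition above :: "real \<Rightarrow> (real \<Rightarrow> real) \<Rightarrow> real \<Rightarrow> real" where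
  "above x p v = indicator {x<..} (ev v p)"

lemma above_01: "0 \<le> above x p v" "above x p v \<le> 1" by (auto simp: above_def indicator_def)

lemma above_measurable[measurable (raw)]:
  assumes "f \<in> borel_measurable N" "g \<in> measurable N (Pi\<^sub>M {0..} (\<lambda>_. borel))" "k \<in> borel_measurable N"
  shows "(\<lambda>w. above (k w) (g w) (f w)) \<in> borel_measurable N"
proof -
  note [measurable] = assms
  have "(\<lambda>w. above (k w) (g w) (f w)) = (\<lambda>w. if k w < ev (f w) (g w) then 1 else 0)"
    by (auto simp: above_def indicator_def)
  also have "\<dots> \<in> borel_measurable N" by measurable
  finally show ?thesis .
qed

lemma occ_if: "occ h t = (LINT v|lborel. (if 0 \<le> v \<and> v \<le> t then h v else 0))"
  unfolding occ_def set_lebesgue_integral_def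
  by (intro Bochner_Integration.integral_cong) (auto split: split_indicator)

lemma occ_above_measurable[measurable (raw)]:
  assumes "f \<in> borel_measurable N" "g \<in> measurable N (Pi\<^sub>M {0..} (\<lambda>_. borel))" "k \<in> borel_measurable N"
  shows "(\<lambda>w. occ (above (k w) (g w)) (f w)) \<in> borel_measurable N"
  unfolding occ_if using assms by measurable

lemma occ_lap_above_measurable[measurable (raw)]:
  assumes "f \<in> borel_measurable N" "g \<in> measurable N (Pi\<^sub>M {0..} (\<lambda>_. borel))" "k \<in> borel_measurable N"
  shows "(\<lambda>w. occ_lap (above (k w) (g w)) s u (f w)) \<in> borel_measurable N"
  unfolding occ_lap_def using assms by measurable

lemma above_borel[measurable]: "p \<in> space (Pi\<^sub>M {0..} (\<lambda>_. borel)) \<Longrightarrow> above x p \<in> borel_measurable borel"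
  by (rule above_measurable[of "\<lambda>v. v" borel "\<lambda>_. p" "\<lambda>_. x"]) auto

lemma occ_lap_01:
  assumes s: "0 < s" and u: "0 < u" and r: "0 \<le> r" and h: "h \<in> borel_measurable borel" "\<And>x. 0 \<le> h x" "\<And>x. h x \<le> 1"
  shows "0 \<le> occ_lap h s u r" "occ_lap h s u r \<le> 1"
proof -
  show "0 \<le> occ_lap h s u r" unfolding occ_lap_def using s by (intro integral_nonneg_AE AE_I2) (auto split: split_indicator)
  have [measurable]: "occ h \<in> borel_measurable borel" by (rule occ_measurable[OF h])
  have le: "exp (- u * (occ h (r + v) - occ h r)) \<le> 1" if "0 \<le> v" for v
    using occ_bounds[OF h, of r "r + v"] u r that by auto
  have "occ_lap h s u r \<le> (LINT v|lborel. indicator {0..} v * (s * exp (- s * v)))"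
    unfolding occ_lap_def
  proof (rule integral_mono)
    show "integrable lborel (\<lambda>v. indicator {0..} v * (s * exp (- s * v)) * exp (- u * (occ h (r + v) - occ h r)))"
      by (rule Bochner_Integration.integrable_bound[OF exp_density_integral(1)[OF s]])
         (use le s in \<open>auto intro!: AE_I2 simp: abs_mult mult_left_le split: split_indicator\<close>)
    show "integrable lborel (\<lambda>v. indicator {0..} v * (s * exp (- s * v)))" by (rule exp_density_integral(1)[OF s])
    show "indicator {0..} v * (s * exp (- s * v)) * exp (- u * (occ h (r + v) - occ h r)) \<le> indicator {0..} v * (s * exp (- s * v))" for v
      using le[of v] s by (auto intro!: mult_left_le split: split_indicator)
  qed
  then show "occ_lap h s u r \<le> 1" by (simp add: exp_density_integral(2)[OF s, simplified])
qed

context levy_path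
begin

lemma ev_post_path: "\<omega> \<in> space M \<Longrightarrow> 0 \<le> r \<Longrightarrow> 0 \<le> v \<Longrightarrow> ev v (post_path r \<omega>) = X (r + v) \<omega> - X r \<omega>"
  by (rule ev_right_continuous[where f = "\<lambda>t. X t \<omega>"]) (auto intro: rcont simp: post_path_def)

lemma post_path_space: "\<omega> \<in> space M \<Longrightarrow> 0 \<le> r \<Longrightarrow> post_path r \<omega> \<in> space Om"
  using measurable_space[OF post_path_meas] by blast

text \<open>Occupation above \<open>x\<close> after time \<open>r\<close> is occupation of the restarted
  path above the level lowered by the increment up to \<open>r\<close>.\<close>

lemma occ_lap_shift:
  assumes w: "\<omega> \<in> space M" and r: "0 \<le> r"
  shows "occ_lap (above x (post_path 0 \<omega>)) s u r = occ_lap (above (x - (X r \<omega> - X 0 \<omega>)) (post_path r \<omega>)) s u 0"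
proof -
  let ?h = "above x (post_path 0 \<omega>)" and ?g = "above (x - (X r \<omega> - X 0 \<omega>)) (post_path r \<omega>)"
  have h[measurable]: "?h \<in> borel_measurable borel" "?g \<in> borel_measurable borel"
    using post_path_space[OF w] r by auto
  have eq: "?h (r + v) = ?g v" if "0 \<le> v" for v
    using that r w by (auto simp: above_def ev_post_path indicator_def)
  have "occ ?h (r + v) - occ ?h r = occ ?g v" if v: "0 \<le> v" for v
  proof -
    have "occ ?h (r + v) - occ ?h r = (LINT t:{r<..r + v}|lborel. ?h t)"
      using occ_split[OF h(1) above_01, of r "r + v"] r v by simp
    also have "\<dots> = (LINT t|lborel. indicator {r<..r + v} (r + t) * ?h (r + t))"
      unfolding set_lebesgue_integral_def
      using lborel_integral_real_affine[of 1 "\<lambda>t. indicator {r<..r + v} t *\<^sub>R ?h t" r] by simp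
    also have "\<dots> = (LINT t:{0<..v}|lborel. ?g t)"
      unfolding set_lebesgue_integral_def
      by (intro Bochner_Integration.integral_cong) (auto simp: eq split: split_indicator)
    also have "\<dots> = occ ?g v" unfolding occ_def by (rule set_integral_Icc_Ioc[OF h(2), symmetric])
    finally show ?thesis .
  qed
  moreover have "occ ?g 0 = 0" by (rule occ_0[OF h(2) above_01])
  ultimately show ?thesis unfolding occ_lap_def
    by (intro Bochner_Integration.integral_cong) (auto split: split_indicator)
qed

text \<open>The occupation transform as a functional of the law of the path, which makes it available at
  random starting levels.\<close>

definition occ_trf :: "real \<Rightarrow> real \<Rightarrow> real \<Rightarrow> real" where
  "occ_trf s u x = (LINT p|distr M Om (post_path 0). occ_lap (above x p) s u 0)"

text \<open>The law of the process at an independent exponential time.\<close>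

definition exp_law :: "real \<Rightarrow> real measure" where
  "exp_law s = distr (density lborel (exponential_density s) \<Otimes>\<^sub>M M) borel (\<lambda>(r, \<omega>). ev r (post_path 0 \<omega>))"

lemma occ_trf_measurable[measurable]: "occ_trf s u \<in> borel_measurable borel"
proof -
  interpret L: prob_space "distr M Om (post_path 0)" by (rule prob_space_distr) simp
  show ?thesis unfolding occ_trf_def by measurable
qed

lemma occ_trf_01:
  assumes "0 < s" "0 < u" shows "0 \<le> occ_trf s u x" "occ_trf s u x \<le> 1"
proof -
  interpret L: prob_space "distr M Om (post_path 0)" by (rule prob_space_distr) simp
  have b: "0 \<le> occ_lap (above x p) s u 0 \<and> occ_lap (above x p) s u 0 \<le> 1" if "p \<in> space (distr M Om (post_path 0))" for p
    using occ_lap_01[OF assms order_refl above_borel above_01, of p x] that by simp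
  show "0 \<le> occ_trf s u x" unfolding occ_trf_def using b by (intro integral_nonneg_AE AE_I2) auto
  have "occ_trf s u x \<le> (LINT p|distr M Om (post_path 0). 1)" unfolding occ_trf_def
    by (rule integral_mono) (use b in \<open>auto intro!: L.integrable_const_bound[where B = 1]\<close>)
  then show "occ_trf s u x \<le> 1" using L.prob_space by simp
qed

end

section \<open>The renewal equation of the occupation transform\<close>

context levy_path
begin

lemma ev_path_measurable[measurable (raw)]:
  assumes "f \<in> borel_measurable N" "g \<in> measurable N M"
  shows "(\<lambda>w. ev (f w) (post_path 0 (g w))) \<in> borel_measurable N"
  by (rule ev_measurable'[OF assms(1) measurable_compose[OF assms(2) post_path_meas]]) simp

lemma prob_space_exp_law: "0 < s \<Longrightarrow> real_distribution (exp_law s)"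
proof -
  assume s: "0 < s"
  interpret E: prob_space "density lborel (exponential_density s)" by (rule prob_space_exponential_density[OF s])
  interpret P: pair_prob_space "density lborel (exponential_density s)" M ..
  show ?thesis unfolding exp_law_def by (rule P.real_distribution_distr) measurable
qed

lemma sets_exp_law[simp, measurable_cong]: "sets (exp_law s) = sets borel" by (simp add: exp_law_def)

lemma exp_law_integral:
  fixes f :: "real \<Rightarrow> 'c::{banach, second_countable_topology}"
  assumes s: "0 < s" and f[measurable]: "f \<in> borel_measurable borel" and b: "\<And>x. norm (f x) \<le> C"
  shows "(\<integral>y. f y \<partial>exp_law s) = (\<integral>r. (indicator {0..} r * (s * exp (- s * r))) *\<^sub>R (\<integral>\<omega>. f (ev r (post_path 0 \<omega>)) \<partial>M) \<partial>lborel)"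
proof -
  interpret E: prob_space "density lborel (exponential_density s)" by (rule prob_space_exponential_density[OF s])
  interpret P: pair_prob_space "density lborel (exponential_density s)" M ..
  have int: "integrable (density lborel (exponential_density s) \<Otimes>\<^sub>M M) (\<lambda>w. f (ev (fst w) (post_path 0 (snd w))))"
    by (rule P.integrable_const_bound[where B = C]) (use b in auto)
  have "(\<integral>y. f y \<partial>exp_law s) = (\<integral>w. f (ev (fst w) (post_path 0 (snd w))) \<partial>(density lborel (exponential_density s) \<Otimes>\<^sub>M M))"
    unfolding exp_law_def by (subst integral_distr) (auto simp: case_prod_beta')
  also have "\<dots> = (\<integral>r. (\<integral>\<omega>. f (ev r (post_path 0 \<omega>)) \<partial>M) \<partial>density lborel (exponential_density s))"
    using P.integral_fst'[OF int] by simp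
  also have "\<dots> = (\<integral>r. exponential_density s r *\<^sub>R (\<integral>\<omega>. f (ev r (post_path 0 \<omega>)) \<partial>M) \<partial>lborel)"
    by (rule integral_density) (auto simp: exponential_density_nonneg s)
  also have "\<dots> = (\<integral>r. (indicator {0..} r * (s * exp (- s * r))) *\<^sub>R (\<integral>\<omega>. f (ev r (post_path 0 \<omega>)) \<partial>M) \<partial>lborel)"
    by (intro Bochner_Integration.integral_cong) (auto simp: exponential_density_def mult.commute)
  finally show ?thesis .
qed

lemma law_ev: 
  fixes f :: "real \<Rightarrow> 'c::{banach, second_countable_topology}"
  assumes r: "0 \<le> r" and f: "f \<in> borel_measurable borel"
  shows "(\<integral>\<omega>. f (ev r (post_path 0 \<omega>)) \<partial>M) = (\<integral>y. f y \<partial>distr M borel (X r))"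
proof -
  have "(\<integral>\<omega>. f (ev r (post_path 0 \<omega>)) \<partial>M) = (\<integral>\<omega>. f (X (0 + r) \<omega> - X 0 \<omega>) \<partial>M)"
    by (intro Bochner_Integration.integral_cong) (use r in \<open>auto simp: ev_post_path\<close>)
  also have "\<dots> = (\<integral>y. f y \<partial>distr M borel (\<lambda>\<omega>. X (0 + r) \<omega> - X 0 \<omega>))"
    by (rule integral_distr[symmetric]) (use r f in auto)
  also have "\<dots> = (\<integral>y. f y \<partial>distr M borel (X r))" using stat[of 0 r] r by simp
  finally show ?thesis .
qed

text \<open>The hypothesis is the Levy-Khintchine formula at one frequency. Bounded exponentials force
  the nonpositive real part, and then the integral over the exponential time converges.\<close>

lemma char_exp_law:
  assumes s: "0 < s" and k: "\<And>r. 0 \<le> r \<Longrightarrow> (CLINT \<omega>|M. exp (\<i> * of_real t * of_real (X r \<omega>))) = exp (of_real r * \<kappa>)"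
  shows "Re \<kappa> \<le> 0" "char (exp_law s) t = of_real s / (of_real s - \<kappa>)"
proof -
  have "norm (CLINT \<omega>|M. exp (\<i> * of_real t * of_real (X 1 \<omega>))) \<le> (LINT \<omega>|M. norm (exp (\<i> * of_real t * of_real (X 1 \<omega>))))"
    by (rule integral_norm_bound)
  also have "\<dots> = 1" by (simp add: prob_space)
  finally show Re: "Re \<kappa> \<le> 0" using k[of 1] by simp
  have E: "(CLINT \<omega>|M. iexp (t * ev r (post_path 0 \<omega>))) = exp (of_real r * \<kappa>)" if r: "0 \<le> r" for r
  proof -
    have "(CLINT \<omega>|M. iexp (t * ev r (post_path 0 \<omega>))) = (CLINT y|distr M borel (X r). iexp (t * y))"
      by (rule law_ev[OF r]) simp
    also have "\<dots> = (CLINT \<omega>|M. exp (\<i> * of_real t * of_real (X r \<omega>)))"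
      using r by (subst integral_distr) (auto simp: mult.assoc)
    finally show ?thesis using k[OF r] by simp
  qed
  have "char (exp_law s) t = (CLINT r|lborel. (indicator {0..} r * (s * exp (- s * r))) *\<^sub>R (CLINT \<omega>|M. iexp (t * ev r (post_path 0 \<omega>))))"
    unfolding char_def by (rule exp_law_integral[OF s, where C = 1]) auto
  also have "\<dots> = (CLINT r|lborel. of_real s * (indicator {0..} r *\<^sub>R (of_real r ^ 0 * exp (- (of_real s - \<kappa>) * of_real r))))"
  proof (intro Bochner_Integration.integral_cong refl)
    fix r :: real
    have "of_real (exp (- s * r)) = exp (- (of_real s * of_real r) :: complex)" by (simp flip: exp_of_real)
    then show "(indicator {0..} r * (s * exp (- s * r))) *\<^sub>R (CLINT \<omega>|M. iexp (t * ev r (post_path 0 \<omega>)))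
       = of_real s * (indicator {0..} r *\<^sub>R (of_real r ^ 0 * exp (- (of_real s - \<kappa>) * of_real r)))"
      using E[of r] by (auto simp: scaleR_conv_of_real algebra_simps exp_add exp_minus exp_diff divide_inverse split: split_indicator)
  qed
  also have "\<dots> = of_real s * (1 / (of_real s - \<kappa>))"
    unfolding integral_mult_right_zero
    using laplace_monomial(2)[of "of_real s - \<kappa>" 0] s Re unfolding set_lebesgue_integral_def by simp
  finally show "char (exp_law s) t = of_real s / (of_real s - \<kappa>)" by simp
qed

text \<open>Averaging \<open>occ_lap_identity\<close> over paths. The path after \<open>r\<close> is
  independent of the increment up to \<open>r\<close> and distributed as the original, so the restarted
  functional averages to the transform at the level \<open>x - y\<close>, and the integral over
  \<open>r\<close> becomes one over the law at an exponential time.\<close>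

lemma occ_trf_equation:
  assumes s: "0 < s" and u: "0 < u"
  shows "occ_trf s u x = 1 - (u / s) * (LINT y|exp_law s. indicator {x<..} y * occ_trf s u (x - y))"
proof -
  let ?L = "distr M Om (post_path 0)"
  interpret L: prob_space ?L by (rule prob_space_distr) simp
  have Zm[measurable]: "post_path 0 \<in> measurable M Om" by simp
  define F where "F r \<omega> = above x (post_path 0 \<omega>) r * occ_lap (above x (post_path 0 \<omega>)) s u r" for r \<omega>
  have Fm[measurable]: "(\<lambda>w. F (fst w) (snd w)) \<in> borel_measurable ((lborel :: real measure) \<Otimes>\<^sub>M M)"
    unfolding F_def by measurable
  have F01: "0 \<le> F r \<omega> \<and> F r \<omega> \<le> 1" if "\<omega> \<in> space M" "0 \<le> r" for r \<omega>
    using occ_lap_01[OF s u that(2) above_borel above_01, of "post_path 0 \<omega>" x] post_path_space[OF that(1)] above_01[of x "post_path 0 \<omega>" r]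
    by (auto simp: F_def intro: mult_le_one)
  interpret P: pair_sigma_finite "lborel :: real measure" M ..
  have int: "integrable ((lborel :: real measure) \<Otimes>\<^sub>M M) (\<lambda>(r, \<omega>). indicator {0..} r * exp (- s * r) * F r \<omega>)"
  proof (rule Bochner_Integration.integrable_bound)
    let ?b = "\<lambda>w :: real \<times> 'a. indicator {0..} (fst w) * (s * exp (- s * fst w))"
    have m: "?b \<in> borel_measurable ((lborel :: real measure) \<Otimes>\<^sub>M M)" by measurable
    have "integrable ((lborel :: real measure) \<Otimes>\<^sub>M M) ?b"
      by (rule P.Fubini_integrable[OF m]) (use exp_density_integral(1)[OF s] s in \<open>auto simp: prob_space abs_mult\<close>)
    then show "integrable ((lborel :: real measure) \<Otimes>\<^sub>M M) (\<lambda>w. (1 / s) * ?b w)"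
      by (rule integrable_mult_right)
    have "(\<lambda>w. indicator {0..} (fst w) * exp (- s * fst w) * F (fst w) (snd w)) \<in> borel_measurable ((lborel :: real measure) \<Otimes>\<^sub>M M)"
      by measurable
    then show "(\<lambda>(r, \<omega>). indicator {0..} r * exp (- s * r) * F r \<omega>) \<in> borel_measurable ((lborel :: real measure) \<Otimes>\<^sub>M M)"
      by (simp add: case_prod_beta')
    show "AE w in (lborel :: real measure) \<Otimes>\<^sub>M M. norm ((\<lambda>(r, \<omega>). indicator {0..} r * exp (- s * r) * F r \<omega>) w) \<le> norm ((1 / s) * ?b w)"
    proof (rule AE_I2)
      fix w assume "w \<in> space ((lborel :: real measure) \<Otimes>\<^sub>M M)"
      then have w: "snd w \<in> space M" by (auto simp: space_pair_measure)
      show "norm ((\<lambda>(r, \<omega>). indicator {0..} r * exp (- s * r) * F r \<omega>) w) \<le> norm ((1 / s) * ?b w)"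
        using F01[OF w, of "fst w"] s by (cases w) (auto simp: abs_mult split: split_indicator)
    qed
  qed
  have inner: "(LINT \<omega>|M. F r \<omega>) = (LINT \<omega>|M. indicator {x<..} (ev r (post_path 0 \<omega>)) * occ_trf s u (x - ev r (post_path 0 \<omega>)))" if r: "0 \<le> r" for r
  proof -
    let ?Pr = "distr M borel (X r)"
    interpret Pr: prob_space ?Pr by (rule prob_space_distr) (use r in simp)
    interpret PP: pair_prob_space ?Pr ?L ..
    have rm[measurable]: "X r \<in> borel_measurable M" "X 0 \<in> borel_measurable M" "post_path r \<in> measurable M Om" using r by auto
    let ?g = "\<lambda>w :: real \<times> (real \<Rightarrow> real). indicator {x<..} (fst w) * occ_lap (above (x - fst w) (snd w)) s u 0"
    have gm: "?g \<in> borel_measurable (borel \<Otimes>\<^sub>M Om)" by measurable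
    have "(LINT \<omega>|M. F r \<omega>) = (LINT \<omega>|M. ?g (X r \<omega> - X 0 \<omega>, post_path r \<omega>))"
    proof (intro Bochner_Integration.integral_cong refl)
      fix \<omega> assume w: "\<omega> \<in> space M"
      show "F r \<omega> = ?g (X r \<omega> - X 0 \<omega>, post_path r \<omega>)"
        unfolding F_def occ_lap_shift[OF w r] using ev_post_path[OF w order_refl r] by (simp add: above_def)
    qed
    also have "\<dots> = (LINT w|distr M (borel \<Otimes>\<^sub>M Om) (\<lambda>\<omega>. (X r \<omega> - X 0 \<omega>, post_path r \<omega>)). ?g w)"
      by (rule integral_distr[OF _ gm, symmetric]) measurable
    also have "\<dots> = (LINT w|(?Pr \<Otimes>\<^sub>M ?L). ?g w)" unfolding markov_law[OF r] ..
    also have "\<dots> = (LINT y|?Pr. LINT p|?L. ?g (y, p))"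
    proof (rule PP.integral_fst'[symmetric])
      have gm': "?g \<in> borel_measurable (?Pr \<Otimes>\<^sub>M ?L)" using gm by (simp cong: measurable_cong_sets sets_pair_measure_cong)
      show "integrable (?Pr \<Otimes>\<^sub>M ?L) ?g"
      proof (rule PP.integrable_const_bound[where B = 1, OF _ gm'], rule AE_I2)
        fix w assume "w \<in> space (?Pr \<Otimes>\<^sub>M ?L)"
        then have "snd w \<in> space Om" by (auto simp: space_pair_measure)
        then show "norm (?g w) \<le> 1"
          using occ_lap_01[OF s u order_refl above_borel above_01, of "snd w" "x - fst w"] by (auto simp: abs_mult split: split_indicator)
      qed
    qed
    also have "\<dots> = (LINT y|?Pr. indicator {x<..} y * occ_trf s u (x - y))"
      unfolding occ_trf_def by simp
    also have "\<dots> = (LINT \<omega>|M. indicator {x<..} (ev r (post_path 0 \<omega>)) * occ_trf s u (x - ev r (post_path 0 \<omega>)))"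
      by (rule law_ev[OF r, symmetric]) measurable
    finally show ?thesis .
  qed
  have "occ_trf s u x = (LINT \<omega>|M. occ_lap (above x (post_path 0 \<omega>)) s u 0)"
    unfolding occ_trf_def by (rule integral_distr) measurable
  also have "\<dots> = (LINT \<omega>|M. 1 - u * (LINT r|lborel. indicator {0..} r * exp (- s * r) * F r \<omega>))"
    by (intro Bochner_Integration.integral_cong refl)
       (simp add: F_def occ_lap_identity[OF above_borel[OF post_path_space[OF _ order_refl]] above_01 s u])
  also have "\<dots> = 1 - u * (LINT \<omega>|M. LINT r|lborel. indicator {0..} r * exp (- s * r) * F r \<omega>)"
    using P.integrable_snd[OF int] by (simp add: prob_space)
  also have "(LINT \<omega>|M. LINT r|lborel. indicator {0..} r * exp (- s * r) * F r \<omega>)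
     = (LINT r|lborel. LINT \<omega>|M. indicator {0..} r * exp (- s * r) * F r \<omega>)"
    by (rule P.Fubini_integral[OF int])
  also have "\<dots> = (LINT r|lborel. (1 / s) * ((indicator {0..} r * (s * exp (- s * r))) *\<^sub>R
      (LINT \<omega>|M. indicator {x<..} (ev r (post_path 0 \<omega>)) * occ_trf s u (x - ev r (post_path 0 \<omega>)))))"
  proof (intro Bochner_Integration.integral_cong refl)
    fix r :: real
    show "(LINT \<omega>|M. indicator {0..} r * exp (- s * r) * F r \<omega>) = (1 / s) * ((indicator {0..} r * (s * exp (- s * r))) *\<^sub>R
      (LINT \<omega>|M. indicator {x<..} (ev r (post_path 0 \<omega>)) * occ_trf s u (x - ev r (post_path 0 \<omega>))))"
      using inner[of r] s by (cases "0 \<le> r") auto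
  qed
  also have "\<dots> = (1 / s) * (LINT y|exp_law s. indicator {x<..} y * occ_trf s u (x - y))"
    unfolding integral_mult_right_zero
    by (subst exp_law_integral[OF s, where C = 1]) (use occ_trf_01[OF s u] in \<open>auto split: split_indicator\<close>)
  finally show ?thesis by simp
qed

text \<open>Independence puts the pair of the exponential time and the path in product form.\<close>

lemma occupation_transform_eq_occ_trf:
  assumes s: "0 < s" and u: "0 < u" and ind: "independent_exponential M X \<theta> s"
  shows "occupation_transform M X \<theta> u x = occ_trf s u x"
proof -
  let ?L = "distr M Om (post_path 0)" and ?E = "density lborel (exponential_density s)"
  interpret L: prob_space ?L by (rule prob_space_distr) simp
  interpret E: prob_space ?E by (rule prob_space_exponential_density[OF s])
  interpret PP: pair_prob_space ?E ?L ..
  define Zp where "Zp \<omega> = (\<lambda>t\<in>{0..}. X t \<omega>)" for \<omega>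
  have Zpm[measurable]: "Zp \<in> measurable M Om" unfolding Zp_def by (rule measurable_restrict) auto
  have th: "distributed M lborel \<theta> (exponential_density s)"
    and inds: "indep_set (sets (vimage_algebra (space M) \<theta> borel)) (sets (vimage_algebra (space M) Zp Om))"
    using ind unfolding independent_exponential_def Zp_def by auto
  have theta_meas[measurable]: "\<theta> \<in> borel_measurable M" and thd: "distr M lborel \<theta> = ?E"
    using th by (auto simp: distributed_def)
  have thd': "distr M borel \<theta> = ?E"
    using thd distr_cong[OF refl, of borel lborel M \<theta> \<theta>] by simp
  have ZL: "distr M Om Zp = ?L"
    by (rule distr_cong_AE) (use X0 in \<open>auto simp: Zp_def post_path_def elim!: eventually_mono\<close>)
  have joint: "distr M (borel \<Otimes>\<^sub>M Om) (\<lambda>\<omega>. (\<theta> \<omega>, Zp \<omega>)) = ?E \<Otimes>\<^sub>M ?L"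
  proof (rule pair_measure_eqI[symmetric])
    show "sigma_finite_measure ?E" "sigma_finite_measure ?L" by unfold_locales
    show "sets (?E \<Otimes>\<^sub>M ?L) = sets (distr M (borel \<Otimes>\<^sub>M Om) (\<lambda>\<omega>. (\<theta> \<omega>, Zp \<omega>)))"
      by (simp cong: sets_pair_measure_cong)
    fix A B assume A: "A \<in> sets ?E" and B: "B \<in> sets ?L"
    have "prob ((\<theta> -` A \<inter> space M) \<inter> (Zp -` B \<inter> space M)) = prob (\<theta> -` A \<inter> space M) * prob (Zp -` B \<inter> space M)"
      by (rule indep_setD[OF inds]) (use A B in \<open>auto intro: in_vimage_algebra\<close>)
    moreover have "emeasure ?E A = emeasure M (\<theta> -` A \<inter> space M)"
      unfolding thd'[symmetric] by (rule emeasure_distr) (use A in auto)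
    moreover have "emeasure ?L B = emeasure M (Zp -` B \<inter> space M)"
      unfolding ZL[symmetric] by (rule emeasure_distr) (use B in auto)
    moreover have "emeasure (distr M (borel \<Otimes>\<^sub>M Om) (\<lambda>\<omega>. (\<theta> \<omega>, Zp \<omega>))) (A \<times> B) = emeasure M ((\<theta> -` A \<inter> space M) \<inter> (Zp -` B \<inter> space M))"
      using A B by (subst emeasure_distr) (auto intro!: arg_cong[where f = "emeasure M"])
    ultimately show "emeasure ?E A * emeasure ?L B = emeasure (distr M (borel \<Otimes>\<^sub>M Om) (\<lambda>\<omega>. (\<theta> \<omega>, Zp \<omega>))) (A \<times> B)"
      by (simp add: emeasure_eq_measure ennreal_mult)
  qed
  let ?G = "\<lambda>w :: real \<times> (real \<Rightarrow> real). exp (- u * occ (above x (snd w)) (fst w))"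
  have Gm: "?G \<in> borel_measurable (borel \<Otimes>\<^sub>M Om)" by measurable
  have "occupation_transform M X \<theta> u x = (LINT \<omega>|M. ?G (\<theta> \<omega>, Zp \<omega>))"
    unfolding occupation_transform_def
  proof (intro Bochner_Integration.integral_cong refl)
    fix \<omega> assume w: "\<omega> \<in> space M"
    have "ev t (Zp \<omega>) = X t \<omega>" if "0 \<le> t" for t
      using ev_right_continuous[where f = "\<lambda>t. X t \<omega>" and r = 0 and a = 0 and v = t and p = "Zp \<omega>"] that w rcont[OF w that]
      by (simp add: Zp_def)
    then have "(LINT t:{0..\<theta> \<omega>}|lborel. indicator {x<..} (X t \<omega>)) = occ (above x (Zp \<omega>)) (\<theta> \<omega>)"
      unfolding occ_def set_lebesgue_integral_def above_def
      by (intro Bochner_Integration.integral_cong) (auto split: split_indicator)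
    then show "exp (- u * (LINT t:{0..\<theta> \<omega>}|lborel. indicator {x<..} (X t \<omega>))) = ?G (\<theta> \<omega>, Zp \<omega>)" by simp
  qed
  also have "\<dots> = (LINT w|(?E \<Otimes>\<^sub>M ?L). ?G w)"
    unfolding joint[symmetric] by (rule integral_distr[OF _ Gm, symmetric]) measurable
  also have "\<dots> = (LINT p|?L. LINT t|?E. ?G (t, p))"
  proof -
    have gm': "?G \<in> borel_measurable (?E \<Otimes>\<^sub>M ?L)" using Gm by (simp cong: measurable_cong_sets sets_pair_measure_cong)
    have "AE t in ?E. 0 \<le> t" by (subst AE_density) (auto simp: exponential_density_def)
    have "integrable (?E \<Otimes>\<^sub>M ?L) ?G"
    proof (rule PP.integrable_const_bound[where B = 1, OF _ gm'], rule AE_I2)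
      fix w assume "w \<in> space (?E \<Otimes>\<^sub>M ?L)"
      have "0 \<le> occ (above x (snd w)) (fst w)"
        unfolding occ_def set_lebesgue_integral_def by (intro integral_nonneg_AE AE_I2) (auto simp: above_01)
      then show "norm (?G w) \<le> 1" using u by simp
    qed
    then have "integrable (?E \<Otimes>\<^sub>M ?L) (case_prod (\<lambda>t p. ?G (t, p)))" by (simp add: case_prod_beta')
    from PP.integral_snd[OF this] show ?thesis by (simp add: case_prod_beta')
  qed
  also have "\<dots> = occ_trf s u x"
    unfolding occ_trf_def
  proof (intro Bochner_Integration.integral_cong refl)
    fix p assume "p \<in> space ?L"
    then have p: "p \<in> space Om" by simp
    have [measurable]: "occ (above x p) \<in> borel_measurable borel" by (rule occ_measurable[OF above_borel[OF p] above_01])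
    have "(LINT t|?E. ?G (t, p)) = (LINT t|lborel. exponential_density s t *\<^sub>R ?G (t, p))"
      by (rule integral_density) (auto simp: exponential_density_nonneg s)
    also have "\<dots> = occ_lap (above x p) s u 0"
      unfolding occ_lap_def occ_0[OF above_borel[OF p] above_01]
      by (intro Bochner_Integration.integral_cong) (auto simp: exponential_density_def mult.commute)
    finally show "(LINT t|?E. ?G (t, p)) = occ_lap (above x p) s u 0" .
  qed
  finally show ?thesis .
qed

end

section \<open>Exchanging the killing rate\<close>

lemma (in prob_space) norm_integral_le_const:
  fixes f :: "'a \<Rightarrow> 'c::{banach, second_countable_topology}"
  assumes b: "\<And>x. norm (f x) \<le> C" and C: "0 \<le> C"
  shows "norm (\<integral>x. f x \<partial>M) \<le> C"
proof (cases "integrable M f")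
  case True
  have "norm (\<integral>x. f x \<partial>M) \<le> (\<integral>x. norm (f x) \<partial>M)" by (rule integral_norm_bound)
  also have "\<dots> \<le> (\<integral>x. C \<partial>M)" by (rule integral_mono) (use True b in auto)
  finally show ?thesis by (simp add: prob_space)
qed (simp add: not_integrable_integral_eq C)

text \<open>Iterating the equation bounds the function by \<open>k ^ n\<close> times its bound.\<close>

lemma contraction_zero:
  fixes h :: "real \<Rightarrow> complex"
  assumes "prob_space \<mu>" and k: "0 \<le> k" "k < 1" and sub: "S' \<subseteq> S"
    and b: "\<And>x. x \<in> S \<Longrightarrow> norm (h x) \<le> B"
    and eq: "\<And>x. x \<in> S \<Longrightarrow> h x = of_real k * (CLINT y|\<mu>. indicator S' (x - y) * h (x - y))"
    and x: "x \<in> S"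
  shows "h x = 0"
proof -
  interpret prob_space \<mu> by fact
  have B: "0 \<le> B" using b[OF x] norm_ge_zero order_trans by blast
  have "norm (h x) \<le> k ^ n * B" if "x \<in> S" for x n
    using that
  proof (induction n arbitrary: x)
    case (Suc n)
    have "norm (CLINT y|\<mu>. indicator S' (x - y) * h (x - y)) \<le> k ^ n * B"
    proof (rule norm_integral_le_const)
      show "norm (indicator S' (x - y) * h (x - y)) \<le> k ^ n * B" for y
        using Suc.IH[of "x - y"] sub B k by (auto simp: indicator_def)
    qed (use B k in auto)
    then have "norm (h x) \<le> k * (k ^ n * B)"
      unfolding eq[OF Suc.prems] using k by (simp add: norm_mult mult_left_mono)
    then show ?case by simp
  qed (use b in simp)
  moreover have "(\<lambda>n. k ^ n * B) \<longlonglongrightarrow> 0 * B" by (intro tendsto_intros LIMSEQ_realpow_zero k)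
  ultimately have "norm (h x) \<le> 0 * B" using x by (intro LIMSEQ_le_const) auto
  then show ?thesis by simp
qed

text \<open>The resolvent identity: an exponential time of rate \<open>p\<close> is one of rate
  \<open>q\<close>, followed with probability \<open>1 - p / q\<close> by an independent one of rate
  \<open>p\<close>. It is proved as an equality of laws, by realising the mixture and comparing
  characteristic functions.\<close>

lemma exponential_mixture:
  fixes f :: "real \<Rightarrow> complex"
  assumes pq: "0 < p" "p < q" and dist: "real_distribution \<mu>" "real_distribution \<mu>'"
    and Re: "\<And>t. Re (\<kappa> t) \<le> 0"
    and char: "\<And>t. char \<mu> t = of_real p / (of_real p - \<kappa> t)" "\<And>t. char \<mu>' t = of_real q / (of_real q - \<kappa> t)"
    and f: "f \<in> borel_measurable borel" and b: "\<And>x. norm (f x) \<le> C"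
  shows "(CLINT y|\<mu>. f y) = of_real (p / q) * (CLINT y|\<mu>'. f y) + of_real (1 - p / q) * (CLINT y|\<mu>'. CLINT z|\<mu>. f (y + z))"
proof -
  interpret m: real_distribution \<mu> by fact
  interpret m': real_distribution \<mu>' by fact
  interpret P: pair_prob_space \<mu>' \<mu> ..
  let ?B = "measure_pmf (bernoulli_pmf (p / q))"
  interpret B: prob_space ?B by (rule prob_space_measure_pmf)
  interpret Q: pair_prob_space ?B "\<mu>' \<Otimes>\<^sub>M \<mu>" ..
  (* A coin with success probability p / q; the second displacement is added on failure. *)
  define h where "h w = (if fst w then fst (snd w) else fst (snd w) + snd (snd w))" for w :: "bool \<times> real \<times> real"
  have hm: "h \<in> borel_measurable (?B \<Otimes>\<^sub>M (\<mu>' \<Otimes>\<^sub>M \<mu>))"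
    unfolding h_def by measurable
  define L where "L = distr (?B \<Otimes>\<^sub>M (\<mu>' \<Otimes>\<^sub>M \<mu>)) borel h"
  interpret L: real_distribution L unfolding L_def by (rule Q.real_distribution_distr[OF hm])
  have int: "(CLINT y|L. g y) = of_real (p / q) * (CLINT y|\<mu>'. g y) + of_real (1 - p / q) * (CLINT y|\<mu>'. CLINT z|\<mu>. g (y + z))"
    if g[measurable]: "g \<in> borel_measurable borel" and gb: "\<And>x. norm (g x) \<le> C'" for g :: "real \<Rightarrow> complex" and C'
  proof -
    have "(CLINT y|L. g y) = (CLINT w|(?B \<Otimes>\<^sub>M (\<mu>' \<Otimes>\<^sub>M \<mu>)). g (h w))"
      unfolding L_def by (rule integral_distr[OF hm g])
    also have "\<dots> = (CLINT b|?B. CLINT w|(\<mu>' \<Otimes>\<^sub>M \<mu>). g (h (b, w)))"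
    proof (rule Q.integral_fst'[symmetric])
      show "integrable (?B \<Otimes>\<^sub>M (\<mu>' \<Otimes>\<^sub>M \<mu>)) (\<lambda>w. g (h w))"
        by (rule Q.integrable_const_bound[where B = C']) (use gb measurable_compose[OF hm g] in auto)
    qed
    also have "\<dots> = (\<Sum>b\<in>UNIV. pmf (bernoulli_pmf (p / q)) b *\<^sub>R (CLINT w|(\<mu>' \<Otimes>\<^sub>M \<mu>). g (h (b, w))))"
      by (rule integral_measure_pmf) auto
    also have "\<dots> = of_real (p / q) * (CLINT w|(\<mu>' \<Otimes>\<^sub>M \<mu>). g (fst w)) + of_real (1 - p / q) * (CLINT w|(\<mu>' \<Otimes>\<^sub>M \<mu>). g (fst w + snd w))"
      using pq by (simp add: UNIV_bool h_def scaleR_conv_of_real)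
    also have "(CLINT w|(\<mu>' \<Otimes>\<^sub>M \<mu>). g (fst w)) = (CLINT y|\<mu>'. CLINT z|\<mu>. g (fst (y, z)))"
      by (rule P.integral_fst'[symmetric]) (rule P.integrable_const_bound[where B = C'], use gb in auto)
    also have "(CLINT w|(\<mu>' \<Otimes>\<^sub>M \<mu>). g (fst w + snd w)) = (CLINT y|\<mu>'. CLINT z|\<mu>. g (fst (y, z) + snd (y, z)))"
      by (rule P.integral_fst'[symmetric]) (rule P.integrable_const_bound[where B = C'], use gb in auto)
    finally show ?thesis using m.prob_space[unfolded m.space_eq_univ] by simp
  qed
  have ident: "P / Q * (Q / (Q - k)) + (1 - P / Q) * (Q / (Q - k) * (P / (P - k))) = P / (P - k)"
    if "Q \<noteq> 0" "Q - k \<noteq> 0" "P - k \<noteq> 0" for P Q k :: complex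
  proof -
    have "P / Q * (Q / (Q - k)) = P * (P - k) / ((Q - k) * (P - k))" using that by simp
    moreover have "(1 - P / Q) * Q = Q - P" using that by (simp add: field_simps)
    then have "(1 - P / Q) * (Q / (Q - k) * (P / (P - k))) = (Q - P) * P / ((Q - k) * (P - k))"
      by (metis (no_types) mult.assoc times_divide_eq_right times_divide_times_eq)
    ultimately have "P / Q * (Q / (Q - k)) + (1 - P / Q) * (Q / (Q - k) * (P / (P - k))) = (P * (P - k) + (Q - P) * P) / ((Q - k) * (P - k))"
      by (simp only: add_divide_distrib)
    also have "P * (P - k) + (Q - P) * P = P * (Q - k)" by (simp add: algebra_simps)
    finally show ?thesis using that by simp
  qed
  have "L = \<mu>"
  proof (rule Levy_uniqueness)
    show "real_distribution L" by unfold_locales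
    show "char L = char \<mu>"
    proof
      fix t
      have nz: "of_real q - \<kappa> t \<noteq> 0" "of_real p - \<kappa> t \<noteq> 0" using Re[of t] pq by (auto simp: complex_eq_iff)
      have nb: "norm (iexp (t * x)) \<le> 1" for x by simp
      have "char L t = of_real (p / q) * char \<mu>' t + of_real (1 - p / q) * (CLINT y|\<mu>'. CLINT z|\<mu>. iexp (t * (y + z)))"
        unfolding char_def by (rule int[OF _ nb]) measurable
      also have "(CLINT y|\<mu>'. CLINT z|\<mu>. iexp (t * (y + z))) = char \<mu>' t * char \<mu> t"
        by (simp add: distrib_left exp_add char_def)
      finally show "char L t = char \<mu> t"
        unfolding char using ident[of "of_real q" "\<kappa> t" "of_real p"] nz pq by simp
    qed
  qed fact
  then show ?thesis using int[OF f b] by simp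
qed

text \<open>The inner expectation in the resolvent identity is again given by the equation for
  \<open>H\<close>, so it can be eliminated. The kernel on the new right-hand side has mass \<open>(q -
  p) / q < 1\<close>, and it acts on the complementary part \<open>H - g\<close>.\<close>

lemma renewal_transfer:
  fixes g H :: "real \<Rightarrow> complex"
  assumes pq: "0 < p" "p < q" and dist: "real_distribution \<mu>" "real_distribution \<mu>'"
    and Re: "\<And>t. Re (\<kappa> t) \<le> 0"
    and char: "\<And>t. char \<mu> t = of_real p / (of_real p - \<kappa> t)" "\<And>t. char \<mu>' t = of_real q / (of_real q - \<kappa> t)"
    and g[measurable]: "g \<in> borel_measurable borel" and gb: "\<And>x. norm (g x) \<le> C"
    and Hm[measurable]: "H \<in> borel_measurable borel" and Hb: "\<And>x. norm (H x) \<le> C'"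
    and H: "\<And>x. H x = K - of_real ((q - p) / p) * (CLINT y|\<mu>. g (x - y))"
  shows "H x = K * of_real (p / q) + of_real ((q - p) / q) * (CLINT y|\<mu>'. H (x - y) - g (x - y))"
proof -
  interpret m: real_distribution \<mu> by fact
  interpret m': real_distribution \<mu>' by fact
  let ?u = "of_real ((q - p) / p) :: complex"
  have u: "?u \<noteq> 0" using pq by simp
  have G: "(CLINT y|\<mu>. g (x - y)) = (K - H x) / ?u" for x using H[of x] u by (simp add: field_simps)
  have iH: "integrable \<mu>' (\<lambda>y. H (x - y))" and ig: "integrable \<mu>' (\<lambda>y. g (x - y))"
    by (rule m'.integrable_const_bound[where B = C'], use Hb in auto)
       (rule m'.integrable_const_bound[where B = C], use gb in auto)
  have "(CLINT y|\<mu>. g (x - y)) = of_real (p / q) * (CLINT y|\<mu>'. g (x - y)) + of_real (1 - p / q) * (CLINT y|\<mu>'. CLINT z|\<mu>. g (x - (y + z)))"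
    by (rule exponential_mixture[OF pq dist Re char, where C = C]) (use gb in auto)
  also have "(CLINT y|\<mu>'. CLINT z|\<mu>. g (x - (y + z))) = (CLINT y|\<mu>'. (K - H (x - y)) / ?u)"
    by (simp only: G[symmetric] diff_diff_eq)
  also have "\<dots> = (K - (CLINT y|\<mu>'. H (x - y))) / ?u"
    using iH m'.prob_space by simp
  finally have "(K - H x) / ?u = of_real (p / q) * (CLINT y|\<mu>'. g (x - y)) + of_real (1 - p / q) * ((K - (CLINT y|\<mu>'. H (x - y))) / ?u)"
    unfolding G .
  moreover have cancel: "v \<noteq> 0 \<Longrightarrow> (K - h) / v = a * G + b * ((K - E) / v) \<Longrightarrow> K - h = v * a * G + b * (K - E)" for v h a G b E :: complex
    by (simp add: field_simps)
  ultimately have "K - H x = ?u * of_real (p / q) * (CLINT y|\<mu>'. g (x - y)) + of_real (1 - p / q) * (K - (CLINT y|\<mu>'. H (x - y)))"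
    using cancel[OF u] by blast
  moreover have u': "?u * of_real (p / q) = of_real ((q - p) / q)" "(of_real (1 - p / q) :: complex) = of_real ((q - p) / q)"
    using pq by (simp_all add: field_simps)
  ultimately have A: "K - H x = of_real ((q - p) / q) * (CLINT y|\<mu>'. g (x - y)) + of_real ((q - p) / q) * (K - (CLINT y|\<mu>'. H (x - y)))"
    by (simp only:)
  have "h = K * (1 - w) + w * (E - G)" if "K - h = w * G + w * (K - E)" for h w G E :: complex
  proof -
    have "h = K - (K - h)" by simp
    also have "\<dots> = K - (w * G + w * (K - E))" using that by (simp only:)
    finally show ?thesis by (simp add: algebra_simps)
  qed
  from this[OF A] have "H x = K * (1 - of_real ((q - p) / q)) + of_real ((q - p) / q) * (CLINT y|\<mu>'. H (x - y) - g (x - y))"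
    using iH ig by (simp only: Bochner_Integration.integral_diff)
  moreover have "1 - of_real ((q - p) / q) = (of_real (p / q) :: complex)" using pq by (simp add: field_simps)
  ultimately show ?thesis by (simp only:)
qed

text \<open>Averaging the characteristic function against \<open>exp (- v)\<close> on the scale
  \<open>n\<close> gives the expectation of \<open>1 / (1 - i n (x - y))\<close>, which converges to the
  mass of \<open>{y}\<close>.\<close>

lemma no_atom_if_char_vanishes:
  assumes dist: "real_distribution \<mu>" and lim: "\<And>v. 0 < v \<Longrightarrow> (\<lambda>n. char \<mu> (real n * v)) \<longlonglongrightarrow> 0"
  shows "measure \<mu> {y} = 0"
proof -
  interpret m: real_distribution \<mu> by fact
  interpret P: pair_sigma_finite "lborel :: real measure" \<mu> ..
  let ?E = "\<lambda>(n::nat) v x. indicator {0..} v *\<^sub>R (of_real (exp (- v)) * iexp (real n * v * (x - y)))"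
  have E: "integrable lborel (\<lambda>v::real. indicator {0..} v * exp (- v))"
    using set_integrable_norm[OF laplace_monomial(1)[of 1 0]] by (simp add: set_integrable_def)
  have int: "integrable ((lborel :: real measure) \<Otimes>\<^sub>M \<mu>) (\<lambda>(v, x). ?E n v x)" for n
  proof (rule P.Fubini_integrable)
    show "(\<lambda>(v, x). ?E n v x) \<in> borel_measurable ((lborel :: real measure) \<Otimes>\<^sub>M \<mu>)" by measurable
    have "norm (?E n v x) = indicator {0..} v * exp (- v)" for v x
      by (auto simp: norm_mult split: split_indicator)
    then show "integrable lborel (\<lambda>v. \<integral>x. norm (case (v, x) of (v, x) \<Rightarrow> ?E n v x) \<partial>\<mu>)"
      using E m.prob_space by (simp only: case_prod_conv lebesgue_integral_const real_scaleR_def mult_1)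
    show "AE v in lborel. integrable \<mu> (\<lambda>x. case (v, x) of (v, x) \<Rightarrow> ?E n v x)"
      by (rule AE_I2, simp, rule m.integrable_const_bound[where B = 1])
         (auto simp: norm_mult split: split_indicator)
  qed
  have 1: "(CLINT x|\<mu>. CLINT v|lborel. ?E n v x) = (CLINT v|lborel. CLINT x|\<mu>. ?E n v x)" for n
    by (rule P.Fubini_integral[OF int])
  have L: "(CLINT v|lborel. ?E n v x) = 1 / (1 - \<i> * of_real (real n * (x - y)))" for n x
  proof -
    have "(CLINT v|lborel. ?E n v x) = (CLINT v:{0..}|lborel. of_real v ^ 0 * exp (- (1 - \<i> * of_real (real n * (x - y))) * of_real v))"
      unfolding set_lebesgue_integral_def
      by (intro Bochner_Integration.integral_cong refl)
         (simp add: exp_of_real[symmetric] exp_add[symmetric] algebra_simps)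
    also have "\<dots> = 1 / (1 - \<i> * of_real (real n * (x - y)))"
      by (subst laplace_monomial(2)) auto
    finally show ?thesis .
  qed
  have "(\<lambda>n. CLINT x|\<mu>. CLINT v|lborel. ?E n v x) \<longlonglongrightarrow> (CLINT x|\<mu>. indicator {y} x)"
    unfolding L
  proof (rule integral_dominated_convergence[where w = "\<lambda>_. 1"])
    show "AE x in \<mu>. (\<lambda>n. 1 / (1 - \<i> * of_real (real n * (x - y)))) \<longlonglongrightarrow> indicator {y} x"
    proof (rule AE_I2)
      fix x
      show "(\<lambda>n. 1 / (1 - \<i> * of_real (real n * (x - y)))) \<longlonglongrightarrow> indicator {y} x"
      proof (cases "x = y")
        case False
        have "filterlim (\<lambda>n. real n * \<bar>x - y\<bar>) at_top sequentially"
          using False by (intro filterlim_at_top_mult_tendsto_pos[OF tendsto_const _ filterlim_real_sequentially]) auto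
        then have "filterlim (\<lambda>n. norm (\<i> * complex_of_real (real n * (x - y)))) at_top sequentially"
          by (simp add: norm_mult abs_mult flip: of_real_diff)
        then have "filterlim (\<lambda>n. \<i> * complex_of_real (real n * (x - y))) at_infinity sequentially"
          by (rule filterlim_norm_at_top_imp_at_infinity)
        then have "filterlim (\<lambda>n. 1 - \<i> * complex_of_real (real n * (x - y))) at_infinity sequentially"
          using tendsto_add_filterlim_at_infinity[OF tendsto_const[of 1], of "\<lambda>n. - (\<i> * complex_of_real (real n * (x - y)))"]
          by (simp add: filterlim_at_infinity_conv_norm_at_top)
        then show ?thesis using False by (simp add: tendsto_divide_0[OF tendsto_const])
      qed simp
    qed
    show "AE x in \<mu>. norm (1 / (1 - \<i> * of_real (real n * (x - y)))) \<le> 1" for n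
    proof (rule AE_I2)
      fix x
      have "1 \<le> norm (1 - \<i> * complex_of_real (real n * (x - y)))"
        using complex_Re_le_cmod[of "1 - \<i> * complex_of_real (real n * (x - y))"] by simp
      then show "norm (1 / (1 - \<i> * complex_of_real (real n * (x - y)))) \<le> 1"
        by (simp add: norm_divide)
    qed
  qed auto
  moreover have "(\<lambda>n. CLINT v|lborel. CLINT x|\<mu>. ?E n v x) \<longlonglongrightarrow> (CLINT v|(lborel :: real measure). 0)"
  proof (rule integral_dominated_convergence[where w = "\<lambda>v. indicator {0..} v * exp (- v)"])
    have eq: "(CLINT x|\<mu>. ?E n v x) = indicator {0..} v *\<^sub>R (of_real (exp (- v)) * iexp (- (real n * v * y))) * char \<mu> (real n * v)" for n v
    proof -
      have "(CLINT x|\<mu>. ?E n v x) = (CLINT x|\<mu>. indicator {0..} v *\<^sub>R (of_real (exp (- v)) * iexp (- (real n * v * y))) * iexp (real n * v * x))"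
        by (intro Bochner_Integration.integral_cong refl) (simp add: exp_add[symmetric] algebra_simps)
      then show ?thesis by (simp add: char_def)
    qed
    have nm: "norm (indicator {0..} v *\<^sub>R (of_real (exp (- v)) * iexp (- (real n * v * y)))) = indicator {0..} v * exp (- v)" for n v
      by (auto simp: norm_mult split: split_indicator)
    show "(\<lambda>v. CLINT x|\<mu>. ?E n v x) \<in> borel_measurable lborel" for n by measurable
    show "integrable lborel (\<lambda>v::real. indicator {0..} v * exp (- v))" by (rule E)
    show "AE v in lborel. norm (CLINT x|\<mu>. ?E n v x) \<le> indicator {0..} v * exp (- v)" for n
      unfolding eq norm_mult[of _ "char _ _"] nm using m.cmod_char_le_1
      by (intro AE_I2 mult_left_le) auto
    show "AE v in lborel. (\<lambda>n. CLINT x|\<mu>. ?E n v x) \<longlonglongrightarrow> 0"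
    proof (rule eventually_mono[OF AE_lborel_singleton[of "0::real"]])
      fix v :: real assume v: "v \<noteq> 0"
      have "(\<lambda>n. norm (CLINT x|\<mu>. ?E n v x)) \<longlonglongrightarrow> 0"
      proof (cases "0 < v")
        case True
        then show ?thesis unfolding eq norm_mult[of _ "char _ _"] nm
          by (intro tendsto_mult_right_zero tendsto_norm_zero lim)
      qed (use v in simp)
      then show "(\<lambda>n. CLINT x|\<mu>. ?E n v x) \<longlonglongrightarrow> 0" by (rule tendsto_norm_zero_cancel)
    qed
  qed auto
  ultimately have "(CLINT x|\<mu>. indicator {y} x) = 0"
    unfolding 1 by (simp add: LIMSEQ_unique)
  moreover have "(CLINT x|\<mu>. indicator {y} x) = (CLINT x|\<mu>. complex_of_real (indicator {y} x))"
    by (intro Bochner_Integration.integral_cong refl) (auto split: split_indicator)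
  ultimately show ?thesis by simp
qed

section \<open>Solving the renewal equation\<close>

lemma occ_profile_cont: "elem_sym N r N \<noteq> 0 \<Longrightarrow> continuous_on UNIV (occ_profile N r r')"
  by (rule continuous_at_imp_continuous_on) (use occ_profile_deriv has_vector_derivative_continuous in blast)

text \<open>Its derivative decays exponentially.\<close>

lemma occ_profile_bounded:
  assumes N: "0 < N" and r: "\<And>i. i \<in> {1..N} \<Longrightarrow> 0 < Re (r i)"
  obtains C where "0 \<le> C" "\<And>x. 0 \<le> x \<Longrightarrow> norm (occ_profile N r r' x) \<le> C"
proof -
  have esN: "elem_sym N r N \<noteq> 0" using r by (rule elem_sym_top_nz)
  have [measurable]: "occ_density N r r' \<in> borel_measurable borel"
    using occ_density_cont by (rule borel_measurable_continuous_onI)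
  obtain \<delta> D where cd: "\<delta> > 0" "D \<ge> 0" "\<And>x. x \<ge> 0 \<Longrightarrow> norm (occ_density N r r' x) \<le> D * exp (- \<delta> * x)"
    using occ_density_bound[where r = r and N = N and r' = r', OF r] by blast
  define g where "g x = indicator {0..} x *\<^sub>R occ_density N r r' x" for x
  have [measurable]: "g \<in> borel_measurable borel" unfolding g_def by measurable
  have gint: "complex_integrable lborel g"
    using exp_bounded_integrable[where z = 0 and g = "occ_density N r r'", OF cd(1) _ cd(3)]
    unfolding g_def set_integrable_def by simp
  let ?C = "1 + (LINT x|lborel. norm (g x))"
  show thesis
  proof (rule that)
    show "0 \<le> ?C" by (intro add_nonneg_nonneg integral_nonneg_AE) auto
    fix x :: real assume x: "0 \<le> x"
    have "(CLINT y|lborel. indicator {0..x} y *\<^sub>R occ_density N r r' y) = occ_profile N r r' x - occ_profile N r r' 0"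
      by (rule integral_FTC_atLeastAtMost[OF x])
         (auto intro!: has_vector_derivative_at_within[OF occ_profile_deriv[OF esN]] occ_density_cont)
    moreover have "indicator {0..x} y *\<^sub>R occ_density N r r' y = indicator {..x} y *\<^sub>R g y" for y
      by (simp add: g_def split: split_indicator)
    ultimately have "norm (occ_profile N r r' x - 1) = norm (CLINT y|lborel. indicator {..x} y *\<^sub>R g y)"
      using occ_profile_0[OF N esN] by simp
    also have "\<dots> \<le> (LINT y|lborel. norm (indicator {..x} y *\<^sub>R g y))" by (rule integral_norm_bound)
    also have "\<dots> \<le> (LINT y|lborel. norm (g y))"
      by (rule integral_mono)
         (use gint in \<open>auto intro!: Bochner_Integration.integrable_bound[OF integrable_norm[OF gint]] split: split_indicator\<close>)
    finally show "norm (occ_profile N r r' x) \<le> ?C"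
      using norm_triangle_sub[of "occ_profile N r r' x" 1] by simp
  qed
qed

context me_cumulant
begin

lemma inverse_growth_poly_right_inf: "((\<lambda>z. 1 / growth_poly z) \<longlongrightarrow> 0) right_inf"
proof -
  have i: "filterlim (\<lambda>z::complex. z) at_infinity right_inf" by (rule filterlim_mono[OF filterlim_ident order_refl inf_le1])
  have p: "((\<lambda>z::complex. 1 / (1 + z)) \<longlongrightarrow> 0) right_inf"
    by (rule tendsto_divide_0[OF tendsto_const tendsto_add_filterlim_at_infinity[OF tendsto_const i]])
  have "((\<lambda>z::complex. - (1 / (- 1 + z))) \<longlongrightarrow> - 0) right_inf"
    by (rule tendsto_minus[OF tendsto_divide_0[OF tendsto_const tendsto_add_filterlim_at_infinity[OF tendsto_const i]]])
  moreover have "- (1 / (- 1 + z)) = 1 / (1 - z)" for z :: complex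
    using minus_divide_right[of 1 "- 1 + z"] by simp
  ultimately have n: "((\<lambda>z::complex. 1 / (1 - z)) \<longlongrightarrow> 0) right_inf" by simp
  have L: "((\<lambda>z. 1 / of_real lead * ((1 / (1 + z)) ^ n_neg * (1 / (1 - z)) ^ n_pos)) \<longlongrightarrow> 1 / of_real lead * (0 ^ n_neg * 0 ^ n_pos)) right_inf"
    by (intro tendsto_mult tendsto_const tendsto_power p n)
  have "(0::complex) ^ n_neg * 0 ^ n_pos = 0" using nd by (auto simp: n_neg_def n_pos_def)
  moreover have "1 / of_real lead * ((1 / (1 + z)) ^ n_neg * (1 / (1 - z)) ^ n_pos) = 1 / growth_poly z" for z
    by (simp add: growth_poly_def power_one_over)
  ultimately show ?thesis using L by (simp only: mult_zero_right)
qed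

text \<open>The cumulant is unbounded along the imaginary axis as soon as there is a Gaussian part or a
  drift.\<close>

lemma no_atoms:
  assumes q: "0 < q" and \<mu>: "real_distribution \<mu>"
    and char: "\<And>t. char \<mu> t = of_real q / (of_real q - cumulant a \<sigma> \<nu> (\<i> * of_real t))"
  shows "measure \<mu> {y} = 0"
proof (rule no_atom_if_char_vanishes[OF \<mu>])
  fix v :: real assume v: "0 < v"
  let ?z = "\<lambda>n. \<i> * complex_of_real (real n * v)"
  have "filterlim (\<lambda>n. real n * v) at_top sequentially"
    using filterlim_at_top_mult_tendsto_pos[OF tendsto_const v filterlim_real_sequentially] by (simp add: mult.commute)
  then have "filterlim (\<lambda>n. norm (?z n)) at_top sequentially" using v by (simp add: norm_mult)
  then have "filterlim ?z at_infinity sequentially" by (rule filterlim_norm_at_top_imp_at_infinity)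
  then have z: "filterlim ?z right_inf sequentially" unfolding filterlim_inf filterlim_principal by simp
  have "(\<lambda>n. of_real q * (1 / growth_poly (?z n)) / ((of_real q - cumul (?z n)) / growth_poly (?z n))) \<longlonglongrightarrow> of_real q * 0 / 1"
    by (intro tendsto_divide tendsto_mult tendsto_const filterlim_compose[OF inverse_growth_poly_right_inf z] filterlim_compose[OF ratio_right_inf z]) simp
  moreover have "char \<mu> (real n * v) = of_real q * (1 / growth_poly (?z n)) / ((of_real q - cumul (?z n)) / growth_poly (?z n))" for n
  proof -
    have "Re (1 + ?z n) \<noteq> 0" "Re (1 - ?z n) \<noteq> 0" by simp_all
    then have "1 + ?z n \<noteq> 0" "1 - ?z n \<noteq> 0" by (metis zero_complex.simps(1))+
    then have B: "growth_poly (?z n) \<noteq> 0" using lead_pos by (auto simp: growth_poly_def)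
    have "cumulant a \<sigma> \<nu> (?z n) = cumul (?z n)" by (rule cumulant_eq(1)) (use me'(7) in auto)
    then show ?thesis unfolding char using B by simp
  qed
  ultimately show "(\<lambda>n. char \<mu> (real n * v)) \<longlonglongrightarrow> 0" by simp
qed

text \<open>After the change of rate both \<open>D\<close> and the multiple of the profile solve the
  same contracted equation on the half-line.\<close>

lemma occupation_above:
  fixes D :: "real \<Rightarrow> real"
  assumes pq: "0 < p" "p < q" and dist: "real_distribution \<mu>" "real_distribution \<mu>'"
    and Re: "\<And>t. Re (cumulant a \<sigma> \<nu> (\<i> * of_real t)) \<le> 0"
    and char: "\<And>t. char \<mu> t = of_real p / (of_real p - cumulant a \<sigma> \<nu> (\<i> * of_real t))"
      "\<And>t. char \<mu>' t = of_real q / (of_real q - cumulant a \<sigma> \<nu> (\<i> * of_real t))"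
    and N: "0 < N" and K: "\<And>w. 0 < Re w \<Longrightarrow> K w = cumul_ext w"
    and r: "lists_roots 1 K p N r" and r': "lists_roots 1 K q N r'"
    and D[measurable]: "D \<in> borel_measurable borel" and D01: "\<And>x. 0 \<le> D x" "\<And>x. D x \<le> 1"
    and eq: "\<And>x. D x = 1 - (q - p) / p * (LINT y|\<mu>. indicator {x<..} y * D (x - y))"
    and x: "0 \<le> x"
  shows "of_real (D x) = elem_sym N r N / elem_sym N r' N * occ_profile N r r' x"
proof -
  interpret m: real_distribution \<mu> by fact
  interpret m': real_distribution \<mu>' by fact
  have rp: "0 < Re (r i)" "0 < Re (r' i)" if "i \<in> {1..N}" for i
    using r r' that by (auto simp: lists_roots_def)
  have es: "elem_sym N r N \<noteq> 0" "elem_sym N r' N \<noteq> 0" by (rule elem_sym_top_nz, rule rp, simp)+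
  define c where "c = elem_sym N r N / elem_sym N r' N"
  define W where "W x = c * occ_profile N r r' x" for x
  define H where "H x = complex_of_real (D x)" for x
  define g where "g z = indicator {..<0} z * H z" for z
  obtain C where C: "0 \<le> C" "\<And>x. 0 \<le> x \<Longrightarrow> norm (occ_profile N r r' x) \<le> C"
    using occ_profile_bounded[where r = r and r' = r', OF N rp(1)] by blast
  have [measurable]: "occ_profile N r r' \<in> borel_measurable borel"
    using occ_profile_cont[OF es(1)] by (rule borel_measurable_continuous_onI)
  have [measurable]: "W \<in> borel_measurable borel" "H \<in> borel_measurable borel" "g \<in> borel_measurable borel"
    unfolding W_def H_def g_def by measurable
  have Hb: "norm (H x) \<le> 1" for x using D01[of x] by (simp add: H_def)
  have Wb: "norm (W x) \<le> norm c * C" if "0 \<le> x" for x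
    using C(2)[OF that] by (simp add: W_def norm_mult mult_left_mono)
  have gb: "norm (g x) \<le> 1" for x using Hb by (auto simp: g_def split: split_indicator)
  have Heq: "H x = 1 - of_real ((q - p) / p) * (CLINT y|\<mu>. g (x - y))" for x
  proof -
    have "(CLINT y|\<mu>. g (x - y)) = (CLINT y|\<mu>. complex_of_real (indicator {x<..} y * D (x - y)))"
      by (intro Bochner_Integration.integral_cong refl) (auto simp: g_def H_def split: split_indicator)
    then have "(CLINT y|\<mu>. g (x - y)) = complex_of_real (LINT y|\<mu>. indicator {x<..} y * D (x - y))"
      by (simp only: integral_complex_of_real)
    then show ?thesis unfolding H_def by (subst eq) (simp only: of_real_diff of_real_mult of_real_1)
  qed
  have H: "H x = of_real (p / q) + of_real ((q - p) / q) * (CLINT y|\<mu>'. indicator {0..} (x - y) * H (x - y))" for x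
  proof -
    have "H (x - y) - g (x - y) = indicator {0..} (x - y) * H (x - y)" for y
      by (auto simp: g_def split: split_indicator)
    then show ?thesis
      using renewal_transfer[OF pq dist Re char _ gb _ Hb Heq, of x] by simp
  qed
  have W: "W x = of_real (p / q) + of_real ((q - p) / q) * (CLINT y|\<mu>'. indicator {0..} (x - y) * W (x - y))" if x: "0 \<le> x" for x
  proof -
    let ?I = "CLINT y|\<mu>'. indicator {..x} y * occ_profile N r r' (x - y)"
    have "(CLINT y|\<mu>'. indicator {0..} (x - y) * W (x - y)) = (CLINT y|\<mu>'. c * (indicator {..x} y * occ_profile N r r' (x - y)))"
      by (intro Bochner_Integration.integral_cong refl) (auto simp: W_def split: split_indicator)
    then have I: "(CLINT y|\<mu>'. indicator {0..} (x - y) * W (x - y)) = c * ?I" by simp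
    have "occ_profile N r r' x + of_real ((p - q) / q) * ?I = of_real (p / q) * (elem_sym N r' N / elem_sym N r N)"
      by (rule profile_equation[OF _ _ K r r' N dist(2) char(2) x]) (use pq in auto)
    then have "c * (occ_profile N r r' x + of_real ((p - q) / q) * ?I) = of_real (p / q)"
      using es by (simp add: c_def)
    moreover have "of_real ((p - q) / q) = - (of_real ((q - p) / q) :: complex)" by (simp add: divide_simps)
    ultimately show ?thesis unfolding I by (simp only: W_def) (simp add: algebra_simps)
  qed
  have "H x - W x = 0"
  proof (rule contraction_zero[where \<mu> = \<mu>' and k = "(q - p) / q" and S = "{0..}" and S' = "{0..}" and h = "\<lambda>x. H x - W x"])
    show "prob_space \<mu>'" by unfold_locales
    show "norm (H x - W x) \<le> 1 + norm c * C" if "x \<in> {0..}" for x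
      using norm_triangle_ineq4[of "H x" "W x"] Hb[of x] Wb[of x] that by simp
    fix x :: real assume x: "x \<in> {0..}"
    have i: "complex_integrable \<mu>' (\<lambda>y. indicator {0..} (x - y) * H (x - y))"
      by (rule m'.integrable_const_bound[where B = 1]) (use Hb in \<open>auto split: split_indicator\<close>)
    have i': "complex_integrable \<mu>' (\<lambda>y. indicator {0..} (x - y) * W (x - y))"
      by (rule m'.integrable_const_bound[where B = "norm c * C"]) (use Wb C in \<open>auto split: split_indicator\<close>)
    have "(CLINT y|\<mu>'. indicator {0..} (x - y) * (H (x - y) - W (x - y))) =
       (CLINT y|\<mu>'. indicator {0..} (x - y) * H (x - y)) - (CLINT y|\<mu>'. indicator {0..} (x - y) * W (x - y))"
      unfolding right_diff_distrib by (rule Bochner_Integration.integral_diff[OF i i'])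
    then show "H x - W x = of_real ((q - p) / q) * (CLINT y|\<mu>'. indicator {0..} (x - y) * (H (x - y) - W (x - y)))"
      using H[of x] W[of x] x by (simp add: right_diff_distrib)
  qed (use pq x in auto)
  then show ?thesis by (simp add: H_def W_def c_def)
qed

text \<open>Here the profile for the exchanged pair of rates solves the original equation on the
  half-line, up to the strictness of the inequality. The difference of \<open>D\<close> and the profile
  therefore solves the homogeneous equation on the half-line; read as a definition on the whole line it
  changes rate to a homogeneous contracted equation.\<close>

lemma occupation_below:
  fixes D :: "real \<Rightarrow> real"
  assumes pq: "0 < p" "p < q" and dist: "real_distribution \<mu>" "real_distribution \<mu>'"
    and Re: "\<And>t. Re (cumulant a \<sigma> \<nu> (\<i> * of_real t)) \<le> 0"
    and char: "\<And>t. char \<mu> t = of_real p / (of_real p - cumulant a \<sigma> \<nu> (\<i> * of_real t))"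
      "\<And>t. char \<mu>' t = of_real q / (of_real q - cumulant a \<sigma> \<nu> (\<i> * of_real t))"
    and N: "0 < N" and K: "\<And>w. 0 < Re w \<Longrightarrow> K w = cumul_ext w"
    and r: "lists_roots 1 K p N r" and r': "lists_roots 1 K q N r'"
    and D[measurable]: "D \<in> borel_measurable borel" and D01: "\<And>x. 0 \<le> D x" "\<And>x. D x \<le> 1"
    and eq: "\<And>x. D x = 1 - (q - p) / p * (LINT y|\<mu>. indicator {..<x} y * D (x - y))"
    and x: "0 \<le> x"
  shows "of_real (D x) = of_real (p / q) * (elem_sym N r' N / elem_sym N r N) * occ_profile N r' r x"
proof -
  interpret m: real_distribution \<mu> by fact
  interpret m': real_distribution \<mu>' by fact
  have rp: "0 < Re (r i)" "0 < Re (r' i)" if "i \<in> {1..N}" for i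
    using r r' that by (auto simp: lists_roots_def)
  have es: "elem_sym N r N \<noteq> 0" "elem_sym N r' N \<noteq> 0" by (rule elem_sym_top_nz, rule rp, simp)+
  define c where "c = of_real (p / q) * (elem_sym N r' N / elem_sym N r N)"
  define W where "W x = c * occ_profile N r' r x" for x
  define E where "E x = complex_of_real (D x) - W x" for x
  define g where "g z = indicator {0<..} z * E z" for z
  (* On the half-line this is E, by the equations for D and W; elsewhere the equation itself serves as a
     definition. *)
  define H where "H x = 0 - of_real ((q - p) / p) * (CLINT y|\<mu>. g (x - y))" for x
  obtain C where C: "0 \<le> C" "\<And>x. 0 \<le> x \<Longrightarrow> norm (occ_profile N r' r x) \<le> C"
    using occ_profile_bounded[where r = r' and r' = r, OF N rp(2)] by blast
  have [measurable]: "occ_profile N r' r \<in> borel_measurable borel"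
    using occ_profile_cont[OF es(2)] by (rule borel_measurable_continuous_onI)
  have Wm[measurable]: "W \<in> borel_measurable borel" unfolding W_def by measurable
  have Em[measurable]: "E \<in> borel_measurable borel" unfolding E_def by measurable
  have gm[measurable]: "g \<in> borel_measurable borel" unfolding g_def by measurable
  have Hm[measurable]: "H \<in> borel_measurable borel" unfolding H_def by measurable
  let ?B = "1 + norm c * C"
  have Wb: "norm (W x) \<le> norm c * C" if "0 \<le> x" for x
    using C(2)[OF that] by (simp add: W_def norm_mult mult_left_mono)
  have Eb: "norm (E x) \<le> ?B" if "0 \<le> x" for x
    using norm_triangle_ineq4[of "complex_of_real (D x)" "W x"] D01[of x] Wb[OF that] by (simp add: E_def)
  have gb: "norm (g x) \<le> ?B" for x using Eb[of x] C by (auto simp: g_def split: split_indicator)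
  have Hb: "norm (H x) \<le> (q - p) / p * ?B" for x
  proof -
    have "norm (CLINT y|\<mu>. g (x - y)) \<le> ?B" by (rule m.norm_integral_le_const[OF gb]) (use C in auto)
    then have "(q - p) / p * norm (CLINT y|\<mu>. g (x - y)) \<le> (q - p) / p * ?B"
      by (rule mult_left_mono) (use pq in auto)
    moreover have "norm (H x) = (q - p) / p * norm (CLINT y|\<mu>. g (x - y))"
      unfolding H_def diff_0 norm_minus_cancel norm_mult norm_of_real using pq by simp
    ultimately show ?thesis by simp
  qed
  have HE: "H x = E x" if x: "0 \<le> x" for x
  proof -
    let ?I = "CLINT y|\<mu>. indicator {..x} y * occ_profile N r' r (x - y)"
    let ?D = "CLINT y|\<mu>. indicator {..<x} y * complex_of_real (D (x - y))"
    (* The two equations differ in whether the point y = x is included. *)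
    have x0: "AE y in \<mu>. y \<noteq> x"
      using no_atoms[OF pq(1) dist(1) char(1), of x] by (intro AE_I[where N = "{x}"]) (auto simp: m.emeasure_eq_measure)
    have i: "complex_integrable \<mu> (\<lambda>y. indicator {..<x} y * complex_of_real (D (x - y)))"
      by (rule m.integrable_const_bound[where B = 1]) (use D01 in \<open>auto split: split_indicator\<close>)
    have i': "complex_integrable \<mu> (\<lambda>y. indicator {..x} y * W (x - y))"
      by (rule m.integrable_const_bound[where B = "norm c * C"]) (use Wb C in \<open>auto split: split_indicator\<close>)
    have "(CLINT y|\<mu>. g (x - y)) = (CLINT y|\<mu>. indicator {..<x} y * complex_of_real (D (x - y)) - indicator {..x} y * W (x - y))"
      by (rule integral_cong_AE)
         (measurable, use x0 in \<open>auto elim!: eventually_mono simp: g_def E_def split: split_indicator\<close>)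
    also have "\<dots> = ?D - (CLINT y|\<mu>. indicator {..x} y * W (x - y))"
      by (rule Bochner_Integration.integral_diff[OF i i'])
    also have "(CLINT y|\<mu>. indicator {..x} y * W (x - y)) = (CLINT y|\<mu>. c * (indicator {..x} y * occ_profile N r' r (x - y)))"
      by (intro Bochner_Integration.integral_cong refl) (simp add: W_def)
    finally have I: "(CLINT y|\<mu>. g (x - y)) = ?D - c * ?I" by simp
    have "occ_profile N r' r x + of_real ((q - p) / p) * ?I = of_real (q / p) * (elem_sym N r N / elem_sym N r' N)"
      by (rule profile_equation[OF _ _ K r' r N dist(1) char(1) x]) (use pq in auto)
    then have "c * (occ_profile N r' r x + of_real ((q - p) / p) * ?I) = 1"
      using es pq by (simp add: c_def)
    then have W1: "W x = 1 - of_real ((q - p) / p) * (c * ?I)" by (simp add: W_def algebra_simps)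
    have "(CLINT y|\<mu>. complex_of_real (indicator {..<x} y * D (x - y))) = ?D"
      by (intro Bochner_Integration.integral_cong refl) (simp split: split_indicator)
    then have "complex_of_real (LINT y|\<mu>. indicator {..<x} y * D (x - y)) = ?D" by (simp only: integral_complex_of_real)
    then have "complex_of_real (D x) = 1 - of_real ((q - p) / p) * ?D" by (subst eq) simp
    then show ?thesis unfolding H_def E_def W1 I by (simp only:) (simp add: algebra_simps)
  qed
  have Hg: "H z - g z = indicator {..0} z * H z" for z
    using HE[of z] by (auto simp: g_def split: split_indicator)
  have HH: "H x = of_real ((q - p) / q) * (CLINT y|\<mu>'. indicator {..0} (x - y) * H (x - y))" for x
    using renewal_transfer[OF pq dist Re char gm gb Hm Hb H_def, of x] unfolding Hg by simp
  have "H x = 0"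
    by (rule contraction_zero[OF _ _ _ _ Hb HH, where S = UNIV]) (use pq in \<open>auto intro: m'.prob_space_axioms\<close>)
  then show ?thesis using HE[OF x] by (simp add: E_def W_def c_def)
qed

end

section \<open>Reflection of the line\<close>

abbreviation reflect :: "real measure \<Rightarrow> real measure" where
  "reflect \<mu> \<equiv> distr \<mu> borel uminus"

abbreviation reflect_poly :: "complex poly \<Rightarrow> complex poly" where
  "reflect_poly p \<equiv> pcompose p [:0, -1:]"

lemma emeasure_reflect:
  assumes "sets \<nu> = sets borel" and A[measurable]: "A \<in> sets borel"
  shows "emeasure (reflect \<nu>) A = emeasure \<nu> {x. - x \<in> A}"
proof -
  note [measurable_cong] = assms(1)
  have "emeasure (reflect \<nu>) A = emeasure \<nu> (uminus -` A \<inter> space \<nu>)" by (rule emeasure_distr) measurable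
  also have "uminus -` A \<inter> space \<nu> = {x. - x \<in> A}" using sets_eq_imp_space_eq[OF assms(1)] by auto
  finally show ?thesis .
qed

lemma levy_measure_reflect:
  assumes "levy_measure \<nu>" shows "levy_measure (reflect \<nu>)"
proof -
  have s[measurable_cong]: "sets \<nu> = sets borel" using assms by (simp add: levy_measure_def)
  have z: "{x::real. - x \<in> {0}} = {0}" by auto
  have "(\<integral>\<^sup>+x. ennreal (min (x\<^sup>2) 1) \<partial>reflect \<nu>) = (\<integral>\<^sup>+x. ennreal (min (x\<^sup>2) 1) \<partial>\<nu>)"
    by (subst nn_integral_distr) auto
  moreover have "(\<integral>\<^sup>+x\<in>{-1..1}. ennreal \<bar>x\<bar> \<partial>reflect \<nu>) = (\<integral>\<^sup>+x\<in>{-1..1}. ennreal \<bar>x\<bar> \<partial>\<nu>)"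
    by (subst nn_integral_distr) (auto intro!: nn_integral_cong split: split_indicator)
  ultimately show ?thesis
    using assms emeasure_reflect[OF s, of "{0}"] unfolding levy_measure_def z by simp
qed

lemma exp_minus_one_reflect:
  assumes "sets \<nu> = sets borel"
  shows "(CLINT x:(- {0})|reflect \<nu>. exp (z * of_real x) - 1) = (CLINT x:(- {0})|\<nu>. exp (- z * of_real x) - 1)"
    and "complex_set_integrable (reflect \<nu>) (- {0}) (\<lambda>x. exp (z * of_real x) - 1) \<longleftrightarrow>
         complex_set_integrable \<nu> (- {0}) (\<lambda>x. exp (- z * of_real x) - 1)"
proof -
  note [measurable_cong] = assms(1)
  have i: "indicator (- {0}) (- x) = (indicator (- {0}) x :: real)" for x :: real by (auto split: split_indicator)
  show "(CLINT x:(- {0})|reflect \<nu>. exp (z * of_real x) - 1) = (CLINT x:(- {0})|\<nu>. exp (- z * of_real x) - 1)"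
    unfolding set_lebesgue_integral_def by (subst integral_distr) (auto simp: i)
  show "complex_set_integrable (reflect \<nu>) (- {0}) (\<lambda>x. exp (z * of_real x) - 1) \<longleftrightarrow>
         complex_set_integrable \<nu> (- {0}) (\<lambda>x. exp (- z * of_real x) - 1)"
    unfolding set_integrable_def by (subst integrable_distr_eq) (auto simp: i)
qed

lemma cumulant_reflect:
  assumes "sets \<nu> = sets borel"
  shows "cumulant (- a) \<sigma> (reflect \<nu>) z = cumulant a \<sigma> \<nu> (- z)"
  unfolding cumulant_def exp_minus_one_reflect(1)[OF assms] by simp

text \<open>Substituting \<open>- x\<close> into the polynomials keeps their degrees and turns negative
  jumps into positive ones.\<close>

lemma matrix_exp_jumps_reflect:
  assumes s: "sets \<nu> = sets borel" and me: "matrix_exp_jumps (- 1) \<nu> m P b"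
  shows "matrix_exp_jumps 1 (reflect \<nu>) m (\<lambda>i. reflect_poly (P i)) b"
proof -
  have half: "{x::real. - x \<in> {x. 0 < 1 * x}} = {x. 0 < - 1 * x}" by auto
  have hl: "emeasure (reflect \<nu>) {x. 0 < 1 * x} = emeasure \<nu> {x. 0 < - 1 * x}"
    using emeasure_reflect[OF s, of "{x. 0 < 1 * x}"] unfolding half by simp
  have ml: "measure (reflect \<nu>) {x. 0 < 1 * x} = measure \<nu> {x. 0 < - 1 * x}"
    unfolding measure_def hl ..
  have dens: "complex_of_real (measure (reflect \<nu>) A) =
        (CLINT x:A|lborel. of_real (measure (reflect \<nu>) {x. 0 < 1 * x}) *
           (\<Sum>i=1..m. poly (reflect_poly (P i)) (of_real x) * exp (- of_real 1 * b i * of_real x)))"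
    if A[measurable]: "A \<in> sets borel" and sub: "A \<subseteq> {x. 0 < 1 * x}" for A
  proof -
    let ?A = "{x. - x \<in> A}"
    let ?f = "\<lambda>x::real. of_real (measure \<nu> {x. 0 < - 1 * x}) * (\<Sum>i=1..m. poly (P i) (of_real x) * exp (- of_real (- 1) * b i * of_real x))"
    have A': "?A \<in> sets borel" by measurable
    have "\<forall>A\<in>sets borel. A \<subseteq> {x. 0 < - 1 * x} \<longrightarrow> complex_of_real (measure \<nu> A) = (CLINT x:A|lborel. ?f x)"
      using me unfolding matrix_exp_jumps_def by (elim conjE)
    moreover have "?A \<subseteq> {x. 0 < - 1 * x}" using sub by auto
    ultimately have "complex_of_real (measure \<nu> ?A) = (CLINT x:?A|lborel. ?f x)" using A' by blast
    also have "\<dots> = (CLINT x|lborel. indicator ?A (0 + - 1 * x) *\<^sub>R ?f (0 + - 1 * x))"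
      unfolding set_lebesgue_integral_def by (subst lborel_integral_real_affine[where c = "- 1" and t = 0]) simp_all
    also have "\<dots> = (CLINT x:A|lborel. of_real (measure (reflect \<nu>) {x. 0 < 1 * x}) *
           (\<Sum>i=1..m. poly (reflect_poly (P i)) (of_real x) * exp (- of_real 1 * b i * of_real x)))"
      unfolding set_lebesgue_integral_def ml
      by (intro Bochner_Integration.integral_cong refl) (auto simp: poly_pcompose split: split_indicator)
    also have "measure \<nu> ?A = measure (reflect \<nu>) A"
      unfolding measure_def emeasure_reflect[OF s A] ..
    finally show ?thesis .
  qed
  have nz: "reflect_poly (P i) \<noteq> 0" if "P i \<noteq> 0" for i
    using that by (subst pcompose_eq_0_iff) auto
  have "\<forall>i\<in>{1..m}. P i \<noteq> 0" using me unfolding matrix_exp_jumps_def by (elim conjE)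
  then have nz': "\<forall>i\<in>{1..m}. reflect_poly (P i) \<noteq> 0" using nz by blast
  show ?thesis
    unfolding matrix_exp_jumps_def hl
    by (intro conjI nz' ballI[of _ "\<lambda>A. A \<subseteq> _ \<longrightarrow> _ A"] impI dens;
        (insert me, unfold matrix_exp_jumps_def, elim conjE, assumption)?)
qed

lemma degree_reflect_poly: "degree (reflect_poly (p :: complex poly)) = degree p"
  by (simp add: degree_pcompose)

lemma num_roots_reflect:
  assumes s: "sets \<nu> = sets borel" and me: "matrix_exp_jumps (- 1) \<nu> m P b"
  shows "num_roots (- 1) a \<sigma> \<nu> m P b = num_roots 1 (- a) \<sigma> (reflect \<nu>) m (\<lambda>i. reflect_poly (P i)) b"
  using me matrix_exp_jumps_reflect[OF s me] by (simp add: num_roots_def case_NS_def me_degree_def degree_reflect_poly)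

lemma nicely_meromorphic_reflect:
  assumes "K nicely_meromorphic_on {r. 0 < \<epsilon> * Re r}"
  shows "(\<lambda>r. K (- r)) nicely_meromorphic_on {r. 0 < - \<epsilon> * Re r}"
  unfolding nicely_meromorphic_on_def
proof (intro conjI ballI)
  have m: "K meromorphic_on {r. 0 < \<epsilon> * Re r}"
    and k: "\<And>z. 0 < \<epsilon> * Re z \<Longrightarrow> is_pole K z \<and> K z = 0 \<or> K \<midarrow>z\<rightarrow> K z"
    using assms unfolding nicely_meromorphic_on_def by auto
  show "(\<lambda>r. K (- r)) meromorphic_on {r. 0 < - \<epsilon> * Re r}"
    by (rule meromorphic_on_compose[OF m]) (auto intro!: analytic_intros)
  fix z assume "z \<in> {r. 0 < - \<epsilon> * Re r}"
  then have "is_pole K (- z) \<and> K (- z) = 0 \<or> K \<midarrow>- z\<rightarrow> K (- z)" by (intro k) simp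
  moreover have "filtermap uminus (at z) = at (- z)" by (rule filtermap_at_minus)
  ultimately show "is_pole (\<lambda>r. K (- r)) z \<and> K (- z) = 0 \<or> (\<lambda>r. K (- r)) \<midarrow>z\<rightarrow> K (- z)"
    unfolding is_pole_def filterlim_def by (simp add: filtermap_filtermap[of K uminus, symmetric])
qed

text \<open>Negation maps the two half-planes, their integrability domains and the cumulants onto each
  other.\<close>

lemma is_continuation_reflect:
  assumes s: "sets \<nu> = sets borel"
  shows "is_continuation (- 1) a \<sigma> \<nu> K \<longleftrightarrow> is_continuation 1 (- a) \<sigma> (reflect \<nu>) (\<lambda>r. K (- r))"
proof -
  have "K nicely_meromorphic_on {r. 0 < - 1 * Re r} \<longleftrightarrow> (\<lambda>r. K (- r)) nicely_meromorphic_on {r. 0 < 1 * Re r}"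
    using nicely_meromorphic_reflect[of K "- 1"] nicely_meromorphic_reflect[of "\<lambda>r. K (- r)" 1] by auto
  moreover have "(\<forall>r. 0 < - 1 * Re r \<and> complex_set_integrable \<nu> (- {0}) (\<lambda>x. exp (r * of_real x) - 1) \<longrightarrow> K r = cumulant a \<sigma> \<nu> r)
    \<longleftrightarrow> (\<forall>r. 0 < 1 * Re r \<and> complex_set_integrable \<nu> (- {0}) (\<lambda>x. exp (- r * of_real x) - 1) \<longrightarrow> K (- r) = cumulant a \<sigma> \<nu> (- r))"
    (is "?L \<longleftrightarrow> ?R")
  proof
    assume L: ?L
    show ?R
    proof (intro allI impI)
      fix r assume "0 < 1 * Re r \<and> complex_set_integrable \<nu> (- {0}) (\<lambda>x. exp (- r * of_real x) - 1)"
      with L[rule_format, of "- r"] show "K (- r) = cumulant a \<sigma> \<nu> (- r)" by simp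
    qed
  next
    assume R: ?R
    show ?L
    proof (intro allI impI)
      fix r assume "0 < - 1 * Re r \<and> complex_set_integrable \<nu> (- {0}) (\<lambda>x. exp (r * of_real x) - 1)"
      with R[rule_format, of "- r"] show "K r = cumulant a \<sigma> \<nu> r" by simp
    qed
  qed
  ultimately show ?thesis
    unfolding is_continuation_def cumulant_reflect[OF s] exp_minus_one_reflect(2)[OF s] by (simp only:)
qed

text \<open>The listed numbers are the same for both signs, since they have positive real part and the
  sign is part of the notion of a root.\<close>

lemma lists_roots_reflect:
  assumes K: "K meromorphic_on {r. 0 < - 1 * Re r}"
  shows "lists_roots (- 1) K s N r \<longleftrightarrow> lists_roots 1 (\<lambda>w. K (- w)) s N r"
proof -
  have sm: "solution_mult (\<lambda>w. K (- w)) s z = solution_mult K s (- z)" if "0 < Re z" for z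
  proof -
    have "(\<lambda>w. K w - of_real s) meromorphic_on {- z}"
      by (intro meromorphic_intros meromorphic_on_subset[OF K]) (use that in auto)
    from zorder_uminus[OF this] show ?thesis by (simp add: solution_mult_def)
  qed
  have neg: "of_real (- 1) * r i = - z \<longleftrightarrow> of_real 1 * r i = z" for i z by auto
  have "(\<forall>z. 0 < - 1 * Re z \<longrightarrow> card {i \<in> {1..N}. of_real (- 1) * r i = z} = solution_mult K s z)
    \<longleftrightarrow> (\<forall>z. 0 < 1 * Re z \<longrightarrow> card {i \<in> {1..N}. of_real 1 * r i = z} = solution_mult (\<lambda>w. K (- w)) s z)" (is "?L \<longleftrightarrow> ?R")
  proof
    assume L: ?L
    show ?R
    proof (intro allI impI)
      fix z :: complex assume z: "0 < 1 * Re z"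
      have "card {i \<in> {1..N}. of_real (- 1) * r i = - z} = solution_mult K s (- z)" using L[rule_format, of "- z"] z by simp
      then show "card {i \<in> {1..N}. of_real 1 * r i = z} = solution_mult (\<lambda>w. K (- w)) s z"
        unfolding neg using sm[of z] z by simp
    qed
  next
    assume R: ?R
    show ?L
    proof (intro allI impI)
      fix z :: complex assume z: "0 < - 1 * Re z"
      have "card {i \<in> {1..N}. of_real 1 * r i = - z} = solution_mult (\<lambda>w. K (- w)) s (- z)" using R[rule_format, of "- z"] z by simp
      then show "card {i \<in> {1..N}. of_real (- 1) * r i = z} = solution_mult K s z"
        using sm[of "- z"] z neg[of _ "- z"] by simp
    qed
  qed
  then show ?thesis unfolding lists_roots_def by (simp only:)
qed

lemma (in me_cumulant) num_roots_pos: "0 < num_roots 1 a \<sigma> \<nu> m P c"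
  using me'(3) by (simp add: num_roots_eq me_degree_def)

lemma (in me_cumulant) cumulant_ext_eq: "0 < Re w \<Longrightarrow> cumulant_ext 1 a \<sigma> \<nu> w = cumul_ext w"
  unfolding cumulant_ext_def by (rule continuation_unique[OF someI[where P = "is_continuation 1 a \<sigma> \<nu>", OF cumul_ext_continuation]])

lemma (in me_cumulant) cumulant_roots_lists:
  assumes "0 < s"
  shows "lists_roots 1 (cumulant_ext 1 a \<sigma> \<nu>) s (num_roots 1 a \<sigma> \<nu> m P c) (cumulant_roots 1 a \<sigma> \<nu> (num_roots 1 a \<sigma> \<nu> m P c) s)"
  unfolding cumulant_roots_def num_roots_eq by (rule someI_ex[OF lists_roots_exist[OF assms cumulant_ext_eq]])

lemma R_mat_companion: "R_mat \<epsilon> a \<sigma> \<nu> N s = companion N (cumulant_roots \<epsilon> a \<sigma> \<nu> N s) (of_real \<epsilon>)"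
  unfolding R_mat_def companion_def rho_vec_def rho_def by (rule cong_mat) auto

text \<open>The scalar product is the profile without its limit at infinity. The sign enters twice: as a
  factor, from the inverse, and as the direction of the argument, from the exponential.\<close>

lemma scalar_prod_eq_occ_profile:
  fixes \<epsilon> :: real
  assumes N: "0 < N" and r: "elem_sym N (cumulant_roots \<epsilon> a \<sigma> \<nu> N s) N \<noteq> 0" and e: "\<epsilon> * \<epsilon> = 1"
  shows "(rho_vec \<epsilon> a \<sigma> \<nu> N s' - rho_vec \<epsilon> a \<sigma> \<nu> N s) \<bullet>
      (R_inv \<epsilon> a \<sigma> \<nu> N s *\<^sub>v (mat_exp (of_real x \<cdot>\<^sub>m R_mat \<epsilon> a \<sigma> \<nu> N s) *\<^sub>v unit_vec N (N - 1)))
    = of_real \<epsilon> * (occ_profile N (cumulant_roots \<epsilon> a \<sigma> \<nu> N s) (cumulant_roots \<epsilon> a \<sigma> \<nu> N s') (\<epsilon> * x)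
        - rho \<epsilon> a \<sigma> \<nu> N N s' / rho \<epsilon> a \<sigma> \<nu> N N s)"
  unfolding R_inv_def R_mat_companion companion_inv_mat_exp[OF N r e]
  by (simp add: rho_vec_def rho_def occ_profile_def scalar_prod_def sum_distrib_left lessThan_atLeast0 mult_ac)

section \<open>The occupation transform in terms of the roots\<close>

theorem theorem3p1:
  fixes M :: "'a measure" and X :: "real \<Rightarrow> 'a \<Rightarrow> real" and \<theta> :: "'a \<Rightarrow> real"
    and \<nu> :: "real measure" and a \<sigma> s u :: real
  assumes "levy_process M X"
    and "levy_measure \<nu>"
    and "0 \<le> \<sigma>"
    and "\<And>t r. 0 \<le> t \<Longrightarrow> Re r = 0 \<Longrightarrow>
           (CLINT \<omega>|M. exp (r * of_real (X t \<omega>))) = exp (of_real t * cumulant a \<sigma> \<nu> r)"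
    and "0 < s" and "0 < u"
    and "independent_exponential M X \<theta> s"
  shows
    "(\<forall>m P b.
        case_NS (-1) a \<sigma> \<nu> m P b \<or> case_S (-1) a \<sigma> \<nu> m P b \<and> 0 < a \<longrightarrow>
        (let D = (\<lambda>x. complex_of_real (occupation_transform M X \<theta> u x));
             N = num_roots (-1) a \<sigma> \<nu> m P b;
             \<rho>\<^sub>N = rho (-1) a \<sigma> \<nu> N N;
             \<rho> = rho_vec (-1) a \<sigma> \<nu> N;
             R = R_mat (-1) a \<sigma> \<nu> N;
             R_inverse = R_inv (-1) a \<sigma> \<nu> N;
             e = unit_vec N (N - 1)
         in D 0 = of_real (s / (s + u)) * (\<rho>\<^sub>N (s + u) / \<rho>\<^sub>N s) \<and>
            (\<forall>x<0. D x = of_real (s / (s + u)) *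
               (1 - \<rho>\<^sub>N (s + u) / \<rho>\<^sub>N s *
                  ((\<rho> s - \<rho> (s + u)) \<bullet>
                   (R_inverse (s + u) *\<^sub>v (mat_exp (of_real x \<cdot>\<^sub>m R (s + u)) *\<^sub>v e))))))) \<and>
     (\<forall>m P c.
        case_NS 1 a \<sigma> \<nu> m P c \<or> case_S 1 a \<sigma> \<nu> m P c \<and> a < 0 \<longrightarrow>
        (let D = (\<lambda>x. complex_of_real (occupation_transform M X \<theta> u x));
             N = num_roots 1 a \<sigma> \<nu> m P c;
             \<rho>\<^sub>N = rho 1 a \<sigma> \<nu> N N;
             \<rho> = rho_vec 1 a \<sigma> \<nu> N;
             R = R_mat 1 a \<sigma> \<nu> N;
             R_inverse = R_inv 1 a \<sigma> \<nu> N;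
             e = unit_vec N (N - 1)
         in D 0 = \<rho>\<^sub>N s / \<rho>\<^sub>N (s + u) \<and>
            (\<forall>x>0. D x = 1 +
               \<rho>\<^sub>N s / \<rho>\<^sub>N (s + u) *
                  ((\<rho> (s + u) - \<rho> s) \<bullet>
                   (R_inverse s *\<^sub>v (mat_exp (of_real x \<cdot>\<^sub>m R s) *\<^sub>v e))))))"
proof -
  interpret L: levy_path M X by unfold_locales fact
  define q where "q = s + u"
  have sq: "0 < s" "s < q" "0 < q" and qs: "(q - s) / s = u / s" using assms(5,6) by (auto simp: q_def)
  have sets: "sets \<nu> = sets borel" using assms(2) by (simp add: levy_measure_def)
  have k: "(CLINT \<omega>|M. exp (\<i> * of_real t * of_real (X r \<omega>))) = exp (of_real r * cumulant a \<sigma> \<nu> (\<i> * of_real t))" if "0 \<le> r" for t r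
    using assms(4)[OF that, of "\<i> * of_real t"] by simp
  have Re: "Re (cumulant a \<sigma> \<nu> (\<i> * of_real t)) \<le> 0" for t by (rule L.char_exp_law(1)[OF sq(1) k])
  have ch: "char (L.exp_law p) t = of_real p / (of_real p - cumulant a \<sigma> \<nu> (\<i> * of_real t))" if "0 < p" for p t
    by (rule L.char_exp_law(2)[OF that k])
  have dist: "real_distribution (L.exp_law s)" "real_distribution (L.exp_law q)" using sq by (simp_all add: L.prob_space_exp_law)
  let ?D = "L.occ_trf s u"
  have occ: "occupation_transform M X \<theta> u x = ?D x" for x
    by (rule L.occupation_transform_eq_occ_trf[OF assms(5-7)])
  have D01: "0 \<le> ?D x" "?D x \<le> 1" for x using L.occ_trf_01[OF assms(5,6)] by auto
  have Deq: "?D x = 1 - (q - s) / s * (LINT y|L.exp_law s. indicator {x<..} y * ?D (x - y))" for x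
    unfolding qs by (rule L.occ_trf_equation[OF assms(5,6)])
  show ?thesis
  proof (intro conjI allI impI)
    fix m P b
    assume case_neg: "case_NS (-1) a \<sigma> \<nu> m P b \<or> case_S (-1) a \<sigma> \<nu> m P b \<and> 0 < a"
    then have me: "matrix_exp_jumps (- 1) \<nu> m P b" and nd: "\<sigma> > 0 \<or> - a \<noteq> 0"
      by (auto simp: case_NS_def case_S_def)
    interpret R: me_cumulant "- a" \<sigma> "reflect \<nu>" m "\<lambda>i. reflect_poly (P i)" b
      by unfold_locales (fact levy_measure_reflect[OF assms(2)] assms(3) matrix_exp_jumps_reflect[OF sets me] nd)+
    define N where "N = num_roots (- 1) a \<sigma> \<nu> m P b"
    have N: "N = me_degree m (\<lambda>i. reflect_poly (P i)) + R.n_pos" and N0: "0 < N"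
      using R.num_roots_pos num_roots_reflect[OF sets me, of a \<sigma>] R.num_roots_eq by (simp_all add: N_def)
    define K where "K = cumulant_ext (- 1) a \<sigma> \<nu>"
    have "is_continuation (- 1) a \<sigma> \<nu> (\<lambda>r. R.cumul_ext (- r))"
      unfolding is_continuation_reflect[OF sets] using R.cumul_ext_continuation by simp
    then have Kc: "is_continuation (- 1) a \<sigma> \<nu> K" unfolding K_def cumulant_ext_def by (rule someI[where P = "is_continuation (- 1) a \<sigma> \<nu>"])
    then have Km: "K meromorphic_on {r. 0 < - 1 * Re r}"
      by (simp add: is_continuation_def nicely_meromorphic_on_def)
    have cumul_ext: "K (- w) = R.cumul_ext w" if "0 < Re w" for w
      using R.continuation_unique[OF Kc[unfolded is_continuation_reflect[OF sets]] that] .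
    define r where "r p = cumulant_roots (- 1) a \<sigma> \<nu> N p" for p
    have r: "lists_roots 1 (\<lambda>w. K (- w)) p N (r p)" if "0 < p" for p
    proof -
      have "\<exists>r. lists_roots (- 1) K p N r"
        unfolding lists_roots_reflect[OF Km] N by (rule R.lists_roots_exist[OF that cumul_ext])
      then have "lists_roots (- 1) K p N (r p)"
        unfolding r_def cumulant_roots_def K_def by (rule someI_ex)
      then show ?thesis unfolding lists_roots_reflect[OF Km] .
    qed
    have es: "elem_sym N (r p) N \<noteq> 0" if "0 < p" for p
      by (rule elem_sym_top_nz) (use r[OF that] in \<open>simp add: lists_roots_def\<close>)
    have chr: "char (reflect (L.exp_law p)) t = of_real p / (of_real p - cumulant (- a) \<sigma> (reflect \<nu>) (\<i> * of_real t))" if "0 < p" for p t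
    proof -
      have "char (reflect (L.exp_law p)) t = char (L.exp_law p) (- t)"
        unfolding char_def by (subst integral_distr) auto
      then show ?thesis unfolding ch[OF that] cumulant_reflect[OF sets] by simp
    qed
    have distr: "real_distribution (reflect (L.exp_law p))" if "0 < p" for p
    proof -
      interpret E: real_distribution "L.exp_law p" by (rule L.prob_space_exp_law[OF that])
      show ?thesis by (rule E.real_distribution_distr) simp
    qed
    have D: "of_real (?D x) = of_real (s / q) * (elem_sym N (r q) N / elem_sym N (r s) N) * occ_profile N (r q) (r s) (- x)" if "x \<le> 0" for x
    proof -
      have "of_real (?D (- (- x))) = of_real (s / q) * (elem_sym N (r q) N / elem_sym N (r s) N) * occ_profile N (r q) (r s) (- x)"
      proof (rule R.occupation_below[OF sq(1,2) distr[OF sq(1)] distr[OF sq(3)] _ chr[OF sq(1)] chr[OF sq(3)] N0 cumul_ext r[OF sq(1)] r[OF sq(3)], where D = "\<lambda>x. ?D (- x)"])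
        show "Re (cumulant (- a) \<sigma> (reflect \<nu>) (\<i> * of_real t)) \<le> 0" for t
          using Re[of "- t"] by (simp add: cumulant_reflect[OF sets])
        show "?D (- x) = 1 - (q - s) / s * (LINT y|reflect (L.exp_law s). indicator {..<x} y * ?D (- (x - y)))" for x
        proof -
          have "(LINT y|reflect (L.exp_law s). indicator {..<x} y * ?D (- (x - y)))
              = (LINT y|L.exp_law s. indicator {..<x} (- y) * ?D (- (x - - y)))"
            by (rule integral_distr) measurable
          also have "\<dots> = (LINT y|L.exp_law s. indicator {- x<..} y * ?D (- x - y))"
            by (intro Bochner_Integration.integral_cong refl) (auto split: split_indicator)
          finally show ?thesis using Deq[of "- x"] by simp
        qed
      qed (use that D01 in auto)
      then show ?thesis by simp
    qed
    have "complex_of_real (?D 0) = of_real (s / q) * (elem_sym N (r q) N / elem_sym N (r s) N)"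
      using D[of 0] occ_profile_0[OF N0 es[OF sq(3)]] by simp
    moreover have "complex_of_real (?D x) = of_real (s / q) *
               (1 - rho (- 1) a \<sigma> \<nu> N N q / rho (- 1) a \<sigma> \<nu> N N s *
                  ((rho_vec (- 1) a \<sigma> \<nu> N s - rho_vec (- 1) a \<sigma> \<nu> N q) \<bullet>
                   (R_inv (- 1) a \<sigma> \<nu> N q *\<^sub>v (mat_exp (of_real x \<cdot>\<^sub>m R_mat (- 1) a \<sigma> \<nu> N q) *\<^sub>v unit_vec N (N - 1)))))"
      if "x < 0" for x
    proof -
      have "elem_sym N (cumulant_roots (- 1) a \<sigma> \<nu> N q) N \<noteq> 0" using es[OF sq(3)] by (simp add: r_def)
      from scalar_prod_eq_occ_profile[OF N0 this, of s x]
      have sp: "(rho_vec (- 1) a \<sigma> \<nu> N s - rho_vec (- 1) a \<sigma> \<nu> N q) \<bullet>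
                   (R_inv (- 1) a \<sigma> \<nu> N q *\<^sub>v (mat_exp (of_real x \<cdot>\<^sub>m R_mat (- 1) a \<sigma> \<nu> N q) *\<^sub>v unit_vec N (N - 1)))
          = elem_sym N (r s) N / elem_sym N (r q) N - occ_profile N (r q) (r s) (- x)"
        by (simp add: r_def rho_def)
      have rho: "rho (- 1) a \<sigma> \<nu> N N p = elem_sym N (r p) N" for p by (simp add: rho_def r_def)
      show ?thesis unfolding sp rho using D[of x] that es[OF sq(1)] es[OF sq(3)] by (simp add: algebra_simps)
    qed
    ultimately show "let D = (\<lambda>x. complex_of_real (occupation_transform M X \<theta> u x));
             N = num_roots (-1) a \<sigma> \<nu> m P b;
             \<rho>\<^sub>N = rho (-1) a \<sigma> \<nu> N N;
             \<rho> = rho_vec (-1) a \<sigma> \<nu> N;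
             R = R_mat (-1) a \<sigma> \<nu> N;
             R_inverse = R_inv (-1) a \<sigma> \<nu> N;
             e = unit_vec N (N - 1)
         in D 0 = of_real (s / (s + u)) * (\<rho>\<^sub>N (s + u) / \<rho>\<^sub>N s) \<and>
            (\<forall>x<0. D x = of_real (s / (s + u)) *
               (1 - \<rho>\<^sub>N (s + u) / \<rho>\<^sub>N s *
                  ((\<rho> s - \<rho> (s + u)) \<bullet>
                   (R_inverse (s + u) *\<^sub>v (mat_exp (of_real x \<cdot>\<^sub>m R (s + u)) *\<^sub>v e)))))"
      unfolding Let_def occ N_def[symmetric] q_def[symmetric] by (simp only: rho_def r_def) blast
  next
    fix m P c
    assume case_pos: "case_NS 1 a \<sigma> \<nu> m P c \<or> case_S 1 a \<sigma> \<nu> m P c \<and> a < 0"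
    interpret R: me_cumulant a \<sigma> \<nu> m P c
      using assms(2,3) case_pos by unfold_locales (auto simp: case_NS_def case_S_def)
    define N where "N = num_roots 1 a \<sigma> \<nu> m P c"
    have N0: "0 < N" unfolding N_def by (rule R.num_roots_pos)
    define r where "r p = cumulant_roots 1 a \<sigma> \<nu> N p" for p
    have r: "lists_roots 1 (cumulant_ext 1 a \<sigma> \<nu>) p N (r p)" if "0 < p" for p
      unfolding r_def N_def by (rule R.cumulant_roots_lists[OF that])
    have es: "elem_sym N (r p) N \<noteq> 0" if "0 < p" for p
      by (rule elem_sym_top_nz) (use r[OF that] in \<open>simp add: lists_roots_def\<close>)
    have D: "of_real (?D x) = elem_sym N (r s) N / elem_sym N (r q) N * occ_profile N (r s) (r q) x" if "0 \<le> x" for x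
      by (rule R.occupation_above[OF sq(1,2) dist Re ch[OF sq(1)] ch[OF sq(3)] N0 R.cumulant_ext_eq r[OF sq(1)] r[OF sq(3)] _ D01 Deq that]) measurable
    have "complex_of_real (?D 0) = elem_sym N (r s) N / elem_sym N (r q) N"
      using D[of 0] occ_profile_0[OF N0 es[OF sq(1)]] by simp
    moreover have "complex_of_real (?D x) = 1 + rho 1 a \<sigma> \<nu> N N s / rho 1 a \<sigma> \<nu> N N q *
                  ((rho_vec 1 a \<sigma> \<nu> N q - rho_vec 1 a \<sigma> \<nu> N s) \<bullet>
                   (R_inv 1 a \<sigma> \<nu> N s *\<^sub>v (mat_exp (of_real x \<cdot>\<^sub>m R_mat 1 a \<sigma> \<nu> N s) *\<^sub>v unit_vec N (N - 1))))"
      if "0 < x" for x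
    proof -
      have "elem_sym N (cumulant_roots 1 a \<sigma> \<nu> N s) N \<noteq> 0" using es[OF sq(1)] by (simp add: r_def)
      from scalar_prod_eq_occ_profile[OF N0 this, of q x]
      have sp: "(rho_vec 1 a \<sigma> \<nu> N q - rho_vec 1 a \<sigma> \<nu> N s) \<bullet>
                   (R_inv 1 a \<sigma> \<nu> N s *\<^sub>v (mat_exp (of_real x \<cdot>\<^sub>m R_mat 1 a \<sigma> \<nu> N s) *\<^sub>v unit_vec N (N - 1)))
          = occ_profile N (r s) (r q) x - elem_sym N (r q) N / elem_sym N (r s) N"
        by (simp add: r_def rho_def)
      have rho: "rho 1 a \<sigma> \<nu> N N p = elem_sym N (r p) N" for p by (simp add: rho_def r_def)
      show ?thesis unfolding sp rho using D[of x] that es[OF sq(1)] es[OF sq(3)] by (simp add: algebra_simps)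
    qed
    ultimately show "let D = (\<lambda>x. complex_of_real (occupation_transform M X \<theta> u x));
             N = num_roots 1 a \<sigma> \<nu> m P c;
             \<rho>\<^sub>N = rho 1 a \<sigma> \<nu> N N;
             \<rho> = rho_vec 1 a \<sigma> \<nu> N;
             R = R_mat 1 a \<sigma> \<nu> N;
             R_inverse = R_inv 1 a \<sigma> \<nu> N;
             e = unit_vec N (N - 1)
         in D 0 = \<rho>\<^sub>N s / \<rho>\<^sub>N (s + u) \<and>
            (\<forall>x>0. D x = 1 +
               \<rho>\<^sub>N s / \<rho>\<^sub>N (s + u) *
                  ((\<rho> (s + u) - \<rho> s) \<bullet>
                   (R_inverse s *\<^sub>v (mat_exp (of_real x \<cdot>\<^sub>m R s) *\<^sub>v e))))"
      unfolding Let_def occ N_def[symmetric] q_def[symmetric] by (simp only: rho_def r_def) blast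
  qed
qed

end
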